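(* Assume that the family of vectors $\widetilde{\mathcal W}$ (defined in the context) is a basis of $\mathbb C^k$. Assume moreover that for all $\mathsf v\in\mathsf V$ the space $Y_{\mathsf v}$ is a subspace of the null isotropic cone of the quadratic form associated with $T_{\mathsf v}+Q_{\mathsf v}B_{\mathsf v}+B_{\mathsf v}^*Q_{\mathsf v}$, i.e. $$T_{\mathsf v}\xi\cdot\bar\xi+2\,\mathrm{Re}\,\big(Q_{\mathsf v}B_{\mathsf v}\xi\cdot\bar\xi\big)=0\qquad\text{for all }\xi\in Y_{\mathsf v},\ \mathsf v\in\mathsf V .$$ Then the operator $\mathbb A$ generates a strongly continuous group on $\mathbf L^2_d(\mathcal G)$.
   Context: Graph. $\mathsf G=(\mathsf V,\mathsf E)$ is a nonempty finite graph without loops, each edge $\mathsf e$ being oriented (with an initial and a terminal endpoint) and identified with an interval $[0,\ell_{\mathsf e}]$, $\ell_{\mathsf e}>0$, where $0$ corresponds to the initial and $\ell_{\mathsf e}$ to the terminal endpoint. $(k_{\mathsf e})_{\mathsf e\in\mathsf E}$ are positive integers, $\mathsf E_{\mathsf v}$ is the set of edges incident with $\mathsf v$, $k:=\sum_{\mathsf e\in\mathsf E}k_{\mathsf e}$, $k_{\mathsf v}:=\sum_{\mathsf e\in\mathsf E_{\mathsf v}}k_{\mathsf e}$. Let $\iota_{\mathsf v\mathsf e}=1$ if $\mathsf v$ is the terminal endpoint of $\mathsf e$, $-1$ if it is the initial endpoint, and $0$ otherwise. For a function $f$ on $[0,\ell_{\mathsf e}]$, $f(\mathsf v)$ is its value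 at the endpoint corresponding to $\mathsf v$. Coefficients. For each $\mathsf e$: $M_{\mathsf e}:[0,\ell_{\mathsf e}]\to M_{k_{\mathsf e}}(\mathbb C)$ is Lipschitz continuous with $M_{\mathsf e}(x)$ invertible for every $x$; $N_{\mathsf e}:[0,\ell_{\mathsf e}]\to M_{k_{\mathsf e}}(\mathbb C)$ is of class $L^\infty$; $Q_{\mathsf e}:[0,\ell_{\mathsf e}]\to M_{k_{\mathsf e}}(\mathbb C)$ is Lipschitz continuous, $Q_{\mathsf e}(x)$ and $Q_{\mathsf e}(x)M_{\mathsf e}(x)$ are Hermitian for all $x$, and there is $q>0$ with $Q_{\mathsf e}(x)\xi\cdot\bar\xi\ge q\|\xi\|^2$ for all $\xi\in\mathbb C^{k_{\mathsf e}}$ and all $x$. Here $a\cdot b=\sum_i a_ib_i$. Vertex data. For each $\mathsf v\in\mathsf V$: $Y^{(d)}_{\mathsf v}\subset Y_{\mathsf v}$ are subspaces of $\mathbb C^{k_{\mathsf v}}$; $B_{\mathsf v}:Y_{\mathsf v}\to Y^{(d)}_{\mathsf v}$ and $C_{\mathsf v}:Y^{(d)}_{\mathsf v}\to Y^{(d)}_{\mathsf v}$ are linear; $Q_{\mathsf v}$ is a Hermitian positive definite operator on $Y^{(d)}_{\mathsf v}$. Adjoints ($B_{\mathsf v}^*:Y^{(d)}_{\mathsf v}\to Y_{\mathsf v}$) and orthogonality are with respect to the Euclidean inner product. $P^{(d)}_{\mathsf v}$ is the orthogonal projector of $\mathbb C^{k_{\mathsf v}}$ onto $Y^{(d)}_{\mathsf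 v}$, and $U^\perp$ is the orthogonal complement of $U$ in $\mathbb C^{k_{\mathsf v}}$. Put $\gamma_{\mathsf v}(u):=(u_{\mathsf e}(\mathsf v))_{\mathsf e\in\mathsf E_{\mathsf v}}\in\mathbb C^{k_{\mathsf v}}$ and let $T_{\mathsf v}:=\mathrm{diag}\big(Q_{\mathsf e}(\mathsf v)M_{\mathsf e}(\mathsf v)\iota_{\mathsf v\mathsf e}\big)_{\mathsf e\in\mathsf E_{\mathsf v}}$ (a block diagonal $k_{\mathsf v}\times k_{\mathsf v}$ matrix). Spaces and operator. $\mathbf L^2(\mathcal G):=\bigoplus_{\mathsf e}L^2(0,\ell_{\mathsf e})^{k_{\mathsf e}}$, $Y^{(d)}:=\bigoplus_{\mathsf v}Y^{(d)}_{\mathsf v}$, and $\mathbf L^2_d(\mathcal G):=\mathbf L^2(\mathcal G)\oplus Y^{(d)}$ with inner product $\big((u,\mathsf x),(v,\mathsf y)\big)_d=\sum_{\mathsf e}\int_0^{\ell_{\mathsf e}}Q_{\mathsf e}u_{\mathsf e}\cdot\bar v_{\mathsf e}\,dx+\sum_{\mathsf v}Q_{\mathsf v}\mathsf x_{\mathsf v}\cdot\bar{\mathsf y}_{\mathsf v}$. With $D_{\max}:=\bigoplus_{\mathsf e}H^1(0,\ell_{\mathsf e})^{k_{\mathsf e}}$, the operator $\mathbb A$ on $\mathbf L^2_d(\mathcal G)$ has domain $$D(\mathbb A)=\{(u,\mathsf x)\in D_{\max}\oplus Y^{(d)}:\ \gamma_{\mathsf v}(u)\in Y_{\mathsf v}\text{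 and }\mathsf x_{\mathsf v}=P^{(d)}_{\mathsf v}\gamma_{\mathsf v}(u)\text{ for all }\mathsf v\in\mathsf V\}$$ and acts as $\mathbb A(u,\mathsf x)=\big((M_{\mathsf e}u_{\mathsf e}'+N_{\mathsf e}u_{\mathsf e})_{\mathsf e\in\mathsf E},\ (B_{\mathsf v}\gamma_{\mathsf v}(u)+C_{\mathsf v}\mathsf x_{\mathsf v})_{\mathsf v\in\mathsf V}\big)$. The family $\widetilde{\mathcal W}$. For each $\mathsf v$ fix bases $\{\mathsf w^{(\mathsf v,i)}\}_i$ of $Y_{\mathsf v}^\perp$, $\{\mathsf y^{(\mathsf v,j)}\}_j$ of $\mathrm{Ran}\,B_{\mathsf v}$, and $\{\mathsf w^{(\mathsf v,l)}_{KB^*}\}_l$ of $\mathrm{Ker}\,B_{\mathsf v}^*\subset Y^{(d)}_{\mathsf v}$, and let $\mathsf w^{(\mathsf v,j)}_{RB^*}:=B_{\mathsf v}^*\mathsf y^{(\mathsf v,j)}$. For $\mathsf w\in\mathbb C^{k_{\mathsf v}}$, written as $(\mathsf w_{\mathsf e})_{\mathsf e\in\mathsf E_{\mathsf v}}$, let $\widetilde{\mathsf w}\in\mathbb C^k$ be its extension by $0$ to the components $\mathsf e\notin\mathsf E_{\mathsf v}$. Then $\widetilde{\mathcal W}$ is the family (over all $\mathsf v\in\mathsf V$ and all indices $i,j,l$) of all the vectors $\widetilde{\mathsf w}^{(\mathsf v,i)}$, $\widetilde{\mathsf w}^{(\mathsf v,j)}_{RB^*}$, $\widetilde{\mathsf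 w}^{(\mathsf v,l)}_{KB^*}$ in $\mathbb C^k$. *)

theory Defs
  imports
    "HOL-Analysis.Analysis"
    "HOL-Library.Function_Algebras"
    "Graph_Theory.Digraph"
    "Jordan_Normal_Form.Matrix"
    "Jordan_Normal_Form.Conjugate"
begin

section \<open>Complex vectors with components in a finite index set\<close>

text \<open>
  The space of complex vectors with components indexed by a finite set \<open>I\<close> is rendered as the space
  of functions vanishing outside \<open>I\<close>. Thus, for index sets \<open>I \<subseteq> J\<close>, a vector with components in
  \<open>I\<close> \<^emph>\<open>is\<close> already its extension by zero to a vector with components in \<open>J\<close>.
\<close>

definition cvecs :: "'i set \<Rightarrow> ('i \<Rightarrow> complex) set" where
  "cvecs I = {f. \<forall>i. i \<notin> I \<longrightarrow> f i = 0}"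

definition cscale :: "complex \<Rightarrow> ('i \<Rightarrow> complex) \<Rightarrow> ('i \<Rightarrow> complex)" where
  "cscale c f = (\<lambda>i. c * f i)"

interpretation cfun: vector_space "cscale :: complex \<Rightarrow> ('i \<Rightarrow> complex) \<Rightarrow> ('i \<Rightarrow> complex)"
  by unfold_locales (auto simp: cscale_def fun_eq_iff algebra_simps)

definition cprod :: "'i set \<Rightarrow> ('i \<Rightarrow> complex) \<Rightarrow> ('i \<Rightarrow> complex) \<Rightarrow> complex" where
  "cprod I a b = (\<Sum>i\<in>I. a i * cnj (b i))"

definition orth_compl :: "'i set \<Rightarrow> ('i \<Rightarrow> complex) set \<Rightarrow> ('i \<Rightarrow> complex) set" where
  "orth_compl I U = {w \<in> cvecs I. \<forall>x\<in>U. cprod I x w = 0}"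

definition orth_proj :: "'i set \<Rightarrow> ('i \<Rightarrow> complex) set \<Rightarrow> ('i \<Rightarrow> complex) \<Rightarrow> ('i \<Rightarrow> complex)" where
  "orth_proj I U x = (THE y. y \<in> U \<and> x - y \<in> orth_compl I U)"

text \<open>The adjoint of a linear operator \<open>U \<rightarrow> W\<close> between two subspaces; as an operator \<open>W \<rightarrow> U\<close> it
  depends on the domain \<open>U\<close>, and it is used only at arguments in \<open>W\<close>.\<close>

definition adjoint_on ::
  "'i set \<Rightarrow> ('i \<Rightarrow> complex) set \<Rightarrow> (('i \<Rightarrow> complex) \<Rightarrow> ('i \<Rightarrow> complex)) \<Rightarrow> ('i \<Rightarrow> complex) \<Rightarrow> ('i \<Rightarrow> complex)"
where
  "adjoint_on I U B y = (THE z. z \<in> U \<and> (\<forall>x\<in>U. cprod I (B x) y = cprod I x z))"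

text \<open>Bases are indexed families; a family with repetitions is not a basis.\<close>

definition basis_family :: "'j set \<Rightarrow> ('j \<Rightarrow> 'i \<Rightarrow> complex) \<Rightarrow> ('i \<Rightarrow> complex) set \<Rightarrow> bool" where
  "basis_family J w U \<longleftrightarrow> inj_on w J \<and> cfun.independent (w ` J) \<and> cfun.span (w ` J) = U"

definition linear_between ::
  "(complex \<Rightarrow> 'a::ab_group_add \<Rightarrow> 'a) \<Rightarrow> 'a set \<Rightarrow> 'a set \<Rightarrow> ('a \<Rightarrow> 'a) \<Rightarrow> bool"
where
  "linear_between scl U W f \<longleftrightarrow>
     (\<forall>x\<in>U. f x \<in> W) \<and>
     (\<forall>x\<in>U. \<forall>y\<in>U. f (x + y) = f x + f y) \<and>
     (\<forall>c. \<forall>x\<in>U. f (scl c x) = scl c (f x))"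


section \<open>Strongly continuous groups and their generators\<close>

text \<open>
  The normed space consists of a carrier \<open>H\<close>, a complex scalar multiplication \<open>scl\<close> and a norm
  \<open>nrm\<close>; only the behaviour of operators on \<open>H\<close> matters.
\<close>

definition bounded_operator ::
  "(complex \<Rightarrow> 'a::ab_group_add \<Rightarrow> 'a) \<Rightarrow> 'a set \<Rightarrow> ('a \<Rightarrow> real) \<Rightarrow> ('a \<Rightarrow> 'a) \<Rightarrow> bool"
where
  "bounded_operator scl H nrm f \<longleftrightarrow>
     linear_between scl H H f \<and> (\<exists>K. \<forall>x\<in>H. nrm (f x) \<le> K * nrm x)"

definition strongly_continuous_group ::
  "(complex \<Rightarrow> 'a::ab_group_add \<Rightarrow> 'a) \<Rightarrow> 'a set \<Rightarrow> ('a \<Rightarrow> real) \<Rightarrow> (real \<Rightarrow> 'a \<Rightarrow> 'a) \<Rightarrow> bool"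
where
  "strongly_continuous_group scl H nrm T \<longleftrightarrow>
     (\<forall>t. bounded_operator scl H nrm (T t)) \<and>
     (\<forall>x\<in>H. T 0 x = x) \<and>
     (\<forall>s t. \<forall>x\<in>H. T (s + t) x = T s (T t x)) \<and>
     (\<forall>x\<in>H. \<forall>t. ((\<lambda>s. nrm (T s x - T t x)) \<longlongrightarrow> 0) (at t))"

text \<open>\<open>A\<close> with domain \<open>D\<close> is the generator: \<open>D\<close> is exactly the set of all \<open>x\<close> for which the
  difference quotients \<open>(T t x - x) / t\<close> converge in \<open>H\<close>, and \<open>A x\<close> is their limit.\<close>

definition generator_of ::
  "(complex \<Rightarrow> 'a::ab_group_add \<Rightarrow> 'a) \<Rightarrow> 'a set \<Rightarrow> ('a \<Rightarrow> real) \<Rightarrow> (real \<Rightarrow> 'a \<Rightarrow> 'a)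
     \<Rightarrow> 'a set \<Rightarrow> ('a \<Rightarrow> 'a) \<Rightarrow> bool"
where
  "generator_of scl H nrm T D A \<longleftrightarrow>
     D \<subseteq> H \<and> A ` D \<subseteq> H \<and>
     (\<forall>x\<in>H. \<forall>y\<in>H.
        x \<in> D \<and> A x = y \<longleftrightarrow>
        ((\<lambda>t. nrm (scl (complex_of_real (1 / t)) (T t x - x) - y)) \<longlongrightarrow> 0) (at 0))"

definition generates_strongly_continuous_group ::
  "(complex \<Rightarrow> 'a::ab_group_add \<Rightarrow> 'a) \<Rightarrow> 'a set \<Rightarrow> ('a \<Rightarrow> real) \<Rightarrow> 'a set \<Rightarrow> ('a \<Rightarrow> 'a) \<Rightarrow> bool"
where
  "generates_strongly_continuous_group scl H nrm D A \<longleftrightarrow>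
     (\<exists>T. strongly_continuous_group scl H nrm T \<and> generator_of scl H nrm T D A)"


section \<open>Square-integrable functions modulo equality almost everywhere\<close>

definition sq_integrable :: "(real \<Rightarrow> complex) \<Rightarrow> bool" where
  "sq_integrable f \<longleftrightarrow> f \<in> borel_measurable lebesgue \<and> integrable lebesgue (\<lambda>x. (cmod (f x))\<^sup>2)"

definition l2_rel :: "(real \<Rightarrow> complex) \<Rightarrow> (real \<Rightarrow> complex) \<Rightarrow> bool" where
  "l2_rel f g \<longleftrightarrow> sq_integrable f \<and> sq_integrable g \<and> (AE x in lebesgue. f x = g x)"

lemma sq_integrable_0 [simp]: "sq_integrable (\<lambda>x. 0)"
  by (simp add: sq_integrable_def)

lemma sq_integrable_scale:
  assumes "sq_integrable f" shows "sq_integrable (\<lambda>x. c * f x)"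
  using assms by (auto simp: sq_integrable_def norm_mult power_mult_distrib)

lemma sq_integrable_add:
  assumes "sq_integrable f" "sq_integrable g" shows "sq_integrable (\<lambda>x. f x + g x)"
proof -
  have [measurable]: "f \<in> borel_measurable lebesgue" "g \<in> borel_measurable lebesgue"
    using assms by (auto simp: sq_integrable_def)
  have bound: "(cmod (a + b))\<^sup>2 \<le> 2 * (cmod a)\<^sup>2 + 2 * (cmod b)\<^sup>2" for a b :: complex
  proof -
    have "(cmod (a + b))\<^sup>2 \<le> (cmod a + cmod b)\<^sup>2"
      by (simp add: norm_triangle_ineq power_mono)
    also have "\<dots> \<le> 2 * (cmod a)\<^sup>2 + 2 * (cmod b)\<^sup>2"
      using sum_squares_bound[of "cmod a" "cmod b"] by (simp add: power2_sum)
    finally show ?thesis .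
  qed
  have "integrable lebesgue (\<lambda>x. 2 * (cmod (f x))\<^sup>2 + 2 * (cmod (g x))\<^sup>2)"
    using assms by (auto simp: sq_integrable_def)
  then have "integrable lebesgue (\<lambda>x. (cmod (f x + g x))\<^sup>2)"
    by (rule Bochner_Integration.integrable_bound) (auto simp: bound)
  then show ?thesis by (simp add: sq_integrable_def)
qed

quotient_type l2fun = "real \<Rightarrow> complex" / partial: l2_rel
  morphisms rep_l2 abs_l2
proof (rule part_equivpI)
  show "\<exists>f. l2_rel f f"
    by (rule exI[of _ "\<lambda>x. 0"]) (simp add: l2_rel_def)
  show "symp l2_rel"
    by (auto simp: symp_def l2_rel_def eq_commute)
  show "transp l2_rel"
  proof (rule transpI)
    fix f g h assume "l2_rel f g" "l2_rel g h"
    then have "sq_integrable f" "sq_integrable h"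
      and "AE x in lebesgue. f x = g x" "AE x in lebesgue. g x = h x"
      by (auto simp: l2_rel_def)
    then show "l2_rel f h" unfolding l2_rel_def by auto
  qed
qed

lift_definition l2_scale :: "complex \<Rightarrow> l2fun \<Rightarrow> l2fun" is "\<lambda>c f x. c * f x"
  by (auto simp: l2_rel_def intro: sq_integrable_scale)

instantiation l2fun :: ab_group_add
begin

lift_definition zero_l2fun :: l2fun is "\<lambda>x. 0"
  by (simp add: l2_rel_def)

lift_definition plus_l2fun :: "l2fun \<Rightarrow> l2fun \<Rightarrow> l2fun" is "\<lambda>f g x. f x + g x"
  unfolding l2_rel_def by (auto intro: sq_integrable_add)

lift_definition uminus_l2fun :: "l2fun \<Rightarrow> l2fun" is "\<lambda>f x. - f x"
  using sq_integrable_scale[of _ "-1"] by (auto simp: l2_rel_def)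

definition minus_l2fun :: "l2fun \<Rightarrow> l2fun \<Rightarrow> l2fun" where
  "minus_l2fun u v = u + - v"

instance
proof
  fix a b c :: l2fun
  show "a + b + c = a + (b + c)"
    by transfer (auto simp: l2_rel_def add.assoc intro!: sq_integrable_add)
  show "a + b = b + a"
    by transfer (auto simp: l2_rel_def add.commute intro!: sq_integrable_add)
  show "0 + a = a"
    by transfer (auto simp: l2_rel_def)
  show "- a + a = 0"
    by transfer (auto simp: l2_rel_def)
  show "a - b = a + - b"
    by (simp add: minus_l2fun_def)
qed

end

text \<open>The space L2 over the interval from \<open>0\<close> to \<open>l\<close>, its elements being extended by zero to the
  real line.\<close>

definition L2_on :: "real \<Rightarrow> l2fun set" where
  "L2_on l = {u. AE x in lebesgue. x \<notin> {0..l} \<longrightarrow> rep_l2 u x = 0}"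


section \<open>The Sobolev space H1 of an interval\<close>

definition test_function :: "real \<Rightarrow> (real \<Rightarrow> real) \<Rightarrow> bool" where
  "test_function l \<phi> \<longleftrightarrow> \<phi> C1_differentiable_on UNIV \<and>
     (\<exists>a b. 0 < a \<and> b < l \<and> (\<forall>x. x \<notin> {a..b} \<longrightarrow> \<phi> x = 0))"

definition weak_derivative :: "real \<Rightarrow> l2fun \<Rightarrow> l2fun \<Rightarrow> bool" where
  "weak_derivative l u g \<longleftrightarrow> (\<forall>\<phi>. test_function l \<phi> \<longrightarrow>
     (LINT x:{0..l}|lebesgue. rep_l2 u x * complex_of_real (deriv \<phi> x)) =
     - (LINT x:{0..l}|lebesgue. rep_l2 g x * complex_of_real (\<phi> x)))"

definition H1_on :: "real \<Rightarrow> l2fun set" where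
  "H1_on l = {u \<in> L2_on l. \<exists>g\<in>L2_on l. weak_derivative l u g}"

definition wderiv :: "real \<Rightarrow> l2fun \<Rightarrow> l2fun" where
  "wderiv l u = (THE g. g \<in> L2_on l \<and> weak_derivative l u g)"

text \<open>The value at a point of \<open>[0, l]\<close> of the continuous representative of an element of H1.\<close>

definition point_value :: "real \<Rightarrow> l2fun \<Rightarrow> real \<Rightarrow> complex" where
  "point_value l u x = (THE c. \<exists>f. continuous_on {0..l} f \<and>
     (AE y in lebesgue. y \<in> {0..l} \<longrightarrow> f y = rep_l2 u y) \<and> f x = c)"


section \<open>Networks with coefficients and vertex data\<close>

text \<open>
  Vertices are the \<open>verts\<close> and edges the \<open>arcs\<close> of a digraph; the tail of an arc is its initial,
  the head its terminal endpoint. A component is a pair \<open>(e, i)\<close> with \<open>i < kdim e\<close>.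
\<close>

type_synonym 'e cvec = "'e \<times> nat \<Rightarrow> complex"

record ('v, 'e) network =
  graph :: "('v, 'e) pre_digraph"
  len :: "'e \<Rightarrow> real"
  kdim :: "'e \<Rightarrow> nat"
  matM :: "'e \<Rightarrow> real \<Rightarrow> complex mat"
  matN :: "'e \<Rightarrow> real \<Rightarrow> complex mat"
  matQ :: "'e \<Rightarrow> real \<Rightarrow> complex mat"
  spaceY :: "'v \<Rightarrow> 'e cvec set"
  spaceYd :: "'v \<Rightarrow> 'e cvec set"
  opB :: "'v \<Rightarrow> 'e cvec \<Rightarrow> 'e cvec"
  opC :: "'v \<Rightarrow> 'e cvec \<Rightarrow> 'e cvec"
  opQ :: "'v \<Rightarrow> 'e cvec \<Rightarrow> 'e cvec"

abbreviation vertices :: "('v, 'e) network \<Rightarrow> 'v set" where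
  "vertices G \<equiv> verts (graph G)"

abbreviation edges :: "('v, 'e) network \<Rightarrow> 'e set" where
  "edges G \<equiv> arcs (graph G)"

definition edges_at :: "('v, 'e) network \<Rightarrow> 'v \<Rightarrow> 'e set" where
  "edges_at G v = in_arcs (graph G) v \<union> out_arcs (graph G) v"

definition comps :: "('v, 'e) network \<Rightarrow> ('e \<times> nat) set" where
  "comps G = (SIGMA e:edges G. {..<kdim G e})"

definition comps_at :: "('v, 'e) network \<Rightarrow> 'v \<Rightarrow> ('e \<times> nat) set" where
  "comps_at G v = (SIGMA e:edges_at G v. {..<kdim G e})"

definition incidence :: "('v, 'e) network \<Rightarrow> 'v \<Rightarrow> 'e \<Rightarrow> complex" where
  "incidence G v e =
     (if v = head (graph G) e then 1 else if v = tail (graph G) e then - 1 else 0)"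

definition endpoint :: "('v, 'e) network \<Rightarrow> 'v \<Rightarrow> 'e \<Rightarrow> real" where
  "endpoint G v e = (if v = head (graph G) e then len G e else 0)"

definition network_graph :: "('v, 'e) network \<Rightarrow> bool" where
  "network_graph G \<longleftrightarrow> fin_digraph (graph G) \<and> loopfree_digraph (graph G) \<and> vertices G \<noteq> {} \<and>
     (\<forall>e\<in>edges G. 0 < len G e \<and> 0 < kdim G e)"

definition hermitian_mat :: "complex mat \<Rightarrow> bool" where
  "hermitian_mat A \<longleftrightarrow> square_mat A \<and> transpose_mat (map_mat cnj A) = A"

definition lipschitz_mat :: "nat \<Rightarrow> real \<Rightarrow> (real \<Rightarrow> complex mat) \<Rightarrow> bool" where
  "lipschitz_mat n l A \<longleftrightarrow> (\<forall>x\<in>{0..l}. A x \<in> carrier_mat n n) \<and>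
     (\<forall>i<n. \<forall>j<n. \<exists>K. K-lipschitz_on {0..l} (\<lambda>x. A x $$ (i, j)))"

definition Linfty_mat :: "nat \<Rightarrow> real \<Rightarrow> (real \<Rightarrow> complex mat) \<Rightarrow> bool" where
  "Linfty_mat n l A \<longleftrightarrow> (\<forall>x\<in>{0..l}. A x \<in> carrier_mat n n) \<and>
     (\<forall>i<n. \<forall>j<n. (\<lambda>x. A x $$ (i, j)) \<in> borel_measurable (lebesgue_on {0..l}) \<and>
        (\<exists>K. AE x in lebesgue_on {0..l}. cmod (A x $$ (i, j)) \<le> K))"

definition edge_coefficients :: "('v, 'e) network \<Rightarrow> bool" where
  "edge_coefficients G \<longleftrightarrow> (\<forall>e\<in>edges G.
     lipschitz_mat (kdim G e) (len G e) (matM G e) \<and>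
     (\<forall>x\<in>{0..len G e}. invertible_mat (matM G e x)) \<and>
     Linfty_mat (kdim G e) (len G e) (matN G e) \<and>
     lipschitz_mat (kdim G e) (len G e) (matQ G e) \<and>
     (\<forall>x\<in>{0..len G e}. hermitian_mat (matQ G e x) \<and> hermitian_mat (matQ G e x * matM G e x)) \<and>
     (\<exists>q>0. \<forall>x\<in>{0..len G e}. \<forall>\<xi>\<in>carrier_vec (kdim G e).
        Re ((matQ G e x *\<^sub>v \<xi>) \<bullet>c \<xi>) \<ge> q * Re (\<xi> \<bullet>c \<xi>)))"

definition vertex_data :: "('v, 'e) network \<Rightarrow> bool" where
  "vertex_data G \<longleftrightarrow> (\<forall>v\<in>vertices G.
     cfun.subspace (spaceY G v) \<and> cfun.subspace (spaceYd G v) \<and>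
     spaceYd G v \<subseteq> spaceY G v \<and> spaceY G v \<subseteq> cvecs (comps_at G v) \<and>
     linear_between cscale (spaceY G v) (spaceYd G v) (opB G v) \<and>
     linear_between cscale (spaceYd G v) (spaceYd G v) (opC G v) \<and>
     linear_between cscale (spaceYd G v) (spaceYd G v) (opQ G v) \<and>
     (\<forall>x\<in>spaceYd G v. \<forall>y\<in>spaceYd G v.
        cprod (comps_at G v) (opQ G v x) y = cprod (comps_at G v) x (opQ G v y)) \<and>
     (\<forall>x\<in>spaceYd G v. x \<noteq> 0 \<longrightarrow> 0 < Re (cprod (comps_at G v) (opQ G v x) x)))"

definition adjB :: "('v, 'e) network \<Rightarrow> 'v \<Rightarrow> 'e cvec \<Rightarrow> 'e cvec" where
  "adjB G v = adjoint_on (comps_at G v) (spaceY G v) (opB G v)"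

text \<open>The block diagonal matrix with blocks \<open>incidence G v e\<close> times \<open>Q M\<close> at the endpoint \<open>v\<close> of
  \<open>e\<close>, for the edges \<open>e\<close> incident with \<open>v\<close>, applied to a vector.\<close>

definition opT :: "('v, 'e) network \<Rightarrow> 'v \<Rightarrow> 'e cvec \<Rightarrow> 'e cvec" where
  "opT G v \<xi> = (\<lambda>(e, i). if (e, i) \<in> comps_at G v
     then \<Sum>j<kdim G e. (matQ G e (endpoint G v e) * matM G e (endpoint G v e)) $$ (i, j)
            * incidence G v e * \<xi> (e, j)
     else 0)"


section \<open>The Hilbert space and the operator\<close>

type_synonym ('v, 'e) state = "('e \<times> nat \<Rightarrow> l2fun) \<times> ('v \<Rightarrow> 'e cvec)"

definition state_scale :: "complex \<Rightarrow> ('v, 'e) state \<Rightarrow> ('v, 'e) state" where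
  "state_scale c = (\<lambda>(u, x). (\<lambda>p. l2_scale c (u p), \<lambda>v. cscale c (x v)))"

text \<open>As for vectors, families indexed by components or by vertices are extended by zero.\<close>

definition L2d :: "('v, 'e) network \<Rightarrow> ('v, 'e) state set" where
  "L2d G = {(u, x).
     (\<forall>(e, i)\<in>comps G. u (e, i) \<in> L2_on (len G e)) \<and> (\<forall>p. p \<notin> comps G \<longrightarrow> u p = 0) \<and>
     (\<forall>v\<in>vertices G. x v \<in> spaceYd G v) \<and> (\<forall>v. v \<notin> vertices G \<longrightarrow> x v = 0)}"

definition L2d_inner :: "('v, 'e) network \<Rightarrow> ('v, 'e) state \<Rightarrow> ('v, 'e) state \<Rightarrow> complex" where
  "L2d_inner G = (\<lambda>(u, x) (v, y).
     (\<Sum>e\<in>edges G. LINT s:{0..len G e}|lebesgue.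
        (\<Sum>i<kdim G e. (\<Sum>j<kdim G e. matQ G e s $$ (i, j) * rep_l2 (u (e, j)) s)
           * cnj (rep_l2 (v (e, i)) s))) +
     (\<Sum>w\<in>vertices G. cprod (comps_at G w) (opQ G w (x w)) (y w)))"

definition L2d_norm :: "('v, 'e) network \<Rightarrow> ('v, 'e) state \<Rightarrow> real" where
  "L2d_norm G z = sqrt (Re (L2d_inner G z z))"

definition trace_at :: "('v, 'e) network \<Rightarrow> 'v \<Rightarrow> ('e \<times> nat \<Rightarrow> l2fun) \<Rightarrow> 'e cvec" where
  "trace_at G v u = (\<lambda>(e, i). if (e, i) \<in> comps_at G v
     then point_value (len G e) (u (e, i)) (endpoint G v e) else 0)"

definition A_dom :: "('v, 'e) network \<Rightarrow> ('v, 'e) state set" where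
  "A_dom G = {(u, x) \<in> L2d G.
     (\<forall>(e, i)\<in>comps G. u (e, i) \<in> H1_on (len G e)) \<and>
     (\<forall>v\<in>vertices G. trace_at G v u \<in> spaceY G v \<and>
        x v = orth_proj (comps_at G v) (spaceYd G v) (trace_at G v u))}"

definition A_op :: "('v, 'e) network \<Rightarrow> ('v, 'e) state \<Rightarrow> ('v, 'e) state" where
  "A_op G = (\<lambda>(u, x).
     (\<lambda>(e, i). if (e, i) \<in> comps G
        then abs_l2 (\<lambda>s. if s \<in> {0..len G e}
               then \<Sum>j<kdim G e. matM G e s $$ (i, j) * rep_l2 (wderiv (len G e) (u (e, j))) s
                                 + matN G e s $$ (i, j) * rep_l2 (u (e, j)) s
               else 0)
        else 0,
      \<lambda>v. if v \<in> vertices G then opB G v (trace_at G v u) + opC G v (x v) else 0))"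


section \<open>The family of vectors extended by zero\<close>

datatype w_index = Orth nat | RanAdj nat | KerAdj nat

text \<open>The families \<open>wY v\<close>, \<open>yR v\<close>, \<open>wK v\<close> have \<open>nY v\<close>, \<open>nR v\<close>, \<open>nK v\<close> members.\<close>

definition W_indices ::
  "('v, 'e) network \<Rightarrow> ('v \<Rightarrow> nat) \<Rightarrow> ('v \<Rightarrow> nat) \<Rightarrow> ('v \<Rightarrow> nat) \<Rightarrow> ('v \<times> w_index) set"
where
  "W_indices G nY nR nK =
     (SIGMA v:vertices G. Orth ` {..<nY v} \<union> RanAdj ` {..<nR v} \<union> KerAdj ` {..<nK v})"

fun W_family ::
  "('v, 'e) network \<Rightarrow> ('v \<Rightarrow> nat \<Rightarrow> 'e cvec) \<Rightarrow> ('v \<Rightarrow> nat \<Rightarrow> 'e cvec) \<Rightarrow> ('v \<Rightarrow> nat \<Rightarrow> 'e cvec)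
     \<Rightarrow> 'v \<times> w_index \<Rightarrow> 'e cvec"
where
  "W_family G wY yR wK (v, Orth i) = wY v i"
| "W_family G wY yR wK (v, RanAdj j) = adjB G v (yR v j)"
| "W_family G wY yR wK (v, KerAdj l) = wK v l"

end

theory Submission
  imports Defs "Jordan_Normal_Form.Determinant"
begin

text \<open>
  The operator is skew-symmetric up to a bounded error, and for small real \<open>h\<close> of either sign
  \<open>1 - h A\<close> is a bijection from its domain onto the space; hence it generates a group.

  \<^bold>\<open>Almost skew-symmetry\<close> (\<open>almost_skew\<close>). On an edge, \<open>Q M\<close> is Hermitian, so twice the real part of the
  form of \<open>Q M u'\<close> with \<open>u\<close> is the derivative of the form of \<open>Q M u\<close> with \<open>u\<close>, up to a term with the
  derivative of \<open>Q M\<close>. That term is controlled by the Lipschitz constant of \<open>Q M\<close>, so integration over the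
  edges leaves the values at their endpoints and an error bounded by the energy (\<open>edge_energy\<close>).
  Collected at the vertices, the endpoint values are the forms of the \<open>opT G v\<close> (\<open>boundary_terms\<close>). By the
  isotropy condition they cancel against the contribution of the \<open>opB G v\<close> to the dynamics in the
  vertices, and what remains comes from \<open>N\<close> and the \<open>opC G v\<close>. So the real part of the inner product of
  \<open>A z\<close> and \<open>z\<close> is at most \<open>w\<close> times the squared norm of \<open>z\<close>, in absolute value, and \<open>1 - h A\<close> is
  bounded below by \<open>1 - w |h|\<close>.

  \<^bold>\<open>Solvability\<close> (\<open>stationary_exists\<close>). The equation \<open>z - h A z = (f, g)\<close> is a linear system of ordinary
  differential equations on every edge, since \<open>M\<close> is invertible; its solutions are parametrised by their
  initial values, which form a vector in \<open>cvecs (comps G)\<close>. The conditions at the vertices are linear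
  conditions on that vector: orthogonality of the boundary values to a basis of the complement of
  \<open>spaceY G v\<close>, and the dynamic equation tested with bases of the range of \<open>opB G v\<close> and of the kernel of its
  adjoint, which is the orthogonal complement of that range in \<open>spaceYd G v\<close>. There is one condition for
  each member of the family \<open>W_family\<close>. As this family is a basis of \<open>cvecs (comps G)\<close>, the system is square,
  and its homogeneous version has only the trivial solution by the lower bound on \<open>1 - h A\<close>.

  \<^bold>\<open>Generation\<close> (\<open>generates_group_if_almost_skew\<close>). The resolvents \<open>J h = (1 - h A)\<^sup>-\<^sup>1\<close> give implicit Euler
  approximations \<open>J (t / 2 ^ n) ^^ 2 ^ n\<close> for every real time \<open>t\<close>. For two small steps, \<open>J h (J k x)\<close> and
  \<open>J (h + k) x\<close> differ by terms of order \<open>h k\<close> on the domain of \<open>A\<^sup>2\<close> (\<open>resolvent_product\<close>). This one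
  estimate yields convergence of the approximations and the group law of the limit; that the domain is
  dense follows from the solvability of \<open>x - h A x = y\<close>.

  The analysis behind these steps consists of the completeness of \<open>L2\<close>, the identification of the weak
  Sobolev space with the absolutely continuous functions having a square integrable derivative
  (\<open>weak_derivative_iff_AC\<close>), integration by parts against a Lipschitz weight (\<open>AC_lipschitz_estimate\<close>),
  and Picard iteration for linear systems with bounded measurable coefficients (\<open>linear_ode_exists\<close>).
\<close>

section \<open>Groups of operators generated by their resolvents\<close>

text \<open>A Banach space that is a subset of a type, as the spaces of the statement are: vectors and families extended by
  zero live in function types that are too large.\<close>

locale normed_carrier = vector_space scl
  for scl :: "complex \<Rightarrow> 'a::ab_group_add \<Rightarrow> 'a" +
  fixes H :: "'a set" and nrm :: "'a \<Rightarrow> real"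
  assumes subspace_H: "subspace H"
    and nrm_triangle: "x \<in> H \<Longrightarrow> y \<in> H \<Longrightarrow> nrm (x + y) \<le> nrm x + nrm y"
    and nrm_scale: "x \<in> H \<Longrightarrow> nrm (scl c x) = cmod c * nrm x"
    and nrm_definite: "x \<in> H \<Longrightarrow> nrm x = 0 \<Longrightarrow> x = 0"
    and nrm_complete: "(\<And>n. X n \<in> H) \<Longrightarrow> (\<And>e. e > 0 \<Longrightarrow> \<exists>N. \<forall>m\<ge>N. \<forall>n\<ge>N. nrm (X m - X n) < e)
          \<Longrightarrow> \<exists>x\<in>H. (\<lambda>n. nrm (X n - x)) \<longlonglongrightarrow> 0"
begin

lemma H_zero [simp, intro]: "0 \<in> H"
  and H_add [simp, intro]: "x \<in> H \<Longrightarrow> y \<in> H \<Longrightarrow> x + y \<in> H"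
  and H_scale [simp, intro]: "x \<in> H \<Longrightarrow> scl c x \<in> H"
  and H_diff [simp, intro]: "x \<in> H \<Longrightarrow> y \<in> H \<Longrightarrow> x - y \<in> H"
  and H_uminus [simp, intro]: "x \<in> H \<Longrightarrow> - x \<in> H"
  using subspace_H subspace_0 subspace_add subspace_scale subspace_diff subspace_neg by auto

lemma nrm_zero [simp]: "nrm 0 = 0"
  using nrm_scale[of 0 0] by simp

lemma nrm_uminus: "x \<in> H \<Longrightarrow> nrm (- x) = nrm x"
  using nrm_scale[of x "-1"] by simp

lemma nrm_nonneg [simp]: "x \<in> H \<Longrightarrow> 0 \<le> nrm x"
  using nrm_triangle[of x "- x"] nrm_uminus[of x] by simp

lemma nrm_minus_commute: "x \<in> H \<Longrightarrow> y \<in> H \<Longrightarrow> nrm (x - y) = nrm (y - x)"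
  using nrm_uminus[of "x - y"] by simp

lemma nrm_diff_triangle: "x \<in> H \<Longrightarrow> y \<in> H \<Longrightarrow> z \<in> H \<Longrightarrow> nrm (x - z) \<le> nrm (x - y) + nrm (y - z)"
  using nrm_triangle[of "x - y" "y - z"] by simp

lemma nrm_diff_le: "x \<in> H \<Longrightarrow> y \<in> H \<Longrightarrow> nrm (x - y) \<le> nrm x + nrm y"
  using nrm_triangle[of x "- y"] nrm_uminus[of y] by simp

lemma limit_unique:
  assumes "x \<in> H" "y \<in> H" "\<forall>\<^sub>F i in F. X i \<in> H" "F \<noteq> bot"
    and "((\<lambda>i. nrm (X i - x)) \<longlongrightarrow> 0) F" "((\<lambda>i. nrm (X i - y)) \<longlongrightarrow> 0) F"
  shows "x = y"
proof -
  have "((\<lambda>i. nrm (X i - x) + nrm (X i - y)) \<longlongrightarrow> 0 + 0) F"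
    using assms by (intro tendsto_add)
  moreover have "\<forall>\<^sub>F i in F. nrm (x - y) \<le> nrm (X i - x) + nrm (X i - y)"
    using assms(3) by eventually_elim
      (metis assms(1,2) nrm_diff_triangle nrm_minus_commute)
  ultimately have "nrm (x - y) \<le> 0"
    using tendsto_lowerbound[of "\<lambda>i. nrm (X i - x) + nrm (X i - y)" "0 + 0" F "nrm (x - y)"] \<open>F \<noteq> bot\<close> by auto
  then have "nrm (x - y) = 0"
    using nrm_nonneg[of "x - y"] H_diff[OF assms(1,2)] by linarith
  then show ?thesis using nrm_definite[of "x - y"] assms by auto
qed

abbreviation rscl :: "real \<Rightarrow> 'a \<Rightarrow> 'a" where "rscl h x \<equiv> scl (complex_of_real h) x"

lemma nrm_rscl: "x \<in> H \<Longrightarrow> nrm (rscl h x) = \<bar>h\<bar> * nrm x"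
  by (simp add: nrm_scale)

end

text \<open>The hypotheses of the Lumer--Phillips theorem for \<open>A\<close> and \<open>- A\<close> at once, \<open>h\<close> being of either sign. The bound
  on \<open>\<omega> * h0\<close> is what makes \<open>1 / (1 - \<omega> * \<bar>h\<bar>)\<close> at most \<open>exp (2 * \<omega> * \<bar>h\<bar>)\<close>, so that bounds for products of
  resolvents depend only on the sum of the step sizes.\<close>

locale resolvent_data = normed_carrier scl H nrm
  for scl :: "complex \<Rightarrow> 'a::ab_group_add \<Rightarrow> 'a" and H nrm +
  fixes D :: "'a set" and A :: "'a \<Rightarrow> 'a" and \<omega> h0 :: real
  assumes subspace_D: "subspace D" and D_sub: "D \<subseteq> H"
    and A_H: "x \<in> D \<Longrightarrow> A x \<in> H"
    and A_add: "x \<in> D \<Longrightarrow> y \<in> D \<Longrightarrow> A (x + y) = A x + A y"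
    and A_scale: "x \<in> D \<Longrightarrow> A (scl c x) = scl c (A x)"
    and omega: "0 \<le> \<omega>" and h0: "0 < h0" "\<omega> * h0 \<le> 1 / 2"
    and expansive: "x \<in> D \<Longrightarrow> \<bar>h\<bar> < h0 \<Longrightarrow> (1 - \<omega> * \<bar>h\<bar>) * nrm x \<le> nrm (x - rscl h (A x))"
    and solvable: "y \<in> H \<Longrightarrow> \<bar>h\<bar> < h0 \<Longrightarrow> h \<noteq> 0 \<Longrightarrow> \<exists>x\<in>D. x - rscl h (A x) = y"
    and dense: "y \<in> H \<Longrightarrow> e > 0 \<Longrightarrow> \<exists>x\<in>D. nrm (y - x) < e"
begin

lemma D_H [simp, intro]: "x \<in> D \<Longrightarrow> x \<in> H" using D_sub by auto
lemma AD_H [simp, intro]: "x \<in> D \<Longrightarrow> A x \<in> H" by (rule A_H)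

lemma D_add [simp, intro]: "x \<in> D \<Longrightarrow> y \<in> D \<Longrightarrow> x + y \<in> D"
  and D_scale [simp, intro]: "x \<in> D \<Longrightarrow> scl c x \<in> D"
  and D_diff [simp, intro]: "x \<in> D \<Longrightarrow> y \<in> D \<Longrightarrow> x - y \<in> D"
  using subspace_D subspace_add subspace_scale subspace_diff by auto

lemma A_diff: "x \<in> D \<Longrightarrow> y \<in> D \<Longrightarrow> A (x - y) = A x - A y"
  using A_add[of "x - y" y] by simp

text \<open>The resolvent \<open>(1 - h A)\<^sup>-\<^sup>1\<close>, one step of the implicit Euler method. For \<open>h = 0\<close> the operator \<open>1 - h A\<close> maps
  \<open>D\<close> onto \<open>D\<close> only, hence the separate clause.\<close>

definition J :: "real \<Rightarrow> 'a \<Rightarrow> 'a" where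
  "J h y = (if h = 0 then y else SOME x. x \<in> D \<and> x - rscl h (A x) = y)"

lemma J_0 [simp]: "J 0 y = y" by (simp add: J_def)

context
  fixes h :: real
  assumes small: "\<bar>h\<bar> < h0"
begin

lemma small_half: "\<omega> * \<bar>h\<bar> \<le> 1 / 2"
  using small omega h0 mult_left_mono[of "\<bar>h\<bar>" h0 \<omega>] by linarith

lemma J_ex: "y \<in> H \<Longrightarrow> h \<noteq> 0 \<Longrightarrow> J h y \<in> D \<and> J h y - rscl h (A (J h y)) = y"
  using someI_ex[of "\<lambda>x. x \<in> D \<and> x - rscl h (A x) = y"] solvable[of y h] small
  by (auto simp: J_def)

lemma J_in_D: "y \<in> H \<Longrightarrow> h \<noteq> 0 \<Longrightarrow> J h y \<in> D"
  and J_D: "y \<in> D \<Longrightarrow> J h y \<in> D" and J_H [simp]: "y \<in> H \<Longrightarrow> J h y \<in> H"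
  and J_eq': "y \<in> H \<Longrightarrow> h \<noteq> 0 \<Longrightarrow> J h y - rscl h (A (J h y)) = y"
  and J_eq: "y \<in> D \<Longrightarrow> J h y - rscl h (A (J h y)) = y"
  using J_ex[of y] by (cases "h = 0"; force)+

lemma injective:
  assumes "x \<in> D" "y \<in> D" "x - rscl h (A x) = y - rscl h (A y)" shows "x = y"
proof -
  have "(1 - \<omega> * \<bar>h\<bar>) * nrm (x - y) \<le> nrm ((x - y) - rscl h (A (x - y)))"
    using expansive[OF _ small] assms by auto
  also have "(x - y) - rscl h (A (x - y)) = 0"
  proof -
    have "rscl h (A (x - y)) = rscl h (A x) - rscl h (A y)"
      using A_diff[OF assms(1,2)] by (simp add: scale_right_diff_distrib)
    then have "(x - y) - rscl h (A (x - y)) = (x - rscl h (A x)) - (y - rscl h (A y))"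
      by simp
    then show ?thesis using assms(3) by simp
  qed
  finally have "(1 - \<omega> * \<bar>h\<bar>) * nrm (x - y) \<le> 0" by simp
  then have "nrm (x - y) \<le> 0" using small_half by (simp add: mult_le_0_iff)
  then have "nrm (x - y) = 0" using assms nrm_nonneg[of "x - y"] by fastforce
  then show ?thesis using nrm_definite[of "x - y"] assms by auto
qed

lemma J_unique: assumes x: "x \<in> D" and y: "x - rscl h (A x) = y" shows "J h y = x"
proof (cases "h = 0")
  case True
  then show ?thesis using y by simp
next
  case False
  have "x - rscl h (A x) \<in> H" using x by blast
  then have "y \<in> H" unfolding y .
  then show ?thesis using injective[OF J_in_D x] J_eq' False y by metis
qed

lemma J_add: assumes "x \<in> H" "y \<in> H" shows "J h (x + y) = J h x + J h y"
proof (cases "h = 0")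
  case False
  show ?thesis
  proof (rule J_unique)
  have "J h x + J h y - rscl h (A (J h x + J h y))
      = (J h x - rscl h (A (J h x))) + (J h y - rscl h (A (J h y)))"
    using J_in_D False assms by (simp add: A_add scale_right_distrib)
  then show "J h x + J h y - rscl h (A (J h x + J h y)) = x + y"
    using J_eq' False assms by simp
  qed (use J_in_D False assms in auto)
qed simp

lemma J_scale: assumes x: "x \<in> H" shows "J h (scl c x) = scl c (J h x)"
proof (cases "h = 0")
  case False
  show ?thesis
  proof (rule J_unique)
    have "scl c (J h x) - rscl h (A (scl c (J h x))) = scl c (J h x - rscl h (A (J h x)))"
      using J_in_D[OF x False] by (simp add: A_scale scale_right_diff_distrib mult.commute)
    then show "scl c (J h x) - rscl h (A (scl c (J h x))) = scl c x"
      using x False J_eq' by simp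
  qed (use J_in_D[OF x False] in auto)
qed simp

lemma J_diff: "x \<in> H \<Longrightarrow> y \<in> H \<Longrightarrow> J h (x - y) = J h x - J h y"
  using J_add[of x "scl (-1) y"] J_scale[of y "-1"] by simp

lemma J_bound: assumes "x \<in> H" shows "nrm (J h x) \<le> exp (2 * \<omega> * \<bar>h\<bar>) * nrm x"
proof (cases "h = 0")
  case False
  define s where "s = \<omega> * \<bar>h\<bar>"
  have s: "0 \<le> s" "s \<le> 1 / 2" using small_half omega by (auto simp: s_def)
  have "(1 - s) * nrm (J h x) \<le> nrm x"
    using expansive[OF J_in_D[OF assms False] small] J_eq'[OF assms False] by (simp add: s_def)
  moreover have "1 \<le> (1 - s) * exp (2 * s)"
  proof -
    have "1 \<le> (1 - s) * (1 + 2 * s)" using s mult_nonneg_nonneg[of s "1 - 2 * s"] by (simp add: algebra_simps)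
    also have "\<dots> \<le> (1 - s) * exp (2 * s)" using s exp_ge_add_one_self[of "2 * s"]
      by (intro mult_left_mono) auto
    finally show ?thesis .
  qed
  ultimately have "nrm (J h x) \<le> (1 - s) * exp (2 * s) * nrm (J h x)"
    using mult_right_mono[of 1 "(1 - s) * exp (2 * s)" "nrm (J h x)"] assms by auto
  also have "\<dots> = exp (2 * s) * ((1 - s) * nrm (J h x))" by simp
  also have "\<dots> \<le> exp (2 * s) * nrm x" using \<open>(1 - s) * nrm (J h x) \<le> nrm x\<close> by simp
  finally show ?thesis by (simp add: s_def mult.assoc)
qed simp

lemma A_J: "x \<in> D \<Longrightarrow> A (J h x) = J h (A x) \<and> A (J h x) \<in> H"
proof (cases "h = 0")
  case True
  then show "x \<in> D \<Longrightarrow> ?thesis" by simp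
next
  case False
  assume x: "x \<in> D"
  have *: "rscl h (A (J h x)) = J h x - x" using J_eq[of x] x by (metis diff_diff_eq2 add_diff_cancel_left')
  then have AJ: "A (J h x) = rscl (1 / h) (J h x - x)"
    using False by (metis (no_types, lifting) of_real_mult scale_scale nonzero_divide_eq_eq of_real_1 scale_one)
  have "A (J h x) \<in> D" unfolding AJ using x J_D by auto
  moreover have "A (J h x) - rscl h (A (A (J h x))) = A x"
  proof -
    have "rscl h (A (A (J h x))) = rscl h (rscl (1 / h) (A (J h x - x)))"
      by (metis A_scale AJ D_diff J_D x)
    also have "\<dots> = A (J h x) - A x" using False x J_D by (simp add: A_diff flip: of_real_mult)
    finally show ?thesis by simp
  qed
  ultimately show ?thesis using J_unique by (metis D_H)
qed

end

lemma J_commute: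
  assumes "\<bar>h\<bar> < h0" "\<bar>k\<bar> < h0" "x \<in> H" shows "J h (J k x) = J k (J h x)"
proof (cases "h = 0")
  case False
  note JD = J_in_D[OF assms(1,3) False]
  show ?thesis
  proof (rule J_unique[OF assms(1)])
    show "J k (J h x) \<in> D" using assms JD J_D by blast
    have "rscl h (A (J k (J h x))) = J k (rscl h (A (J h x)))"
      using A_J[OF assms(2) JD] J_scale[OF assms(2)] JD by simp
    then have "J k (J h x) - rscl h (A (J k (J h x))) = J k (J h x - rscl h (A (J h x)))"
      using J_diff[OF assms(2)] JD by simp
    then show "J k (J h x) - rscl h (A (J k (J h x))) = J k x"
      using J_eq'[OF assms(1,3) False] by simp
  qed
qed simp

text \<open>The domain of \<open>A\<^sup>2\<close>, where two Euler steps can be compared with one up to second order.\<close>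

definition D2 :: "'a set" where "D2 = {x \<in> D. A x \<in> D}"

lemma D2_D: "x \<in> D2 \<Longrightarrow> x \<in> D" and D2_A: "x \<in> D2 \<Longrightarrow> A x \<in> D" by (auto simp: D2_def)

lemma J_D2: assumes "\<bar>h\<bar> < h0" "h \<noteq> 0" "x \<in> D" shows "J h x \<in> D2"
  using A_J[OF assms(1,3)] J_D[OF assms(1,3)] J_in_D[OF assms(1) _ assms(2), of "A x"] assms by (auto simp: D2_def)

lemma J_near: assumes "\<bar>h\<bar> < h0" "x \<in> D" shows "J h x - x = rscl h (J h (A x))"
  using J_eq[OF assms(1), of x] A_J[OF assms] assms(2) by (metis diff_diff_eq2 add_diff_cancel_left')

text \<open>Let \<open>y\<close> be the product of the three resolvents at \<open>x\<close>. Removing one factor applies \<open>1 - (h + k) A\<close> to \<open>y\<close>,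
  removing the two others applies \<open>(1 - k A) (1 - h A)\<close>: the first order terms agree, and the difference
  is \<open>h k A\<^sup>2 y\<close>.\<close>

lemma resolvent_product:
  assumes h: "\<bar>h\<bar> < h0" and k: "\<bar>k\<bar> < h0" and hk: "\<bar>h + k\<bar> < h0" and x: "x \<in> D2"
  shows "nrm (J h (J k x) - J (h + k) x)
           \<le> \<bar>h * k\<bar> * exp (4 * \<omega> * (\<bar>h\<bar> + \<bar>k\<bar>)) * nrm (A (A x))"
proof -
  define y where "y = J h (J k (J (h + k) x))"
  have xH: "x \<in> H" "x \<in> D" "A x \<in> D" using x D2_D D2_A by auto
  have comm: "y = J (h + k) (J h (J k x))"
    unfolding y_def using J_commute h k hk xH by simp
  have yJ: "y = J k (J h (J (h + k) x))"
    unfolding y_def using J_commute h k hk xH by simp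
  have Ay: "A y = J h (J k (J (h + k) (A x)))" "y \<in> D"
    unfolding y_def using A_J[OF h] A_J[OF k] A_J[OF hk] xH J_D[OF h] J_D[OF k] J_D[OF hk] by simp_all
  have AAy: "A (A y) = J h (J k (J (h + k) (A (A x))))" "A y \<in> D"
    unfolding Ay using A_J[OF h] A_J[OF k] A_J[OF hk] xH J_D[OF h] J_D[OF k] J_D[OF hk] by simp_all
  have AAyH: "A (A y) \<in> H" using AAy(2) by simp
  have 1: "J h (J k x) = y - rscl (h + k) (A y)"
    unfolding comm using J_eq[OF hk, of "J h (J k x)"] h k xH J_D by simp
  have 2: "J k (J (h + k) x) = y - rscl h (A y)"
    unfolding y_def using J_eq[OF h, of "J k (J (h + k) x)"] hk k xH J_D by simp
  have "J (h + k) x = J k (J (h + k) x) - rscl k (A (J k (J (h + k) x)))"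
    using J_eq[OF k, of "J (h + k) x"] hk xH J_D by simp
  also have "\<dots> = y - rscl h (A y) - rscl k (A y - rscl h (A (A y)))"
    unfolding 2 using Ay AAy by (simp add: A_diff A_scale)
  also have "\<dots> = y - rscl (h + k) (A y) + rscl (h * k) (A (A y))"
    by (simp add: scale_right_diff_distrib scale_left_distrib mult.commute)
  finally have "J h (J k x) - J (h + k) x = - rscl (h * k) (A (A y))"
    unfolding 1 by simp
  then have "nrm (J h (J k x) - J (h + k) x) = \<bar>h * k\<bar> * nrm (A (A y))"
    using AAyH by (simp add: nrm_uminus nrm_scale abs_mult norm_mult)
  also have "nrm (A (A y)) \<le> exp (2 * \<omega> * \<bar>h\<bar>) * (exp (2 * \<omega> * \<bar>k\<bar>) * (exp (2 * \<omega> * \<bar>h + k\<bar>) * nrm (A (A x))))"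
    unfolding AAy
    using J_bound[OF h, of "J k (J (h + k) (A (A x)))"] J_bound[OF k, of "J (h + k) (A (A x))"]
      J_bound[OF hk, of "A (A x)"] xH h k hk
    by (smt (verit, ccfv_SIG) AD_H J_H exp_gt_zero mult_left_mono)
  also have "\<dots> = exp (2 * \<omega> * (\<bar>h\<bar> + \<bar>k\<bar> + \<bar>h + k\<bar>)) * nrm (A (A x))"
    by (simp add: exp_add algebra_simps)
  also have "\<dots> \<le> exp (4 * \<omega> * (\<bar>h\<bar> + \<bar>k\<bar>)) * nrm (A (A x))"
  proof -
    have "\<bar>h\<bar> + \<bar>k\<bar> + \<bar>h + k\<bar> \<le> 2 * (\<bar>h\<bar> + \<bar>k\<bar>)"
      by (metis abs_triangle_ineq add_left_mono mult_2)
    then have "2 * \<omega> * (\<bar>h\<bar> + \<bar>k\<bar> + \<bar>h + k\<bar>) \<le> 2 * \<omega> * (2 * (\<bar>h\<bar> + \<bar>k\<bar>))"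
      using omega by (intro mult_left_mono) auto
    then show ?thesis using xH by (intro mult_right_mono) (auto simp: algebra_simps)
  qed
  finally show ?thesis by (simp add: mult_left_mono mult.assoc)
qed

end

lemma (in normed_carrier) iterate_mem:
  assumes "\<And>x. x \<in> H \<Longrightarrow> F x \<in> H" "x \<in> H" shows "(F ^^ N) x \<in> H"
  using assms by (induction N) auto

lemma (in normed_carrier) iterate_bound:
  assumes F: "\<And>x. x \<in> H \<Longrightarrow> F x \<in> H" and b: "\<And>x. x \<in> H \<Longrightarrow> nrm (F x) \<le> a * nrm x"
    and a: "0 \<le> a" and x: "x \<in> H"
  shows "nrm ((F ^^ N) x) \<le> a ^ N * nrm x"
proof (induction N)
  case (Suc N)
  have "nrm ((F ^^ Suc N) x) \<le> a * nrm ((F ^^ N) x)"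
    using b[of "(F ^^ N) x"] iterate_mem[of F x N] F x by simp
  also have "\<dots> \<le> a * (a ^ N * nrm x)" using Suc a by (intro mult_left_mono)
  finally show ?case by (simp add: mult.assoc)
qed simp

text \<open>The telescoping sum of \<open>F ^^ i (F - G) G ^^ j\<close> over \<open>i + j = N - 1\<close>; since \<open>F\<close> and \<open>G\<close> commute, only the
  difference of \<open>F\<close> and \<open>G\<close> at \<open>x\<close> itself enters.\<close>

lemma (in normed_carrier) iterate_diff:
  assumes F: "\<And>x. x \<in> H \<Longrightarrow> F x \<in> H" and G: "\<And>x. x \<in> H \<Longrightarrow> G x \<in> H"
    and Fd: "\<And>x y. x \<in> H \<Longrightarrow> y \<in> H \<Longrightarrow> F (x - y) = F x - F y"
    and Gd: "\<And>x y. x \<in> H \<Longrightarrow> y \<in> H \<Longrightarrow> G (x - y) = G x - G y"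
    and comm: "\<And>x. x \<in> H \<Longrightarrow> F (G x) = G (F x)"
    and Fb: "\<And>x. x \<in> H \<Longrightarrow> nrm (F x) \<le> a * nrm x"
    and Gb: "\<And>x. x \<in> H \<Longrightarrow> nrm (G x) \<le> a * nrm x"
    and a: "1 \<le> a"
  shows "x \<in> H \<Longrightarrow> nrm ((F ^^ N) x - (G ^^ N) x) \<le> real N * a ^ N * nrm (F x - G x)"
proof (induction N arbitrary: x)
  case (Suc N)
  note x = \<open>x \<in> H\<close>
  have diffN: "(F ^^ N) (u - v) = (F ^^ N) u - (F ^^ N) v" if "u \<in> H" "v \<in> H" for u v
    using that by (induction N) (auto simp: Fd iterate_mem[OF F])
  have mem: "F x \<in> H" "G x \<in> H" "F x - G x \<in> H" using F G x by auto
  have eq: "(F ^^ Suc N) x - (G ^^ Suc N) x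
      = (F ^^ N) (F x - G x) + ((F ^^ N) (G x) - (G ^^ N) (G x))"
    using diffN[OF mem(1,2)] by (simp add: funpow_Suc_right del: funpow.simps)
  have "nrm ((F ^^ N) (F x - G x)) \<le> a ^ N * nrm (F x - G x)"
    using iterate_bound[OF F Fb _ mem(3)] a by simp
  also have "\<dots> \<le> a ^ Suc N * nrm (F x - G x)"
    using a mem by (intro mult_right_mono power_increasing) auto
  finally have 1: "nrm ((F ^^ N) (F x - G x)) \<le> a ^ Suc N * nrm (F x - G x)" .
  have "nrm ((F ^^ N) (G x) - (G ^^ N) (G x)) \<le> real N * a ^ N * nrm (F (G x) - G (G x))"
    by (rule Suc.IH) (use mem in auto)
  also have "F (G x) - G (G x) = G (F x - G x)" using comm Gd mem x by simp
  also have "real N * a ^ N * nrm (G (F x - G x)) \<le> real N * a ^ N * (a * nrm (F x - G x))"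
    using Gb mem a by (intro mult_left_mono) auto
  finally have 2: "nrm ((F ^^ N) (G x) - (G ^^ N) (G x)) \<le> real N * a ^ Suc N * nrm (F x - G x)"
    by (simp add: algebra_simps)
  have "nrm ((F ^^ Suc N) x - (G ^^ Suc N) x)
      \<le> nrm ((F ^^ N) (F x - G x)) + nrm ((F ^^ N) (G x) - (G ^^ N) (G x))"
    unfolding eq using mem iterate_mem[OF F] iterate_mem[OF G] by (intro nrm_triangle) auto
  with 1 2 show ?case by (simp add: algebra_simps)
qed simp

context resolvent_data begin

text \<open>Step numbers that are powers of two, so that one refinement replaces each step by two half steps.\<close>

definition euler :: "nat \<Rightarrow> real \<Rightarrow> 'a \<Rightarrow> 'a" where
  "euler n t = J (t / 2 ^ n) ^^ 2 ^ n"

lemma euler_mem [simp]: "\<bar>t\<bar> / 2 ^ n < h0 \<Longrightarrow> x \<in> H \<Longrightarrow> euler n t x \<in> H"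
  unfolding euler_def by (rule iterate_mem) auto

lemma euler_bound:
  assumes "\<bar>t\<bar> / 2 ^ n < h0" "x \<in> H"
  shows "nrm (euler n t x) \<le> exp (2 * \<omega> * \<bar>t\<bar>) * nrm x"
proof -
  have "nrm (euler n t x) \<le> exp (2 * \<omega> * \<bar>t / 2 ^ n\<bar>) ^ 2 ^ n * nrm x"
    unfolding euler_def by (rule iterate_bound) (use assms in \<open>auto intro: J_bound[of "t / 2 ^ n", simplified]\<close>)
  also have "exp (2 * \<omega> * \<bar>t / 2 ^ n\<bar>) ^ 2 ^ n = exp (2 * \<omega> * \<bar>t\<bar>)"
    by (simp flip: exp_of_nat_mult)
  finally show ?thesis .
qed

lemma euler_linear:
  assumes t: "\<bar>t\<bar> / 2 ^ n < h0" and x: "x \<in> H"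
  shows "y \<in> H \<Longrightarrow> euler n t (x + y) = euler n t x + euler n t y"
    and "y \<in> H \<Longrightarrow> euler n t (x - y) = euler n t x - euler n t y"
    and "euler n t (scl c x) = scl c (euler n t x)"
    and "\<bar>k\<bar> < h0 \<Longrightarrow> euler n t (J k x) = J k (euler n t x)"
proof -
  have s: "\<bar>t / 2 ^ n\<bar> < h0" using t by simp
  have mem: "z \<in> H \<Longrightarrow> (J (t / 2 ^ n) ^^ m) z \<in> H" for m z
    by (rule iterate_mem) (use s in auto)
  have add: "y \<in> H \<Longrightarrow> (J (t / 2 ^ n) ^^ m) (x + y) = (J (t / 2 ^ n) ^^ m) x + (J (t / 2 ^ n) ^^ m) y" for m
    by (induction m) (use J_add[OF s] mem x in auto)
  have diff: "y \<in> H \<Longrightarrow> (J (t / 2 ^ n) ^^ m) (x - y) = (J (t / 2 ^ n) ^^ m) x - (J (t / 2 ^ n) ^^ m) y" for m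
    by (induction m) (use J_diff[OF s] mem x in auto)
  have sc: "(J (t / 2 ^ n) ^^ m) (scl c x) = scl c ((J (t / 2 ^ n) ^^ m) x)" for m
    by (induction m) (use J_scale[OF s] mem x in auto)
  have comm: "\<bar>k\<bar> < h0 \<Longrightarrow> (J (t / 2 ^ n) ^^ m) (J k x) = J k ((J (t / 2 ^ n) ^^ m) x)" for m
    by (induction m) (use J_commute[OF s] mem x in auto)
  show "y \<in> H \<Longrightarrow> euler n t (x + y) = euler n t x + euler n t y"
    and "y \<in> H \<Longrightarrow> euler n t (x - y) = euler n t x - euler n t y"
    and "euler n t (scl c x) = scl c (euler n t x)"
    and "\<bar>k\<bar> < h0 \<Longrightarrow> euler n t (J k x) = J k (euler n t x)"
    unfolding euler_def using add diff sc comm by auto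
qed

text \<open>Each of the \<open>2 ^ n\<close> steps contributes the error \<open>s * t / 4 ^ n\<close> of \<open>resolvent_product\<close>.\<close>

lemma euler_product:
  assumes st: "(\<bar>s\<bar> + \<bar>t\<bar>) / 2 ^ n < h0" and x: "x \<in> D2"
  shows "nrm (euler n s (euler n t x) - euler n (s + t) x)
          \<le> \<bar>s * t\<bar> * exp (6 * \<omega> * (\<bar>s\<bar> + \<bar>t\<bar>)) * nrm (A (A x)) / 2 ^ n"
proof -
  define N :: nat where "N = 2 ^ n"
  define h k where "h = s / 2 ^ n" and "k = t / 2 ^ n"
  have hk: "\<bar>h\<bar> + \<bar>k\<bar> < h0" using st by (simp add: h_def k_def add_divide_distrib)
  then have small: "\<bar>h\<bar> < h0" "\<bar>k\<bar> < h0" "\<bar>h + k\<bar> < h0" using abs_triangle_ineq[of h k] by auto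
  have sum: "(s + t) / 2 ^ n = h + k" by (simp add: h_def k_def add_divide_distrib)
  have xH: "x \<in> H" "A (A x) \<in> H" using x D2_D D2_A by auto
  define a where "a = exp (2 * \<omega> * (\<bar>h\<bar> + \<bar>k\<bar>))"
  have a: "1 \<le> a" unfolding a_def using omega by simp
  have comp: "((\<lambda>y. J h (J k y)) ^^ m) y = (J h ^^ m) ((J k ^^ m) y)" if "y \<in> H" for y m
  proof (induction m)
    case (Suc m)
    have mem: "(J k ^^ m) y \<in> H" "(J h ^^ i) ((J k ^^ m) y) \<in> H" for i
      using that small by (auto intro!: iterate_mem)
    have "J k ((J h ^^ i) ((J k ^^ m) y)) = (J h ^^ i) (J k ((J k ^^ m) y))" for i
      using J_commute[OF small(2,1)] mem by (induction i) auto
    then show ?case using Suc by simp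
  qed simp
  have "nrm (((\<lambda>y. J h (J k y)) ^^ N) x - (J (h + k) ^^ N) x)
      \<le> real N * a ^ N * nrm (J h (J k x) - J (h + k) x)"
  proof (rule iterate_diff)
    fix y assume y: "y \<in> H"
    show "J h (J k (J (h + k) y)) = J (h + k) (J h (J k y))"
      using J_commute small y by simp
    have "nrm (J h (J k y)) \<le> exp (2 * \<omega> * \<bar>h\<bar>) * (exp (2 * \<omega> * \<bar>k\<bar>) * nrm y)"
      using J_bound[OF small(1), of "J k y"] small y
      by (intro order_trans[OF _ mult_left_mono[OF J_bound[OF small(2) y]]]) auto
    then show "nrm (J h (J k y)) \<le> a * nrm y" by (simp add: a_def exp_add algebra_simps)
    have "\<omega> * \<bar>h + k\<bar> \<le> \<omega> * (\<bar>h\<bar> + \<bar>k\<bar>)"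
      using omega abs_triangle_ineq by (rule mult_left_mono[rotated])
    then have "exp (2 * \<omega> * \<bar>h + k\<bar>) \<le> a" by (simp add: a_def)
    then show "nrm (J (h + k) y) \<le> a * nrm y"
      using J_bound[OF small(3) y] mult_right_mono[of _ a "nrm y"] y by fastforce
  qed (use small a xH in \<open>auto simp: J_diff\<close>)
  also have "((\<lambda>y. J h (J k y)) ^^ N) x = euler n s (euler n t x)"
    using comp[OF xH(1)] by (simp add: euler_def N_def h_def k_def)
  also have "(J (h + k) ^^ N) x = euler n (s + t) x"
    by (simp add: euler_def N_def sum)
  also have "a ^ N = exp (2 * \<omega> * (\<bar>s\<bar> + \<bar>t\<bar>))"
  proof -
    have "real N * (\<bar>h\<bar> + \<bar>k\<bar>) = \<bar>s\<bar> + \<bar>t\<bar>"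
      by (simp add: N_def h_def k_def algebra_simps)
    moreover have "a ^ N = exp (2 * \<omega> * (real N * (\<bar>h\<bar> + \<bar>k\<bar>)))"
      unfolding a_def by (simp add: mult_ac flip: exp_of_nat_mult)
    ultimately show ?thesis by simp
  qed
  also have "real N * exp (2 * \<omega> * (\<bar>s\<bar> + \<bar>t\<bar>)) * nrm (J h (J k x) - J (h + k) x)
      \<le> real N * exp (2 * \<omega> * (\<bar>s\<bar> + \<bar>t\<bar>)) * (\<bar>h * k\<bar> * exp (4 * \<omega> * (\<bar>s\<bar> + \<bar>t\<bar>)) * nrm (A (A x)))"
  proof (intro mult_left_mono)
    have "\<bar>h\<bar> \<le> \<bar>s\<bar>" "\<bar>k\<bar> \<le> \<bar>t\<bar>" by (auto simp: h_def k_def divide_le_eq mult_le_cancel_left1)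
    then have "4 * \<omega> * (\<bar>h\<bar> + \<bar>k\<bar>) \<le> 4 * \<omega> * (\<bar>s\<bar> + \<bar>t\<bar>)"
      using omega by (intro mult_left_mono) auto
    then have "\<bar>h * k\<bar> * exp (4 * \<omega> * (\<bar>h\<bar> + \<bar>k\<bar>)) * nrm (A (A x))
        \<le> \<bar>h * k\<bar> * exp (4 * \<omega> * (\<bar>s\<bar> + \<bar>t\<bar>)) * nrm (A (A x))"
      using xH by (intro mult_right_mono mult_left_mono) auto
    then show "nrm (J h (J k x) - J (h + k) x) \<le> \<bar>h * k\<bar> * exp (4 * \<omega> * (\<bar>s\<bar> + \<bar>t\<bar>)) * nrm (A (A x))"
      using resolvent_product[OF small x] by linarith
  qed auto
  also have "\<dots> = \<bar>s * t\<bar> * exp (6 * \<omega> * (\<bar>s\<bar> + \<bar>t\<bar>)) * nrm (A (A x)) / 2 ^ n"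
  proof -
    have "exp (6 * \<omega> * (\<bar>s\<bar> + \<bar>t\<bar>)) = exp (2 * \<omega> * (\<bar>s\<bar> + \<bar>t\<bar>)) * exp (4 * \<omega> * (\<bar>s\<bar> + \<bar>t\<bar>))"
      by (simp add: algebra_simps flip: exp_add)
    then show ?thesis by (simp add: N_def h_def k_def abs_mult)
  qed
  finally show ?thesis .
qed

text \<open>Two half steps instead of one step, that is, \<open>euler_product\<close> for the times \<open>t / 2\<close> and \<open>t / 2\<close>.\<close>

lemma euler_Suc:
  assumes t: "\<bar>t\<bar> / 2 ^ n < h0" and x: "x \<in> D2"
  shows "nrm (euler (Suc n) t x - euler n t x) \<le> t\<^sup>2 / 4 * exp (6 * \<omega> * \<bar>t\<bar>) * nrm (A (A x)) / 2 ^ n"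
proof -
  have two: "(2::nat) ^ Suc n = 2 ^ n + 2 ^ n" and half: "t / 2 ^ Suc n = t / 2 / 2 ^ n" by simp_all
  have "euler (Suc n) t x = euler n (t / 2) (euler n (t / 2) x)"
    unfolding euler_def two half funpow_add comp_def ..
  moreover have "\<bar>t / 2\<bar> + \<bar>t / 2\<bar> = \<bar>t\<bar>" "t / 2 + t / 2 = t" "\<bar>t / 2 * (t / 2)\<bar> = t\<^sup>2 / 4"
    by (simp_all add: power2_eq_square)
  ultimately show ?thesis
    using euler_product[of "t / 2" "t / 2" n x] t x by metis
qed

lemma small_mono:
  fixes t :: real
  assumes t: "\<bar>t\<bar> / 2 ^ n < h0" and "n \<le> m" shows "\<bar>t\<bar> / 2 ^ m < h0"
proof -
  have "\<bar>t\<bar> / 2 ^ m \<le> \<bar>t\<bar> / 2 ^ n" using assms by (intro divide_left_mono) auto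
  then show ?thesis using t by simp
qed

lemma euler_tail:
  assumes t: "\<bar>t\<bar> / 2 ^ n < h0" and x: "x \<in> D2" and nm: "n \<le> m"
  shows "nrm (euler m t x - euler n t x) \<le> t\<^sup>2 / 2 * exp (6 * \<omega> * \<bar>t\<bar>) * nrm (A (A x)) / 2 ^ n"
proof -
  define K where "K = t\<^sup>2 / 4 * exp (6 * \<omega> * \<bar>t\<bar>) * nrm (A (A x))"
  have xH: "x \<in> H" "A (A x) \<in> H" using x D2_D D2_A by auto
  have K: "0 \<le> K" using xH by (auto simp: K_def)
  have "nrm (euler m t x - euler n t x) \<le> K * (2 / 2 ^ n - 2 / 2 ^ m)"
    using nm
  proof (induction m rule: dec_induct)
    case (step m)
    have tm: "\<bar>t\<bar> / 2 ^ m < h0" "\<bar>t\<bar> / 2 ^ Suc m < h0"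
      using small_mono[OF t, of m] small_mono[OF t, of "Suc m"] step by auto
    have "nrm (euler (Suc m) t x - euler n t x)
        \<le> nrm (euler (Suc m) t x - euler m t x) + nrm (euler m t x - euler n t x)"
      using tm t xH by (intro nrm_diff_triangle euler_mem)
    also have "\<dots> \<le> K / 2 ^ m + K * (2 / 2 ^ n - 2 / 2 ^ m)"
      using euler_Suc[OF tm(1) x] step.IH unfolding K_def by (rule add_mono)
    also have "\<dots> = K * (2 / 2 ^ n - 2 / 2 ^ Suc m)" by (simp add: algebra_simps)
    finally show ?case .
  qed simp
  also have "\<dots> \<le> K * (2 / 2 ^ n)" using K by (intro mult_left_mono) auto
  also have "\<dots> = t\<^sup>2 / 2 * exp (6 * \<omega> * \<bar>t\<bar>) * nrm (A (A x)) / 2 ^ n"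
    unfolding K_def by (simp add: mult.assoc)
  finally show ?thesis .
qed

text \<open>\<open>J h\<close> maps \<open>D\<close> into \<open>D2\<close> and tends to the identity on \<open>D\<close> as \<open>h\<close> tends to \<open>0\<close>.\<close>

lemma dense_D2:
  assumes y: "y \<in> H" and e: "e > 0" shows "\<exists>x\<in>D2. nrm (y - x) < e"
proof -
  obtain z where z: "z \<in> D" "nrm (y - z) < e / 2" using dense[OF y, of "e / 2"] e by auto
  define M where "M = exp (2 * \<omega> * h0) * nrm (A z) + 1"
  have M: "M \<ge> 1" using z by (simp add: M_def)
  define h where "h = min (h0 / 2) (e / (4 * M))"
  have h: "0 < h" "h < h0" "h * M \<le> e / 4"
    using h0 e M by (auto simp: h_def min_def field_simps)
  have "nrm (J h z - z) = h * nrm (J h (A z))"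
    using J_near[of h z] h z nrm_rscl[of "J h (A z)" h] by simp
  also have "\<dots> \<le> h * M"
  proof (intro mult_left_mono)
    have "nrm (J h (A z)) \<le> exp (2 * \<omega> * h) * nrm (A z)" using J_bound[of h "A z"] h z by simp
    also have "\<dots> \<le> exp (2 * \<omega> * h0) * nrm (A z)"
      using h omega z by (intro mult_right_mono) (auto intro: mult_left_mono)
    finally show "nrm (J h (A z)) \<le> M" by (simp add: M_def)
  qed (use h in auto)
  finally have "nrm (z - J h z) < e / 2" using h e z nrm_minus_commute[of z "J h z"] by auto
  then have "nrm (y - J h z) < e"
    using nrm_diff_triangle[of y z "J h z"] z y h by auto
  then show ?thesis using J_D2[of h z] h z by auto
qed

lemma eventually_small: "\<forall>\<^sub>F n in sequentially. \<bar>t\<bar> / 2 ^ n < h0"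
proof -
  have "(\<lambda>n. \<bar>t\<bar> / 2 ^ n) \<longlonglongrightarrow> 0" by (rule LIMSEQ_divide_realpow_zero) simp
  then show ?thesis using h0 by (intro order_tendstoD)
qed

lemma obtain_small: obtains n0 where "\<And>n. n0 \<le> n \<Longrightarrow> \<bar>t\<bar> / 2 ^ n < h0"
proof -
  obtain n0 where "\<forall>n\<ge>n0. \<bar>t\<bar> / 2 ^ n < h0"
    using eventually_small[of t] unfolding eventually_sequentially by blast
  then show thesis using that by blast
qed

text \<open>On \<open>D2\<close> the refinements form a geometric series (\<open>euler_tail\<close>); the general case follows by density, as the
  approximations are uniformly bounded.\<close>

lemma euler_converges:
  assumes x: "x \<in> H"
  shows "\<exists>y\<in>H. (\<lambda>n. nrm (euler n t x - y)) \<longlonglongrightarrow> 0"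
proof -
  obtain n0 where n0: "\<And>n. n0 \<le> n \<Longrightarrow> \<bar>t\<bar> / 2 ^ n < h0" using obtain_small[of t] by blast
  define E where "E = exp (2 * \<omega> * \<bar>t\<bar>)"
  have E: "E > 0" by (simp add: E_def)
  have "\<exists>y\<in>H. (\<lambda>n. nrm (euler (n + n0) t x - y)) \<longlonglongrightarrow> 0"
  proof (rule nrm_complete)
    fix e :: real assume e: "e > 0"
    obtain z where z: "z \<in> D2" "nrm (x - z) < e / (8 * E)"
      using dense_D2[OF x, of "e / (8 * E)"] e E by auto
    have zH: "z \<in> H" "x - z \<in> H" using z D2_D x by auto
    define K where "K = t\<^sup>2 / 2 * exp (6 * \<omega> * \<bar>t\<bar>) * nrm (A (A z))"
    have "(\<lambda>n. K / 2 ^ n) \<longlonglongrightarrow> 0" by (rule LIMSEQ_divide_realpow_zero) simp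
    then have "\<forall>\<^sub>F n in sequentially. K / 2 ^ n < e / 4" using e by (intro order_tendstoD) auto
    then obtain N where N: "\<And>n. n \<ge> N \<Longrightarrow> K / 2 ^ n < e / 4" unfolding eventually_sequentially by auto
    define N1 where "N1 = max N n0"
    have close: "nrm (euler n t x - euler N1 t z) < e / 2" if "n \<ge> N1" for n
    proof -
      have n: "\<bar>t\<bar> / 2 ^ n < h0" "\<bar>t\<bar> / 2 ^ N1 < h0" using that n0 by (auto simp: N1_def)
      have "nrm (euler n t x - euler n t z) \<le> E * nrm (x - z)"
        using euler_bound[OF n(1) zH(2)] euler_linear(2)[OF n(1) x zH(1)] by (simp add: E_def)
      also have "\<dots> \<le> E * (e / (8 * E))" using z E by (intro mult_left_mono) auto
      also have "\<dots> = e / 8" using E by simp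
      finally have "nrm (euler n t x - euler n t z) \<le> e / 8" .
      moreover have "nrm (euler n t z - euler N1 t z) \<le> K / 2 ^ N1"
        using euler_tail[OF n(2) z(1) that] by (simp add: K_def)
      moreover have "K / 2 ^ N1 < e / 4" by (rule N) (simp add: N1_def)
      ultimately show ?thesis
        using nrm_diff_triangle[of "euler n t x" "euler n t z" "euler N1 t z"] n x zH e by auto
    qed
    have "nrm (euler (m + n0) t x - euler (n + n0) t x) < e" if "m \<ge> N1" "n \<ge> N1" for m n
    proof -
      have mem: "euler i t x \<in> H" "euler i t z \<in> H" if "i \<ge> N1" for i
        using that n0[of i] x zH by (auto simp: N1_def)
      have m: "m + n0 \<ge> N1" "n + n0 \<ge> N1" using that by auto
      have "nrm (euler N1 t z - euler (n + n0) t x) = nrm (euler (n + n0) t x - euler N1 t z)"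
        using m mem by (intro nrm_minus_commute) auto
      then show ?thesis
        using close[OF m(1)] close[OF m(2)]
          nrm_diff_triangle[OF mem(1)[OF m(1)] mem(2)[OF order_refl] mem(1)[OF m(2)]] by linarith
    qed
    then show "\<exists>N. \<forall>m\<ge>N. \<forall>n\<ge>N. nrm (euler (m + n0) t x - euler (n + n0) t x) < e" by blast
  qed (use n0 x in auto)
  then show ?thesis using LIMSEQ_offset[of "\<lambda>n. nrm (euler n t x - _)" n0 0] by blast
qed

definition T :: "real \<Rightarrow> 'a \<Rightarrow> 'a" where
  "T t x = (SOME y. y \<in> H \<and> (\<lambda>n. nrm (euler n t x - y)) \<longlonglongrightarrow> 0)"

lemma T_H [simp]: "x \<in> H \<Longrightarrow> T t x \<in> H"
  and T_lim: "x \<in> H \<Longrightarrow> (\<lambda>n. nrm (euler n t x - T t x)) \<longlonglongrightarrow> 0"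
  using someI_ex[of "\<lambda>y. y \<in> H \<and> (\<lambda>n. nrm (euler n t x - y)) \<longlonglongrightarrow> 0"] euler_converges[of x t]
  unfolding T_def by blast+

lemma euler_eventually_mem: "x \<in> H \<Longrightarrow> \<forall>\<^sub>F n in sequentially. euler n t x \<in> H"
  using eventually_small[of t] by eventually_elim simp

lemma T_unique:
  assumes x: "x \<in> H" "y \<in> H" and b: "\<forall>\<^sub>F n in sequentially. nrm (euler n t x - y) \<le> b n" and "b \<longlonglongrightarrow> 0"
  shows "T t x = y"
proof -
  have "(\<lambda>n. nrm (euler n t x - y)) \<longlonglongrightarrow> 0"
    by (rule tendsto_sandwich[OF _ b tendsto_const \<open>b \<longlonglongrightarrow> 0\<close>],
        rule eventually_mono[OF euler_eventually_mem[OF x(1), of t]]) (use x in simp)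
  then show ?thesis
    using limit_unique[of "T t x" y "\<lambda>n. euler n t x" sequentially] x T_lim[OF x(1)]
      euler_eventually_mem[OF x(1)] by auto
qed

lemma T_bound: assumes x: "x \<in> H" shows "nrm (T t x) \<le> exp (2 * \<omega> * \<bar>t\<bar>) * nrm x"
proof (rule tendsto_lowerbound[of "\<lambda>n. nrm (euler n t x - T t x) + exp (2 * \<omega> * \<bar>t\<bar>) * nrm x"])
  show "(\<lambda>n. nrm (euler n t x - T t x) + exp (2 * \<omega> * \<bar>t\<bar>) * nrm x) \<longlonglongrightarrow> exp (2 * \<omega> * \<bar>t\<bar>) * nrm x"
    using tendsto_add[OF T_lim[OF x, of t] tendsto_const] by simp
  show "\<forall>\<^sub>F n in sequentially. nrm (T t x) \<le> nrm (euler n t x - T t x) + exp (2 * \<omega> * \<bar>t\<bar>) * nrm x"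
    using eventually_small[of t]
  proof eventually_elim
    case (elim n)
    have "nrm (T t x) \<le> nrm (T t x - euler n t x) + nrm (euler n t x)"
      using nrm_triangle[of "T t x - euler n t x" "euler n t x"] elim x by simp
    moreover have "nrm (T t x - euler n t x) = nrm (euler n t x - T t x)"
      using elim x by (intro nrm_minus_commute) auto
    ultimately show ?case using euler_bound[OF elim x] by linarith
  qed
qed simp

lemma T_add: assumes x: "x \<in> H" "y \<in> H" shows "T t (x + y) = T t x + T t y"
proof (rule T_unique)
  show "\<forall>\<^sub>F n in sequentially. nrm (euler n t (x + y) - (T t x + T t y))
      \<le> nrm (euler n t x - T t x) + nrm (euler n t y - T t y)"
    using eventually_small[of t]
  proof eventually_elim
    case (elim n)
    have "euler n t (x + y) - (T t x + T t y) = (euler n t x - T t x) + (euler n t y - T t y)"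
      using euler_linear[OF elim] x by simp
    then show ?case
      using elim x nrm_triangle[of "euler n t x - T t x" "euler n t y - T t y"] by (simp only:) simp
  qed
  show "(\<lambda>n. nrm (euler n t x - T t x) + nrm (euler n t y - T t y)) \<longlonglongrightarrow> 0"
    using tendsto_add[OF T_lim T_lim, OF x, of t t] by simp
qed (use x in auto)

lemma T_scale: assumes x: "x \<in> H" shows "T t (scl c x) = scl c (T t x)"
proof (rule T_unique)
  show "\<forall>\<^sub>F n in sequentially. nrm (euler n t (scl c x) - scl c (T t x)) \<le> cmod c * nrm (euler n t x - T t x)"
    using eventually_small[of t]
  proof eventually_elim
    case (elim n)
    have "euler n t (scl c x) - scl c (T t x) = scl c (euler n t x - T t x)"
      using euler_linear(3)[OF elim x] by (simp add: scale_right_diff_distrib)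
    then show ?case using elim x nrm_scale[of "euler n t x - T t x" c] by (simp only:) simp
  qed
  show "(\<lambda>n. cmod c * nrm (euler n t x - T t x)) \<longlonglongrightarrow> 0"
    using tendsto_mult[OF tendsto_const T_lim[OF x, of t]] by simp
qed (use x in auto)

lemma T_diff: "x \<in> H \<Longrightarrow> y \<in> H \<Longrightarrow> T t (x - y) = T t x - T t y"
  using T_add[of "x - y" y t] by simp

lemma T_J: assumes h: "\<bar>h\<bar> < h0" and x: "x \<in> H" shows "T t (J h x) = J h (T t x)"
proof (rule T_unique)
  show "\<forall>\<^sub>F n in sequentially. nrm (euler n t (J h x) - J h (T t x))
      \<le> exp (2 * \<omega> * \<bar>h\<bar>) * nrm (euler n t x - T t x)"
    using eventually_small[of t]
  proof eventually_elim
    case (elim n)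
    have "euler n t (J h x) - J h (T t x) = J h (euler n t x - T t x)"
      using euler_linear(4)[OF elim x h] J_diff[OF h, of "euler n t x" "T t x"] elim x by simp
    then show ?case using elim x J_bound[OF h, of "euler n t x - T t x"] by (simp only:) simp
  qed
  show "(\<lambda>n. exp (2 * \<omega> * \<bar>h\<bar>) * nrm (euler n t x - T t x)) \<longlonglongrightarrow> 0"
    using tendsto_mult[OF tendsto_const T_lim[OF x, of t]] by simp
qed (use x h in auto)

lemma T_0: assumes x: "x \<in> H" shows "T 0 x = x"
proof (rule T_unique[where b = "\<lambda>n. 0"])
  have "(J 0 ^^ m) x = x" for m by (induction m) auto
  then show "\<forall>\<^sub>F n in sequentially. nrm (euler n 0 x - x) \<le> 0" by (simp add: euler_def)
qed (use x in auto)

text \<open>The density argument by which identities for \<open>T\<close> extend from \<open>D2\<close>; \<open>P\<close> is the difference of the two sides.\<close>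

lemma T_agree:
  assumes x: "x \<in> H"
    and lin: "\<And>y z. y \<in> H \<Longrightarrow> z \<in> H \<Longrightarrow> P (y - z) = P y - P z"
    and bound: "\<And>y. y \<in> H \<Longrightarrow> P y \<in> H \<and> nrm (P y) \<le> C * nrm y"
    and zero: "\<And>y. y \<in> D2 \<Longrightarrow> P y = 0"
  shows "P x = 0"
proof -
  define K where "K = max C 1"
  have K: "K \<ge> 1" by (simp add: K_def)
  have "nrm (P x) \<le> e" if e: "e > 0" for e
  proof -
    obtain z where z: "z \<in> D2" "nrm (x - z) < e / K" using dense_D2[OF x, of "e / K"] e K by auto
    have zH: "z \<in> H" "x - z \<in> H" using z D2_D x by auto
    have "nrm (P x) \<le> C * nrm (x - z)" using bound[OF zH(2)] lin[OF x zH(1)] zero[OF z(1)] by simp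
    also have "\<dots> \<le> K * nrm (x - z)" using zH by (intro mult_right_mono) (auto simp: K_def)
    also have "\<dots> \<le> K * (e / K)" using z K by (intro mult_left_mono) auto
    finally show ?thesis using K by simp
  qed
  then have "nrm (P x) \<le> 0" using field_le_epsilon[of "nrm (P x)" 0] by simp
  then have "nrm (P x) = 0" using nrm_nonneg[of "P x"] bound[OF x] by linarith
  then show ?thesis using nrm_definite[of "P x"] bound[OF x] by simp
qed

text \<open>On \<open>D2\<close> the error of \<open>euler_product\<close> tends to zero with \<open>n\<close>.\<close>

lemma T_add_time: assumes x: "x \<in> H" shows "T (s + t) x = T s (T t x)"
proof -
  have "T (s + t) x - T s (T t x) = 0"
  proof (rule T_agree[OF x, where C = "exp (2 * \<omega> * \<bar>s + t\<bar>) + exp (2 * \<omega> * \<bar>s\<bar>) * exp (2 * \<omega> * \<bar>t\<bar>)"])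
    fix y assume y: "y \<in> H"
    have "nrm (T s (T t y)) \<le> exp (2 * \<omega> * \<bar>s\<bar>) * (exp (2 * \<omega> * \<bar>t\<bar>) * nrm y)"
      using T_bound[of "T t y" s] y
      by (intro order_trans[OF _ mult_left_mono[OF T_bound[OF y, of t]]]) auto
    then have "nrm (T (s + t) y - T s (T t y))
        \<le> exp (2 * \<omega> * \<bar>s + t\<bar>) * nrm y + exp (2 * \<omega> * \<bar>s\<bar>) * (exp (2 * \<omega> * \<bar>t\<bar>) * nrm y)"
      using nrm_diff_le[of "T (s + t) y" "T s (T t y)"] T_bound[OF y, of "s + t"] y by simp
    then show "T (s + t) y - T s (T t y) \<in> H \<and> nrm (T (s + t) y - T s (T t y))
        \<le> (exp (2 * \<omega> * \<bar>s + t\<bar>) + exp (2 * \<omega> * \<bar>s\<bar>) * exp (2 * \<omega> * \<bar>t\<bar>)) * nrm y"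
      using y by (simp add: distrib_right mult.assoc)
  next
    fix y assume y: "y \<in> D2"
    have yH: "y \<in> H" "A (A y) \<in> H" using y D2_D D2_A by auto
    have "T (s + t) y = T s (T t y)"
    proof (rule T_unique)
      show "\<forall>\<^sub>F n in sequentially. nrm (euler n (s + t) y - T s (T t y))
          \<le> \<bar>s * t\<bar> * exp (6 * \<omega> * (\<bar>s\<bar> + \<bar>t\<bar>)) * nrm (A (A y)) / 2 ^ n
            + exp (2 * \<omega> * \<bar>s\<bar>) * nrm (euler n t y - T t y) + nrm (euler n s (T t y) - T s (T t y))"
        using eventually_small[of s] eventually_small[of t] eventually_small[of "\<bar>s\<bar> + \<bar>t\<bar>"]
          eventually_small[of "s + t"]
      proof eventually_elim
        case (elim n)
        have mem: "euler n (s + t) y \<in> H" "euler n s (euler n t y) \<in> H" "euler n s (T t y) \<in> H"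
          "T s (T t y) \<in> H" "euler n t y - T t y \<in> H" "euler n t y \<in> H" "T t y \<in> H"
          using elim yH by auto
        have 1: "nrm (euler n (s + t) y - euler n s (euler n t y))
            \<le> \<bar>s * t\<bar> * exp (6 * \<omega> * (\<bar>s\<bar> + \<bar>t\<bar>)) * nrm (A (A y)) / 2 ^ n"
          using euler_product[of s t n y] elim y nrm_minus_commute[OF mem(1,2)] by simp
        have 2: "nrm (euler n s (euler n t y) - euler n s (T t y)) \<le> exp (2 * \<omega> * \<bar>s\<bar>) * nrm (euler n t y - T t y)"
          using euler_bound[OF elim(1) mem(5)] euler_linear(2)[OF elim(1) mem(6,7)] by simp
        have "nrm (euler n (s + t) y - T s (T t y))
            \<le> nrm (euler n (s + t) y - euler n s (euler n t y)) + nrm (euler n s (euler n t y) - T s (T t y))"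
          using mem by (intro nrm_diff_triangle)
        also have "nrm (euler n s (euler n t y) - T s (T t y))
            \<le> nrm (euler n s (euler n t y) - euler n s (T t y)) + nrm (euler n s (T t y) - T s (T t y))"
          using mem by (intro nrm_diff_triangle)
        finally show ?case using 1 2 by linarith
      qed
      have "(\<lambda>n. \<bar>s * t\<bar> * exp (6 * \<omega> * (\<bar>s\<bar> + \<bar>t\<bar>)) * nrm (A (A y)) / 2 ^ n
            + exp (2 * \<omega> * \<bar>s\<bar>) * nrm (euler n t y - T t y) + nrm (euler n s (T t y) - T s (T t y)))
        \<longlonglongrightarrow> 0 + exp (2 * \<omega> * \<bar>s\<bar>) * 0 + 0"
        using yH by (intro tendsto_add tendsto_mult tendsto_const T_lim LIMSEQ_divide_realpow_zero) auto
      then show "(\<lambda>n. \<bar>s * t\<bar> * exp (6 * \<omega> * (\<bar>s\<bar> + \<bar>t\<bar>)) * nrm (A (A y)) / 2 ^ n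
            + exp (2 * \<omega> * \<bar>s\<bar>) * nrm (euler n t y - T t y) + nrm (euler n s (T t y) - T s (T t y)))
        \<longlonglongrightarrow> 0" by simp
    qed (use yH in auto)
    then show "T (s + t) y - T s (T t y) = 0" by simp
  qed (simp add: T_diff)
  then show ?thesis by simp
qed

end

lemma (in normed_carrier) nrm_rscl_le: "x \<in> H \<Longrightarrow> nrm x \<le> b \<Longrightarrow> nrm (rscl r x) \<le> \<bar>r\<bar> * b"
  by (simp add: nrm_rscl mult_left_mono)

context resolvent_data begin

lemma J_approx:
  assumes y: "y \<in> H" and e: "e > 0" shows "\<exists>h. 0 < h \<and> h < h0 \<and> nrm (J h y - y) < e"
proof -
  define E where "E = exp (2 * \<omega> * h0) + 1"
  have E: "E > 0" by (simp add: E_def add_pos_pos)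
  obtain z where z: "z \<in> D" "nrm (y - z) < e / (2 * E)" using dense[OF y, of "e / (2 * E)"] e E by auto
  have zH: "z \<in> H" "y - z \<in> H" using z y by auto
  define M where "M = E * nrm (A z) + 1"
  have M: "M > 0" using z E by (simp add: M_def add_nonneg_pos)
  define h where "h = min (h0 / 2) (e / (2 * M))"
  have h: "0 < h" "h < h0" "h * M \<le> e / 2"
    using h0 e M by (auto simp: h_def min_def field_simps)
  have Jb: "nrm (J h v) \<le> (E - 1) * nrm v" if "v \<in> H" for v
  proof -
    have "nrm (J h v) \<le> exp (2 * \<omega> * h) * nrm v" using J_bound[of h v] h that by simp
    also have "\<dots> \<le> (E - 1) * nrm v"
      using h omega that unfolding E_def by (intro mult_right_mono) (auto intro: mult_left_mono)
    finally show ?thesis .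
  qed
  have JH: "J h y \<in> H" "J h z \<in> H" "J h (y - z) \<in> H" using h zH y by auto
  have "nrm (J h z - z) = h * nrm (J h (A z))"
    using J_near[of h z] h z nrm_rscl[of "J h (A z)" h] by simp
  also have "\<dots> < h * M"
  proof (rule mult_strict_left_mono)
    have "nrm (J h (A z)) \<le> (E - 1) * nrm (A z)" using Jb[of "A z"] z by simp
    also have "\<dots> < M" using nrm_nonneg[OF AD_H[OF z(1)]] unfolding M_def left_diff_distrib by linarith
    finally show "nrm (J h (A z)) < M" .
  qed (use h in simp)
  finally have 1: "nrm (J h z - z) < e / 2" using h(3) by linarith
  have eq: "J h y - y = (J h (y - z) + - (y - z)) + (J h z - z)"
    using J_diff[of h y z] h y zH by simp
  have "nrm (J h y - y) \<le> nrm (J h (y - z)) + nrm (- (y - z)) + nrm (J h z - z)"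
    unfolding eq using JH zH y by (intro order_trans[OF nrm_triangle] add_right_mono nrm_triangle) auto
  also have "\<dots> \<le> E * nrm (y - z) + nrm (J h z - z)"
    using Jb[OF zH(2)] nrm_uminus[OF zH(2)] by (simp add: algebra_simps)
  also have "E * nrm (y - z) < e / 2" using z E by (simp add: field_simps)
  finally show ?thesis using 1 h by auto
qed

lemma T_near_J:
  assumes t: "\<bar>t\<bar> < h0" and x: "x \<in> D2"
  shows "nrm (T t x - J t x) \<le> t\<^sup>2 / 2 * exp (6 * \<omega> * \<bar>t\<bar>) * nrm (A (A x))"
proof -
  define K where "K = t\<^sup>2 / 2 * exp (6 * \<omega> * \<bar>t\<bar>) * nrm (A (A x))"
  have xH: "x \<in> H" using x D2_D by auto
  have J: "euler 0 t x = J t x" by (simp add: euler_def)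
  have "nrm (T t x - J t x) \<le> K"
  proof (rule tendsto_lowerbound[of "\<lambda>n. nrm (euler n t x - T t x) + K"])
    show "(\<lambda>n. nrm (euler n t x - T t x) + K) \<longlonglongrightarrow> K"
      using tendsto_add[OF T_lim[OF xH, of t] tendsto_const[of K]] by simp
    show "\<forall>\<^sub>F n in sequentially. nrm (T t x - J t x) \<le> nrm (euler n t x - T t x) + K"
      using eventually_small[of t]
    proof eventually_elim
      case (elim n)
      have "nrm (euler n t x - J t x) \<le> K"
        using euler_tail[of t 0 x n] t x unfolding K_def J by simp
      moreover have "nrm (T t x - euler n t x) = nrm (euler n t x - T t x)"
        using elim xH by (intro nrm_minus_commute) auto
      ultimately show ?case
        using nrm_diff_triangle[of "T t x" "euler n t x" "J t x"] elim xH t by simp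
    qed
  qed simp
  then show ?thesis by (simp add: K_def)
qed

text \<open>Every Euler step moves \<open>x\<close> by at most its length times a multiple of \<open>nrm (A x)\<close>.\<close>

lemma T_lipschitz:
  assumes x: "x \<in> D"
  shows "nrm (T t x - x) \<le> \<bar>t\<bar> * exp (4 * \<omega> * \<bar>t\<bar>) * nrm (A x)"
proof (rule tendsto_lowerbound[of "\<lambda>n. nrm (euler n t x - T t x) + \<bar>t\<bar> * exp (4 * \<omega> * \<bar>t\<bar>) * nrm (A x)"])
  show "(\<lambda>n. nrm (euler n t x - T t x) + \<bar>t\<bar> * exp (4 * \<omega> * \<bar>t\<bar>) * nrm (A x))
      \<longlonglongrightarrow> \<bar>t\<bar> * exp (4 * \<omega> * \<bar>t\<bar>) * nrm (A x)"
    using tendsto_add[OF T_lim[of x t] tendsto_const[of "\<bar>t\<bar> * exp (4 * \<omega> * \<bar>t\<bar>) * nrm (A x)"]] x by simp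
  show "\<forall>\<^sub>F n in sequentially. nrm (T t x - x)
      \<le> nrm (euler n t x - T t x) + \<bar>t\<bar> * exp (4 * \<omega> * \<bar>t\<bar>) * nrm (A x)"
    using eventually_small[of t]
  proof eventually_elim
    case (elim n)
    define h where "h = t / 2 ^ n"
    have h: "\<bar>h\<bar> < h0" using elim by (simp add: h_def)
    define a where "a = exp (2 * \<omega> * \<bar>h\<bar>)"
    have a: "1 \<le> a" using omega by (simp add: a_def)
    have "nrm ((J h ^^ 2 ^ n) x - ((\<lambda>x. x) ^^ 2 ^ n) x) \<le> real (2 ^ n) * a ^ 2 ^ n * nrm (J h x - x)"
    proof (rule iterate_diff)
      show "nrm y \<le> a * nrm y" if "y \<in> H" for y
        using mult_right_mono[OF a, of "nrm y"] that by simp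
      show "nrm (J h y) \<le> a * nrm y" if "y \<in> H" for y
        unfolding a_def by (rule J_bound[OF h that])
    qed (use h a x in \<open>auto simp: J_diff\<close>)
    moreover have "((\<lambda>x. x) ^^ m) x = x" for m by (induction m) auto
    ultimately have "nrm (euler n t x - x) \<le> 2 ^ n * a ^ 2 ^ n * nrm (J h x - x)"
      by (simp add: euler_def h_def)
    also have "a ^ 2 ^ n = exp (2 * \<omega> * \<bar>t\<bar>)"
      unfolding a_def h_def by (simp flip: exp_of_nat_mult)
    also have "nrm (J h x - x) \<le> \<bar>h\<bar> * (exp (2 * \<omega> * \<bar>t\<bar>) * nrm (A x))"
    proof -
      have "\<bar>h\<bar> \<le> \<bar>t\<bar>" by (auto simp: h_def divide_le_eq mult_le_cancel_left1)
      then have "exp (2 * \<omega> * \<bar>h\<bar>) * nrm (A x) \<le> exp (2 * \<omega> * \<bar>t\<bar>) * nrm (A x)"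
        using omega x by (intro mult_right_mono) (auto intro: mult_left_mono)
      then have "nrm (J h (A x)) \<le> exp (2 * \<omega> * \<bar>t\<bar>) * nrm (A x)"
        using J_bound[OF h, of "A x"] x by auto
      then show ?thesis
        using J_near[OF h x] nrm_rscl[of "J h (A x)" h] h x by (simp add: mult_left_mono)
    qed
    also have "2 ^ n * exp (2 * \<omega> * \<bar>t\<bar>) * (\<bar>h\<bar> * (exp (2 * \<omega> * \<bar>t\<bar>) * nrm (A x)))
        = \<bar>t\<bar> * (exp (2 * \<omega> * \<bar>t\<bar>) * exp (2 * \<omega> * \<bar>t\<bar>)) * nrm (A x)"
      by (simp add: h_def)
    also have "exp (2 * \<omega> * \<bar>t\<bar>) * exp (2 * \<omega> * \<bar>t\<bar>) = exp (4 * \<omega> * \<bar>t\<bar>)"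
      by (simp flip: exp_add)
    finally have "nrm (euler n t x - x) \<le> \<bar>t\<bar> * exp (4 * \<omega> * \<bar>t\<bar>) * nrm (A x)"
      by simp
    moreover have "nrm (T t x - euler n t x) = nrm (euler n t x - T t x)"
      using elim x by (intro nrm_minus_commute) auto
    ultimately show ?case
      using nrm_diff_triangle[of "T t x" "euler n t x" x] elim x by simp
  qed
qed simp

lemma T_quotient_D2:
  assumes t: "\<bar>t\<bar> < h0" "t \<noteq> 0" and x: "x \<in> D2"
  shows "nrm (rscl (1 / t) (T t x - x) - A x) \<le> \<bar>t\<bar> * (2 * exp (6 * \<omega> * h0) * nrm (A (A x)))"
proof -
  have xH: "x \<in> H" "x \<in> D" "A x \<in> D" "A (A x) \<in> H" using x D2_D D2_A by auto
  have JH: "J t x \<in> H" "J t (A x) \<in> H" "J t (A (A x)) \<in> H" using xH t by auto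
  have "rscl (1 / t) (J t x - x) = J t (A x)"
    using J_near[OF t(1) xH(2)] t(2) by (simp flip: of_real_mult)
  moreover have "rscl (1 / t) (T t x - x) = rscl (1 / t) (T t x - J t x) + rscl (1 / t) (J t x - x)"
    by (simp flip: scale_right_distrib)
  ultimately have eq: "rscl (1 / t) (T t x - x) - A x = rscl (1 / t) (T t x - J t x) + rscl t (J t (A (A x)))"
    using J_near[OF t(1) xH(3)] by (simp add: algebra_simps)
  have expm: "exp (c * \<omega> * \<bar>t\<bar>) * nrm (A (A x)) \<le> exp (6 * \<omega> * h0) * nrm (A (A x))" if "0 \<le> c" "c \<le> 6" for c
  proof -
    have "c * (\<omega> * \<bar>t\<bar>) \<le> 6 * (\<omega> * h0)"
      using that omega t by (intro mult_mono) auto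
    then show ?thesis using xH by (intro mult_right_mono) (auto simp: mult.assoc)
  qed
  have "nrm (rscl (1 / t) (T t x - J t x)) \<le> \<bar>1 / t\<bar> * (t\<^sup>2 / 2 * exp (6 * \<omega> * \<bar>t\<bar>) * nrm (A (A x)))"
    by (rule nrm_rscl_le) (use T_near_J[OF t(1) x] xH JH in auto)
  also have "\<dots> = \<bar>t\<bar> / 2 * (exp (6 * \<omega> * \<bar>t\<bar>) * nrm (A (A x)))"
    using t(2) by (simp add: power2_eq_square abs_if)
  also have "\<dots> \<le> \<bar>t\<bar> * (exp (6 * \<omega> * h0) * nrm (A (A x)))"
    by (rule mult_mono) (use expm[of 6] xH in auto)
  finally have 1: "nrm (rscl (1 / t) (T t x - J t x)) \<le> \<bar>t\<bar> * (exp (6 * \<omega> * h0) * nrm (A (A x)))" .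
  have "nrm (rscl t (J t (A (A x)))) \<le> \<bar>t\<bar> * (exp (6 * \<omega> * h0) * nrm (A (A x)))"
    by (rule nrm_rscl_le[OF JH(3) order_trans[OF J_bound[OF t(1) xH(4)]]]) (use expm[of 2] in simp)
  then show ?thesis
    using 1 nrm_triangle[of "rscl (1 / t) (T t x - J t x)" "rscl t (J t (A (A x)))"] xH JH
    unfolding eq by (simp add: algebra_simps)
qed

text \<open>An arbitrary \<open>x\<close> in \<open>D\<close> is approximated in the graph norm by \<open>J h x\<close>, which lies in \<open>D2\<close>; the remainder is
  controlled by \<open>T_lipschitz\<close>.\<close>

lemma T_quotient:
  assumes x: "x \<in> D"
  shows "((\<lambda>t. nrm (rscl (1 / t) (T t x - x) - A x)) \<longlongrightarrow> 0) (at 0)"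
proof (rule tendstoI)
  fix e :: real assume e: "e > 0"
  define E where "E = exp (4 * \<omega> * h0) + 1"
  have E: "E > 0" by (simp add: E_def add_pos_pos)
  obtain h where h: "0 < h" "h < h0" "nrm (J h (A x) - A x) < e / (2 * E)"
    using J_approx[of "A x" "e / (2 * E)"] x e E by auto
  define z where "z = J h x"
  have z: "z \<in> D2" "A z = J h (A x)"
    using J_D2[of h x] A_J[of h x] x h by (auto simp: z_def)
  have zH: "z \<in> D" "x - z \<in> D" "z \<in> H" "A z \<in> H" using D2_D[OF z(1)] x by auto
  define M where "M = 2 * exp (6 * \<omega> * h0) * nrm (A (A z)) + 1"
  have M: "M > 0" using nrm_nonneg[OF AD_H[OF D2_A[OF z(1)]]] by (simp add: M_def add_nonneg_pos)
  have xz: "nrm (A (x - z)) < e / (2 * E)"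
    using h(3) nrm_minus_commute[of "A x" "A z"] x zH by (simp add: A_diff z)
  show "\<forall>\<^sub>F t in at 0. dist (nrm (rscl (1 / t) (T t x - x) - A x)) 0 < e"
    unfolding eventually_at
  proof (intro exI conjI ballI impI)
    show "0 < min h0 (e / (2 * M))" using h0 e M by auto
    fix t :: real assume "t \<in> UNIV" "t \<noteq> 0 \<and> dist t 0 < min h0 (e / (2 * M))"
    then have t: "t \<noteq> 0" "\<bar>t\<bar> < h0" "\<bar>t\<bar> * M < e / 2" using M by (auto simp: field_simps)
    have eq: "rscl (1 / t) (T t x - x) - A x
        = rscl (1 / t) (T t (x - z) - (x - z)) + (rscl (1 / t) (T t z - z) - A z) + (- A (x - z))"
      using zH x by (simp add: T_diff A_diff scale_right_diff_distrib)
    have 1: "nrm (rscl (1 / t) (T t (x - z) - (x - z))) \<le> (E - 1) * nrm (A (x - z))"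
    proof -
      have "nrm (rscl (1 / t) (T t (x - z) - (x - z))) \<le> \<bar>1 / t\<bar> * (\<bar>t\<bar> * exp (4 * \<omega> * \<bar>t\<bar>) * nrm (A (x - z)))"
        by (rule nrm_rscl_le) (use T_lipschitz[OF zH(2), of t] zH x in auto)
      also have "\<dots> = exp (4 * \<omega> * \<bar>t\<bar>) * nrm (A (x - z))" using t(1) by simp
      also have "\<dots> \<le> (E - 1) * nrm (A (x - z))"
        using t(2) omega zH unfolding E_def by (intro mult_right_mono) (auto intro: mult_left_mono)
      finally show ?thesis .
    qed
    have "nrm (rscl (1 / t) (T t z - z) - A z) \<le> \<bar>t\<bar> * M"
      using T_quotient_D2[OF t(2,1) z(1)] by (simp add: M_def algebra_simps)
    then have 2: "nrm (rscl (1 / t) (T t z - z) - A z) < e / 2" using t(3) by linarith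
    have mem: "rscl (1 / t) (T t (x - z) - (x - z)) \<in> H" "rscl (1 / t) (T t z - z) - A z \<in> H" "A (x - z) \<in> H"
      "rscl (1 / t) (T t x - x) - A x \<in> H"
      using zH x by auto
    have "nrm (rscl (1 / t) (T t x - x) - A x)
        \<le> nrm (rscl (1 / t) (T t (x - z) - (x - z))) + nrm (rscl (1 / t) (T t z - z) - A z) + nrm (- A (x - z))"
      unfolding eq using mem
      by (intro order_trans[OF nrm_triangle] add_right_mono nrm_triangle) auto
    also have "\<dots> < (E - 1) * nrm (A (x - z)) + e / 2 + nrm (A (x - z))"
      using 1 2 nrm_uminus[OF mem(3)] by linarith
    also have "\<dots> = E * nrm (A (x - z)) + e / 2" by (simp add: algebra_simps)
    also have "\<dots> < e / 2 + e / 2"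
      using xz E by (simp add: field_simps)
    finally show "dist (nrm (rscl (1 / t) (T t x - x) - A x)) 0 < e"
      using mem(4) by simp
  qed
qed

text \<open>The generator of \<open>T\<close> is no proper extension of \<open>A\<close>: \<open>J h\<close> commutes with \<open>T\<close> and maps into \<open>D\<close>, so the limit of the
  quotients gives \<open>A (J h x) = J h y\<close>. This says \<open>x = J h (x - h y)\<close>, whence \<open>x\<close> lies in the range of \<open>J h\<close>.\<close>

lemma T_quotient_converse:
  assumes x: "x \<in> H" and y: "y \<in> H"
    and lim: "((\<lambda>t. nrm (rscl (1 / t) (T t x - x) - y)) \<longlongrightarrow> 0) (at 0)"
  shows "x \<in> D \<and> A x = y"
proof -
  define h where "h = h0 / 2"
  have h: "0 < h" "h < h0" "\<bar>h\<bar> < h0" "h \<noteq> 0" using h0 by (auto simp: h_def)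
  have JD: "J h x \<in> D" "J h y \<in> D" using J_in_D h x y by auto
  have "A (J h x) = J h y"
  proof (rule limit_unique[where F = "at (0::real)"])
    show "((\<lambda>t. nrm (rscl (1 / t) (T t (J h x) - J h x) - A (J h x))) \<longlongrightarrow> 0) (at 0)"
      using T_quotient[OF JD(1)] .
    show "((\<lambda>t. nrm (rscl (1 / t) (T t (J h x) - J h x) - J h y)) \<longlongrightarrow> 0) (at 0)"
    proof (rule tendsto_sandwich[OF _ _ tendsto_const])
      have "rscl (1 / t) (T t (J h x) - J h x) - J h y = J h (rscl (1 / t) (T t x - x) - y)" for t
        using x y h JD by (simp add: T_J J_diff J_scale)
      then show "\<forall>\<^sub>F t in at 0. nrm (rscl (1 / t) (T t (J h x) - J h x) - J h y)
          \<le> exp (2 * \<omega> * \<bar>h\<bar>) * nrm (rscl (1 / t) (T t x - x) - y)"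
        using J_bound[OF h(3)] x y by simp
      show "((\<lambda>t. exp (2 * \<omega> * \<bar>h\<bar>) * nrm (rscl (1 / t) (T t x - x) - y)) \<longlongrightarrow> 0) (at 0)"
        using tendsto_mult[OF tendsto_const lim] by simp
      show "\<forall>\<^sub>F t in at 0. 0 \<le> nrm (rscl (1 / t) (T t (J h x) - J h x) - J h y)"
        using x JD by (intro always_eventually) auto
    qed
  qed (use JD x in auto)
  then have "x = J h x - rscl h (J h y)" using J_eq'[OF h(3) x h(4)] by simp
  then have eq: "x = J h (x - rscl h y)" using x y h by (simp add: J_diff J_scale)
  have mem: "x - rscl h y \<in> H" using x y by auto
  have "x \<in> D" using J_in_D[OF h(3) mem h(4)] eq by simp
  moreover have "x - rscl h (A x) = x - rscl h y"
    using J_eq'[OF h(3) mem h(4)] eq by simp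
  then have "rscl h (A x) = rscl h y" by simp
  then have "A x = y" using h(4) scale_cancel_left by simp
  ultimately show ?thesis by blast
qed

lemma T_continuous:
  assumes x: "x \<in> H"
  shows "((\<lambda>s. nrm (T s x - T t x)) \<longlongrightarrow> 0) (at t)"
proof -
  have at0: "((\<lambda>s. nrm (T s x - x)) \<longlongrightarrow> 0) (at 0)"
  proof (rule tendstoI)
    fix e :: real assume e: "e > 0"
    define E where "E = exp (4 * \<omega>) + 1"
    have E: "E > 0" by (simp add: E_def add_pos_pos)
    obtain z where z: "z \<in> D" "nrm (x - z) < e / (2 * E)" using dense[OF x, of "e / (2 * E)"] e E by auto
    have zH: "z \<in> H" "x - z \<in> H" "A z \<in> H" using z x by auto
    define M where "M = E * nrm (A z) + 1"
    have M: "M > 0" using zH E by (simp add: M_def add_nonneg_pos)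
    show "\<forall>\<^sub>F s in at 0. dist (nrm (T s x - x)) 0 < e"
      unfolding eventually_at
    proof (intro exI conjI ballI impI)
      show "0 < min 1 (e / (2 * M))" using e M by auto
      fix s :: real assume "s \<in> UNIV" "s \<noteq> 0 \<and> dist s 0 < min 1 (e / (2 * M))"
      then have s: "\<bar>s\<bar> < 1" "\<bar>s\<bar> * M < e / 2" using M by (auto simp: field_simps)
      have ex: "exp (c * \<omega> * \<bar>s\<bar>) \<le> E - 1" if "0 \<le> c" "c \<le> 4" for c
      proof -
        have "c * \<omega> * \<bar>s\<bar> \<le> 4 * \<omega> * 1" using that s omega by (intro mult_mono) auto
        then show ?thesis by (simp add: E_def)
      qed
      have "nrm (T s (x - z)) \<le> exp (2 * \<omega> * \<bar>s\<bar>) * nrm (x - z)" by (rule T_bound[OF zH(2)])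
      also have "\<dots> \<le> (E - 1) * nrm (x - z)" using ex[of 2] zH by (intro mult_right_mono) auto
      finally have 1: "nrm (T s (x - z)) \<le> (E - 1) * nrm (x - z)" .
      have "nrm (T s z - z) \<le> \<bar>s\<bar> * exp (4 * \<omega> * \<bar>s\<bar>) * nrm (A z)" by (rule T_lipschitz[OF z(1)])
      also have "\<dots> \<le> \<bar>s\<bar> * E * nrm (A z)"
        using ex[of 4] zH by (intro mult_right_mono mult_left_mono) auto
      also have "\<dots> \<le> \<bar>s\<bar> * M" by (simp add: M_def algebra_simps)
      finally have 2: "nrm (T s z - z) < e / 2" using s(2) by linarith
      have eq: "T s x - x = T s (x - z) + (T s z - z) + (- (x - z))" using x zH by (simp add: T_diff)
      have "nrm (T s x - x) \<le> nrm (T s (x - z)) + nrm (T s z - z) + nrm (- (x - z))"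
        unfolding eq using x zH by (intro order_trans[OF nrm_triangle] add_right_mono nrm_triangle) auto
      also have "\<dots> < E * nrm (x - z) + e / 2"
        using 1 2 nrm_uminus[OF zH(2)] by (simp add: algebra_simps)
      also have "\<dots> < e / 2 + e / 2" using z E by (simp add: field_simps)
      finally show "dist (nrm (T s x - x)) 0 < e" using x by simp
    qed
  qed
  have "((\<lambda>h. nrm (T (t + h) x - T t x)) \<longlongrightarrow> 0) (at 0)"
  proof (rule tendsto_sandwich[OF _ _ tendsto_const])
    have "T (t + h) x - T t x = T t (T h x - x)" for h
      using x by (simp add: T_add_time T_diff)
    then show "\<forall>\<^sub>F h in at 0. nrm (T (t + h) x - T t x) \<le> exp (2 * \<omega> * \<bar>t\<bar>) * nrm (T h x - x)"
      using T_bound x by simp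
    show "((\<lambda>h. exp (2 * \<omega> * \<bar>t\<bar>) * nrm (T h x - x)) \<longlongrightarrow> 0) (at 0)"
      using tendsto_mult[OF tendsto_const at0] by simp
  qed (use x in \<open>intro always_eventually, auto\<close>)
  then show ?thesis by (rule LIM_offset_zero_cancel)
qed

theorem generates_group: "generates_strongly_continuous_group scl H nrm D A"
proof -
  have "bounded_operator scl H nrm (T t)" for t
    unfolding bounded_operator_def linear_between_def using T_add T_scale T_bound T_H by metis
  then have "strongly_continuous_group scl H nrm T"
    unfolding strongly_continuous_group_def using T_0 T_add_time T_continuous by blast
  moreover have "generator_of scl H nrm T D A"
    unfolding generator_of_def
  proof (intro conjI ballI iffI)
    fix x y assume "x \<in> H" "y \<in> H" "((\<lambda>t. nrm (rscl (1 / t) (T t x - x) - y)) \<longlongrightarrow> 0) (at 0)"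
    then show "x \<in> D" "A x = y" using T_quotient_converse by blast+
  next
    fix x y assume "x \<in> D \<and> A x = y"
    then show "((\<lambda>t. nrm (rscl (1 / t) (T t x - x) - y)) \<longlongrightarrow> 0) (at 0)" using T_quotient by blast
  qed (use D_sub A_H in auto)
  ultimately show ?thesis unfolding generates_strongly_continuous_group_def by blast
qed

end

section \<open>Skew-symmetry up to a bounded term in a Hilbert space\<close>

locale inner_carrier = vector_space scl
  for scl :: "complex \<Rightarrow> 'a::ab_group_add \<Rightarrow> 'a" +
  fixes H :: "'a set" and ip :: "'a \<Rightarrow> 'a \<Rightarrow> complex"
  assumes carrier_subspace: "subspace H"
    and ip_add: "x \<in> H \<Longrightarrow> y \<in> H \<Longrightarrow> z \<in> H \<Longrightarrow> ip (x + y) z = ip x z + ip y z"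
    and ip_scale: "x \<in> H \<Longrightarrow> y \<in> H \<Longrightarrow> ip (scl c x) y = c * ip x y"
    and ip_hermitian: "x \<in> H \<Longrightarrow> y \<in> H \<Longrightarrow> ip y x = cnj (ip x y)"
    and ip_pos: "x \<in> H \<Longrightarrow> x \<noteq> 0 \<Longrightarrow> 0 < Re (ip x x)"
begin

definition nrm :: "'a \<Rightarrow> real" where "nrm x = sqrt (Re (ip x x))"

lemma mem_zero [simp, intro]: "0 \<in> H"
  and mem_add [simp, intro]: "x \<in> H \<Longrightarrow> y \<in> H \<Longrightarrow> x + y \<in> H"
  and mem_scale [simp, intro]: "x \<in> H \<Longrightarrow> scl c x \<in> H"
  and mem_diff [simp, intro]: "x \<in> H \<Longrightarrow> y \<in> H \<Longrightarrow> x - y \<in> H"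
  using carrier_subspace subspace_0 subspace_add subspace_scale subspace_diff by auto

lemma ip_0 [simp]: "x \<in> H \<Longrightarrow> ip 0 x = 0" "x \<in> H \<Longrightarrow> ip x 0 = 0"
proof -
  show *: "ip 0 x = 0" if "x \<in> H" for x using ip_scale[of 0 x 0] that by simp
  show "ip x 0 = 0" if "x \<in> H" for x using ip_hermitian[of 0 x] *[of x] that by simp
qed

lemma ip_diff: "x \<in> H \<Longrightarrow> y \<in> H \<Longrightarrow> z \<in> H \<Longrightarrow> ip (x - y) z = ip x z - ip y z"
  using ip_add[of "x - y" y z] by simp

lemma ip_add_right: "x \<in> H \<Longrightarrow> y \<in> H \<Longrightarrow> z \<in> H \<Longrightarrow> ip z (x + y) = ip z x + ip z y"
  and ip_diff_right: "x \<in> H \<Longrightarrow> y \<in> H \<Longrightarrow> z \<in> H \<Longrightarrow> ip z (x - y) = ip z x - ip z y"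
  and ip_scale_right: "x \<in> H \<Longrightarrow> y \<in> H \<Longrightarrow> ip x (scl c y) = cnj c * ip x y"
  by (metis ip_hermitian ip_add mem_add complex_cnj_add,
      metis ip_hermitian ip_diff mem_diff complex_cnj_diff,
      metis ip_hermitian ip_scale mem_scale complex_cnj_mult)

lemma ip_self_real: "x \<in> H \<Longrightarrow> ip x x = of_real (Re (ip x x))"
  using ip_hermitian[of x x] by (simp add: complex_eq_iff)

lemma Re_ip_nonneg: "x \<in> H \<Longrightarrow> 0 \<le> Re (ip x x)"
  using ip_pos[of x] by (cases "x = 0") auto

lemma nrm_sq: "x \<in> H \<Longrightarrow> (nrm x)\<^sup>2 = Re (ip x x)"
  by (simp add: nrm_def Re_ip_nonneg)

lemma nrm_ge_0: "x \<in> H \<Longrightarrow> 0 \<le> nrm x"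
  by (simp add: nrm_def Re_ip_nonneg)

lemma projection_residual:
  assumes x: "x \<in> H" and y: "y \<in> H" "y \<noteq> 0"
  shows "(nrm (x - scl (ip x y / ip y y) y))\<^sup>2 = (nrm x)\<^sup>2 - (cmod (ip x y))\<^sup>2 / (nrm y)\<^sup>2"
proof -
  define r where "r = Re (ip y y)"
  have r: "r > 0" "ip y y = of_real r" using ip_pos[OF y] ip_self_real[OF y(1)] by (auto simp: r_def)
  define c where "c = ip x y / ip y y"
  have "ip (x - scl c y) (x - scl c y) = ip x x - cnj c * ip x y - c * cnj (ip x y) + c * cnj c * ip y y"
    using x y ip_hermitian[OF x y(1)] by (simp add: ip_diff ip_diff_right ip_scale ip_scale_right algebra_simps)
  also have "\<dots> = ip x x - of_real ((cmod (ip x y))\<^sup>2 / r)"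
    using r complex_norm_square[of "ip x y"] by (simp add: c_def field_simps)
  finally have "Re (ip (x - scl c y) (x - scl c y)) = Re (ip x x) - (cmod (ip x y))\<^sup>2 / r" by simp
  then show ?thesis using nrm_sq[OF x] nrm_sq[of "x - scl c y"] nrm_sq[OF y(1)] x y by (simp add: r_def c_def)
qed

lemma Cauchy_Schwarz:
  assumes x: "x \<in> H" and y: "y \<in> H" shows "cmod (ip x y) \<le> nrm x * nrm y"
proof (cases "y = 0")
  case False
  have "0 < (nrm y)\<^sup>2" using ip_pos[OF y False] nrm_sq[OF y] by simp
  moreover have "0 \<le> (nrm x)\<^sup>2 - (cmod (ip x y))\<^sup>2 / (nrm y)\<^sup>2"
    using projection_residual[OF x y False] zero_le_power2 by metis
  ultimately have "(cmod (ip x y))\<^sup>2 \<le> (nrm x * nrm y)\<^sup>2"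
    by (simp add: field_simps power_mult_distrib)
  then show ?thesis by (rule power2_le_imp_le) (use nrm_ge_0 x y in auto)
qed (use x y in \<open>auto simp: nrm_def\<close>)

lemma nrm_add_sq:
  assumes "x \<in> H" "y \<in> H"
  shows "(nrm (x + y))\<^sup>2 = (nrm x)\<^sup>2 + 2 * Re (ip x y) + (nrm y)\<^sup>2"
    and "(nrm (x - y))\<^sup>2 = (nrm x)\<^sup>2 - 2 * Re (ip x y) + (nrm y)\<^sup>2"
proof -
  have "Re (ip y x) = Re (ip x y)" using ip_hermitian[OF assms] by simp
  then show "(nrm (x + y))\<^sup>2 = (nrm x)\<^sup>2 + 2 * Re (ip x y) + (nrm y)\<^sup>2"
    and "(nrm (x - y))\<^sup>2 = (nrm x)\<^sup>2 - 2 * Re (ip x y) + (nrm y)\<^sup>2"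
    using assms by (simp_all add: nrm_sq ip_add ip_add_right ip_diff ip_diff_right)
qed

lemma nrm_subadditive: assumes "x \<in> H" "y \<in> H" shows "nrm (x + y) \<le> nrm x + nrm y"
proof -
  have "Re (ip x y) \<le> nrm x * nrm y" using Cauchy_Schwarz[OF assms] complex_Re_le_cmod order_trans by blast
  then have "(nrm (x + y))\<^sup>2 \<le> (nrm x + nrm y)\<^sup>2"
    using nrm_add_sq(1)[OF assms] by (simp add: power2_sum)
  then show ?thesis by (rule power2_le_imp_le) (use nrm_ge_0 assms in auto)
qed

lemma nrm_homogeneous: assumes "x \<in> H" shows "nrm (scl c x) = cmod c * nrm x"
proof -
  have "(nrm (scl c x))\<^sup>2 = Re (c * cnj c * ip x x)"
    using assms by (simp add: nrm_sq ip_scale ip_scale_right mult.assoc mult.left_commute[of c])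
  also have "\<dots> = Re (complex_of_real ((cmod c)\<^sup>2) * ip x x)"
    using complex_norm_square[of c] by simp
  also have "\<dots> = (cmod c * nrm x)\<^sup>2"
    by (simp add: power_mult_distrib nrm_sq[OF assms] del: of_real_power)
  finally show ?thesis using assms nrm_ge_0 by (simp add: power2_eq_iff_nonneg)
qed

end

locale hilbert_carrier = inner_carrier scl H ip
  for scl :: "complex \<Rightarrow> 'a::ab_group_add \<Rightarrow> 'a" and H ip +
  assumes complete: "(\<And>n. X n \<in> H) \<Longrightarrow> (\<And>e. e > 0 \<Longrightarrow> \<exists>N. \<forall>m\<ge>N. \<forall>n\<ge>N. nrm (X m - X n) < e)
          \<Longrightarrow> \<exists>x\<in>H. (\<lambda>n. nrm (X n - x)) \<longlonglongrightarrow> 0"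

sublocale hilbert_carrier \<subseteq> normed_carrier scl H nrm
proof unfold_locales
  show "x = 0" if "x \<in> H" "nrm x = 0" for x
    using that ip_pos[of x] by (auto simp: nrm_def)
qed (use carrier_subspace nrm_subadditive nrm_homogeneous complete in blast)+

context hilbert_carrier begin

text \<open>Projection onto a subspace that need not be closed: by the parallelogram law a minimizing sequence is Cauchy, and
  the difference of \<open>y\<close> and its limit is orthogonal to \<open>D\<close>.\<close>

lemma dense_if_orthogonal_trivial:
  assumes D: "subspace D" "D \<subseteq> H"
    and orth: "\<And>w. w \<in> H \<Longrightarrow> (\<And>x. x \<in> D \<Longrightarrow> ip w x = 0) \<Longrightarrow> w = 0"
    and y: "y \<in> H" and e: "e > 0"
  shows "\<exists>x\<in>D. nrm (y - x) < e"
proof -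
  have DH: "x \<in> D \<Longrightarrow> x \<in> H" for x using D by auto
  define d where "d = (INF x\<in>D. nrm (y - x))"
  have bdd: "bdd_below ((\<lambda>x. nrm (y - x)) ` D)" using y DH by (intro bdd_belowI2[of _ 0]) auto
  have D0: "0 \<in> D" using D subspace_0 by blast
  have d_le: "d \<le> nrm (y - x)" if "x \<in> D" for x unfolding d_def by (rule cINF_lower[OF bdd that])
  have d0: "0 \<le> d" unfolding d_def using D0 y DH by (intro cINF_greatest) auto
  have "\<exists>x\<in>D. nrm (y - x) < d + 1 / real (Suc n)" for n
    using cINF_less_iff[OF _ bdd, of "d + 1 / real (Suc n)"] D0 unfolding d_def by auto
  then obtain X where X: "\<And>n. X n \<in> D" "\<And>n. nrm (y - X n) < d + 1 / real (Suc n)" by metis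
  have XH: "X n \<in> H" for n using X DH by blast
  have near: "nrm (y - X n) < d + a" if "n \<ge> N" "1 / real (Suc N) \<le> a" for n N a
  proof -
    have "1 / real (Suc n) \<le> 1 / real (Suc N)" using that by (intro divide_left_mono) auto
    then show ?thesis using X(2)[of n] that by linarith
  qed
  have "\<exists>p\<in>H. (\<lambda>n. nrm (X n - p)) \<longlonglongrightarrow> 0"
  proof (rule complete)
    fix e :: real assume e: "e > 0"
    \<comment> \<open>chosen so that \<open>4 (d + a)\<^sup>2 - 4 d\<^sup>2\<close>, the bound from the parallelogram law, is less than \<open>e\<^sup>2\<close>\<close>
    define a where "a = min 1 (e\<^sup>2 / (8 * d + 5))"
    have pos: "0 < 8 * d + 5" using d0 by simp
    then have a: "0 < a" "a \<le> 1" using e by (auto simp: a_def)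
    have "a \<le> e\<^sup>2 / (8 * d + 5)" by (simp add: a_def)
    then have a_le: "a * (8 * d + 5) \<le> e\<^sup>2" using pos by (simp only: pos_le_divide_eq)
    obtain N where N: "1 / real (Suc N) < a" using a(1) nat_approx_posE by blast
    have "nrm (X m - X n) < e" if "m \<ge> N" "n \<ge> N" for m n
    proof -
      define u v where "u = y - X m" and "v = y - X n"
      have uv: "u \<in> H" "v \<in> H" using y XH by (auto simp: u_def v_def)
      have small: "nrm u < d + a" "nrm v < d + a"
        using near[OF that(1)] near[OF that(2)] N by (auto simp: u_def v_def)
      have "2 * d \<le> nrm (u + v)"
      proof -
        have "u + v = scl 2 (y - scl (1/2) (X m + X n))"
          by (simp add: u_def v_def scale_right_diff_distrib scale_left_distrib[of 1 1, simplified])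
        moreover have "scl (1/2) (X m + X n) \<in> D" using D X by (auto intro: subspace_scale subspace_add)
        ultimately show ?thesis using d_le y DH by (simp add: nrm_homogeneous)
      qed
      then have "4 * d\<^sup>2 \<le> (nrm (u + v))\<^sup>2" using d0 power_mono[of "2 * d" "nrm (u + v)" 2] by simp
      moreover have "(nrm (u + v))\<^sup>2 + (nrm (v - u))\<^sup>2 = 2 * (nrm u)\<^sup>2 + 2 * (nrm v)\<^sup>2"
        using nrm_add_sq[OF uv] nrm_minus_commute[OF uv] by simp
      moreover have "(nrm u)\<^sup>2 \<le> (d + a)\<^sup>2" "(nrm v)\<^sup>2 \<le> (d + a)\<^sup>2"
        using small uv by (auto intro!: power_mono)
      ultimately have "(nrm (v - u))\<^sup>2 \<le> 4 * (d + a)\<^sup>2 - 4 * d\<^sup>2" by linarith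
      also have "\<dots> = a * (8 * d + 4 * a)" by (simp add: power2_eq_square algebra_simps)
      also have "\<dots> < a * (8 * d + 5)" using a by simp
      also have "\<dots> \<le> e\<^sup>2" by (rule a_le)
      finally have "nrm (v - u) < e" using e by (simp add: power2_less_imp_less)
      then show ?thesis by (simp add: u_def v_def)
    qed
    then show "\<exists>N. \<forall>m\<ge>N. \<forall>n\<ge>N. nrm (X m - X n) < e" by blast
  qed (rule XH)
  then obtain p where p: "p \<in> H" "(\<lambda>n. nrm (X n - p)) \<longlonglongrightarrow> 0" by blast
  define w where "w = y - p"
  have wH: "w \<in> H" using y p by (simp add: w_def)
  have "ip w x = 0" if x: "x \<in> D" for x
  proof (rule ccontr)
    assume nz: "ip w x \<noteq> 0"
    have xH: "x \<in> H" "x \<noteq> 0" using x DH nz wH by auto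
    define c where "c = ip w x / ip x x"
    have cxH: "w - scl c x \<in> H" using wH xH by auto
    have "nrm w \<le> d"
    proof (rule tendsto_lowerbound)
      have "(\<lambda>n. (d + 1 / real (Suc n)) + nrm (X n - p)) \<longlonglongrightarrow> (d + 0) + 0"
        by (intro tendsto_add tendsto_const p LIMSEQ_Suc lim_1_over_n)
      then show "(\<lambda>n. (d + 1 / real (Suc n)) + nrm (X n - p)) \<longlonglongrightarrow> d" by simp
      show "\<forall>\<^sub>F n in sequentially. nrm w \<le> (d + 1 / real (Suc n)) + nrm (X n - p)"
      proof (intro always_eventually allI)
        fix n show "nrm w \<le> (d + 1 / real (Suc n)) + nrm (X n - p)"
          using nrm_diff_triangle[OF y XH[of n] p(1)] X(2)[of n] unfolding w_def by linarith
      qed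
    qed simp
    moreover have "d \<le> nrm (w - scl c x)"
    proof (rule tendsto_lowerbound)
      show "(\<lambda>n. nrm (w - scl c x) + nrm (X n - p)) \<longlonglongrightarrow> nrm (w - scl c x)"
        using tendsto_add[OF tendsto_const p(2)] by simp
      show "\<forall>\<^sub>F n in sequentially. d \<le> nrm (w - scl c x) + nrm (X n - p)"
      proof (intro always_eventually allI)
        fix n
        have "X n + scl c x \<in> D" using D X x by (auto intro: subspace_scale subspace_add)
        then have "d \<le> nrm (y - (X n + scl c x))" by (rule d_le)
        also have "y - (X n + scl c x) = (w - scl c x) + (p - X n)" by (simp add: w_def)
        also have "nrm \<dots> \<le> nrm (w - scl c x) + nrm (X n - p)"
          using nrm_triangle[of "w - scl c x" "p - X n"] nrm_minus_commute[OF p(1) XH[of n]] cxH p XH[of n] by auto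
        finally show "d \<le> nrm (w - scl c x) + nrm (X n - p)" .
      qed
    qed simp
    ultimately have "(nrm w)\<^sup>2 \<le> (nrm (w - scl c x))\<^sup>2" using wH by (intro power_mono) auto
    also have "\<dots> = (nrm w)\<^sup>2 - (cmod (ip w x))\<^sup>2 / (nrm x)\<^sup>2"
      unfolding c_def by (rule projection_residual[OF wH xH])
    finally have "(cmod (ip w x))\<^sup>2 / (nrm x)\<^sup>2 \<le> 0" by simp
    moreover have "0 < (nrm x)\<^sup>2" using ip_pos[OF xH] nrm_sq[OF xH(1)] by simp
    ultimately show False using nz by (simp add: divide_le_0_iff)
  qed
  then have "w = 0" using orth wH by blast
  then have "(\<lambda>n. nrm (X n - y)) \<longlonglongrightarrow> 0" using p by (simp add: w_def)
  then obtain n where "nrm (X n - y) < e"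
    using e order_tendstoD(2)[of "\<lambda>n. nrm (X n - y)" 0 sequentially e] eventually_sequentially by auto
  then show ?thesis using X(1) nrm_minus_commute[OF y XH] by metis
qed

text \<open>By the estimate on \<open>ip (A x) x\<close> and the Cauchy--Schwarz inequality, \<open>1 - h A\<close> is bounded below. Solvability also makes \<open>D\<close>
  dense: if \<open>w\<close> is orthogonal to \<open>D\<close> and \<open>x - h A x = w\<close>, then the same estimate applied to \<open>ip w x = 0\<close> gives \<open>x = 0\<close>.\<close>

theorem generates_group_if_almost_skew:
  assumes D: "subspace D" "D \<subseteq> H"
    and A: "\<And>x. x \<in> D \<Longrightarrow> A x \<in> H"
      "\<And>x y. x \<in> D \<Longrightarrow> y \<in> D \<Longrightarrow> A (x + y) = A x + A y"
      "\<And>c x. x \<in> D \<Longrightarrow> A (scl c x) = scl c (A x)"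
    and skew: "\<And>x. x \<in> D \<Longrightarrow> \<bar>Re (ip (A x) x)\<bar> \<le> \<omega> * (nrm x)\<^sup>2" and \<omega>: "0 \<le> \<omega>"
    and range: "\<And>h y. y \<in> H \<Longrightarrow> h \<noteq> 0 \<Longrightarrow> \<omega> * \<bar>h\<bar> < 1 \<Longrightarrow> \<exists>x\<in>D. x - scl (of_real h) (A x) = y"
  shows "generates_strongly_continuous_group scl H nrm D A"
proof -
  \<comment> \<open>\<open>\<omega> + 1\<close> instead of \<open>\<omega>\<close>, as \<open>\<omega>\<close> may be zero\<close>
  define h0 where "h0 = 1 / (2 * (\<omega> + 1))"
  have h0: "0 < h0" "\<omega> * h0 \<le> 1 / 2" using \<omega> by (auto simp: h0_def field_simps)
  have small: "\<omega> * \<bar>h\<bar> < 1" if "\<bar>h\<bar> < h0" for h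
    using mult_left_mono[of "\<bar>h\<bar>" h0 \<omega>] that h0 \<omega> by linarith
  have DH: "x \<in> D \<Longrightarrow> x \<in> H" for x using D by auto
  have key: "(1 - \<omega> * \<bar>h\<bar>) * (nrm x)\<^sup>2 \<le> Re (ip (x - rscl h (A x)) x)" if "x \<in> D" for x h
  proof -
    have "\<bar>h * Re (ip (A x) x)\<bar> \<le> \<bar>h\<bar> * (\<omega> * (nrm x)\<^sup>2)"
      using skew[OF that] by (simp add: abs_mult mult_left_mono)
    then show ?thesis
      using that A DH by (simp add: ip_diff ip_scale nrm_sq algebra_simps)
  qed
  interpret resolvent_data scl H nrm D A \<omega> h0
  proof unfold_locales
    show "(1 - \<omega> * \<bar>h\<bar>) * nrm x \<le> nrm (x - rscl h (A x))" if x: "x \<in> D" for x h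
    proof (cases "x = 0")
      case False
      then have pos: "0 < nrm x" using ip_pos x DH by (auto simp: nrm_def)
      have "Re (ip (x - rscl h (A x)) x) \<le> nrm (x - rscl h (A x)) * nrm x"
        using Cauchy_Schwarz[of "x - rscl h (A x)" x] complex_Re_le_cmod[of "ip (x - rscl h (A x)) x"] x A DH
        by auto
      then have "((1 - \<omega> * \<bar>h\<bar>) * nrm x) * nrm x \<le> nrm (x - rscl h (A x)) * nrm x"
        using key[OF x, of h] by (simp add: power2_eq_square mult.assoc)
      then show ?thesis using pos by simp
    qed (use x A[of x] in auto)
    show "\<exists>x\<in>D. nrm (y - x) < e" if "y \<in> H" "e > 0" for y e
    proof (rule dense_if_orthogonal_trivial[OF D _ that])
      fix w assume w: "w \<in> H" "\<And>x. x \<in> D \<Longrightarrow> ip w x = 0"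
      obtain x where x: "x \<in> D" "x - rscl (h0 / 2) (A x) = w"
        using range[OF w(1), of "h0 / 2"] small[of "h0 / 2"] h0 by auto
      have "(1 - \<omega> * \<bar>h0 / 2\<bar>) * (nrm x)\<^sup>2 \<le> 0" using key[OF x(1), of "h0 / 2"] x w(2)[OF x(1)] by simp
      then have "(nrm x)\<^sup>2 \<le> 0" using small[of "h0 / 2"] h0 by (simp add: mult_le_0_iff)
      then have "x = 0" using nrm_definite[of x] x DH by simp
      moreover have "A 0 = 0" using A(3)[of 0 0] D subspace_0 by simp
      ultimately show "w = 0" using x by simp
    qed
  qed (use D A \<omega> h0 range small in auto)
  show ?thesis by (rule generates_group)
qed

end

section \<open>Linear algebra in finite dimension\<close>

context inner_carrier begin

text \<open>Induction on the spanning set: in the step, \<open>b\<close> is replaced by its component \<open>b'\<close> orthogonal to the span of the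
  others, as in the Gram--Schmidt process.\<close>

lemma riesz_representation:
  assumes "finite S" "S \<subseteq> H"
    and "\<And>x y. x \<in> span S \<Longrightarrow> y \<in> span S \<Longrightarrow> f (x + y) = f x + f y"
    and "\<And>c x. x \<in> span S \<Longrightarrow> f (scl c x) = c * f x"
  shows "\<exists>z\<in>span S. \<forall>x\<in>span S. f x = ip x z"
  using assms
proof (induction S arbitrary: f rule: finite_induct)
  case empty
  have "f 0 = 0" using empty(3)[of 0 0] by simp
  then show ?case by simp
next
  case (insert b S)
  have sub: "span S \<subseteq> span (insert b S)" by (rule span_mono) auto
  have spanH: "span (insert b S) \<subseteq> H" using insert.prems(1) carrier_subspace span_minimal by blast
  have SH: "S \<subseteq> H" "b \<in> H" using insert.prems(1) by auto
  have "\<exists>z\<in>span S. \<forall>x\<in>span S. ip x b = ip x z"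
  proof (rule insert.IH[OF SH(1)])
    show "ip (x + y) b = ip x b + ip y b" if "x \<in> span S" "y \<in> span S" for x y
      using that sub spanH SH(2) by (intro ip_add) auto
    show "ip (scl c x) b = c * ip x b" if "x \<in> span S" for c x
      using that sub spanH SH(2) by (intro ip_scale) auto
  qed
  then obtain p where p: "p \<in> span S" "\<And>x. x \<in> span S \<Longrightarrow> ip x b = ip x p" by auto
  have "\<exists>z\<in>span S. \<forall>x\<in>span S. f x = ip x z"
  proof (rule insert.IH[OF SH(1)])
    show "f (x + y) = f x + f y" if "x \<in> span S" "y \<in> span S" for x y
      using that sub by (intro insert.prems(2)) auto
    show "f (scl c x) = c * f x" if "x \<in> span S" for c x
      using that sub by (intro insert.prems(3)) auto
  qed
  then obtain z where z: "z \<in> span S" "\<And>x. x \<in> span S \<Longrightarrow> f x = ip x z" by auto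
  define b' where "b' = b - p"
  have mem: "b' \<in> span (insert b S)" using p(1) sub span_base[of b "insert b S"] span_diff
    unfolding b'_def by blast
  have b'H: "b' \<in> H" "p \<in> H" "z \<in> H" using mem p(1) z(1) sub spanH by auto
  have orth: "ip s b' = 0" if "s \<in> span S" for s
    using p(2)[OF that] that sub spanH b'H SH by (auto simp: b'_def ip_diff_right)
  show ?case
  proof (cases "b' = 0")
    case True
    then have "b \<in> span S" using p(1) by (simp add: b'_def)
    then have "span (insert b S) = span S" by (rule span_redundant)
    then show ?thesis using z by auto
  next
    case False
    have nz: "ip b' b' \<noteq> 0" using ip_pos[OF b'H(1) False] by auto
    define \<alpha> where "\<alpha> = cnj (f b' / ip b' b')"
    have "f x = ip x (z + scl \<alpha> b')" if x: "x \<in> span (insert b S)" for x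
    proof -
      obtain k where k: "x - scl k b \<in> span S" using x span_breakdown_eq by blast
      define s where "s = (x - scl k b) + scl k p"
      have s: "s \<in> span S" using k p(1) span_add span_scale unfolding s_def by blast
      have sH: "s \<in> H" using s sub spanH by auto
      have xs: "x = s + scl k b'" by (simp add: s_def b'_def scale_right_diff_distrib)
      have "f x = f s + k * f b'"
        unfolding xs using insert.prems(2)[of s "scl k b'"] insert.prems(3)[OF mem] s sub mem span_scale by auto
      moreover have "ip x (z + scl \<alpha> b') = ip s z + k * (cnj \<alpha> * ip b' b')"
      proof -
        have "ip b' z = 0" using ip_hermitian[OF b'H(3,1)] orth[OF z(1)] by simp
        then show ?thesis
          unfolding xs using sH b'H orth[OF s]
          by (simp add: ip_add ip_add_right ip_scale ip_scale_right)
      qed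
      moreover have "cnj \<alpha> * ip b' b' = f b'" using nz by (simp add: \<alpha>_def)
      ultimately show ?thesis using z(2)[OF s] by simp
    qed
    moreover have "z + scl \<alpha> b' \<in> span (insert b S)"
      using z(1) sub mem span_add span_scale by blast
    ultimately show ?thesis by blast
  qed
qed

lemma functional_bounded:
  assumes "finite S" "span S = H"
    and "\<And>x y. x \<in> H \<Longrightarrow> y \<in> H \<Longrightarrow> f (x + y) = f x + f y"
    and "\<And>c x. x \<in> H \<Longrightarrow> f (scl c x) = c * f x"
  shows "\<exists>K\<ge>0. \<forall>x\<in>H. cmod (f x) \<le> K * nrm x"
proof -
  have "S \<subseteq> H" using assms(2) span_superset by blast
  then obtain z where z: "z \<in> H" "\<And>x. x \<in> H \<Longrightarrow> f x = ip x z"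
    using riesz_representation[of S f] assms by auto
  show ?thesis
    using z Cauchy_Schwarz[OF _ z(1)] nrm_ge_0[OF z(1)] by (intro exI[of _ "nrm z"]) (auto simp: mult.commute)
qed

end

lemma sum_fun_eval: "(\<Sum>a\<in>A. f a) x = (\<Sum>a\<in>A. f a x)" for f :: "'b \<Rightarrow> 'i \<Rightarrow> complex"
  by (induction A rule: infinite_finite_induct) auto

definition unit_at :: "'i \<Rightarrow> 'i \<Rightarrow> complex" where "unit_at i = (\<lambda>j. if j = i then 1 else 0)"

lemma inj_unit_at: "inj unit_at"
  by (auto simp: inj_def unit_at_def fun_eq_iff split: if_splits)

lemma subspace_cvecs: "cfun.subspace (cvecs I)"
  by (auto simp: cfun.subspace_def cvecs_def cscale_def)

lemma cvecs_expand:
  assumes "finite I" "x \<in> cvecs I" shows "x = (\<Sum>i\<in>I. cscale (x i) (unit_at i))"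
proof
  fix j
  have "(\<Sum>i\<in>I. x i * (if j = i then 1 else 0)) = (if j \<in> I then x j else 0)"
    using assms(1) by (simp add: if_distrib cong: if_cong)
  then show "x j = (\<Sum>i\<in>I. cscale (x i) (unit_at i)) j"
    using assms(2) by (auto simp: sum_fun_eval cscale_def unit_at_def cvecs_def)
qed

lemma span_unit_at: assumes "finite I" shows "cfun.span (unit_at ` I) = cvecs I"
proof
  show "cfun.span (unit_at ` I) \<subseteq> cvecs I"
    by (rule cfun.span_minimal[OF _ subspace_cvecs]) (auto simp: cvecs_def unit_at_def)
  show "cvecs I \<subseteq> cfun.span (unit_at ` I)"
  proof
    fix x :: "'a \<Rightarrow> complex" assume "x \<in> cvecs I"
    then have "x = (\<Sum>i\<in>I. cscale (x i) (unit_at i))" using cvecs_expand assms by blast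
    also have "\<dots> \<in> cfun.span (unit_at ` I)"
      by (intro cfun.span_sum cfun.span_scale cfun.span_base) auto
    finally show "x \<in> cfun.span (unit_at ` I)" .
  qed
qed

lemma independent_image_unit_at:
  fixes f :: "('i \<Rightarrow> complex) \<Rightarrow> ('j \<Rightarrow> complex)"
  assumes I: "finite I"
    and add: "\<And>x y. x \<in> cvecs I \<Longrightarrow> y \<in> cvecs I \<Longrightarrow> f (x + y) = f x + f y"
    and scale: "\<And>c x. x \<in> cvecs I \<Longrightarrow> f (cscale c x) = cscale c (f x)"
    and ker: "\<And>x. x \<in> cvecs I \<Longrightarrow> f x = 0 \<Longrightarrow> x = 0"
  shows "cfun.independent ((\<lambda>i. f (unit_at i)) ` I)" and "inj_on (\<lambda>i. f (unit_at i)) I"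
proof -
  have f_inj: "x = y" if "x \<in> cvecs I" "y \<in> cvecs I" "f x = f y" for x y
  proof -
    have mem: "x - y \<in> cvecs I" using that cfun.subspace_diff[OF subspace_cvecs[of I]] by blast
    have "f x = f (x - y) + f y" using add[OF mem that(2)] by simp
    then show ?thesis using ker[OF mem] that(3) by simp
  qed
  have unit: "unit_at i \<in> cvecs I" if "i \<in> I" for i using that by (auto simp: cvecs_def unit_at_def)
  show inj: "inj_on (\<lambda>i. f (unit_at i)) I"
    using f_inj unit inj_unit_at by (metis (no_types, lifting) inj_onI injD)
  have f_sum: "(\<Sum>i\<in>J. cscale (a i) (unit_at i)) \<in> cvecs I \<and>
      f (\<Sum>i\<in>J. cscale (a i) (unit_at i)) = (\<Sum>i\<in>J. cscale (a i) (f (unit_at i)))"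
    if "finite J" "J \<subseteq> I" for a J
    using that
  proof (induction J rule: finite_induct)
    case empty
    have "f 0 = 0" using scale[of 0 0] cfun.subspace_0[OF subspace_cvecs[of I]] by simp
    then show ?case using cfun.subspace_0[OF subspace_cvecs[of I]] by (simp add: zero_fun_def)
  next
    case (insert j J)
    then have IH: "(\<Sum>i\<in>J. cscale (a i) (unit_at i)) \<in> cvecs I"
      "f (\<Sum>i\<in>J. cscale (a i) (unit_at i)) = (\<Sum>i\<in>J. cscale (a i) (f (unit_at i)))" by auto
    have u: "unit_at j \<in> cvecs I" "cscale (a j) (unit_at j) \<in> cvecs I"
      using unit insert.prems cfun.subspace_scale[OF subspace_cvecs[of I]] by auto
    show ?case
      unfolding sum.insert[OF insert.hyps] add[OF u(2) IH(1)] scale[OF u(1)] IH(2)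
      by (intro conjI refl cfun.subspace_add[OF subspace_cvecs[of I] u(2) IH(1)])
  qed
  show "cfun.independent ((\<lambda>i. f (unit_at i)) ` I)"
  proof (rule ccontr)
    assume "\<not> cfun.independent ((\<lambda>i. f (unit_at i)) ` I)"
    then obtain u v where u: "v \<in> (\<lambda>i. f (unit_at i)) ` I" "u v \<noteq> 0"
        "(\<Sum>v\<in>(\<lambda>i. f (unit_at i)) ` I. cscale (u v) v) = 0"
      using cfun.dependent_finite[of "(\<lambda>i. f (unit_at i)) ` I"] I by auto
    define a where "a = (\<lambda>i. u (f (unit_at i)))"
    have "(\<Sum>i\<in>I. cscale (a i) (f (unit_at i))) = 0"
      using u(3) sum.reindex[OF inj, of "\<lambda>v. cscale (u v) v"] by (simp add: a_def)
    then have zero: "(\<Sum>i\<in>I. cscale (a i) (unit_at i)) = 0" using f_sum[OF I order_refl, of a] ker by auto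
    have "a i = 0" if "i \<in> I" for i
    proof -
      define x where "x = (\<lambda>i. if i \<in> I then a i else 0)"
      have "x \<in> cvecs I" by (simp add: x_def cvecs_def)
      then have "x = (\<Sum>i\<in>I. cscale (x i) (unit_at i))" using cvecs_expand I by blast
      also have "\<dots> = (\<Sum>i\<in>I. cscale (a i) (unit_at i))" by (rule sum.cong) (auto simp: x_def)
      finally have "x i = 0" using zero by simp
      then show ?thesis using that by (simp add: x_def)
    qed
    then show False using u(1,2) by (auto simp: a_def)
  qed
qed

lemma independent_unit_at: "finite I \<Longrightarrow> cfun.independent (unit_at ` I)"
  using independent_image_unit_at(1)[of I "\<lambda>x. x"] by simp

text \<open>The exchange lemma, applied in both directions with the family of the unit vectors.\<close>

lemma card_basis_cvecs:
  assumes I: "finite I" and basis: "basis_family J w (cvecs I)"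
  shows "finite J \<and> card J = card I"
proof -
  have w: "inj_on w J" "cfun.independent (w ` J)" "cfun.span (w ` J) = cvecs I"
    using basis by (auto simp: basis_family_def)
  have "w ` J \<subseteq> cfun.span (unit_at ` I)"
    unfolding span_unit_at[OF I] w(3)[symmetric] by (rule cfun.span_superset)
  then have 1: "finite (w ` J)" "card (w ` J) \<le> card (unit_at ` I)"
    using cfun.independent_span_bound[of "unit_at ` I" "w ` J"] I w(2) by auto
  have "unit_at ` I \<subseteq> cfun.span (w ` J)"
    unfolding w(3) span_unit_at[OF I, symmetric] by (rule cfun.span_superset)
  then have 2: "card (unit_at ` I) \<le> card (w ` J)"
    using cfun.independent_span_bound[of "w ` J" "unit_at ` I"] independent_unit_at[OF I] 1 by auto
  have "card (unit_at ` I) = card I" by (rule card_image) (rule inj_on_subset[OF inj_unit_at], simp)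
  then show ?thesis using 1 2 card_image[OF w(1)] finite_imageD[OF _ w(1)] by auto
qed

text \<open>A vector outside the span of the images of the unit vectors would give an independent family larger than the dimension.\<close>

lemma injective_imp_surjective:
  fixes f :: "('i \<Rightarrow> complex) \<Rightarrow> ('j \<Rightarrow> complex)"
  assumes I: "finite I" "finite J" "card I = card J"
    and maps: "\<And>x. x \<in> cvecs I \<Longrightarrow> f x \<in> cvecs J"
    and add: "\<And>x y. x \<in> cvecs I \<Longrightarrow> y \<in> cvecs I \<Longrightarrow> f (x + y) = f x + f y"
    and scale: "\<And>c x. x \<in> cvecs I \<Longrightarrow> f (cscale c x) = cscale c (f x)"
    and ker: "\<And>x. x \<in> cvecs I \<Longrightarrow> f x = 0 \<Longrightarrow> x = 0"
    and y: "y \<in> cvecs J"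
  shows "\<exists>x\<in>cvecs I. f x = y"
proof -
  let ?B = "(\<lambda>i. f (unit_at i)) ` I"
  have B: "cfun.independent ?B" "inj_on (\<lambda>i. f (unit_at i)) I"
    by (rule independent_image_unit_at[OF I(1) add scale ker]; assumption)+
  have unit: "unit_at i \<in> cvecs I" if "i \<in> I" for i using that by (auto simp: cvecs_def unit_at_def)
  have sub: "?B \<subseteq> cfun.span (unit_at ` J)" unfolding span_unit_at[OF I(2)] using maps unit by auto
  have card: "card ?B = card (unit_at ` J)"
    using card_image[OF B(2)] card_image[OF inj_on_subset[OF inj_unit_at subset_UNIV], of J] I(3) by simp
  have "y \<in> cfun.span ?B"
  proof (rule ccontr)
    assume y': "y \<notin> cfun.span ?B"
    then have notin: "y \<notin> ?B" using cfun.span_base[of y ?B] by auto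
    have "insert y ?B \<subseteq> cfun.span (unit_at ` J)" using sub y span_unit_at[OF I(2)] by simp
    then have "card (insert y ?B) \<le> card (unit_at ` J)"
      using cfun.independent_span_bound[OF finite_imageI[OF I(2)] cfun.independent_insertI[OF y' B(1)]] by blast
    then show False using card notin I(1) by simp
  qed
  moreover have "cfun.span ?B \<subseteq> f ` cvecs I"
  proof (rule cfun.span_minimal)
    show "?B \<subseteq> f ` cvecs I" using unit by auto
    note sub = cfun.subspace_add[OF subspace_cvecs[of I]] cfun.subspace_scale[OF subspace_cvecs[of I]]
      cfun.subspace_0[OF subspace_cvecs[of I]]
    have f0: "f 0 = 0" using scale[of 0 0] sub(3) by simp
    show "cfun.subspace (f ` cvecs I)"
      unfolding cfun.subspace_def
    proof (intro conjI ballI allI)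
      show "0 \<in> f ` cvecs I" using f0 sub(3) by (metis imageI)
      show "x + y \<in> f ` cvecs I" if xy: "x \<in> f ` cvecs I" "y \<in> f ` cvecs I" for x y
      proof -
        obtain a b where "a \<in> cvecs I" "b \<in> cvecs I" "x = f a" "y = f b" using xy by auto
        then show ?thesis using add sub(1) by (intro image_eqI[of _ _ "a + b"]) auto
      qed
      show "cscale c x \<in> f ` cvecs I" if x: "x \<in> f ` cvecs I" for c x
      proof -
        obtain a where "a \<in> cvecs I" "x = f a" using x by auto
        then show ?thesis using scale sub(2) by (intro image_eqI[of _ _ "cscale c a"]) auto
      qed
    qed
  qed
  ultimately show ?thesis by blast
qed

lemma cprod_simps:
  "cprod I (x + y) z = cprod I x z + cprod I y z"
  "cprod I (x - y) z = cprod I x z - cprod I y z"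
  "cprod I (cscale c x) z = c * cprod I x z"
  "cprod I z (x + y) = cprod I z x + cprod I z y"
  "cprod I z (x - y) = cprod I z x - cprod I z y"
  "cprod I z (cscale c x) = cnj c * cprod I z x"
  "cprod I 0 z = 0" "cprod I z 0 = 0"
  by (simp_all add: cprod_def cscale_def sum.distrib sum_subtractf sum_distrib_left algebra_simps)

lemma cprod_cnj: "cprod I y x = cnj (cprod I x y)"
  by (simp add: cprod_def mult.commute)

lemma Re_cprod_self: "Re (cprod I x x) = (\<Sum>i\<in>I. (cmod (x i))\<^sup>2)"
  by (simp add: cprod_def cmod_power2) (simp add: power2_eq_square)

lemma inner_carrier_cprod:
  assumes "finite I" shows "inner_carrier cscale (cvecs I) (cprod I)"
proof unfold_locales
  show "0 < Re (cprod I x x)" if x: "x \<in> cvecs I" "x \<noteq> 0" for x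
  proof -
    obtain i where i: "x i \<noteq> 0" using x(2) by (auto simp: fun_eq_iff)
    then have "i \<in> I" using x(1) by (auto simp: cvecs_def)
    then show ?thesis unfolding Re_cprod_self using assms i
      by (intro sum_pos2[of I i]) auto
  qed
qed (auto simp: cprod_simps subspace_cvecs intro: cprod_cnj)

lemma subspace_spanned:
  assumes I: "finite I" and U: "cfun.subspace U" "U \<subseteq> cvecs I"
  obtains S where "finite S" "cfun.span S = U"
proof -
  obtain B where B: "B \<subseteq> U" "cfun.independent B" "U \<subseteq> cfun.span B" "card B = cfun.dim U"
    by (rule cfun.basis_exists[of U])
  have "B \<subseteq> cfun.span (unit_at ` I)" using B(1) U(2) span_unit_at[OF I] by auto
  then have "finite B" using cfun.independent_span_bound[of "unit_at ` I" B] I B(2) by auto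
  moreover have "cfun.span B = U" using B(1,3) cfun.span_minimal[OF B(1) U(1)] by auto
  ultimately show thesis using that by blast
qed

lemma riesz_cprod:
  assumes I: "finite I" and U: "cfun.subspace U" "U \<subseteq> cvecs I"
    and add: "\<And>x y. x \<in> U \<Longrightarrow> y \<in> U \<Longrightarrow> f (x + y) = f x + f y"
    and scale: "\<And>c x. x \<in> U \<Longrightarrow> f (cscale c x) = c * f x"
  shows "\<exists>!z. z \<in> U \<and> (\<forall>x\<in>U. f x = cprod I x z)"
proof -
  interpret E: inner_carrier cscale "cvecs I" "cprod I" by (rule inner_carrier_cprod[OF I])
  obtain S where S: "finite S" "cfun.span S = U" using subspace_spanned[OF I U] .
  have "S \<subseteq> cvecs I" using S U cfun.span_superset by blast
  then obtain z where z: "z \<in> U" "\<forall>x\<in>U. f x = cprod I x z"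
    using E.riesz_representation[of S f] S add scale by auto
  show ?thesis
  proof (rule ex1I[of _ z])
    fix w assume w: "w \<in> U \<and> (\<forall>x\<in>U. f x = cprod I x w)"
    have mem: "w - z \<in> U" using w z U cfun.subspace_diff by blast
    then have "cprod I (w - z) (w - z) = 0" using w z by (simp add: cprod_simps(5))
    then show "w = z" using E.ip_pos[of "w - z"] mem U by auto
  qed (use z in auto)
qed

context
  fixes I :: "'i set" and U :: "('i \<Rightarrow> complex) set"
  assumes I: "finite I" and U: "cfun.subspace U" "U \<subseteq> cvecs I"
begin

lemma orth_proj_unique_ex:
  assumes x: "x \<in> cvecs I" shows "\<exists>!y. y \<in> U \<and> x - y \<in> orth_compl I U"
proof -
  have iff: "x - y \<in> orth_compl I U \<longleftrightarrow> (\<forall>z\<in>U. cprod I z x = cprod I z y)" if "y \<in> U" for y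
  proof -
    have "x - y \<in> cvecs I" using x that U(2) cfun.subspace_diff[OF subspace_cvecs[of I]] by blast
    then show ?thesis by (simp add: orth_compl_def cprod_simps)
  qed
  have "\<exists>!y. y \<in> U \<and> (\<forall>z\<in>U. cprod I z x = cprod I z y)"
    by (rule riesz_cprod[OF I U]) (simp_all add: cprod_simps)
  then show ?thesis using iff by (metis (no_types, lifting))
qed

lemma orth_proj_mem: "x \<in> cvecs I \<Longrightarrow> orth_proj I U x \<in> U"
  and orth_proj_orth: "x \<in> cvecs I \<Longrightarrow> x - orth_proj I U x \<in> orth_compl I U"
  using theI'[OF orth_proj_unique_ex[of x]] by (auto simp: orth_proj_def)

lemma cprod_orth_proj:
  assumes "x \<in> cvecs I" "y \<in> U"
  shows "cprod I y (orth_proj I U x) = cprod I y x" and "cprod I (orth_proj I U x) y = cprod I x y"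
proof -
  show "cprod I y (orth_proj I U x) = cprod I y x"
    using orth_proj_orth[OF assms(1)] assms(2) by (simp add: orth_compl_def cprod_simps)
  then show "cprod I (orth_proj I U x) y = cprod I x y"
    using cprod_cnj[of I "orth_proj I U x" y] cprod_cnj[of I x y] by simp
qed

lemma orth_proj_eqI: "x \<in> cvecs I \<Longrightarrow> y \<in> U \<Longrightarrow> x - y \<in> orth_compl I U \<Longrightarrow> orth_proj I U x = y"
  using orth_proj_unique_ex[of x] orth_proj_mem[of x] orth_proj_orth[of x] by blast

lemma orth_proj_add:
  assumes "x \<in> cvecs I" "y \<in> cvecs I" shows "orth_proj I U (x + y) = orth_proj I U x + orth_proj I U y"
proof (rule orth_proj_eqI)
  show "x + y \<in> cvecs I" using assms cfun.subspace_add[OF subspace_cvecs[of I]] by blast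
  show "orth_proj I U x + orth_proj I U y \<in> U" using assms orth_proj_mem cfun.subspace_add[OF U(1)] by blast
  show "x + y - (orth_proj I U x + orth_proj I U y) \<in> orth_compl I U"
    using orth_proj_orth[OF assms(1)] orth_proj_orth[OF assms(2)]
    by (auto simp: orth_compl_def cprod_simps cvecs_def)
qed

lemma orth_proj_scale:
  assumes "x \<in> cvecs I" shows "orth_proj I U (cscale c x) = cscale c (orth_proj I U x)"
proof (rule orth_proj_eqI)
  show "cscale c x \<in> cvecs I" using assms cfun.subspace_scale[OF subspace_cvecs[of I]] by blast
  show "cscale c (orth_proj I U x) \<in> U" using assms orth_proj_mem cfun.subspace_scale[OF U(1)] by blast
  show "cscale c x - cscale c (orth_proj I U x) \<in> orth_compl I U"
    using orth_proj_orth[OF assms(1)] cfun.subspace_scale[OF subspace_cvecs[of I], of "x - orth_proj I U x" c]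
    by (auto simp: orth_compl_def cprod_simps cfun.scale_right_diff_distrib)
qed

text \<open>The difference of \<open>x\<close> and its projection lies in the orthogonal complement, hence is orthogonal to itself.\<close>

lemma double_orth_compl:
  assumes x: "x \<in> cvecs I" and orth: "\<And>w. w \<in> orth_compl I U \<Longrightarrow> cprod I x w = 0"
  shows "x \<in> U"
proof -
  interpret E: inner_carrier cscale "cvecs I" "cprod I" by (rule inner_carrier_cprod[OF I])
  define w where "w = x - orth_proj I U x"
  have w: "w \<in> orth_compl I U" unfolding w_def by (rule orth_proj_orth[OF x])
  have "cprod I (orth_proj I U x) w = 0" using w orth_proj_mem[OF x] by (simp add: orth_compl_def)
  then have "cprod I w w = 0" using orth[OF w] by (simp add: w_def cprod_simps(2))
  then have "w = 0" using E.ip_pos[of w] w by (auto simp: orth_compl_def)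
  then show ?thesis using orth_proj_mem[OF x] by (simp add: w_def)
qed

lemma adjoint_on_prop:
  assumes "linear_between cscale U W B"
  shows "adjoint_on I U B y \<in> U" and "x \<in> U \<Longrightarrow> cprod I (B x) y = cprod I x (adjoint_on I U B y)"
proof -
  have "\<exists>!z. z \<in> U \<and> (\<forall>x\<in>U. cprod I (B x) y = cprod I x z)"
    by (rule riesz_cprod[OF I U]) (use assms in \<open>auto simp: linear_between_def cprod_simps\<close>)
  from theI'[OF this]
  show "adjoint_on I U B y \<in> U" and "x \<in> U \<Longrightarrow> cprod I (B x) y = cprod I x (adjoint_on I U B y)"
    by (auto simp: adjoint_on_def)
qed

text \<open>The limit is orthogonal to every vector of the orthogonal complement.\<close>

lemma subspace_closed_limit:
  assumes X: "\<And>n. X n \<in> U" and lim: "\<And>i. i \<in> I \<Longrightarrow> (\<lambda>n. X n i) \<longlonglongrightarrow> x i" and x: "x \<in> cvecs I"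
  shows "x \<in> U"
proof (rule double_orth_compl[OF x])
  fix w assume w: "w \<in> orth_compl I U"
  have "(\<lambda>n. cprod I (X n) w) \<longlonglongrightarrow> cprod I x w"
    unfolding cprod_def using lim by (intro tendsto_intros) auto
  moreover have "cprod I (X n) w = 0" for n using w X by (simp add: orth_compl_def)
  ultimately show "cprod I x w = 0" by (simp add: LIMSEQ_const_iff)
qed

end

section \<open>Primitives of integrable functions\<close>

abbreviation LI :: "real \<Rightarrow> real measure" where "LI l \<equiv> lebesgue_on {0..l}"

definition prim :: "real \<Rightarrow> (real \<Rightarrow> complex) \<Rightarrow> real \<Rightarrow> complex" where
  "prim l g x = (LINT y|LI l. (if y \<le> x then g y else 0))"

lemma space_LI [simp]: "space (LI l) = {0..l}"
  by simp

lemma measurable_id_LI [measurable]: "(\<lambda>x. x) \<in> borel_measurable (LI l)"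
  by (rule continuous_imp_measurable_on_sets_lebesgue) auto

lemma finite_measure_LI: "finite_measure (LI l)"
  by (rule finite_measure_lebesgue_on) auto

lemma AE_LI_iff: "(AE x in LI l. P x) \<longleftrightarrow> (AE x in lebesgue. x \<in> {0..l} \<longrightarrow> P x)"
  by (rule AE_restrict_space_iff) auto

lemma AE_neq_lebesgue: "AE y in lebesgue. y \<noteq> (c::real)"
  using AE_lborel_singleton[of c] by (rule AE_completion)

lemma AE_neq_LI: "AE y in LI l. y \<noteq> c"
  unfolding AE_LI_iff using AE_neq_lebesgue[of c] by eventually_elim auto

lemma LINT_LI: "(LINT x:{0..l}|lebesgue. f x) = (LINT x|LI l. (f x :: complex))"
  unfolding set_lebesgue_integral_def by (rule integral_restrict_space[symmetric]) auto

lemma measurable_cut [measurable]: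
  "(\<lambda>y. y \<le> x) \<in> measurable (LI l) (count_space UNIV)"
  "(\<lambda>y. x \<le> y) \<in> measurable (LI l) (count_space UNIV)"
  by measurable

lemma integrable_cut:
  fixes g :: "real \<Rightarrow> complex"
  assumes g: "integrable (LI l) g"
  shows "integrable (LI l) (\<lambda>y. if y \<le> x then g y else 0)"
    and "integrable (LI l) (\<lambda>y. if x \<le> y then g y else 0)"
proof -
  have [measurable]: "g \<in> borel_measurable (LI l)" using g by auto
  show "integrable (LI l) (\<lambda>y. if y \<le> x then g y else 0)"
    and "integrable (LI l) (\<lambda>y. if x \<le> y then g y else 0)"
    by (rule Bochner_Integration.integrable_bound[OF g]; auto)+
qed

lemma norm_prim_le:
  assumes g: "integrable (LI l) g" shows "cmod (prim l g x) \<le> (LINT y|LI l. cmod (g y))"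
  unfolding prim_def
  by (rule order_trans[OF integral_norm_bound integral_mono]) (use integrable_cut[OF g] g in auto)

lemma prim_continuous:
  assumes g: "integrable (LI l) g" shows "continuous_on S (prim l g)"
proof (rule continuous_on_subset[OF _ subset_UNIV], unfold continuous_on_sequentially, intro allI ballI impI)
  fix X :: "nat \<Rightarrow> real" and x assume X: "(\<forall>n. X n \<in> UNIV) \<and> X \<longlonglongrightarrow> x"
  have [measurable]: "g \<in> borel_measurable (LI l)" using g by auto
  show "(prim l g \<circ> X) \<longlonglongrightarrow> prim l g x"
    unfolding prim_def comp_def
  proof (rule integral_dominated_convergence[where w = "\<lambda>y. cmod (g y)"])
    show "AE y in LI l. (\<lambda>n. if y \<le> X n then g y else 0) \<longlonglongrightarrow> (if y \<le> x then g y else 0)"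
      using AE_neq_LI[of x l]
    proof eventually_elim
      case (elim y)
      show ?case
      proof (cases "y < x")
        case True
        then have "\<forall>\<^sub>F n in sequentially. y < X n" using X by (auto intro: order_tendstoD)
        then have "\<forall>\<^sub>F n in sequentially. (if y \<le> X n then g y else 0) = g y" by eventually_elim simp
        then show ?thesis using True by (simp add: tendsto_eventually)
      next
        case False
        then have "x < y" using elim by simp
        then have "\<forall>\<^sub>F n in sequentially. X n < y" using X by (auto intro: order_tendstoD)
        then have "\<forall>\<^sub>F n in sequentially. (if y \<le> X n then g y else 0) = 0" by eventually_elim simp
        then show ?thesis using False elim by (simp add: tendsto_eventually)
      qed
    qed
  qed (use g in auto)
qed

lemma continuous_measurable_LI:
  "continuous_on {0..l} (f :: real \<Rightarrow> 'b::euclidean_space) \<Longrightarrow> f \<in> borel_measurable (LI l)"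
  by (rule continuous_imp_measurable_on_sets_lebesgue) auto

lemma continuous_integrable_LI:
  "continuous_on {0..l} (f :: real \<Rightarrow> 'b::euclidean_space) \<Longrightarrow> integrable (LI l) f"
  by (rule continuous_imp_integrable_real)

lemma prim_measurable: "integrable (LI l) g \<Longrightarrow> prim l g \<in> borel_measurable (LI l)"
  by (rule continuous_measurable_LI) (rule prim_continuous)

lemma prim_nonpos: "x \<le> 0 \<Longrightarrow> prim l g x = 0"
  unfolding prim_def
  by (rule integral_eq_zero_AE, use AE_neq_LI[of 0 l] AE_space[of "LI l"] in eventually_elim) auto

lemma prim_end: "l \<le> x \<Longrightarrow> prim l g x = (LINT y|LI l. g y)"
  unfolding prim_def by (rule Bochner_Integration.integral_cong) auto

lemma prim_linear:
  assumes "integrable (LI l) g" "integrable (LI l) h"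
  shows "prim l (\<lambda>y. g y + h y) x = prim l g x + prim l h x"
    and "prim l (\<lambda>y. g y - h y) x = prim l g x - prim l h x"
    and "prim l (\<lambda>y. c * g y) x = c * prim l g x"
proof -
  note cut = integrable_cut(1)[OF assms(1), of x] integrable_cut(1)[OF assms(2), of x]
  show "prim l (\<lambda>y. g y + h y) x = prim l g x + prim l h x"
    unfolding prim_def by (subst Bochner_Integration.integral_add[OF cut, symmetric])
      (auto intro!: Bochner_Integration.integral_cong)
  show "prim l (\<lambda>y. g y - h y) x = prim l g x - prim l h x"
    unfolding prim_def by (subst Bochner_Integration.integral_diff[OF cut, symmetric])
      (auto intro!: Bochner_Integration.integral_cong)
  show "prim l (\<lambda>y. c * g y) x = c * prim l g x"
  proof -
    have "prim l (\<lambda>y. c * g y) x = (LINT y|LI l. c * (if y \<le> x then g y else 0))"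
      unfolding prim_def by (rule Bochner_Integration.integral_cong) auto
    then show ?thesis by (simp add: prim_def)
  qed
qed

lemma prim_cong_AE:
  assumes "AE y in LI l. g y = h y" "g \<in> borel_measurable (LI l)" "h \<in> borel_measurable (LI l)"
  shows "prim l g x = prim l h x"
proof -
  have [measurable]: "g \<in> borel_measurable (LI l)" "h \<in> borel_measurable (LI l)" using assms by auto
  show ?thesis unfolding prim_def
    by (rule integral_cong_AE) (use assms(1) in \<open>auto elim: eventually_mono\<close>)
qed

lemma prim_cong: "(\<And>y. y \<in> {0..l} \<Longrightarrow> y \<le> x \<Longrightarrow> g y = h y) \<Longrightarrow> prim l g x = prim l h x"
  unfolding prim_def by (rule Bochner_Integration.integral_cong) auto

lemma integrable_mult_bounded:
  fixes f g :: "real \<Rightarrow> complex"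
  assumes f: "integrable (LI l) f" and g: "g \<in> borel_measurable (LI l)"
    and b: "AE x in LI l. cmod (g x) \<le> B"
  shows "integrable (LI l) (\<lambda>x. f x * g x)"
proof -
  have [measurable]: "f \<in> borel_measurable (LI l)" "g \<in> borel_measurable (LI l)" using f g by auto
  show ?thesis
  proof (rule Bochner_Integration.integrable_bound)
    show "integrable (LI l) (\<lambda>x. \<bar>B\<bar> * cmod (f x))" using f by simp
    show "AE x in LI l. norm (f x * g x) \<le> norm (\<bar>B\<bar> * cmod (f x))"
      using b
    proof eventually_elim
      case (elim x)
      then have "cmod (g x) \<le> \<bar>B\<bar>" by linarith
      then show ?case
        using mult_left_mono[of "cmod (g x)" "\<bar>B\<bar>" "cmod (f x)"] by (simp add: norm_mult mult.commute)
    qed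
  qed measurable
qed

lemma integrable_mult_prim:
  assumes "integrable (LI l) f" "integrable (LI l) g" shows "integrable (LI l) (\<lambda>x. f x * prim l g x)"
  by (rule integrable_mult_bounded[OF assms(1) prim_measurable[OF assms(2)]])
    (use norm_prim_le[OF assms(2)] in auto)

text \<open>Fubini on the triangle \<open>y \<le> x\<close>.\<close>

lemma integration_by_parts_total:
  assumes f: "integrable (LI l) f" and g: "integrable (LI l) g"
  shows "(LINT x|LI l. f x * prim l g x + prim l f x * g x) = (LINT x|LI l. f x) * (LINT x|LI l. g x)"
proof -
  interpret finite_measure "LI l" by (rule finite_measure_LI)
  interpret P: pair_sigma_finite "LI l" "LI l" ..
  have [measurable]: "f \<in> borel_measurable (LI l)" "g \<in> borel_measurable (LI l)" using f g by auto
  have [measurable]: "f \<in> borel_measurable (lebesgue_on {0..l})" "g \<in> borel_measurable (lebesgue_on {0..l})" using f g by auto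
  define h where "h = (\<lambda>x y. f x * (if y \<le> x then g y else 0))"
  have h_meas [measurable]: "case_prod h \<in> borel_measurable (LI l \<Otimes>\<^sub>M LI l)"
    unfolding h_def case_prod_beta by measurable
  have h_int: "integrable (LI l \<Otimes>\<^sub>M LI l) (case_prod h)"
  proof (rule P.Fubini_integrable[OF h_meas])
    show "AE x in LI l. integrable (LI l) (\<lambda>y. case_prod h (x, y))"
      using integrable_cut(1)[OF g] by (auto simp: h_def)
    have eq: "(LINT y|LI l. norm (case_prod h (x, y))) = cmod (f x) * (LINT y|LI l. norm (if y \<le> x then g y else 0))" for x
      by (simp add: h_def norm_mult)
    show "integrable (LI l) (\<lambda>x. LINT y|LI l. norm (case_prod h (x, y)))"
      unfolding eq
    proof (rule Bochner_Integration.integrable_bound)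
      show "integrable (LI l) (\<lambda>x. cmod (f x) * (LINT y|LI l. norm (g y)))" using f by simp
      show "AE x in LI l. norm (cmod (f x) * (LINT y|LI l. norm (if y \<le> x then g y else 0)))
          \<le> norm (cmod (f x) * (LINT y|LI l. norm (g y)))"
      proof (rule AE_I2)
        fix x
        have "(LINT y|LI l. norm (if y \<le> x then g y else 0)) \<le> (LINT y|LI l. norm (g y))"
          by (rule integral_mono) (use integrable_cut(1)[OF g] g in auto)
        then show "norm (cmod (f x) * (LINT y|LI l. norm (if y \<le> x then g y else 0)))
          \<le> norm (cmod (f x) * (LINT y|LI l. norm (g y)))"
          by (simp add: abs_mult mult_left_mono)
      qed
    qed measurable
  qed
  have 1: "(LINT x|LI l. LINT y|LI l. h x y) = (LINT x|LI l. f x * prim l g x)"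
    by (simp add: h_def prim_def)
  have inner: "(LINT x|LI l. h x y) = ((LINT x|LI l. f x) - prim l f y) * g y" for y
  proof -
    have "(LINT x|LI l. h x y) = (LINT x|LI l. (if y \<le> x then f x else 0) * g y)"
      unfolding h_def by (rule Bochner_Integration.integral_cong) auto
    also have "\<dots> = (LINT x|LI l. (if y \<le> x then f x else 0)) * g y" by simp
    also have "(LINT x|LI l. (if y \<le> x then f x else 0)) = (LINT x|LI l. f x - (if x \<le> y then f x else 0))"
      by (rule integral_cong_AE, measurable, use AE_neq_LI[of y l] in eventually_elim) auto
    also have "\<dots> = (LINT x|LI l. f x) - prim l f y"
      unfolding prim_def using f integrable_cut(1)[OF f] by simp
    finally show ?thesis .
  qed
  have i1: "integrable (LI l) (\<lambda>x. f x * prim l g x)" by (rule integrable_mult_prim[OF f g])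
  have i2: "integrable (LI l) (\<lambda>x. prim l f x * g x)"
    using integrable_mult_prim[OF g f] by (simp add: mult.commute)
  have "(LINT x|LI l. f x * prim l g x) = (LINT y|LI l. LINT x|LI l. h x y)"
    unfolding 1[symmetric] by (rule P.Fubini_integral[OF h_int, symmetric])
  also have "\<dots> = (LINT y|LI l. (LINT x|LI l. f x) * g y - prim l f y * g y)"
    unfolding inner by (simp add: algebra_simps)
  also have "\<dots> = (LINT x|LI l. f x) * (LINT x|LI l. g x) - (LINT x|LI l. prim l f x * g x)"
    using g i2 by simp
  finally show ?thesis using i1 i2 by simp
qed

lemma prim_mult:
  assumes f: "integrable (LI l) f" and g: "integrable (LI l) g"
  shows "prim l f x * prim l g x = prim l (\<lambda>y. f y * prim l g y + prim l f y * g y) x"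
proof -
  let ?c = "\<lambda>h y. if y \<le> x then h y else (0::complex)"
  have cut: "prim l (?c h) y = prim l h y" if "y \<le> x" for h y
    by (rule prim_cong) (use that in auto)
  have "prim l f x * prim l g x = (LINT y|LI l. ?c f y) * (LINT y|LI l. ?c g y)" by (simp add: prim_def)
  also have "\<dots> = (LINT y|LI l. ?c f y * prim l (?c g) y + prim l (?c f) y * ?c g y)"
    by (rule integration_by_parts_total[symmetric]) (use integrable_cut f g in auto)
  also have "\<dots> = prim l (\<lambda>y. f y * prim l g y + prim l f y * g y) x"
    unfolding prim_def[of l _ x] by (rule Bochner_Integration.integral_cong) (auto simp: cut)
  finally show ?thesis .
qed

text \<open>\<open>F\<close> is absolutely continuous on \<open>[0, l]\<close> with derivative \<open>f\<close>.\<close>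

definition AC :: "real \<Rightarrow> (real \<Rightarrow> complex) \<Rightarrow> (real \<Rightarrow> complex) \<Rightarrow> bool" where
  "AC l F f \<longleftrightarrow> integrable (LI l) f \<and> (\<forall>x\<in>{0..l}. F x = F 0 + prim l f x)"

lemma AC_continuous: assumes "AC l F f" shows "continuous_on {0..l} F"
proof -
  have "continuous_on {0..l} (\<lambda>x. F 0 + prim l f x)"
    using assms by (intro continuous_intros prim_continuous) (auto simp: AC_def)
  then show ?thesis by (rule continuous_on_eq) (use assms in \<open>unfold AC_def, metis\<close>)
qed

lemma AC_mult_integrable:
  assumes F: "AC l F f" and g: "integrable (LI l) g"
  shows "integrable (LI l) (\<lambda>x. g x * F x)" and "integrable (LI l) (\<lambda>x. F x * g x)"
proof -
  have "compact (F ` {0..l})" by (intro compact_continuous_image AC_continuous[OF F]) auto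
  then obtain B where B: "\<And>x. x \<in> {0..l} \<Longrightarrow> cmod (F x) \<le> B"
    using compact_imp_bounded bounded_iff by (metis (no_types, opaque_lifting) imageI)
  show "integrable (LI l) (\<lambda>x. g x * F x)"
    by (rule integrable_mult_bounded[OF g continuous_measurable_LI[OF AC_continuous[OF F]], where B = B])
      (use B in \<open>auto intro!: AE_I2\<close>)
  then show "integrable (LI l) (\<lambda>x. F x * g x)" by (simp add: mult.commute)
qed

lemma AC_mult:
  assumes F: "AC l F f" and G: "AC l G g"
  shows "AC l (\<lambda>x. F x * G x) (\<lambda>x. f x * G x + F x * g x)"
  unfolding AC_def
proof (intro conjI ballI)
  define a b where "a = F 0" and "b = G 0"
  have f: "integrable (LI l) f" "\<And>x. x \<in> {0..l} \<Longrightarrow> F x = a + prim l f x"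
    and g: "integrable (LI l) g" "\<And>x. x \<in> {0..l} \<Longrightarrow> G x = b + prim l g x"
    using F G unfolding AC_def a_def b_def by metis+
  show int: "integrable (LI l) (\<lambda>x. f x * G x + F x * g x)"
    using AC_mult_integrable[OF G f(1)] AC_mult_integrable[OF F g(1)] by simp
  fix x assume x: "x \<in> {0..l}"
  have i: "integrable (LI l) (\<lambda>y. f y * prim l g y + prim l f y * g y)"
    using integrable_mult_prim[OF f(1) g(1)] integrable_mult_prim[OF g(1) f(1)] by (simp add: mult.commute)
  have "prim l (\<lambda>x. f x * G x + F x * g x) x
      = prim l (\<lambda>y. (f y * prim l g y + prim l f y * g y) + (b * f y + a * g y)) x"
    by (rule prim_cong) (simp add: f(2) g(2) algebra_simps)
  also have "\<dots> = prim l f x * prim l g x + (b * prim l f x + a * prim l g x)"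
    using i f(1) g(1) by (simp add: prim_linear prim_mult)
  finally show "F x * G x = F 0 * G 0 + prim l (\<lambda>x. f x * G x + F x * g x) x"
    unfolding a_def[symmetric] b_def[symmetric] using f(2)[OF x] g(2)[OF x] by (simp add: algebra_simps)
qed

lemma AC_cnj: assumes "AC l F f" shows "AC l (\<lambda>x. cnj (F x)) (\<lambda>x. cnj (f x))"
proof -
  have "prim l (\<lambda>x. cnj (f x)) x = cnj (prim l f x)" for x
  proof -
    have "prim l (\<lambda>x. cnj (f x)) x = (LINT y|LI l. cnj (if y \<le> x then f y else 0))"
      unfolding prim_def by (rule Bochner_Integration.integral_cong) auto
    then show ?thesis by (simp add: prim_def)
  qed
  then show ?thesis using assms unfolding AC_def by (metis complex_cnj_add integrable_cnj)
qed

lemma AC_total: assumes "AC l F f" "0 \<le> l" shows "(LINT x|LI l. f x) = F l - F 0"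
proof -
  have "F l = F 0 + prim l f l" using assms unfolding AC_def by (metis atLeastAtMost_iff order_refl)
  then show ?thesis using prim_end[of l l f] by simp
qed

lemma prim_eq_integral:
  assumes g: "integrable (LI l) g" and x: "0 \<le> x" "x \<le> l"
  shows "prim l g x = integral {0..x} g"
proof -
  have eq: "{..x} \<inter> {0..l} = {0..x}" using x by auto
  have "prim l g x = integral\<^sup>L (lebesgue_on ({..x} \<inter> {0..l})) g"
    unfolding prim_def using Lebesgue_Measure.integral_restrict_Int[of "{..x}" "{0..l}" g] by (simp del: Int_atMost)
  then have "prim l g x = integral\<^sup>L (lebesgue_on {0..x}) g" unfolding eq .
  moreover have "integrable (lebesgue_on {0..x}) g"
  proof -
    have "set_integrable lebesgue {0..l} g"
      using g integrable_restrict_space[of "{0..l}" lebesgue g] by (simp add: set_integrable_def)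
    then have "set_integrable lebesgue {0..x} g" by (rule set_integrable_subset) (use x in auto)
    then show ?thesis
      using integrable_restrict_space[of "{0..x}" lebesgue g] by (simp add: set_integrable_def)
  qed
  ultimately show ?thesis by (simp add: lebesgue_integral_eq_integral)
qed

lemma AC_C1:
  assumes D: "\<And>x. x \<in> {0..l} \<Longrightarrow> (F has_vector_derivative f x) (at x within {0..l})"
    and f: "continuous_on {0..l} f"
  shows "AC l F f"
  unfolding AC_def
proof (intro conjI ballI)
  show int: "integrable (LI l) f" by (rule continuous_integrable_LI[OF f])
  fix x assume x: "x \<in> {0..l}"
  have "(f has_integral (F x - F 0)) {0..x}"
  proof (rule fundamental_theorem_of_calculus)
    fix y assume "y \<in> {0..x}"
    then show "(F has_vector_derivative f y) (at y within {0..x})"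
      using has_vector_derivative_within_subset[OF D, of y "{0..x}"] x by auto
  qed (use x in auto)
  then show "F x = F 0 + prim l f x"
    using prim_eq_integral[OF int] x by (simp add: integral_unique)
qed

lemma prim_clamp:
  assumes "0 \<le> l" shows "prim l g x = prim l g (max 0 (min l x))"
proof -
  consider "x \<le> 0" | "l \<le> x" | "0 < x" "x < l" by linarith
  then show ?thesis by cases (use assms prim_nonpos prim_end in \<open>auto simp: max_def min_def\<close>)
qed

text \<open>The integral of \<open>g\<close> vanishes over intervals, hence over Borel sets, hence over Lebesgue measurable sets.\<close>

lemma prim_zero_imp:
  assumes l: "0 \<le> l" and g: "integrable (LI l) g" and z: "\<And>x. x \<in> {0..l} \<Longrightarrow> prim l g x = 0"
  shows "AE x in LI l. g x = 0"
proof -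
  define g' where "g' = (\<lambda>x. if x \<in> {0..l} then g x else 0)"
  have g'_ind: "g' = (\<lambda>x. indicator {0..l} x *\<^sub>R g x)" by (auto simp: g'_def fun_eq_iff)
  have g'_int: "integrable lebesgue g'"
    using g integrable_restrict_space[of "{0..l}" lebesgue g] unfolding g'_ind by auto
  have conv: "(LINT x:A|lebesgue. g' x) = (LINT x|LI l. (if x \<in> A then g x else 0))" for A
  proof -
    have "(LINT x:A|lebesgue. g' x) = (LINT x|lebesgue. indicator {0..l} x *\<^sub>R (if x \<in> A then g x else 0))"
      unfolding set_lebesgue_integral_def by (rule Bochner_Integration.integral_cong) (auto simp: g'_def)
    also have "\<dots> = (LINT x|LI l. (if x \<in> A then g x else 0))"
      by (rule integral_restrict_space[symmetric]) auto
    finally show ?thesis .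
  qed
  have [measurable]: "g \<in> borel_measurable (LI l)" using g by auto
  have zero: "prim l g x = 0" for x using z prim_clamp[OF l, of g x] l by auto
  have total: "(LINT x|lebesgue. g' x) = 0"
    using conv[of UNIV] zero[of l] prim_end[of l l g] by (simp add: set_lebesgue_integral_def)
  have borel: "(LINT x:A|lebesgue. g' x) = 0" if "A \<in> sets borel" for A
    using that
  proof (induction rule: borel_set_induct)
    case empty
    then show ?case by (simp add: set_lebesgue_integral_def)
  next
    case (interval a b)
    have "(LINT x|LI l. (if x \<in> {a..b} then g x else 0))
        = (LINT x|LI l. (if x \<le> b then g x else 0) - (if x \<le> a then g x else 0))"
      by (rule integral_cong_AE, measurable, use AE_neq_LI[of a l] in eventually_elim) (use interval in auto)
    also have "\<dots> = prim l g b - prim l g a"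
      unfolding prim_def using integrable_cut(1)[OF g] by simp
    finally show ?case unfolding conv using zero by simp
  next
    case (compl A)
    have "(LINT x:A \<union> -A|lebesgue. g' x) = (LINT x:A|lebesgue. g' x) + (LINT x:-A|lebesgue. g' x)"
      using compl(1) by (intro set_integral_Un) (auto simp: set_integrable_def intro!: integrable_mult_indicator g'_int)
    then show ?case using compl(2) total by (simp add: set_lebesgue_integral_def)
  next
    case (union f)
    have "set_integrable lebesgue (\<Union>i. f i) g'"
      using union(2) unfolding set_integrable_def by (intro integrable_mult_indicator g'_int) (auto intro!: sets.countable_UN)
    then have "(LINT x:(\<Union>i. f i)|lebesgue. g' x) = (\<Sum>i. (LINT x:f i|lebesgue. g' x))"
      using union(1,2) by (intro lebesgue_integral_countable_add) (auto simp: disjoint_family_on_def)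
    then show ?case using union(3) by simp
  qed
  interpret finite_measure "LI l" by (rule finite_measure_LI)
  show ?thesis
  proof (rule density_zero[OF g])
    fix A :: "real set" assume "A \<in> sets (LI l)"
    then have A_leb: "A \<in> sets lebesgue" by (auto simp: sets_restrict_space)
    then obtain S N N' where A: "A = S \<union> N" "N \<subseteq> N'" "N' \<in> null_sets lborel" "S \<in> sets lborel"
      by (auto elim: sets_completionE)
    have "AE x in lebesgue. x \<notin> N'"
      using AE_not_in[OF A(3)] by (rule AE_completion)
    then have ae: "AE x in lebesgue. x \<in> A \<longleftrightarrow> x \<in> S"
      by eventually_elim (use A in auto)
    have "(LINT x:A|lebesgue. g' x) = (LINT x:S|lebesgue. g' x)"
      unfolding set_lebesgue_integral_def
    proof (rule integral_cong_AE)
      show "AE x in lebesgue. indicat_real A x *\<^sub>R g' x = indicat_real S x *\<^sub>R g' x"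
        using ae by eventually_elim (auto simp: indicator_def)
    qed (use A_leb A(4) g'_int in \<open>auto intro!: borel_measurable_scaleR borel_measurable_indicator\<close>)
    moreover have "set_lebesgue_integral (LI l) A g = (LINT x:A|lebesgue. g' x)"
    proof -
      have "set_lebesgue_integral (LI l) A g = (LINT x|LI l. (if x \<in> A then g x else 0))"
        unfolding set_lebesgue_integral_def
        by (rule Bochner_Integration.integral_cong) (auto simp: indicator_def)
      then show ?thesis unfolding conv .
    qed
    ultimately show "set_lebesgue_integral (LI l) A g = 0" using borel[of S] A(4) by simp
  qed
qed

lemma integral_norm_bound_mult:
  fixes f g :: "real \<Rightarrow> complex"
  assumes f: "integrable (LI l) f" and gf: "integrable (LI l) (\<lambda>x. g x * f x)"
    and b: "\<And>x. x \<in> {0..l} \<Longrightarrow> cmod (g x) \<le> B"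
  shows "cmod (LINT x|LI l. g x * f x) \<le> B * (LINT x|LI l. cmod (f x))"
proof -
  have "cmod (LINT x|LI l. g x * f x) \<le> (LINT x|LI l. cmod (g x * f x))" by (rule integral_norm_bound)
  also have "\<dots> \<le> (LINT x|LI l. B * cmod (f x))"
  proof (rule integral_mono)
    show "integrable (LI l) (\<lambda>x. cmod (g x * f x))" using gf by (rule integrable_norm)
  qed (use f b in \<open>auto simp: norm_mult mult_right_mono\<close>)
  finally show ?thesis by simp
qed

text \<open>For a continuously differentiable \<open>s\<close> the left-hand side is the modulus of the integral of \<open>s' F\<close>. A Lipschitz function is replaced by
  its averages over intervals of length \<open>h\<close>: these are continuously differentiable, their derivatives, being
  difference quotients, are bounded by \<open>K\<close>, and they converge uniformly.\<close>

lemma AC_lipschitz_estimate: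
  assumes l: "0 \<le> l" and F: "AC l F f" and s: "K-lipschitz_on {0..l} s"
  shows "cmod (s l * F l - s 0 * F 0 - (LINT x|LI l. s x * f x)) \<le> K * (LINT x|LI l. cmod (F x))"
proof -
  \<comment> \<open>extension of \<open>s\<close> beyond the endpoints with the same Lipschitz constant, needed for the averages near \<open>l\<close>\<close>
  define r where "r = (\<lambda>x. s (max 0 (min l x)))"
  have K: "0 \<le> K" using lipschitz_on_nonneg[OF s] .
  have r_lip: "cmod (r x - r y) \<le> K * \<bar>x - y\<bar>" for x y
  proof -
    have "cmod (r x - r y) \<le> K * \<bar>max 0 (min l x) - max 0 (min l y)\<bar>"
      using lipschitz_onD[OF s, of "max 0 (min l x)" "max 0 (min l y)"] l
      by (auto simp: r_def dist_norm)
    also have "\<dots> \<le> K * \<bar>x - y\<bar>" using K by (intro mult_left_mono) auto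
    finally show ?thesis .
  qed
  have r_cont: "continuous_on A r" for A
  proof -
    have "K-lipschitz_on A r" using r_lip K by (auto simp: lipschitz_on_def dist_norm)
    then show ?thesis by (rule lipschitz_on_continuous_on)
  qed
  have rs: "r x = s x" if "x \<in> {0..l}" for x using that by (simp add: r_def)
  have f: "integrable (LI l) f" using F by (simp add: AC_def)
  have Fc: "continuous_on {0..l} F" by (rule AC_continuous[OF F])
  have Fi: "integrable (LI l) F" by (rule continuous_integrable_LI[OF Fc])
  have s_cont: "continuous_on {0..l} s" using s by (rule lipschitz_on_continuous_on)
  have bounded_prod: "integrable (LI l) (\<lambda>x. g x * f x)" if "continuous_on {0..l} g" for g
  proof -
    have "compact (g ` {0..l})" using that by (intro compact_continuous_image) auto
    then obtain B where B: "\<And>x. x \<in> {0..l} \<Longrightarrow> cmod (g x) \<le> B"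
      using compact_imp_bounded bounded_iff by (metis (no_types, opaque_lifting) imageI)
    have "integrable (LI l) (\<lambda>x. f x * g x)"
      by (rule integrable_mult_bounded[OF f continuous_measurable_LI[OF that], where B = B])
        (use B in \<open>auto intro!: AE_I2\<close>)
    then show ?thesis by (simp add: mult.commute)
  qed
  obtain S where S: "\<And>x. x \<in> {0..l + 1} \<Longrightarrow> (S has_vector_derivative r x) (at x within {0..l + 1})"
    using antiderivative_continuous[OF r_cont] by blast
  define C where "C = K * (cmod (F l) + cmod (F 0) + (LINT x|LI l. cmod (f x)))"
  have est: "cmod (s l * F l - s 0 * F 0 - (LINT x|LI l. s x * f x)) \<le> K * (LINT x|LI l. cmod (F x)) + C * h"
    if h: "0 < h" "h \<le> 1" for h
  proof -
    define m where "m = (\<lambda>x. (S (x + h) - S x) / of_real h)"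
    define d where "d = (\<lambda>x. (r (x + h) - r x) / of_real h)"
    have m_AC: "AC l m d"
    proof (rule AC_C1)
      show "continuous_on {0..l} d"
        unfolding d_def using h
        by (intro continuous_intros continuous_on_compose2[OF r_cont[of UNIV]]) auto
      fix x assume x: "x \<in> {0..l}"
      have img: "(\<lambda>x. x + h) ` {0..l} \<subseteq> {0..l + 1}" using h by auto
      have "((\<lambda>x. x + h) has_vector_derivative 1) (at x within {0..l})"
        by (auto intro!: derivative_eq_intros simp: has_vector_derivative_def)
      moreover have "(S has_vector_derivative r (x + h)) (at (x + h) within (\<lambda>x. x + h) ` {0..l})"
        using has_vector_derivative_within_subset[OF S img, of "x + h"] x h by auto
      ultimately have "(S \<circ> (\<lambda>x. x + h) has_vector_derivative 1 *\<^sub>R r (x + h)) (at x within {0..l})"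
        by (rule vector_diff_chain_within)
      moreover have "(S has_vector_derivative r x) (at x within {0..l})"
        using has_vector_derivative_within_subset[OF S, of x "{0..l}"] x by auto
      ultimately have "((\<lambda>x. S (x + h) - S x) has_vector_derivative (r (x + h) - r x)) (at x within {0..l})"
        using has_vector_derivative_diff by (fastforce simp: o_def)
      then show "(m has_vector_derivative d x) (at x within {0..l})"
        unfolding m_def d_def by (rule has_vector_derivative_divide)
    qed
    have d_bound: "cmod (d x) \<le> K" for x
      using r_lip[of "x + h" x] h by (simp add: d_def norm_divide field_simps)
    have m_close: "cmod (m x - s x) \<le> K * h" if x: "x \<in> {0..l}" for x
    proof -
      have "(r has_integral (S (x + h) - S x)) {x..x + h}"
      proof (rule fundamental_theorem_of_calculus)
        fix y assume "y \<in> {x..x + h}"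
        then show "(S has_vector_derivative r y) (at y within {x..x + h})"
          using has_vector_derivative_within_subset[OF S, of y "{x..x + h}"] x h by auto
      qed (use h in simp)
      moreover have "((\<lambda>y. r x) has_integral (h *\<^sub>R r x)) {x..x + h}"
        using has_integral_const_real[of "r x" x "x + h"] h by simp
      ultimately have "((\<lambda>y. r y - r x) has_integral (S (x + h) - S x - h *\<^sub>R r x)) {x..x + h}"
        by (rule has_integral_diff)
      moreover have "cmod (r y - r x) \<le> K * h" if "y \<in> {x..x + h}" for y
        using r_lip[of y x] that mult_left_mono[of "\<bar>y - x\<bar>" h K] K by auto
      ultimately have "cmod (S (x + h) - S x - h *\<^sub>R r x) \<le> K * h * measure lborel {x..x + h}"
        using K h by (intro has_integral_bound_real[where f = "\<lambda>y. r y - r x"]) auto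
      then have "cmod (S (x + h) - S x - h *\<^sub>R r x) \<le> K * h * h" using h by simp
      moreover have eq: "m x - s x = (S (x + h) - S x - h *\<^sub>R r x) / of_real h"
        using h rs[OF x] by (simp add: m_def scaleR_conv_of_real field_simps)
      have "cmod (m x - s x) = cmod (S (x + h) - S x - h *\<^sub>R r x) / h"
        unfolding eq using h by (simp add: norm_divide)
      ultimately show ?thesis using h by (simp add: pos_divide_le_eq)
    qed
    have m_cont: "continuous_on {0..l} m" by (rule AC_continuous[OF m_AC])
    have d_int: "integrable (LI l) d" using m_AC by (simp add: AC_def)
    have dF: "integrable (LI l) (\<lambda>x. d x * F x)" by (rule AC_mult_integrable[OF F d_int])
    have mf: "integrable (LI l) (\<lambda>x. m x * f x)" "integrable (LI l) (\<lambda>x. s x * f x)"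
      by (rule bounded_prod, fact)+
    have "(LINT x|LI l. d x * F x + m x * f x) = m l * F l - m 0 * F 0"
      by (rule AC_total[OF AC_mult[OF m_AC F] l])
    then have "s l * F l - s 0 * F 0 - (LINT x|LI l. s x * f x)
        = (LINT x|LI l. d x * F x) - (m l - s l) * F l + (m 0 - s 0) * F 0
          + (LINT x|LI l. (m x - s x) * f x)"
      using dF mf by (simp add: algebra_simps)
    also have "cmod \<dots> \<le> K * (LINT x|LI l. cmod (F x)) + K * h * cmod (F l) + K * h * cmod (F 0)
          + K * h * (LINT x|LI l. cmod (f x))"
    proof (intro order_trans[OF norm_triangle_ineq] order_trans[OF norm_triangle_ineq4] add_mono)
      show "cmod (LINT x|LI l. d x * F x) \<le> K * (LINT x|LI l. cmod (F x))"
        by (rule integral_norm_bound_mult[OF Fi dF d_bound])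
      show "cmod (LINT x|LI l. (m x - s x) * f x) \<le> K * h * (LINT x|LI l. cmod (f x))"
        by (rule integral_norm_bound_mult[OF f _ m_close]) (use mf in \<open>auto simp: algebra_simps\<close>)
      show "cmod ((m l - s l) * F l) \<le> K * h * cmod (F l)" "cmod ((m 0 - s 0) * F 0) \<le> K * h * cmod (F 0)"
        using m_close l by (auto simp: norm_mult intro!: mult_right_mono)
    qed
    also have "\<dots> = K * (LINT x|LI l. cmod (F x)) + C * h" by (simp add: C_def algebra_simps)
    finally show ?thesis .
  qed
  show ?thesis
  proof (rule tendsto_lowerbound)
    have "(\<lambda>n. K * (LINT x|LI l. cmod (F x)) + C * (1 / real (Suc n))) \<longlonglongrightarrow> K * (LINT x|LI l. cmod (F x)) + C * 0"
      by (intro tendsto_intros LIMSEQ_Suc lim_1_over_n)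
    then show "(\<lambda>n. K * (LINT x|LI l. cmod (F x)) + C * (1 / real (Suc n))) \<longlonglongrightarrow> K * (LINT x|LI l. cmod (F x))"
      by simp
    show "\<forall>\<^sub>F n in sequentially. cmod (s l * F l - s 0 * F 0 - (LINT x|LI l. s x * f x))
        \<le> K * (LINT x|LI l. cmod (F x)) + C * (1 / real (Suc n))"
      by (intro always_eventually allI est) auto
  qed simp
qed

lemma continuous_AE_eq:
  fixes F G :: "real \<Rightarrow> complex"
  assumes l: "0 < l" and FG: "continuous_on {0..l} F" "continuous_on {0..l} G"
    and ae: "AE x in LI l. F x = G x" and x: "x \<in> {0..l}"
  shows "F x = G x"
proof -
  define h where "h = (\<lambda>x. F x - G x)"
  have h: "continuous_on {0..l} h" unfolding h_def by (intro continuous_intros FG)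
  have int: "integrable (LI l) h" by (rule continuous_integrable_LI[OF h])
  have "integral {0..y} h = 0" if y: "y \<in> {0..l}" for y
  proof -
    have "integral {0..y} h = prim l h y" using prim_eq_integral[OF int] y by simp
    also have "\<dots> = prim l (\<lambda>x. 0) y"
      by (rule prim_cong_AE) (use ae int in \<open>auto simp: h_def elim: eventually_mono\<close>)
    finally show ?thesis by (simp add: prim_def)
  qed
  then have "((\<lambda>y. integral {0..y} h) has_vector_derivative 0) (at x within {0..l})"
    using x by (intro has_vector_derivative_transform[OF x _ has_vector_derivative_const[of 0]]) auto
  moreover have "((\<lambda>y. integral {0..y} h) has_vector_derivative h x) (at x within {0..l})"
    by (rule integral_has_vector_derivative[OF h x])
  ultimately have "h x = 0"
    using vector_derivative_unique_within_closed_interval[of 0 l x "\<lambda>y. integral {0..y} h"] l x by auto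
  then show ?thesis by (simp add: h_def)
qed

text \<open>The primitive of \<open>\<psi>\<close> vanishes to the right of its support because the total integral is zero.\<close>

lemma test_function_of_density:
  fixes \<psi> :: "real \<Rightarrow> real"
  assumes ab: "0 < a" "b < l" "a \<le> b" and \<psi>: "continuous_on UNIV \<psi>" and supp: "\<And>x. x \<notin> {a..b} \<Longrightarrow> \<psi> x = 0"
    and total: "integral {0..l} \<psi> = 0"
  shows "\<exists>\<phi>. test_function l \<phi> \<and> deriv \<phi> = \<psi>"
proof -
  define \<phi> where "\<phi> = (\<lambda>x. integral {0..x} \<psi>)"
  have \<psi>_cont: "continuous_on A \<psi>" for A using \<psi> by (rule continuous_on_subset) auto
  have \<psi>_int: "\<psi> integrable_on {u..v}" for u v by (rule integrable_continuous_interval[OF \<psi>_cont])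
  have vanish: "integral {u..v} \<psi> = 0" if "v < a \<or> b < u" for u v
  proof -
    have "integral {u..v} \<psi> = integral {u..v} (\<lambda>x. 0)"
      by (rule integral_cong) (use that in \<open>auto intro!: supp\<close>)
    then show ?thesis by simp
  qed
  have left: "\<phi> x = 0" if "x < a" for x using vanish[of x 0] that by (simp add: \<phi>_def)
  have right: "\<phi> x = 0" if x: "b < x" for x
  proof (cases "x \<le> l")
    case True
    have "integral {0..x} \<psi> + integral {x..l} \<psi> = integral {0..l} \<psi>"
      by (rule Henstock_Kurzweil_Integration.integral_combine) (use True x ab \<psi>_int in auto)
    then show ?thesis using vanish[of l x] x total by (simp add: \<phi>_def)
  next
    case False
    have "integral {0..l} \<psi> + integral {l..x} \<psi> = integral {0..x} \<psi>"
      by (rule Henstock_Kurzweil_Integration.integral_combine) (use False x ab \<psi>_int in auto)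
    then show ?thesis using vanish[of x l] ab total by (simp add: \<phi>_def)
  qed
  have D: "(\<phi> has_vector_derivative \<psi> x) (at x)" for x
  proof (cases "x < a")
    case True
    have "((\<lambda>x. 0) has_vector_derivative 0) (at x)" by simp
    then have "(\<phi> has_vector_derivative 0) (at x)"
      by (rule has_vector_derivative_transform_within_open[of _ _ _ "{..<a}"]) (use True left in auto)
    then show ?thesis using supp[of x] True by simp
  next
    case False
    have "(\<phi> has_vector_derivative \<psi> x) (at x within {0..x + 1})"
      unfolding \<phi>_def by (rule integral_has_vector_derivative[OF \<psi>_cont]) (use False ab in auto)
    then show ?thesis using False ab at_within_interior[of x "{0..x + 1}"] by simp
  qed
  have "test_function l \<phi>"
    unfolding test_function_def C1_differentiable_on_def
    using D \<psi> ab left right by (intro conjI exI[of _ \<psi>] exI[of _ a] exI[of _ b]) (auto simp: not_le)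
  moreover have "deriv \<phi> = \<psi>"
    using D by (auto simp: fun_eq_iff has_real_derivative_iff_has_vector_derivative intro!: DERIV_imp_deriv)
  ultimately show ?thesis by blast
qed

text \<open>Continuous functions that increase to the indicator function of the open interval from \<open>a\<close> to \<open>b\<close>.\<close>

definition plateau :: "real \<Rightarrow> real \<Rightarrow> nat \<Rightarrow> real \<Rightarrow> real" where
  "plateau a b n x = max 0 (min 1 (real n * ((x - a) * (b - x))))"

lemma plateau_props:
  assumes "a < b"
  shows "continuous_on A (plateau a b n)" "x \<notin> {a..b} \<Longrightarrow> plateau a b n x = 0"
    "0 \<le> plateau a b n x" "plateau a b n x \<le> 1"
    "(\<lambda>n. plateau a b n x) \<longlonglongrightarrow> (if a < x \<and> x < b then 1 else 0)"
proof -
  show "continuous_on A (plateau a b n)" unfolding plateau_def by (intro continuous_intros)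
  have neg: "(x - a) * (b - x) \<le> 0" if "\<not> (a < x \<and> x < b)"
    using that assms by (intro mult_le_0_iff[THEN iffD2]) auto
  then have zero: "plateau a b n x = 0" if "\<not> (a < x \<and> x < b)" for n
    using that mult_nonneg_nonpos[of "real n" "(x - a) * (b - x)"] by (auto simp: plateau_def)
  then show "x \<notin> {a..b} \<Longrightarrow> plateau a b n x = 0" by auto
  show "0 \<le> plateau a b n x" "plateau a b n x \<le> 1" by (auto simp: plateau_def)
  show "(\<lambda>n. plateau a b n x) \<longlonglongrightarrow> (if a < x \<and> x < b then 1 else 0)"
  proof (cases "a < x \<and> x < b")
    case True
    define p where "p = (x - a) * (b - x)"
    have p: "0 < p" using True by (simp add: p_def)
    obtain N :: nat where N: "1 / p < real N" using reals_Archimedean2 by blast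
    have "plateau a b n x = 1" if "n \<ge> N" for n
    proof -
      have "1 / p < real n" using N that by linarith
      then have "1 < real n * p" using p by (simp add: field_simps)
      then show ?thesis by (simp add: plateau_def p_def)
    qed
    then have "\<forall>\<^sub>F n in sequentially. plateau a b n x = 1" unfolding eventually_sequentially by blast
    then show ?thesis using True by (simp add: tendsto_eventually)
  next
    case False
    then show ?thesis using zero[OF False] by auto
  qed
qed

lemma plateau_limit:
  assumes ab: "a < b" and w: "integrable (LI l) w"
  shows "(\<lambda>n. LINT x|LI l. w x * complex_of_real (plateau a b n x)) \<longlonglongrightarrow> prim l w b - prim l w a"
proof -
  have [measurable]: "w \<in> borel_measurable (LI l)" using w by auto
  have [measurable]: "plateau a b n \<in> borel_measurable (LI l)" for n
    by (rule continuous_measurable_LI[OF plateau_props(1)[OF ab]])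
  have "(\<lambda>n. LINT x|LI l. w x * complex_of_real (plateau a b n x))
      \<longlonglongrightarrow> (LINT x|LI l. w x * complex_of_real (if a < x \<and> x < b then 1 else 0))"
  proof (rule integral_dominated_convergence[where w = "\<lambda>x. cmod (w x)"])
    show "AE x in LI l. (\<lambda>n. w x * complex_of_real (plateau a b n x))
        \<longlonglongrightarrow> w x * complex_of_real (if a < x \<and> x < b then 1 else 0)"
      using plateau_props(5)[OF ab] by (intro AE_I2 tendsto_intros)
    show "AE x in LI l. norm (w x * complex_of_real (plateau a b n x)) \<le> cmod (w x)" for n
      using plateau_props(3,4)[OF ab, of n] by (intro AE_I2) (simp add: norm_mult mult_left_le)
  qed (use w in auto)
  also have "(LINT x|LI l. w x * complex_of_real (if a < x \<and> x < b then 1 else 0))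
      = (LINT x|LI l. (if x \<le> b then w x else 0) - (if x \<le> a then w x else 0))"
    by (rule integral_cong_AE, measurable, use AE_neq_LI[of a l] AE_neq_LI[of b l] in eventually_elim)
      (use ab in auto)
  also have "\<dots> = prim l w b - prim l w a" unfolding prim_def using integrable_cut(1)[OF w] by simp
  finally show ?thesis .
qed

lemma prim_const: assumes "0 \<le> x" "x \<le> l" shows "prim l (\<lambda>y. c) x = c * of_real x"
proof -
  have "prim l (\<lambda>y. c) x = integral {0..x} (\<lambda>y. c)"
    by (rule prim_eq_integral) (use assms continuous_integrable_LI[of l "\<lambda>y. c"] in auto)
  then show ?thesis using assms by (simp add: scaleR_conv_of_real)
qed

text \<open>The mean of \<open>w\<close> over an interval is compared with the mean over a fixed interval, by test functions whose derivative is a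
  combination of two plateaus with total integral zero. All means agree, so the primitive of \<open>w\<close> is affine.\<close>

lemma du_Bois_Reymond:
  assumes l: "0 < l" and w: "integrable (LI l) w"
    and zero: "\<And>\<phi>. test_function l \<phi> \<Longrightarrow> (LINT x|LI l. w x * complex_of_real (deriv \<phi> x)) = 0"
  shows "\<exists>c. AE x in LI l. w x = c"
proof -
  define p q where "p = l / 3" and "q = 2 * l / 3"
  have pq: "0 < p" "p < q" "q < l" using l by (auto simp: p_def q_def)
  define W where "W = (\<lambda>x. prim l w x)"
  define c where "c = (W q - W p) / of_real (q - p)"
  have one: "integrable (LI l) (\<lambda>x. 1 :: complex)" by (rule continuous_integrable_LI) auto
  have len: "prim l (\<lambda>x. 1) b - prim l (\<lambda>x. 1) a = of_real (b - a)" if "0 \<le> a" "a \<le> b" "b \<le> l" for a b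
    using that by (simp add: prim_const)
  have diff: "W b - W a = c * of_real (b - a)" if ab: "0 < a" "a < b" "b < l" for a b
  proof -
    define P Q where "P = plateau a b" and "Q = plateau p q"
    have Pc: "continuous_on A (P n)" "continuous_on A (Q n)" for A n
      unfolding P_def Q_def using plateau_props(1) ab pq by blast+
    define IP IQ where "IP = (\<lambda>n. LINT x|LI l. P n x)" and "IQ = (\<lambda>n. LINT x|LI l. Q n x)"
    have wi: "integrable (LI l) (\<lambda>x. w x * complex_of_real (P n x))" "integrable (LI l) (\<lambda>x. w x * complex_of_real (Q n x))" for n
      by (rule integrable_mult_bounded[OF w continuous_measurable_LI, where B = 1];
          use plateau_props(3,4)[OF ab(2), of n] plateau_props(3,4)[OF pq(2), of n] in
          \<open>auto intro!: continuous_intros Pc simp: P_def[symmetric] Q_def[symmetric]\<close>)+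
    have key: "of_real (IQ n) * (LINT x|LI l. w x * complex_of_real (P n x))
        = of_real (IP n) * (LINT x|LI l. w x * complex_of_real (Q n x))" for n
    proof -
      define \<psi> where "\<psi> = (\<lambda>x. IQ n * P n x - IP n * Q n x)"
      have cont: "continuous_on A \<psi>" for A unfolding \<psi>_def by (intro continuous_intros Pc)
      have "integral {0..l} \<psi> = (LINT x|LI l. \<psi> x)"
        using lebesgue_integral_eq_integral[OF continuous_integrable_LI[OF cont], of l] by simp
      also have "\<dots> = IQ n * IP n - IP n * IQ n"
        unfolding \<psi>_def using continuous_integrable_LI[OF Pc(1), of l n] continuous_integrable_LI[OF Pc(2), of l n]
        by (simp add: IP_def IQ_def)
      finally have tot: "integral {0..l} \<psi> = 0" by simp
      have supp: "\<psi> x = 0" if "x \<notin> {min a p..max b q}" for x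
      proof -
        have "P n x = 0" "Q n x = 0"
          unfolding P_def Q_def using that by (intro plateau_props(2) ab pq; auto)+
        then show ?thesis by (simp add: \<psi>_def)
      qed
      obtain \<phi> where \<phi>: "test_function l \<phi>" "deriv \<phi> = \<psi>"
      proof -
        have "min a p \<le> max b q" using ab by linarith
        then show thesis
          using that test_function_of_density[of "min a p" "max b q" l \<psi>, OF _ _ _ cont supp tot] ab pq by auto
      qed
      have "0 = (LINT x|LI l. w x * complex_of_real (\<psi> x))" using zero[OF \<phi>(1)] \<phi>(2) by simp
      also have "\<dots> = (LINT x|LI l. of_real (IQ n) * (w x * complex_of_real (P n x))
          - of_real (IP n) * (w x * complex_of_real (Q n x)))"
        by (simp add: \<psi>_def algebra_simps)
      also have "\<dots> = of_real (IQ n) * (LINT x|LI l. w x * complex_of_real (P n x))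
        - of_real (IP n) * (LINT x|LI l. w x * complex_of_real (Q n x))"
        using wi by simp
      finally show ?thesis by simp
    qed
    have IP: "(\<lambda>n. complex_of_real (IP n)) \<longlonglongrightarrow> of_real (b - a)"
      using plateau_limit[OF ab(2) one] len[of a b] ab by (simp add: IP_def P_def)
    have IQ: "(\<lambda>n. complex_of_real (IQ n)) \<longlonglongrightarrow> of_real (q - p)"
      using plateau_limit[OF pq(2) one] len[of p q] pq by (simp add: IQ_def Q_def)
    have "of_real (q - p) * (W b - W a) = of_real (b - a) * (W q - W p)"
    proof (rule LIMSEQ_unique)
      show "(\<lambda>n. of_real (IQ n) * (LINT x|LI l. w x * complex_of_real (P n x)))
          \<longlonglongrightarrow> of_real (q - p) * (W b - W a)"
        unfolding W_def P_def by (intro tendsto_mult IQ plateau_limit[OF ab(2) w])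
      show "(\<lambda>n. of_real (IQ n) * (LINT x|LI l. w x * complex_of_real (P n x)))
          \<longlonglongrightarrow> of_real (b - a) * (W q - W p)"
        unfolding key unfolding W_def Q_def by (intro tendsto_mult IP plateau_limit[OF pq(2) w])
    qed
    then show ?thesis using pq by (simp add: c_def field_simps)
  qed
  define V where "V = (\<lambda>x. prim l (\<lambda>y. w y - c * 1) x)"
  have ci: "integrable (LI l) (\<lambda>y. c * 1)" using continuous_integrable_LI[of l "\<lambda>y. c"] by simp
  have V_int: "integrable (LI l) (\<lambda>y. w y - c * 1)" using w ci by (rule Bochner_Integration.integrable_diff)
  have V: "V x = W x - c * of_real x" if "0 \<le> x" "x \<le> l" for x
    using prim_linear(2)[OF w ci, of x] prim_const[OF that, of c] by (simp add: V_def W_def)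
  have const: "V x = V p" if "0 < x" "x < l" for x
  proof (cases x p rule: linorder_cases)
    case less
    have "W x = W p - (W p - W x)" by simp
    also have "W p - W x = c * of_real (p - x)" by (rule diff) (use less that pq in auto)
    finally show ?thesis using V[of x] V[of p] that pq by (simp add: right_diff_distrib)
  next
    case greater
    have "W x = W p + (W x - W p)" by simp
    also have "W x - W p = c * of_real (x - p)" by (rule diff) (use greater that pq in auto)
    finally show ?thesis using V[of x] V[of p] that pq by (simp add: right_diff_distrib)
  qed simp
  have V_cont: "continuous_on {0..l} V" unfolding V_def by (rule prim_continuous[OF V_int])
  have "AE x in LI l. V x = V p"
    using AE_neq_LI[of 0 l] AE_neq_LI[of l l] AE_space[of "LI l"]
    by eventually_elim (auto intro!: const)
  then have Vp: "V x = V p" if "x \<in> {0..l}" for x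
    using continuous_AE_eq[OF l V_cont continuous_on_const _ that] by blast
  have "V 0 = 0" by (simp add: V_def prim_nonpos)
  then have "prim l (\<lambda>y. w y - c * 1) x = 0" if "x \<in> {0..l}" for x
    using Vp[OF that] Vp[of 0] l by (simp add: V_def)
  then have "AE x in LI l. w x - c * 1 = 0"
    using prim_zero_imp[OF _ V_int] l by simp
  then show ?thesis by (intro exI[of _ c]) (auto elim: eventually_mono)
qed

section \<open>Square-integrable functions and the Sobolev space of an interval\<close>

lemma l2_rel_rep: "l2_rel (rep_l2 u) (rep_l2 u)"
  by (rule Quotient3_rep_reflp[OF Quotient3_l2fun])

lemma rep_sq_integrable: "sq_integrable (rep_l2 u)"
  using l2_rel_rep[of u] by (simp add: l2_rel_def)

lemma l2_eq_iff: "u = v \<longleftrightarrow> (AE x in lebesgue. rep_l2 u x = rep_l2 v x)"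
  using Quotient3_rel_rep[OF Quotient3_l2fun, of u v] rep_sq_integrable[of u] rep_sq_integrable[of v]
  by (auto simp: l2_rel_def)

lemma rep_abs_l2: assumes "sq_integrable f" shows "AE x in lebesgue. rep_l2 (abs_l2 f) x = f x"
proof -
  have "l2_rel f f" using assms by (simp add: l2_rel_def)
  then have "l2_rel f (rep_l2 (abs_l2 f))" by (rule rep_abs_rsp[OF Quotient3_l2fun])
  then show ?thesis by (auto simp: l2_rel_def elim: eventually_mono)
qed

lemma rep_l2_add: "AE x in lebesgue. rep_l2 (u + v) x = rep_l2 u x + rep_l2 v x"
  unfolding plus_l2fun_def map_fun_def comp_def id_def
  by (rule rep_abs_l2) (intro sq_integrable_add rep_sq_integrable)

lemma rep_l2_scale: "AE x in lebesgue. rep_l2 (l2_scale c u) x = c * rep_l2 u x"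
  unfolding l2_scale_def map_fun_def comp_def id_def
  by (rule rep_abs_l2) (intro sq_integrable_scale rep_sq_integrable)

lemma rep_l2_zero: "AE x in lebesgue. rep_l2 0 x = 0"
  unfolding zero_l2fun_def by (rule rep_abs_l2) simp

lemma rep_l2_uminus: "AE x in lebesgue. rep_l2 (- u) x = - rep_l2 u x"
  unfolding uminus_l2fun_def map_fun_def comp_def id_def
  by (rule rep_abs_l2) (use sq_integrable_scale[OF rep_sq_integrable, of "-1" u] in simp)

lemma rep_l2_diff: "AE x in lebesgue. rep_l2 (u - v) x = rep_l2 u x - rep_l2 v x"
  unfolding minus_l2fun_def using rep_l2_add[of u "- v"] rep_l2_uminus[of v]
  by eventually_elim simp

lemma AE_LI_if_lebesgue: "AE x in lebesgue. P x \<Longrightarrow> AE x in LI l. P x"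
  unfolding AE_LI_iff by (auto elim: eventually_mono)

lemmas rep_LI =
  rep_l2_add[THEN AE_LI_if_lebesgue] rep_l2_scale[THEN AE_LI_if_lebesgue] rep_l2_zero[THEN AE_LI_if_lebesgue]
  rep_l2_uminus[THEN AE_LI_if_lebesgue] rep_l2_diff[THEN AE_LI_if_lebesgue]

lemma L2_on_eqI:
  assumes "u \<in> L2_on l" "v \<in> L2_on l" "AE x in LI l. rep_l2 u x = rep_l2 v x" shows "u = v"
proof -
  have "AE x in lebesgue. x \<notin> {0..l} \<longrightarrow> rep_l2 u x = 0" "AE x in lebesgue. x \<notin> {0..l} \<longrightarrow> rep_l2 v x = 0"
    using assms by (auto simp: L2_on_def)
  moreover have "AE x in lebesgue. x \<in> {0..l} \<longrightarrow> rep_l2 u x = rep_l2 v x" using assms(3) by (simp add: AE_LI_iff)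
  ultimately have "AE x in lebesgue. rep_l2 u x = rep_l2 v x" by eventually_elim metis
  then show ?thesis by (simp add: l2_eq_iff)
qed

lemma L2_on_closed:
  "0 \<in> L2_on l" "u \<in> L2_on l \<Longrightarrow> v \<in> L2_on l \<Longrightarrow> u + v \<in> L2_on l" "u \<in> L2_on l \<Longrightarrow> l2_scale c u \<in> L2_on l"
  "u \<in> L2_on l \<Longrightarrow> v \<in> L2_on l \<Longrightarrow> u - v \<in> L2_on l"
proof -
  show "0 \<in> L2_on l" unfolding L2_on_def using rep_l2_zero by (auto elim: eventually_mono)
  show "u + v \<in> L2_on l" if "u \<in> L2_on l" "v \<in> L2_on l"
    using that rep_l2_add[of u v] unfolding L2_on_def mem_Collect_eq by eventually_elim auto
  show "l2_scale c u \<in> L2_on l" if "u \<in> L2_on l"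
    using that rep_l2_scale[of c u] unfolding L2_on_def mem_Collect_eq by eventually_elim auto
  show "u - v \<in> L2_on l" if "u \<in> L2_on l" "v \<in> L2_on l"
    using that rep_l2_diff[of u v] unfolding L2_on_def mem_Collect_eq by eventually_elim auto
qed

lemma rep_measurable_LI [measurable]: "rep_l2 u \<in> borel_measurable (LI l)"
  using rep_sq_integrable[of u] by (intro measurable_restrict_space1) (simp add: sq_integrable_def)

lemma square_integrable_LI:
  fixes f :: "real \<Rightarrow> complex"
  assumes [measurable]: "f \<in> borel_measurable (LI l)" and sq: "integrable (LI l) (\<lambda>x. (cmod (f x))\<^sup>2)"
  shows "integrable (LI l) f"
proof (rule Bochner_Integration.integrable_bound)
  interpret finite_measure "LI l" by (rule finite_measure_LI)
  show "integrable (LI l) (\<lambda>x. 1 + (cmod (f x))\<^sup>2)" using sq by simp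
  show "AE x in LI l. norm (f x) \<le> norm (1 + (cmod (f x))\<^sup>2)"
  proof (rule AE_I2)
    fix x have "2 * cmod (f x) * 1 \<le> (cmod (f x))\<^sup>2 + 1\<^sup>2" by (rule sum_squares_bound)
    then have "cmod (f x) \<le> 1 + (cmod (f x))\<^sup>2"
      using norm_ge_zero[of "f x"] unfolding power_one mult_1_right by linarith
    then show "norm (f x) \<le> norm (1 + (cmod (f x))\<^sup>2)" by simp
  qed
qed measurable

lemma rep_square_integrable_LI: "integrable (LI l) (\<lambda>x. (cmod (rep_l2 u x))\<^sup>2)"
proof -
  have "integrable lebesgue (\<lambda>x. indicator {0..l} x *\<^sub>R (cmod (rep_l2 u x))\<^sup>2)"
    using rep_sq_integrable[of u] by (intro integrable_mult_indicator) (auto simp: sq_integrable_def)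
  then show ?thesis by (subst integrable_restrict_space) auto
qed

lemma rep_integrable_LI: "integrable (LI l) (rep_l2 u)"
  by (rule square_integrable_LI[OF rep_measurable_LI rep_square_integrable_LI])

definition lift :: "real \<Rightarrow> (real \<Rightarrow> complex) \<Rightarrow> l2fun" where
  "lift l f = abs_l2 (\<lambda>s. if s \<in> {0..l} then f s else 0)"

lemma lift_props:
  assumes f: "f \<in> borel_measurable (LI l)" and sq: "integrable (LI l) (\<lambda>x. (cmod (f x))\<^sup>2)"
  shows "lift l f \<in> L2_on l" and "AE x in LI l. rep_l2 (lift l f) x = f x"
proof -
  have ind: "(\<lambda>s. if s \<in> {0..l} then f s else 0) = (\<lambda>x. indicator {0..l} x *\<^sub>R f x)"
    by (auto simp: fun_eq_iff)
  have sqi: "sq_integrable (\<lambda>s. if s \<in> {0..l} then f s else 0)"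
    unfolding sq_integrable_def
  proof
    show "(\<lambda>s. if s \<in> {0..l} then f s else 0) \<in> borel_measurable lebesgue"
      unfolding ind using f borel_measurable_restrict_space_iff[of "{0..l}" lebesgue f] by auto
    have "integrable lebesgue (\<lambda>x. indicator {0..l} x *\<^sub>R (cmod (f x))\<^sup>2)"
      using sq by (subst (asm) integrable_restrict_space) auto
    then show "integrable lebesgue (\<lambda>x. (cmod (if x \<in> {0..l} then f x else 0))\<^sup>2)"
      by (rule Bochner_Integration.integrable_cong[THEN iffD1, rotated -1]) auto
  qed
  show "lift l f \<in> L2_on l"
    unfolding L2_on_def lift_def using rep_abs_l2[OF sqi] by (auto elim: eventually_mono)
  show "AE x in LI l. rep_l2 (lift l f) x = f x"
    unfolding AE_LI_iff lift_def using rep_abs_l2[OF sqi] by (auto elim: eventually_mono)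
qed

lemma square_integrable_mult_bounded:
  fixes f g :: "real \<Rightarrow> complex"
  assumes f: "f \<in> borel_measurable (LI l)" "integrable (LI l) (\<lambda>x. (cmod (f x))\<^sup>2)"
    and g: "g \<in> borel_measurable (LI l)" "AE x in LI l. cmod (g x) \<le> B"
  shows "integrable (LI l) (\<lambda>x. (cmod (g x * f x))\<^sup>2)"
proof -
  have [measurable]: "f \<in> borel_measurable (LI l)" "g \<in> borel_measurable (LI l)" using f g by auto
  show ?thesis
  proof (rule Bochner_Integration.integrable_bound)
    show "integrable (LI l) (\<lambda>x. B\<^sup>2 * (cmod (f x))\<^sup>2)" using f by simp
    show "AE x in LI l. norm ((cmod (g x * f x))\<^sup>2) \<le> norm (B\<^sup>2 * (cmod (f x))\<^sup>2)"
      using g(2)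
    proof eventually_elim
      case (elim x)
      have "(cmod (g x))\<^sup>2 \<le> B\<^sup>2" by (rule power_mono[OF elim]) simp
      then have "(cmod (g x))\<^sup>2 * (cmod (f x))\<^sup>2 \<le> B\<^sup>2 * (cmod (f x))\<^sup>2" by (rule mult_right_mono) simp
      then show ?case by (simp add: norm_mult power_mult_distrib)
    qed
  qed measurable
qed

lemma square_integrable_add:
  fixes f g :: "real \<Rightarrow> complex"
  assumes "f \<in> borel_measurable (LI l)" "integrable (LI l) (\<lambda>x. (cmod (f x))\<^sup>2)"
    and "g \<in> borel_measurable (LI l)" "integrable (LI l) (\<lambda>x. (cmod (g x))\<^sup>2)"
  shows "integrable (LI l) (\<lambda>x. (cmod (f x + g x))\<^sup>2)"
proof -
  have [measurable]: "f \<in> borel_measurable (LI l)" "g \<in> borel_measurable (LI l)" using assms by auto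
  show ?thesis
  proof (rule Bochner_Integration.integrable_bound)
    show "integrable (LI l) (\<lambda>x. 2 * (cmod (f x))\<^sup>2 + 2 * (cmod (g x))\<^sup>2)" using assms by simp
    show "AE x in LI l. norm ((cmod (f x + g x))\<^sup>2) \<le> norm (2 * (cmod (f x))\<^sup>2 + 2 * (cmod (g x))\<^sup>2)"
    proof (rule AE_I2)
      fix x
      have "(cmod (f x + g x))\<^sup>2 \<le> (cmod (f x) + cmod (g x))\<^sup>2" by (simp add: norm_triangle_ineq power_mono)
      also have "\<dots> \<le> 2 * (cmod (f x))\<^sup>2 + 2 * (cmod (g x))\<^sup>2"
        using sum_squares_bound[of "cmod (f x)" "cmod (g x)"] by (simp add: power2_sum)
      finally show "norm ((cmod (f x + g x))\<^sup>2) \<le> norm (2 * (cmod (f x))\<^sup>2 + 2 * (cmod (g x))\<^sup>2)" by simp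
    qed
  qed measurable
qed

lemma square_integrable_sum:
  fixes f :: "'j \<Rightarrow> real \<Rightarrow> complex"
  assumes "finite J" "\<And>j. j \<in> J \<Longrightarrow> f j \<in> borel_measurable (LI l) \<and> integrable (LI l) (\<lambda>x. (cmod (f j x))\<^sup>2)"
  shows "(\<lambda>x. \<Sum>j\<in>J. f j x) \<in> borel_measurable (LI l) \<and> integrable (LI l) (\<lambda>x. (cmod (\<Sum>j\<in>J. f j x))\<^sup>2)"
  using assms
proof (induction J rule: finite_induct)
  case (insert j J)
  then have "(\<lambda>x. \<Sum>j\<in>J. f j x) \<in> borel_measurable (LI l) \<and> integrable (LI l) (\<lambda>x. (cmod (\<Sum>j\<in>J. f j x))\<^sup>2)"
    and "f j \<in> borel_measurable (LI l) \<and> integrable (LI l) (\<lambda>x. (cmod (f j x))\<^sup>2)" by auto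
  then show ?case using insert.hyps square_integrable_add[of "f j" l "\<lambda>x. \<Sum>j\<in>J. f j x"] by auto
qed simp

lemma product_integrable:
  fixes f g :: "real \<Rightarrow> complex"
  assumes "f \<in> borel_measurable (LI l)" "integrable (LI l) (\<lambda>x. (cmod (f x))\<^sup>2)"
    and "g \<in> borel_measurable (LI l)" "integrable (LI l) (\<lambda>x. (cmod (g x))\<^sup>2)"
  shows "integrable (LI l) (\<lambda>x. f x * g x)"
proof -
  have [measurable]: "f \<in> borel_measurable (LI l)" "g \<in> borel_measurable (LI l)" using assms by auto
  show ?thesis
  proof (rule Bochner_Integration.integrable_bound)
    show "integrable (LI l) (\<lambda>x. (cmod (f x))\<^sup>2 + (cmod (g x))\<^sup>2)" using assms by simp
    show "AE x in LI l. norm (f x * g x) \<le> norm ((cmod (f x))\<^sup>2 + (cmod (g x))\<^sup>2)"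
    proof (rule AE_I2)
      fix x
      have "0 \<le> cmod (f x) * cmod (g x)" by simp
      then have "cmod (f x) * cmod (g x) \<le> (cmod (f x))\<^sup>2 + (cmod (g x))\<^sup>2"
        using sum_squares_bound[of "cmod (f x)" "cmod (g x)"] unfolding mult.assoc by linarith
      then show "norm (f x * g x) \<le> norm ((cmod (f x))\<^sup>2 + (cmod (g x))\<^sup>2)"
        by (simp add: norm_mult)
    qed
  qed measurable
qed

text \<open>From right to left this is integration by parts. Conversely, \<open>du_Bois_Reymond\<close> applies to the difference of \<open>u\<close> and
  the primitive of \<open>g\<close>.\<close>

lemma weak_derivative_iff_AC:
  assumes l: "0 < l"
  shows "weak_derivative l u g \<longleftrightarrow> (\<exists>F. AC l F (rep_l2 g) \<and> (AE x in LI l. rep_l2 u x = F x))"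
proof
  have test: "AC l (\<lambda>x. complex_of_real (\<phi> x)) (\<lambda>x. complex_of_real (deriv \<phi> x)) \<and> \<phi> 0 = 0 \<and> \<phi> l = 0"
    if "test_function l \<phi>" for \<phi>
  proof (intro conjI)
    obtain D where D: "\<And>x. (\<phi> has_vector_derivative D x) (at x)" "continuous_on UNIV D"
      using \<open>test_function l \<phi>\<close> by (auto simp: test_function_def C1_differentiable_on_def)
    then have der: "deriv \<phi> = D"
      by (auto simp: fun_eq_iff has_real_derivative_iff_has_vector_derivative intro!: DERIV_imp_deriv)
    show "AC l (\<lambda>x. complex_of_real (\<phi> x)) (\<lambda>x. complex_of_real (deriv \<phi> x))"
      unfolding der
    proof (rule AC_C1)
      show "((\<lambda>x. complex_of_real (\<phi> x)) has_vector_derivative complex_of_real (D x)) (at x within {0..l})" for x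
        using D(1)[of x] by (intro has_vector_derivative_of_real)
          (auto simp: has_real_derivative_iff_has_vector_derivative[symmetric] intro: has_field_derivative_at_within)
      show "continuous_on {0..l} (\<lambda>x. complex_of_real (D x))"
        by (intro continuous_intros continuous_on_subset[OF D(2)]) auto
    qed
    show "\<phi> 0 = 0" "\<phi> l = 0" using \<open>test_function l \<phi>\<close> by (auto simp: test_function_def)
  qed
  have parts: "(LINT x|LI l. F x * complex_of_real (deriv \<phi> x)) = - (LINT x|LI l. f x * complex_of_real (\<phi> x))"
    if F: "AC l F f" and \<phi>: "test_function l \<phi>" for F f \<phi>
  proof -
    note t = test[OF \<phi>]
    have i: "integrable (LI l) (\<lambda>x. F x * complex_of_real (deriv \<phi> x))"
      "integrable (LI l) (\<lambda>x. f x * complex_of_real (\<phi> x))"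
      using AC_mult_integrable(2)[OF F] AC_mult_integrable(1)[of l "\<lambda>x. complex_of_real (\<phi> x)"] t F
      unfolding AC_def by blast+
    have "(LINT x|LI l. f x * complex_of_real (\<phi> x) + F x * complex_of_real (deriv \<phi> x)) = 0"
      using AC_total[OF AC_mult[OF F conjunct1[OF t]]] l t by simp
    then show ?thesis using i by (simp add: eq_neg_iff_add_eq_0 add.commute)
  qed
  have deriv_bound: "integrable (LI l) (\<lambda>x. f x * complex_of_real (deriv \<phi> x))"
    if f: "integrable (LI l) f" and \<phi>: "test_function l \<phi>" for f \<phi>
  proof -
    obtain D where D: "\<And>x. (\<phi> has_vector_derivative D x) (at x)" "continuous_on UNIV D"
      using \<phi> by (auto simp: test_function_def C1_differentiable_on_def)
    then have der: "deriv \<phi> = D"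
      by (auto simp: fun_eq_iff has_real_derivative_iff_has_vector_derivative intro!: DERIV_imp_deriv)
    have c: "continuous_on {0..l} (\<lambda>x. complex_of_real (deriv \<phi> x))"
      unfolding der by (intro continuous_intros continuous_on_subset[OF D(2)]) auto
    have "compact ((\<lambda>x. complex_of_real (deriv \<phi> x)) ` {0..l})" by (intro compact_continuous_image c) auto
    then obtain B where B: "\<And>x. x \<in> {0..l} \<Longrightarrow> cmod (complex_of_real (deriv \<phi> x)) \<le> B"
      using compact_imp_bounded bounded_iff by (metis (no_types, lifting) imageI)
    show ?thesis
      by (rule integrable_mult_bounded[OF f continuous_measurable_LI[OF c], where B = B])
        (use B in \<open>auto intro!: AE_I2\<close>)
  qed
  {
    assume "\<exists>F. AC l F (rep_l2 g) \<and> (AE x in LI l. rep_l2 u x = F x)"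
    then obtain F where F: "AC l F (rep_l2 g)" "AE x in LI l. rep_l2 u x = F x" by blast
    show "weak_derivative l u g"
      unfolding weak_derivative_def LINT_LI
    proof (intro allI impI)
      fix \<phi> assume \<phi>: "test_function l \<phi>"
      have i: "integrable (LI l) (\<lambda>x. rep_l2 u x * complex_of_real (deriv \<phi> x))"
        "integrable (LI l) (\<lambda>x. F x * complex_of_real (deriv \<phi> x))"
        using deriv_bound[OF rep_integrable_LI \<phi>] deriv_bound[OF continuous_integrable_LI[OF AC_continuous[OF F(1)]] \<phi>]
        by auto
      have "(LINT x|LI l. rep_l2 u x * complex_of_real (deriv \<phi> x)) = (LINT x|LI l. F x * complex_of_real (deriv \<phi> x))"
        by (rule integral_cong_AE) (use i F(2) in \<open>auto elim: eventually_mono\<close>)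
      then show "(LINT x|LI l. rep_l2 u x * complex_of_real (deriv \<phi> x))
          = - (LINT x|LI l. rep_l2 g x * complex_of_real (\<phi> x))"
        using parts[OF F(1) \<phi>] by simp
    qed
  }
  {
    assume wd: "weak_derivative l u g"
    define P where "P = prim l (rep_l2 g)"
    have P: "AC l P (rep_l2 g)" by (simp add: AC_def P_def prim_nonpos rep_integrable_LI)
    have Pi: "integrable (LI l) P" by (rule continuous_integrable_LI[OF AC_continuous[OF P]])
    have "\<exists>c. AE x in LI l. rep_l2 u x - P x = c"
    proof (rule du_Bois_Reymond[OF l])
      show "integrable (LI l) (\<lambda>x. rep_l2 u x - P x)"
        using rep_integrable_LI Pi by (rule Bochner_Integration.integrable_diff)
      fix \<phi> assume \<phi>: "test_function l \<phi>"
      have "(LINT x|LI l. (rep_l2 u x - P x) * complex_of_real (deriv \<phi> x))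
          = (LINT x|LI l. rep_l2 u x * complex_of_real (deriv \<phi> x)) - (LINT x|LI l. P x * complex_of_real (deriv \<phi> x))"
        using deriv_bound[OF rep_integrable_LI \<phi>, of u] deriv_bound[OF Pi \<phi>] by (simp add: left_diff_distrib)
      then show "(LINT x|LI l. (rep_l2 u x - P x) * complex_of_real (deriv \<phi> x)) = 0"
        using wd \<phi> parts[OF P \<phi>] unfolding weak_derivative_def LINT_LI by simp
    qed
    then obtain c where c: "AE x in LI l. rep_l2 u x - P x = c" by blast
    have "AC l (\<lambda>x. c + P x) (rep_l2 g)"
      by (simp add: AC_def P_def prim_nonpos rep_integrable_LI)
    moreover have "AE x in LI l. rep_l2 u x = c + P x" using c by eventually_elim (simp add: algebra_simps)
    ultimately show "\<exists>F. AC l F (rep_l2 g) \<and> (AE x in LI l. rep_l2 u x = F x)" by blast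
  }
qed

lemma AC_derivative_unique:
  assumes l: "0 < l" and F: "AC l F f" and G: "AC l G g" and ae: "AE x in LI l. F x = G x"
  shows "AE x in LI l. f x = g x"
proof -
  have eq: "F x = G x" if "x \<in> {0..l}" for x
    using continuous_AE_eq[OF l AC_continuous[OF F] AC_continuous[OF G] ae that] .
  have fg: "integrable (LI l) f" "integrable (LI l) g" using F G by (auto simp: AC_def)
  have "AE x in LI l. f x - g x = 0"
  proof (rule prim_zero_imp)
    fix x assume x: "x \<in> {0..l}"
    have "F x = F 0 + prim l f x" "G x = G 0 + prim l g x" using F G x unfolding AC_def by metis+
    moreover have "F 0 = G 0" "F x = G x" using eq[of 0] eq[OF x] l by auto
    ultimately show "prim l (\<lambda>x. f x - g x) x = 0" using prim_linear(2)[OF fg] by simp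
  qed (use l fg in auto)
  then show ?thesis by eventually_elim simp
qed

lemma wderiv_eqI:
  assumes l: "0 < l" and g: "g \<in> L2_on l" and wd: "weak_derivative l u g" shows "wderiv l u = g"
  unfolding wderiv_def
proof (rule the_equality)
  fix h assume h: "h \<in> L2_on l \<and> weak_derivative l u h"
  obtain F G where F: "AC l F (rep_l2 g)" "AE x in LI l. rep_l2 u x = F x"
    and G: "AC l G (rep_l2 h)" "AE x in LI l. rep_l2 u x = G x"
    using wd h weak_derivative_iff_AC[OF l] by metis
  have "AE x in LI l. G x = F x" using F(2) G(2) by eventually_elim simp
  then have "AE x in LI l. rep_l2 h x = rep_l2 g x" by (rule AC_derivative_unique[OF l G(1) F(1)])
  then show "h = g" using L2_on_eqI h g by blast
qed (use g wd in auto)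

lemma point_value_eqI:
  assumes l: "0 < l" and F: "continuous_on {0..l} F" "AE x in LI l. rep_l2 u x = F x" and x: "x \<in> {0..l}"
  shows "point_value l u x = F x"
  unfolding point_value_def
proof (rule the_equality)
  show "\<exists>f. continuous_on {0..l} f \<and> (AE y in lebesgue. y \<in> {0..l} \<longrightarrow> f y = rep_l2 u y) \<and> f x = F x"
    using F unfolding AE_LI_iff by (intro exI[of _ F]) (auto elim: eventually_mono)
  fix c assume "\<exists>f. continuous_on {0..l} f \<and> (AE y in lebesgue. y \<in> {0..l} \<longrightarrow> f y = rep_l2 u y) \<and> f x = c"
  then obtain f where f: "continuous_on {0..l} f" "AE y in LI l. f y = rep_l2 u y" "f x = c"
    unfolding AE_LI_iff by blast
  have "AE y in LI l. f y = F y" using f(2) F(2) by eventually_elim simp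
  then show "c = F x" using continuous_AE_eq[OF l f(1) F(1) _ x] f(3) by simp
qed

text \<open>The continuous representative \<open>F\<close> is the one whose values \<open>point_value\<close> takes.\<close>

lemma H1_cases:
  assumes l: "0 < l" and u: "u \<in> H1_on l"
  obtains F where "AC l F (rep_l2 (wderiv l u))" "AE x in LI l. rep_l2 u x = F x"
    "wderiv l u \<in> L2_on l" "\<And>x. x \<in> {0..l} \<Longrightarrow> point_value l u x = F x"
proof -
  obtain g where g: "g \<in> L2_on l" "weak_derivative l u g" using u by (auto simp: H1_on_def)
  have w: "wderiv l u = g" by (rule wderiv_eqI[OF l g])
  obtain F where F: "AC l F (rep_l2 g)" "AE x in LI l. rep_l2 u x = F x"
    using weak_derivative_iff_AC[OF l] g by blast
  show thesis
    using that[of F] F g point_value_eqI[OF l AC_continuous[OF F(1)] F(2)] unfolding w by blast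
qed

lemma H1_intro:
  assumes l: "0 < l" and F: "AC l F f" and sq: "integrable (LI l) (\<lambda>x. (cmod (f x))\<^sup>2)"
    and u: "u \<in> L2_on l" "AE x in LI l. rep_l2 u x = F x"
  shows "u \<in> H1_on l" and "AE x in LI l. rep_l2 (wderiv l u) x = f x"
    and "x \<in> {0..l} \<Longrightarrow> point_value l u x = F x"
proof -
  have f: "integrable (LI l) f" using F by (simp add: AC_def)
  have g: "lift l f \<in> L2_on l" "AE x in LI l. rep_l2 (lift l f) x = f x"
    using lift_props[OF _ sq] f by auto
  have "AC l F (rep_l2 (lift l f))"
  proof -
    have "prim l (rep_l2 (lift l f)) x = prim l f x" for x
      by (rule prim_cong_AE[OF g(2)]) (use f in auto)
    then show ?thesis using F unfolding AC_def using rep_integrable_LI by metis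
  qed
  then have wd: "weak_derivative l u (lift l f)" using u(2) weak_derivative_iff_AC[OF l] by blast
  show "u \<in> H1_on l" using u(1) g(1) wd by (auto simp: H1_on_def)
  show "AE x in LI l. rep_l2 (wderiv l u) x = f x" using g wderiv_eqI[OF l g(1) wd] by simp
  show "x \<in> {0..l} \<Longrightarrow> point_value l u x = F x"
    by (rule point_value_eqI[OF l AC_continuous[OF F] u(2)])
qed

text \<open>On an interval of finite length a Cauchy sequence in the quadratic mean is Cauchy in the mean, so a subsequence converges
  almost everywhere; the lemma of Fatou makes the pointwise limit the limit in the quadratic mean.\<close>

lemma L2_complete:
  assumes X: "\<And>n. X n \<in> L2_on l"
    and cauchy: "\<And>e. e > 0 \<Longrightarrow> \<exists>N. \<forall>m\<ge>N. \<forall>n\<ge>N.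
      (LINT x|LI l. (cmod (rep_l2 (X m) x - rep_l2 (X n) x))\<^sup>2) < e"
  shows "\<exists>u\<in>L2_on l. (\<lambda>n. LINT x|LI l. (cmod (rep_l2 (X n) x - rep_l2 u x))\<^sup>2) \<longlonglongrightarrow> 0"
proof -
  define f where "f = (\<lambda>n. rep_l2 (X n))"
  interpret finite_measure "LI l" by (rule finite_measure_LI)
  have [measurable]: "f n \<in> borel_measurable (LI l)" for n by (simp add: f_def)
  have f_sq: "integrable (LI l) (\<lambda>x. (cmod (f n x))\<^sup>2)" for n
    unfolding f_def by (rule rep_square_integrable_LI)
  have f_int: "integrable (LI l) (f n)" for n unfolding f_def by (rule rep_integrable_LI)
  have diff_sq: "integrable (LI l) (\<lambda>x. (cmod (f m x - f n x))\<^sup>2)" for m n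
    using square_integrable_add[of "f m" l "\<lambda>x. - f n x"] f_sq by simp
  define \<mu> where "\<mu> = measure (LI l) (space (LI l)) + 1"
  have \<mu>: "\<mu> > 0" by (simp add: \<mu>_def add_nonneg_pos)
  have L1: "\<exists>N. \<forall>i\<ge>N. \<forall>j\<ge>N. (LINT x|LI l. norm (f i x - f j x)) < e" if e: "e > 0" for e
  proof -
    define \<epsilon> where "\<epsilon> = e / (2 * \<mu>)"
    have \<epsilon>: "\<epsilon> > 0" using e \<mu> by (simp add: \<epsilon>_def)
    obtain N where N: "\<And>m n. m \<ge> N \<Longrightarrow> n \<ge> N \<Longrightarrow> (LINT x|LI l. (cmod (f m x - f n x))\<^sup>2) < \<epsilon> * (e / 2)"
      using cauchy[of "\<epsilon> * (e / 2)"] \<epsilon> e unfolding f_def by auto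
    have "(LINT x|LI l. norm (f i x - f j x)) < e" if ij: "i \<ge> N" "j \<ge> N" for i j
    proof -
      have pt: "a \<le> \<epsilon> + a\<^sup>2 / \<epsilon>" if "0 \<le> a" for a :: real
      proof (cases "a \<le> \<epsilon>")
        case True
        then show ?thesis using \<epsilon> by (simp add: add_increasing2)
      next
        case False
        then have "a * \<epsilon> \<le> a * a" using that by (intro mult_left_mono) auto
        then have "a \<le> a\<^sup>2 / \<epsilon>" using \<epsilon> by (simp add: pos_le_divide_eq power2_eq_square)
        then show ?thesis using \<epsilon> by simp
      qed
      have "(LINT x|LI l. norm (f i x - f j x)) \<le> (LINT x|LI l. \<epsilon> + (cmod (f i x - f j x))\<^sup>2 / \<epsilon>)"
        by (rule integral_mono) (use f_int diff_sq pt in auto)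
      also have "\<dots> = \<epsilon> * measure (LI l) (space (LI l)) + (LINT x|LI l. (cmod (f i x - f j x))\<^sup>2) / \<epsilon>"
        using diff_sq by simp
      also have "\<dots> < \<epsilon> * \<mu> + (\<epsilon> * (e / 2)) / \<epsilon>"
        using N[OF ij] \<epsilon> by (intro add_strict_mono divide_strict_right_mono) (auto simp: \<mu>_def)
      also have "\<dots> = e" using \<mu> \<epsilon> by (simp add: \<epsilon>_def)
      finally show ?thesis .
    qed
    then show ?thesis by blast
  qed
  obtain r where r: "strict_mono r" "AE x in LI l. Cauchy (\<lambda>i. f (r i) x)"
    using cauchy_L1_AE_cauchy_subseq[of "LI l" f] f_int L1 by blast
  define g where "g = (\<lambda>x. lim (\<lambda>i. f (r i) x))"
  have [measurable]: "g \<in> borel_measurable (LI l)"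
    unfolding g_def by (rule borel_measurable_lim_metric) measurable
  have conv: "AE x in LI l. (\<lambda>i. f (r i) x) \<longlonglongrightarrow> g x"
    using r(2) by eventually_elim (simp add: g_def Cauchy_convergent_iff convergent_LIMSEQ_iff)
  have close: "integrable (LI l) (\<lambda>x. (cmod (f n x - g x))\<^sup>2) \<and> (LINT x|LI l. (cmod (f n x - g x))\<^sup>2) \<le> e"
    if e: "e > 0" and N: "\<And>m n. m \<ge> N \<Longrightarrow> n \<ge> N \<Longrightarrow> (LINT x|LI l. (cmod (f m x - f n x))\<^sup>2) < e" and n: "n \<ge> N" for e n N
  proof -
    have bound: "(\<integral>\<^sup>+ x. ennreal ((cmod (f n x - g x))\<^sup>2) \<partial>LI l) \<le> ennreal e"
    proof -
      have "(\<integral>\<^sup>+ x. ennreal ((cmod (f n x - g x))\<^sup>2) \<partial>LI l)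
          = (\<integral>\<^sup>+ x. liminf (\<lambda>i. ennreal ((cmod (f n x - f (r i) x))\<^sup>2)) \<partial>LI l)"
      proof (rule nn_integral_cong_AE, use conv in eventually_elim)
        case (elim x)
        have "(\<lambda>i. ennreal ((cmod (f n x - f (r i) x))\<^sup>2)) \<longlonglongrightarrow> ennreal ((cmod (f n x - g x))\<^sup>2)"
          by (intro tendsto_intros elim)
        then show ?case by (intro lim_imp_Liminf[symmetric]) auto
      qed
      also have "\<dots> \<le> liminf (\<lambda>i. \<integral>\<^sup>+ x. ennreal ((cmod (f n x - f (r i) x))\<^sup>2) \<partial>LI l)"
        by (rule nn_integral_liminf) measurable
      also have "\<dots> \<le> ennreal e"
      proof (rule Liminf_le)
        show "\<forall>\<^sub>F i in sequentially. (\<integral>\<^sup>+ x. ennreal ((cmod (f n x - f (r i) x))\<^sup>2) \<partial>LI l) \<le> ennreal e"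
          using eventually_ge_at_top[of N]
        proof eventually_elim
          case (elim i)
          then have "r i \<ge> N" using seq_suble[OF r(1), of i] by simp
          then have "(LINT x|LI l. (cmod (f n x - f (r i) x))\<^sup>2) \<le> e" using N[OF n] by (simp add: less_imp_le)
          moreover have "(\<integral>\<^sup>+ x. ennreal ((cmod (f n x - f (r i) x))\<^sup>2) \<partial>LI l)
              = ennreal (LINT x|LI l. (cmod (f n x - f (r i) x))\<^sup>2)"
            by (rule nn_integral_eq_integral[OF diff_sq]) simp
          ultimately show ?case by (simp add: ennreal_leI)
        qed
      qed simp
      finally show ?thesis .
    qed
    have int: "integrable (LI l) (\<lambda>x. (cmod (f n x - g x))\<^sup>2)"
      by (rule integrableI_bounded) (use bound in \<open>auto intro: le_less_trans\<close>)
    have "ennreal (LINT x|LI l. (cmod (f n x - g x))\<^sup>2) \<le> ennreal e"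
      using bound nn_integral_eq_integral[OF int] by simp
    then show ?thesis using int e by simp
  qed
  have ex_N: "\<exists>N. \<forall>m\<ge>N. \<forall>n\<ge>N. (LINT x|LI l. (cmod (f m x - f n x))\<^sup>2) < e" if "e > 0" for e
    using cauchy[OF that] by (simp add: f_def)
  obtain N where "\<forall>m\<ge>N. \<forall>n\<ge>N. (LINT x|LI l. (cmod (f m x - f n x))\<^sup>2) < 1" using ex_N[of 1] by auto
  then have "integrable (LI l) (\<lambda>x. (cmod (f N x - g x))\<^sup>2)" using close[of 1 N N] by simp
  then have "integrable (LI l) (\<lambda>x. (cmod (f N x + - (f N x - g x)))\<^sup>2)"
    using f_sq by (intro square_integrable_add) (auto simp: norm_minus_commute)
  then have g_sq: "integrable (LI l) (\<lambda>x. (cmod (g x))\<^sup>2)" by simp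
  define u where "u = lift l g"
  have u: "u \<in> L2_on l" "AE x in LI l. rep_l2 u x = g x"
    unfolding u_def using lift_props[OF _ g_sq] by auto
  have eq: "(LINT x|LI l. (cmod (rep_l2 (X n) x - rep_l2 u x))\<^sup>2) = (LINT x|LI l. (cmod (f n x - g x))\<^sup>2)" for n
    by (rule integral_cong_AE) (use u(2) in \<open>auto simp: f_def elim: eventually_mono\<close>)
  have "(\<lambda>n. LINT x|LI l. (cmod (f n x - g x))\<^sup>2) \<longlonglongrightarrow> 0"
  proof (rule LIMSEQ_I)
    fix e :: real assume e: "e > 0"
    obtain N where N: "\<forall>m\<ge>N. \<forall>n\<ge>N. (LINT x|LI l. (cmod (f m x - f n x))\<^sup>2) < e / 2" using ex_N[of "e / 2"] e by auto
    have "norm ((LINT x|LI l. (cmod (f n x - g x))\<^sup>2) - 0) < e" if "n \<ge> N" for n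
    proof -
      have "0 \<le> (LINT x|LI l. (cmod (f n x - g x))\<^sup>2)" by (rule Bochner_Integration.integral_nonneg) simp
      moreover have "(LINT x|LI l. (cmod (f n x - g x))\<^sup>2) \<le> e / 2" using close[of "e / 2" N n] N that e by simp
      ultimately show ?thesis using e by simp
    qed
    then show "\<exists>N. \<forall>n\<ge>N. norm ((LINT x|LI l. (cmod (f n x - g x))\<^sup>2) - 0) < e" by blast
  qed
  then have "(\<lambda>n. LINT x|LI l. (cmod (rep_l2 (X n) x - rep_l2 u x))\<^sup>2) \<longlonglongrightarrow> 0" unfolding eq .
  then show ?thesis using u(1) by (rule bexI)
qed

section \<open>Linear systems of differential equations with bounded measurable coefficients\<close>

text \<open>Integration gains the factor \<open>1 / m\<close> in a supremum norm with exponential weight.\<close>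

lemma prim_exp_bound:
  assumes h: "integrable (LI l) h" and b: "AE y in LI l. cmod (h y) \<le> a * exp (m * y)"
    and m: "0 < m" and a: "0 \<le> a" and x: "x \<in> {0..l}"
  shows "cmod (prim l h x) \<le> a / m * exp (m * x)"
proof -
  define E where "E = (\<lambda>y. complex_of_real (a * exp (m * y)))"
  have AC: "AC l (\<lambda>y. complex_of_real (a / m * exp (m * y))) E"
  proof (rule AC_C1)
    show "((\<lambda>y. complex_of_real (a / m * exp (m * y))) has_vector_derivative E y) (at y within {0..l})" for y
      unfolding E_def using m
      by (intro has_vector_derivative_of_real) (auto intro!: derivative_eq_intros)
    show "continuous_on {0..l} E" unfolding E_def by (intro continuous_intros)
  qed
  have E_int: "integrable (LI l) E" using AC by (simp add: AC_def)
  have "cmod (prim l h x) \<le> (LINT y|LI l. cmod (if y \<le> x then h y else 0))"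
    unfolding prim_def by (rule integral_norm_bound)
  also have "\<dots> \<le> (LINT y|LI l. Re (if y \<le> x then E y else 0))"
  proof (rule integral_mono_AE)
    show "integrable (LI l) (\<lambda>y. cmod (if y \<le> x then h y else 0))"
      using integrable_cut(1)[OF h] by (rule integrable_norm)
    show "integrable (LI l) (\<lambda>y. Re (if y \<le> x then E y else 0))"
      using integrable_cut(1)[OF E_int] by (rule integrable_Re)
    show "AE y in LI l. cmod (if y \<le> x then h y else 0) \<le> Re (if y \<le> x then E y else 0)"
      using b by eventually_elim (auto simp: E_def)
  qed
  also have "\<dots> = Re (prim l E x)"
    unfolding prim_def using integrable_cut(1)[OF E_int] by simp
  also have "prim l E x = complex_of_real (a / m * exp (m * x)) - complex_of_real (a / m * exp (m * 0))"
  proof -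
    have "complex_of_real (a / m * exp (m * x)) = complex_of_real (a / m * exp (m * 0)) + prim l E x"
      using AC x unfolding AC_def by blast
    then show ?thesis by simp
  qed
  also have "Re \<dots> \<le> a / m * exp (m * x)" using a m by simp
  finally show ?thesis .
qed

text \<open>Picard iteration \<open>U\<close>. In the supremum norm with weight \<open>exp (m * x)\<close> and \<open>m\<close> large, each step halves the
  increments \<open>d\<close>, so it converges on the whole interval at once.\<close>

lemma linear_ode_exists:
  fixes P :: "'i \<Rightarrow> 'i \<Rightarrow> real \<Rightarrow> complex" and g :: "'i \<Rightarrow> real \<Rightarrow> complex" and c :: "'i \<Rightarrow> complex"
  assumes I: "finite I" and l: "0 \<le> l"
    and P: "\<And>i j. i \<in> I \<Longrightarrow> j \<in> I \<Longrightarrow> P i j \<in> borel_measurable (LI l)"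
    and B: "\<And>i j. i \<in> I \<Longrightarrow> j \<in> I \<Longrightarrow> AE x in LI l. cmod (P i j x) \<le> B"
    and g: "\<And>i. i \<in> I \<Longrightarrow> integrable (LI l) (g i)"
  shows "\<exists>u. \<forall>i\<in>I. u i 0 = c i \<and> AC l (u i) (\<lambda>x. (\<Sum>j\<in>I. P i j x * u j x) + g i x)"
proof -
  define b where "b = \<bar>B\<bar>"
  have b: "0 \<le> b" by (simp add: b_def)
  have Bb: "AE x in LI l. cmod (P i j x) \<le> b" if "i \<in> I" "j \<in> I" for i j
    using B[OF that] by eventually_elim (simp add: b_def)
  define rhs where "rhs = (\<lambda>v i x. (\<Sum>j\<in>I. P i j x * v j x) + g i x)"
  define U where "U = rec_nat (\<lambda>i x. 0) (\<lambda>n v i x. c i + prim l (rhs v i) x)"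
  have U0: "U 0 = (\<lambda>i x. 0)" and US: "U (Suc n) = (\<lambda>i x. c i + prim l (rhs (U n) i) x)" for n
    by (auto simp: U_def)
  have Pv_int: "integrable (LI l) (\<lambda>x. \<Sum>j\<in>I. P i j x * v j x)"
    if "i \<in> I" "\<And>j. j \<in> I \<Longrightarrow> continuous_on {0..l} (v j)" for i v
  proof (rule Bochner_Integration.integrable_sum)
    fix j assume j: "j \<in> I"
    have "integrable (LI l) (\<lambda>x. v j x * P i j x)"
      by (rule integrable_mult_bounded[OF continuous_integrable_LI[OF that(2)[OF j]] P[OF that(1) j] Bb[OF that(1) j]])
    then show "integrable (LI l) (\<lambda>x. P i j x * v j x)" by (simp add: mult.commute)
  qed
  have rhs_int: "integrable (LI l) (rhs v i)" if "i \<in> I" "\<And>j. j \<in> I \<Longrightarrow> continuous_on {0..l} (v j)" for i v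
    unfolding rhs_def using Pv_int[OF that] g[OF that(1)] by (rule Bochner_Integration.integrable_add)
  have U_cont: "continuous_on {0..l} (U n i)" if "i \<in> I" for n i
    using that
  proof (induction n arbitrary: i)
    case (Suc n)
    show ?case unfolding US by (intro continuous_intros prim_continuous rhs_int Suc)
  qed (simp add: U0)
  define d where "d = (\<lambda>n i x. U (Suc n) i x - U n i x)"
  \<comment> \<open>twice a bound for the norm of the matrix \<open>P\<close>; the summand \<open>1\<close> keeps \<open>m\<close> positive\<close>
  define m where "m = 2 * (b * real (card I)) + 1"
  have m: "0 < m" using b by (simp add: m_def add_nonneg_pos)
  define C where "C = (\<Sum>i\<in>I. cmod (c i) + (LINT y|LI l. cmod (g i y)))"
  have C_nonneg: "0 \<le> C" unfolding C_def by (intro sum_nonneg add_nonneg_nonneg Bochner_Integration.integral_nonneg) auto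
  have d_bound: "cmod (d n i x) \<le> C / 2 ^ n * exp (m * x)" if "i \<in> I" "x \<in> {0..l}" for n i x
    using that
  proof (induction n arbitrary: i x)
    case 0
    have "d 0 i x = c i + prim l (g i) x" by (simp add: d_def US U0 rhs_def)
    then have "cmod (d 0 i x) \<le> cmod (c i) + (LINT y|LI l. cmod (g i y))"
      using norm_triangle_le[OF add_left_mono[OF norm_prim_le[OF g[OF 0(1)]]]] by simp
    also have "\<dots> \<le> C"
      unfolding C_def by (rule member_le_sum[OF 0(1)]) (use I in \<open>auto intro!: add_nonneg_nonneg Bochner_Integration.integral_nonneg\<close>)
    also have "\<dots> \<le> C * exp (m * x)" using C_nonneg m 0(2) by (simp add: mult_le_cancel_left1)
    finally show ?case by simp
  next
    case (Suc n)
    define h where "h = (\<lambda>x. \<Sum>j\<in>I. P i j x * d n j x)"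
    have d_cont: "continuous_on {0..l} (d n j)" if "j \<in> I" for j
      unfolding d_def by (intro continuous_intros U_cont that)
    have h_int: "integrable (LI l) h" unfolding h_def by (rule Pv_int[OF Suc.prems(1) d_cont])
    have "d (Suc n) i x = prim l (rhs (U (Suc n)) i) x - prim l (rhs (U n) i) x"
      unfolding d_def US[of "Suc n"] US[of n] by simp
    also have "\<dots> = prim l (\<lambda>y. rhs (U (Suc n)) i y - rhs (U n) i y) x"
      by (rule prim_linear(2)[symmetric]) (intro rhs_int U_cont Suc.prems; assumption)+
    also have "(\<lambda>y. rhs (U (Suc n)) i y - rhs (U n) i y) = h"
      by (simp add: rhs_def h_def d_def fun_eq_iff right_diff_distrib sum_subtractf)
    finally have d_eq: "d (Suc n) i x = prim l h x" .
    have "AE y in LI l. \<forall>j\<in>I. cmod (P i j y) \<le> b" by (intro AE_finite_allI[OF I] Bb Suc.prems(1))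
    then have "AE y in LI l. cmod (h y) \<le> (b * real (card I)) * (C / 2 ^ n) * exp (m * y)"
      using AE_space
    proof eventually_elim
      case (elim y)
      have "cmod (h y) \<le> (\<Sum>j\<in>I. cmod (P i j y * d n j y))" unfolding h_def by (rule norm_sum)
      also have "\<dots> \<le> (\<Sum>j\<in>I. b * (C / 2 ^ n * exp (m * y)))"
        unfolding norm_mult by (intro sum_mono mult_mono Suc.IH) (use elim b in auto)
      finally show ?case by (simp add: algebra_simps)
    qed
    then have "cmod (prim l h x) \<le> (b * real (card I)) * (C / 2 ^ n) / m * exp (m * x)"
      by (intro prim_exp_bound[OF h_int _ m _ Suc.prems(2)]) (use b C_nonneg in auto)
    also have "(b * real (card I)) * (C / 2 ^ n) / m \<le> C / 2 ^ Suc n"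
    proof -
      have "(b * real (card I)) / m \<le> 1 / 2" using m by (simp add: m_def divide_le_eq)
      then have "(b * real (card I)) / m * (C / 2 ^ n) \<le> 1 / 2 * (C / 2 ^ n)"
        using C_nonneg by (intro mult_right_mono) auto
      then show ?thesis by (simp add: field_simps)
    qed
    finally show ?case unfolding d_eq by simp
  qed
  define K where "K = C * exp (m * l)"
  have d_bound': "cmod (d n i x) \<le> K * (1 / 2) ^ n" if "i \<in> I" "x \<in> {0..l}" for n i x
  proof -
    have "C / 2 ^ n * exp (m * x) \<le> C / 2 ^ n * exp (m * l)"
      using that(2) m C_nonneg by (intro mult_left_mono) auto
    then show ?thesis using d_bound[OF that, of n] by (simp add: K_def power_one_over field_simps)
  qed
  have K: "0 \<le> K" using C_nonneg by (simp add: K_def)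
  have summ: "summable (\<lambda>n. K * (1 / 2) ^ n)" by (intro summable_mult summable_geometric) simp
  define u where "u = (\<lambda>i x. \<Sum>n. d n i x)"
  have telescope: "(\<Sum>n<N. d n i x) = U N i x" for N i x
    by (induction N) (auto simp: d_def U0)
  have unif: "uniform_limit {0..l} (\<lambda>n. U n i) (u i) sequentially" if "i \<in> I" for i
    using Weierstrass_m_test[of "{0..l}" "\<lambda>n. d n i" "\<lambda>n. K * (1 / 2) ^ n", OF d_bound'[OF that] summ]
    unfolding telescope u_def by simp
  have u_cont: "continuous_on {0..l} (u i)" if "i \<in> I" for i
    by (rule uniform_limit_theorem[OF _ unif[OF that]]) (use U_cont[OF that] in auto)
  have U_lim: "(\<lambda>n. U n i x) \<longlonglongrightarrow> u i x" if "i \<in> I" "x \<in> {0..l}" for i x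
    using tendsto_uniform_limitI[OF unif] that by blast
  have U_bound: "cmod (U n i x) \<le> 2 * K" if "i \<in> I" "x \<in> {0..l}" for n i x
  proof -
    have "cmod (U n i x) \<le> (\<Sum>k<n. cmod (d k i x))" unfolding telescope[symmetric] by (rule norm_sum)
    also have "\<dots> \<le> (\<Sum>k<n. K * (1 / 2) ^ k)" by (intro sum_mono d_bound' that)
    also have "\<dots> \<le> (\<Sum>k. K * (1 / 2) ^ k)" by (rule sum_le_suminf[OF summ]) (use K in auto)
    also have "\<dots> = 2 * K" using suminf_mult[of "\<lambda>k. (1 / 2 :: real) ^ k" K] suminf_geometric[of "1 / 2 :: real"]
      by simp
    finally show ?thesis .
  qed
  have fixed: "u i x = c i + prim l (rhs u i) x" if i: "i \<in> I" and x: "x \<in> {0..l}" for i x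
  proof (rule LIMSEQ_unique)
    show "(\<lambda>n. U (Suc n) i x) \<longlonglongrightarrow> u i x" using U_lim[OF i x] by (rule LIMSEQ_Suc)
    have rU: "integrable (LI l) (rhs (U n) i)" for n by (intro rhs_int i U_cont; assumption)
    have ru: "integrable (LI l) (rhs u i)" by (intro rhs_int i u_cont; assumption)
    have "(\<lambda>n. prim l (rhs (U n) i) x) \<longlonglongrightarrow> prim l (rhs u i) x"
      unfolding prim_def
    proof (rule integral_dominated_convergence[where w = "\<lambda>y. real (card I) * (b * (2 * K)) + cmod (g i y)"])
      show "(\<lambda>y. if y \<le> x then rhs u i y else 0) \<in> borel_measurable (LI l)"
        using integrable_cut(1)[OF ru] by auto
      show "(\<lambda>y. if y \<le> x then rhs (U n) i y else 0) \<in> borel_measurable (LI l)" for n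
        using integrable_cut(1)[OF rU] by auto
      interpret finite_measure "LI l" by (rule finite_measure_LI)
      show "integrable (LI l) (\<lambda>y. real (card I) * (b * (2 * K)) + cmod (g i y))" using g[OF i] by simp
      show "AE y in LI l. (\<lambda>n. if y \<le> x then rhs (U n) i y else 0) \<longlonglongrightarrow> (if y \<le> x then rhs u i y else 0)"
        using AE_space
      proof eventually_elim
        case (elim y)
        have "(\<lambda>n. rhs (U n) i y) \<longlonglongrightarrow> rhs u i y"
          unfolding rhs_def using elim by (intro tendsto_intros U_lim) auto
        then show ?case by auto
      qed
      show "AE y in LI l. norm (if y \<le> x then rhs (U n) i y else 0) \<le> real (card I) * (b * (2 * K)) + cmod (g i y)" for n
      proof -
        have "AE y in LI l. \<forall>j\<in>I. cmod (P i j y) \<le> b" by (intro AE_finite_allI[OF I] Bb i)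
        then show ?thesis using AE_space
        proof eventually_elim
          case (elim y)
          have "cmod (\<Sum>j\<in>I. P i j y * U n j y) \<le> (\<Sum>j\<in>I. cmod (P i j y * U n j y))" by (rule norm_sum)
          also have "\<dots> \<le> (\<Sum>j\<in>I. b * (2 * K))"
            unfolding norm_mult by (intro sum_mono mult_mono U_bound) (use elim b in auto)
          finally have "cmod (rhs (U n) i y) \<le> real (card I) * (b * (2 * K)) + cmod (g i y)"
            unfolding rhs_def by (intro norm_triangle_le) simp
          then show ?case using b K by (auto intro: order_trans[OF norm_ge_zero])
        qed
      qed
    qed
    then show "(\<lambda>n. U (Suc n) i x) \<longlonglongrightarrow> c i + prim l (rhs u i) x"
      unfolding US by (intro tendsto_intros)
  qed
  show ?thesis
  proof (intro exI[of _ u] ballI conjI)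
    fix i assume i: "i \<in> I"
    show u0: "u i 0 = c i" using fixed[OF i, of 0] l by (simp add: prim_nonpos)
    show "AC l (u i) (\<lambda>x. (\<Sum>j\<in>I. P i j x * u j x) + g i x)"
      unfolding AC_def u0 using fixed[OF i] rhs_int[OF i u_cont] by (simp add: rhs_def)
  qed
qed

section \<open>Matrix functions on an interval\<close>

lemma continuous_on_det:
  fixes A :: "real \<Rightarrow> complex mat"
  assumes A: "\<And>x. x \<in> S \<Longrightarrow> A x \<in> carrier_mat n n"
    and cont: "\<And>i j. i < n \<Longrightarrow> j < n \<Longrightarrow> continuous_on S (\<lambda>x. A x $$ (i, j))"
  shows "continuous_on S (\<lambda>x. det (A x))"
proof -
  have "continuous_on S (\<lambda>x. \<Sum>p\<in>{p. p permutes {0..<n}}. signof p * (\<Prod>i = 0..<n. A x $$ (i, p i)))"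
    by (intro continuous_intros cont) (auto dest: permutes_in_image)
  then show ?thesis
  proof (rule continuous_on_eq)
    fix x assume "x \<in> S"
    then show "(\<Sum>p\<in>{p. p permutes {0..<n}}. signof p * (\<Prod>i = 0..<n. A x $$ (i, p i))) = det (A x)"
      using det_def'[OF A] by simp
  qed
qed

lemma invertible_mat_det:
  assumes "invertible_mat (A :: complex mat)" "A \<in> carrier_mat n n" shows "det A \<noteq> 0"
proof -
  obtain B where B: "A * B = 1\<^sub>m (dim_row A)" "B * A = 1\<^sub>m (dim_row B)"
    using assms by (auto simp: invertible_mat_def inverts_mat_def)
  have "dim_col B = n" using arg_cong[OF B(1), of dim_col] assms(2) by simp
  moreover have "dim_row B = n" using arg_cong[OF B(2), of dim_col] assms(2) by simp
  ultimately have "B \<in> carrier_mat n n" by (intro carrier_matI)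
  then have "det (A * B) = det A * det B" by (rule det_mult[OF assms(2)])
  moreover have "det (A * B) = 1" unfolding B(1) by simp
  ultimately show ?thesis by auto
qed

text \<open>Cramer's rule: the entries of the inverse are quotients of determinants.\<close>

lemma inverse_mat_continuous:
  fixes A :: "real \<Rightarrow> complex mat"
  assumes A: "\<And>x. x \<in> S \<Longrightarrow> A x \<in> carrier_mat n n"
    and cont: "\<And>i j. i < n \<Longrightarrow> j < n \<Longrightarrow> continuous_on S (\<lambda>x. A x $$ (i, j))"
    and inv: "\<And>x. x \<in> S \<Longrightarrow> invertible_mat (A x)"
  shows "\<exists>R. (\<forall>i<n. \<forall>j<n. continuous_on S (R i j)) \<and>
    (\<forall>x\<in>S. \<forall>i<n. \<forall>j<n. (\<Sum>k<n. A x $$ (i, k) * R k j x) = (if i = j then 1 else 0))"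
proof -
  define R where "R = (\<lambda>i j x. adj_mat (A x) $$ (i, j) / det (A x))"
  have det: "det (A x) \<noteq> 0" if "x \<in> S" for x using invertible_mat_det inv A that by blast
  have "continuous_on S (R i j)" if ij: "i < n" "j < n" for i j
  proof -
    obtain m where m: "n = Suc m" using ij by (cases n) auto
    have "continuous_on S (\<lambda>x. det (mat_delete (A x) j i))"
    proof (rule continuous_on_det[where n = m])
      show "mat_delete (A x) j i \<in> carrier_mat m m" if "x \<in> S" for x
        using mat_delete_carrier[OF A[OF that], of j i] m by simp
      fix a b assume ab: "a < m" "b < m"
      have "insert_index j a < n" "insert_index i b < n" using ab m by (auto simp: insert_index_def)
      then have "continuous_on S (\<lambda>x. A x $$ (insert_index j a, insert_index i b))" by (rule cont)
      then show "continuous_on S (\<lambda>x. mat_delete (A x) j i $$ (a, b))"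
        by (rule continuous_on_eq)
          (rule mat_delete_index, use A m ij ab in auto)
    qed
    then have "continuous_on S (\<lambda>x. (-1) ^ (j + i) * det (mat_delete (A x) j i) / det (A x))"
      by (intro continuous_intros continuous_on_det[OF A cont]) (use det in auto)
    then show ?thesis
    proof (rule continuous_on_eq)
      fix x assume "x \<in> S"
      then show "(-1) ^ (j + i) * det (mat_delete (A x) j i) / det (A x) = R i j x"
        using A[of x] ij by (auto simp: R_def adj_mat_def cofactor_def)
    qed
  qed
  moreover have "(\<Sum>k<n. A x $$ (i, k) * R k j x) = (if i = j then 1 else 0)"
    if x: "x \<in> S" and ij: "i < n" "j < n" for x i j
  proof -
    have "(A x * adj_mat (A x)) $$ (i, j) = (\<Sum>k<n. A x $$ (i, k) * adj_mat (A x) $$ (k, j))"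
      using A[OF x] adj_mat(1)[OF A[OF x]] ij
      by (auto simp: scalar_prod_def lessThan_atLeast0 intro!: sum.cong)
    then have "(\<Sum>k<n. A x $$ (i, k) * adj_mat (A x) $$ (k, j)) = (det (A x) \<cdot>\<^sub>m 1\<^sub>m n) $$ (i, j)"
      using adj_mat(2)[OF A[OF x]] by simp
    also have "\<dots> = (if i = j then det (A x) else 0)" using ij by simp
    finally have "(\<Sum>k<n. A x $$ (i, k) * adj_mat (A x) $$ (k, j)) / det (A x) = (if i = j then 1 else 0)"
      using det[OF x] by simp
    then show ?thesis by (simp add: R_def sum_divide_distrib)
  qed
  ultimately show ?thesis by blast
qed

lemma continuous_bounded_LI:
  assumes "continuous_on {0..l} (f :: real \<Rightarrow> complex)"
  obtains B where "0 \<le> B" "\<And>x. x \<in> {0..l} \<Longrightarrow> cmod (f x) \<le> B"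
proof -
  have "compact (f ` {0..l})" by (intro compact_continuous_image assms) auto
  then have "bounded (f ` {0..l})" by (rule compact_imp_bounded)
  then obtain B where "\<forall>y\<in>f ` {0..l}. cmod y \<le> B" unfolding bounded_iff by blast
  then show thesis using that[of "\<bar>B\<bar>"] by force
qed

lemma finite_family_bound:
  fixes P :: "'i \<Rightarrow> real \<Rightarrow> bool"
  assumes "finite I" "\<And>i. i \<in> I \<Longrightarrow> \<exists>K. P i K" and mono: "\<And>i K K'. P i K \<Longrightarrow> K \<le> K' \<Longrightarrow> P i K'"
  shows "\<exists>K\<ge>0. \<forall>i\<in>I. P i K"
  using assms(1,2)
proof (induction I rule: finite_induct)
  case (insert i I)
  obtain K where "0 \<le> K" "\<forall>i\<in>I. P i K" using insert.IH insert.prems by auto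
  moreover obtain K' where "P i K'" using insert.prems[of i] by auto
  ultimately show ?case using mono[of _ K "max K K'"] mono[of i K' "max K K'"]
    by (intro exI[of _ "max K K'"]) auto
qed auto

lemma Linfty_mat_props:
  assumes "Linfty_mat n l A" "i < n" "j < n"
  shows "(\<lambda>x. A x $$ (i, j)) \<in> borel_measurable (LI l)" and "\<exists>K. AE x in LI l. cmod (A x $$ (i, j)) \<le> K"
  using assms unfolding Linfty_mat_def by auto

section \<open>Linear operations on Sobolev functions and states\<close>

lemma AC_add:
  assumes "AC l F f" "AC l G g" shows "AC l (\<lambda>x. F x + G x) (\<lambda>x. f x + g x)"
  unfolding AC_def
proof (intro conjI ballI)
  have fg: "integrable (LI l) f" "integrable (LI l) g" using assms by (auto simp: AC_def)
  then show "integrable (LI l) (\<lambda>x. f x + g x)" by simp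
  fix x assume x: "x \<in> {0..l}"
  have "F x = F 0 + prim l f x" "G x = G 0 + prim l g x" using assms x unfolding AC_def by metis+
  then show "F x + G x = F 0 + G 0 + prim l (\<lambda>x. f x + g x) x"
    unfolding prim_linear(1)[OF fg] by (simp only: ac_simps)
qed

lemma AC_scale:
  assumes "AC l F f" shows "AC l (\<lambda>x. c * F x) (\<lambda>x. c * f x)"
  unfolding AC_def
proof (intro conjI ballI)
  have f: "integrable (LI l) f" using assms by (auto simp: AC_def)
  then show "integrable (LI l) (\<lambda>x. c * f x)" by simp
  fix x assume x: "x \<in> {0..l}"
  have "F x = F 0 + prim l f x" using assms x unfolding AC_def by metis
  then show "c * F x = c * F 0 + prim l (\<lambda>x. c * f x) x"
    unfolding prim_linear(3)[OF f f] by (simp only: distrib_left)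
qed

lemma AC_zero: "AC l (\<lambda>x. 0) (\<lambda>x. 0)"
  by (simp add: AC_def prim_def)

lemma H1_add:
  assumes l: "0 < l" and u: "u \<in> H1_on l" and v: "v \<in> H1_on l"
  shows "u + v \<in> H1_on l"
    and "AE x in LI l. rep_l2 (wderiv l (u + v)) x = rep_l2 (wderiv l u) x + rep_l2 (wderiv l v) x"
    and "x \<in> {0..l} \<Longrightarrow> point_value l (u + v) x = point_value l u x + point_value l v x"
proof -
  obtain F where F: "AC l F (rep_l2 (wderiv l u))" "AE x in LI l. rep_l2 u x = F x"
    "\<And>x. x \<in> {0..l} \<Longrightarrow> point_value l u x = F x" using H1_cases[OF l u] by metis
  obtain G where G: "AC l G (rep_l2 (wderiv l v))" "AE x in LI l. rep_l2 v x = G x"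
    "\<And>x. x \<in> {0..l} \<Longrightarrow> point_value l v x = G x" using H1_cases[OF l v] by metis
  note AC = AC_add[OF F(1) G(1)]
  have sq: "integrable (LI l) (\<lambda>x. (cmod (rep_l2 (wderiv l u) x + rep_l2 (wderiv l v) x))\<^sup>2)"
    by (intro square_integrable_add rep_measurable_LI rep_square_integrable_LI)
  have mem: "u + v \<in> L2_on l" using u v L2_on_closed(2) by (auto simp: H1_on_def)
  have ae: "AE x in LI l. rep_l2 (u + v) x = F x + G x"
    using rep_LI(1)[of u v] F(2) G(2) by eventually_elim simp
  note * = H1_intro[OF l AC sq mem ae]
  show "u + v \<in> H1_on l" by (rule *(1))
  show "AE x in LI l. rep_l2 (wderiv l (u + v)) x = rep_l2 (wderiv l u) x + rep_l2 (wderiv l v) x" by (rule *(2))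
  show "x \<in> {0..l} \<Longrightarrow> point_value l (u + v) x = point_value l u x + point_value l v x"
    using *(3) F(3) G(3) by simp
qed

lemma H1_scale:
  assumes l: "0 < l" and u: "u \<in> H1_on l"
  shows "l2_scale c u \<in> H1_on l"
    and "AE x in LI l. rep_l2 (wderiv l (l2_scale c u)) x = c * rep_l2 (wderiv l u) x"
    and "x \<in> {0..l} \<Longrightarrow> point_value l (l2_scale c u) x = c * point_value l u x"
proof -
  obtain F where F: "AC l F (rep_l2 (wderiv l u))" "AE x in LI l. rep_l2 u x = F x"
    "\<And>x. x \<in> {0..l} \<Longrightarrow> point_value l u x = F x" using H1_cases[OF l u] by metis
  note AC = AC_scale[OF F(1), of c]
  have sq: "integrable (LI l) (\<lambda>x. (cmod (c * rep_l2 (wderiv l u) x))\<^sup>2)"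
    using rep_square_integrable_LI by (simp add: norm_mult power_mult_distrib)
  have mem: "l2_scale c u \<in> L2_on l" using u L2_on_closed(3) by (auto simp: H1_on_def)
  have ae: "AE x in LI l. rep_l2 (l2_scale c u) x = c * F x"
    using rep_LI(2)[of c u] F(2) by eventually_elim simp
  note * = H1_intro[OF l AC sq mem ae]
  show "l2_scale c u \<in> H1_on l" by (rule *(1))
  show "AE x in LI l. rep_l2 (wderiv l (l2_scale c u)) x = c * rep_l2 (wderiv l u) x" by (rule *(2))
  show "x \<in> {0..l} \<Longrightarrow> point_value l (l2_scale c u) x = c * point_value l u x"
    using *(3) F(3) by simp
qed

lemma H1_zero: assumes l: "0 < l" shows "0 \<in> H1_on l" and "x \<in> {0..l} \<Longrightarrow> point_value l 0 x = 0"
  using H1_intro[OF l AC_zero _ L2_on_closed(1) rep_LI(3)] by auto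

lemma l2_scale_module:
  "l2_scale a (u + v) = l2_scale a u + l2_scale a v"
  "l2_scale (a + b) u = l2_scale a u + l2_scale b u"
  "l2_scale a (l2_scale b u) = l2_scale (a * b) u"
  "l2_scale 1 u = u"
proof -
  show "l2_scale a (u + v) = l2_scale a u + l2_scale a v"
    unfolding l2_eq_iff using rep_l2_scale[of a "u + v"] rep_l2_add[of u v]
      rep_l2_add[of "l2_scale a u" "l2_scale a v"] rep_l2_scale[of a u] rep_l2_scale[of a v]
    by eventually_elim (simp add: distrib_left)
  show "l2_scale (a + b) u = l2_scale a u + l2_scale b u"
    unfolding l2_eq_iff using rep_l2_scale[of "a + b" u]
      rep_l2_add[of "l2_scale a u" "l2_scale b u"] rep_l2_scale[of a u] rep_l2_scale[of b u]
    by eventually_elim (simp add: distrib_right)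
  show "l2_scale a (l2_scale b u) = l2_scale (a * b) u"
    unfolding l2_eq_iff using rep_l2_scale[of "a * b" u] rep_l2_scale[of a "l2_scale b u"] rep_l2_scale[of b u]
    by eventually_elim simp
  show "l2_scale 1 u = u"
    unfolding l2_eq_iff using rep_l2_scale[of 1 u] by eventually_elim simp
qed

lemma vector_space_state_scale: "vector_space (state_scale :: complex \<Rightarrow> ('v, 'e) state \<Rightarrow> ('v, 'e) state)"
  by unfold_locales
    (auto simp: state_scale_def l2_scale_module fun_eq_iff cscale_def distrib_left distrib_right)

lemma lipschitz_mult:
  fixes f g :: "real \<Rightarrow> complex"
  assumes f: "K-lipschitz_on {0..l} f" and g: "L-lipschitz_on {0..l} g"
  shows "\<exists>C. C-lipschitz_on {0..l} (\<lambda>x. f x * g x)"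
proof -
  have "compact (f ` {0..l})" "compact (g ` {0..l})"
    by (intro compact_continuous_image lipschitz_on_continuous_on[OF f] lipschitz_on_continuous_on[OF g]; simp)+
  then have "bounded (f ` {0..l})" "bounded (g ` {0..l})" by (auto intro: compact_imp_bounded)
  then obtain a b where a: "\<And>x. x \<in> {0..l} \<Longrightarrow> cmod (f x) \<le> a" and b: "\<And>x. x \<in> {0..l} \<Longrightarrow> cmod (g x) \<le> b"
    unfolding bounded_iff by fast
  have K: "0 \<le> K" "0 \<le> L" using f g lipschitz_on_nonneg by auto
  have "(\<bar>a\<bar> * L + \<bar>b\<bar> * K)-lipschitz_on {0..l} (\<lambda>x. f x * g x)"
    unfolding lipschitz_on_def
  proof (intro conjI ballI)
    show "0 \<le> \<bar>a\<bar> * L + \<bar>b\<bar> * K" using K by simp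
    fix x y assume xy: "x \<in> {0..l}" "y \<in> {0..l}"
    have "dist (f x * g x) (f y * g y) = cmod (f x * (g x - g y) + (f x - f y) * g y)"
      by (simp add: dist_norm algebra_simps)
    also have "\<dots> \<le> cmod (f x) * cmod (g x - g y) + cmod (f x - f y) * cmod (g y)"
      using norm_triangle_ineq[of "f x * (g x - g y)" "(f x - f y) * g y"] by (simp add: norm_mult)
    also have "\<dots> \<le> \<bar>a\<bar> * (L * dist x y) + (K * dist x y) * \<bar>b\<bar>"
      using a[OF xy(1)] b[OF xy(2)] lipschitz_onD[OF f xy] lipschitz_onD[OF g xy] K
      by (intro add_mono mult_mono) (auto simp: dist_norm)
    finally show "dist (f x * g x) (f y * g y) \<le> (\<bar>a\<bar> * L + \<bar>b\<bar> * K) * dist x y"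
      by (simp add: algebra_simps)
  qed
  then show ?thesis by blast
qed

lemma lipschitz_sum:
  fixes f :: "'j \<Rightarrow> real \<Rightarrow> complex"
  assumes "finite J" "\<And>j. j \<in> J \<Longrightarrow> \<exists>C. C-lipschitz_on S (f j)"
  shows "\<exists>C. C-lipschitz_on S (\<lambda>x. \<Sum>j\<in>J. f j x)"
  using assms
proof (induction J rule: finite_induct)
  case empty
  have "0-lipschitz_on S (\<lambda>x. 0 :: complex)" by (simp add: lipschitz_on_def)
  then show ?case by auto
next
  case (insert j J)
  obtain C where "C-lipschitz_on S (f j)" using insert.prems[of j] by auto
  moreover obtain C' where "C'-lipschitz_on S (\<lambda>x. \<Sum>j\<in>J. f j x)" using insert.IH insert.prems by auto
  ultimately have CC: "C-lipschitz_on S (f j)" "C'-lipschitz_on S (\<lambda>x. \<Sum>j\<in>J. f j x)" by auto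
  from lipschitz_on_add[OF CC] show ?case using insert.hyps by auto
qed

text \<open>Each coordinate of \<open>L x\<close> is a linear functional, hence given by an inner product with a fixed vector.\<close>

lemma linear_map_bounded:
  fixes L :: "('i \<Rightarrow> complex) \<Rightarrow> ('i \<Rightarrow> complex)"
  assumes I: "finite I" and U: "cfun.subspace U" "U \<subseteq> cvecs I"
    and ip: "inner_carrier cscale U ip"
    and add: "\<And>x y. x \<in> U \<Longrightarrow> y \<in> U \<Longrightarrow> L (x + y) = L x + L y"
    and scale: "\<And>c x. x \<in> U \<Longrightarrow> L (cscale c x) = cscale c (L x)"
  shows "\<exists>K\<ge>0. \<forall>x\<in>U. \<forall>i\<in>I. cmod (L x i) \<le> K * sqrt (Re (ip x x))"
proof -
  interpret E: inner_carrier cscale U ip by (rule ip)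
  obtain S where S: "finite S" "cfun.span S = U" using subspace_spanned[OF I U] .
  have one: "\<exists>K\<ge>0. \<forall>x\<in>U. cmod (L x i) \<le> K * sqrt (Re (ip x x))" for i
    using E.functional_bounded[OF S, of "\<lambda>x. L x i"] add scale
    by (auto simp: E.nrm_def cscale_def)
  then obtain k where k: "\<And>i. 0 \<le> k i" "\<And>i x. x \<in> U \<Longrightarrow> cmod (L x i) \<le> k i * sqrt (Re (ip x x))" by metis
  show ?thesis
  proof (intro exI[of _ "\<Sum>i\<in>I. k i"] conjI ballI)
    show "0 \<le> (\<Sum>i\<in>I. k i)" using k(1) by (intro sum_nonneg) auto
    fix x i assume x: "x \<in> U" "i \<in> I"
    have "k i \<le> (\<Sum>i\<in>I. k i)" by (rule member_le_sum) (use x I k in auto)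
    then have "k i * sqrt (Re (ip x x)) \<le> (\<Sum>i\<in>I. k i) * sqrt (Re (ip x x))"
      using E.Re_ip_nonneg[OF x(1)] by (intro mult_right_mono) auto
    then show "cmod (L x i) \<le> (\<Sum>i\<in>I. k i) * sqrt (Re (ip x x))" using k(2)[OF x(1), of i] by linarith
  qed
qed

lemma quadratic_form_bounded:
  fixes L :: "('i \<Rightarrow> complex) \<Rightarrow> ('i \<Rightarrow> complex)"
  assumes I: "finite I" and U: "cfun.subspace U" "U \<subseteq> cvecs I"
    and ip: "inner_carrier cscale U ip"
    and add: "\<And>x y. x \<in> U \<Longrightarrow> y \<in> U \<Longrightarrow> L (x + y) = L x + L y"
    and scale: "\<And>c x. x \<in> U \<Longrightarrow> L (cscale c x) = cscale c (L x)"
  shows "\<exists>K\<ge>0. \<forall>x\<in>U. cmod (cprod I (L x) x) \<le> K * Re (ip x x)"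
proof -
  interpret E: inner_carrier cscale U ip by (rule ip)
  obtain K where K: "0 \<le> K" "\<And>x i. x \<in> U \<Longrightarrow> i \<in> I \<Longrightarrow> cmod (L x i) \<le> K * sqrt (Re (ip x x))"
    using linear_map_bounded[OF I U ip add scale] by blast
  obtain k where k: "0 \<le> k" "\<And>x i. x \<in> U \<Longrightarrow> i \<in> I \<Longrightarrow> cmod (x i) \<le> k * sqrt (Re (ip x x))"
    using linear_map_bounded[OF I U ip, of "\<lambda>x. x"] by blast
  show ?thesis
  proof (intro exI[of _ "real (card I) * (K * k)"] conjI ballI)
    show "0 \<le> real (card I) * (K * k)" using K k by simp
    fix x assume x: "x \<in> U"
    define r where "r = sqrt (Re (ip x x))"
    have r: "r * r = Re (ip x x)" "0 \<le> r" using E.Re_ip_nonneg[OF x] by (auto simp: r_def)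
    have "cmod (cprod I (L x) x) \<le> (\<Sum>i\<in>I. cmod (L x i) * cmod (x i))"
      unfolding cprod_def by (rule order_trans[OF norm_sum]) (simp add: norm_mult)
    also have "\<dots> \<le> (\<Sum>i\<in>I. (K * r) * (k * r))"
      unfolding r_def using K(1) k(1) E.Re_ip_nonneg[OF x] by (intro sum_mono mult_mono K(2) k(2) x) auto
    also have "\<dots> = real (card I) * (K * k) * Re (ip x x)" unfolding r(1)[symmetric] by simp
    finally show "cmod (cprod I (L x) x) \<le> real (card I) * (K * k) * Re (ip x x)" .
  qed
qed

lemma l2_scale_zero: "l2_scale c 0 = 0"
  unfolding l2_eq_iff using rep_l2_scale[of c 0] rep_l2_zero by eventually_elim simp

lemma borel_measurable_cnj:
  "f \<in> borel_measurable M \<Longrightarrow> (\<lambda>x. cnj (f x)) \<in> borel_measurable M" for f :: "'a \<Rightarrow> complex"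
  by (rule borel_measurable_continuous_on[of cnj]) (intro continuous_intros)

section \<open>The Hilbert space of a network\<close>

locale net =
  fixes G :: "('v, 'e) network"
  assumes graph: "network_graph G" and coeff: "edge_coefficients G" and vdata: "vertex_data G"
begin

lemma finite_edges [simp]: "finite (edges G)" and finite_vertices [simp]: "finite (vertices G)"
  using graph by (auto simp: network_graph_def fin_digraph_def fin_digraph_axioms_def)

lemma len_pos: "e \<in> edges G \<Longrightarrow> 0 < len G e"
  using graph by (auto simp: network_graph_def)

lemma endpoints_in: "e \<in> edges G \<Longrightarrow> head (graph G) e \<in> vertices G" "e \<in> edges G \<Longrightarrow> tail (graph G) e \<in> vertices G"
  using graph by (auto simp: network_graph_def fin_digraph_def wf_digraph_def)

lemma no_loop: "e \<in> edges G \<Longrightarrow> tail (graph G) e \<noteq> head (graph G) e"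
  using graph by (auto simp: network_graph_def loopfree_digraph_def loopfree_digraph_axioms_def)

lemma edges_at_iff: "e \<in> edges_at G v \<longleftrightarrow> e \<in> edges G \<and> (v = head (graph G) e \<or> v = tail (graph G) e)"
  by (auto simp: edges_at_def in_arcs_def out_arcs_def)

lemma comps_iff: "(e, i) \<in> comps G \<longleftrightarrow> e \<in> edges G \<and> i < kdim G e"
  by (auto simp: comps_def)

lemma comps_at_iff: "(e, i) \<in> comps_at G v \<longleftrightarrow> e \<in> edges_at G v \<and> i < kdim G e"
  by (auto simp: comps_at_def)

lemma comps_at_comps: "p \<in> comps_at G v \<Longrightarrow> p \<in> comps G"
  by (cases p) (auto simp: comps_iff comps_at_iff edges_at_iff)

lemma finite_comps [simp]: "finite (comps G)" "finite (comps_at G v)"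
proof -
  show "finite (comps G)" unfolding comps_def by simp
  then show "finite (comps_at G v)" using comps_at_comps by (meson finite_subset subsetI)
qed

lemma endpoint_in: "e \<in> edges G \<Longrightarrow> endpoint G v e \<in> {0..len G e}"
  using len_pos[of e] by (auto simp: endpoint_def)

abbreviation Q where "Q e i j \<equiv> (\<lambda>s. matQ G e s $$ (i, j))"
abbreviation M where "M e i j \<equiv> (\<lambda>s. matM G e s $$ (i, j))"
abbreviation N where "N e i j \<equiv> (\<lambda>s. matN G e s $$ (i, j))"
abbreviation L where "L e \<equiv> LI (len G e)"

lemma coeff_lip:
  assumes "e \<in> edges G" "i < kdim G e" "j < kdim G e"
  shows "\<exists>K. K-lipschitz_on {0..len G e} (Q e i j)" "\<exists>K. K-lipschitz_on {0..len G e} (M e i j)"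
  using assms coeff by (auto simp: edge_coefficients_def lipschitz_mat_def)

lemma coeff_cont:
  assumes "e \<in> edges G" "i < kdim G e" "j < kdim G e"
  shows "continuous_on {0..len G e} (Q e i j)" "continuous_on {0..len G e} (M e i j)"
  using coeff_lip[OF assms] lipschitz_on_continuous_on by blast+

lemma coeff_meas:
  assumes "e \<in> edges G" "i < kdim G e" "j < kdim G e"
  shows "Q e i j \<in> borel_measurable (L e)" "M e i j \<in> borel_measurable (L e)" "N e i j \<in> borel_measurable (L e)"
proof -
  show "Q e i j \<in> borel_measurable (L e)" "M e i j \<in> borel_measurable (L e)"
    using coeff_cont[OF assms] by (auto intro: continuous_measurable_LI)
  show "N e i j \<in> borel_measurable (L e)"
    by (rule Linfty_mat_props(1)[OF _ assms(2,3)]) (use coeff assms(1) in \<open>simp add: edge_coefficients_def\<close>)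
qed

lemma coeff_bounded:
  assumes "e \<in> edges G"
  shows "\<exists>B\<ge>0. \<forall>i<kdim G e. \<forall>j<kdim G e. (AE s in L e. cmod (Q e i j s) \<le> B) \<and>
    (AE s in L e. cmod (M e i j s) \<le> B) \<and> (AE s in L e. cmod (N e i j s) \<le> B)"
proof -
  have cont: "\<exists>B. AE s in L e. cmod (f s) \<le> B" if c: "continuous_on {0..len G e} f" for f
  proof -
    obtain B where "0 \<le> B" "\<And>x. x \<in> {0..len G e} \<Longrightarrow> cmod (f x) \<le> B"
      using continuous_bounded_LI[OF c] by metis
    then have "AE s in L e. cmod (f s) \<le> B" by (intro AE_I2) simp
    then show ?thesis by blast
  qed
  define P where "P = (\<lambda>(i, j) B. (AE s in L e. cmod (Q e i j s) \<le> B) \<and>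
    (AE s in L e. cmod (M e i j s) \<le> B) \<and> (AE s in L e. cmod (N e i j s) \<le> B))"
  have mono: "AE s in L e. cmod (f s) \<le> K'" if "AE s in L e. cmod (f s) \<le> K" "K \<le> K'" for f K K'
    using that(1) by eventually_elim (use that(2) in simp)
  have Pmono: "P ij K'" if "P ij K" "K \<le> K'" for ij K K'
    using that(1) mono[OF _ that(2)] by (auto simp: P_def split: prod.splits)
  have "\<exists>K. P ij K" if "ij \<in> {..<kdim G e} \<times> {..<kdim G e}" for ij
  proof -
    obtain i j where ij: "ij = (i, j)" "i < kdim G e" "j < kdim G e" using \<open>ij \<in> _\<close> by auto
    obtain B1 where B1: "AE s in L e. cmod (Q e i j s) \<le> B1" using cont coeff_cont(1)[OF assms ij(2,3)] by blast
    obtain B2 where B2: "AE s in L e. cmod (M e i j s) \<le> B2" using cont coeff_cont(2)[OF assms ij(2,3)] by blast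
    have "Linfty_mat (kdim G e) (len G e) (matN G e)" using coeff assms by (simp add: edge_coefficients_def)
    then obtain B3 where B3: "AE s in L e. cmod (N e i j s) \<le> B3" using Linfty_mat_props(2) ij(2,3) by blast
    have "P (i, j) (max B1 (max B2 B3))"
      unfolding P_def using mono[OF B1] mono[OF B2] mono[OF B3] by auto
    then show ?thesis using ij(1) by blast
  qed
  note ex = this
  have "\<exists>K\<ge>0. \<forall>ij\<in>{..<kdim G e} \<times> {..<kdim G e}. P ij K"
  proof (rule finite_family_bound)
    show "finite ({..<kdim G e} \<times> {..<kdim G e})" by simp
    show "\<exists>K. P ij K" if "ij \<in> {..<kdim G e} \<times> {..<kdim G e}" for ij by (rule ex[OF that])
    show "P ij K'" if "P ij K" "K \<le> K'" for ij K K' by (rule Pmono[OF that])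
  qed
  then obtain K where K: "K \<ge> 0" "\<forall>ij\<in>{..<kdim G e} \<times> {..<kdim G e}. P ij K" by blast
  have "P (i, j) K" if "i < kdim G e" "j < kdim G e" for i j using K(2) that by simp
  then show ?thesis using K(1) unfolding P_def by (intro exI[of _ K]) simp
qed

lemma Q_hermitian:
  assumes "e \<in> edges G" "s \<in> {0..len G e}" "i < kdim G e" "j < kdim G e"
  shows "cnj (Q e i j s) = Q e j i s"
proof -
  have "hermitian_mat (matQ G e s)" "matQ G e s \<in> carrier_mat (kdim G e) (kdim G e)"
    using coeff assms by (auto simp: edge_coefficients_def lipschitz_mat_def)
  then show ?thesis using assms(3,4) unfolding hermitian_mat_def
    by (metis (no_types, lifting) carrier_matD(1) carrier_matD(2) index_map_mat(1,2,3) index_transpose_mat(1))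
qed

definition QM :: "'e \<Rightarrow> nat \<Rightarrow> nat \<Rightarrow> real \<Rightarrow> complex" where
  "QM e i k s = (\<Sum>j<kdim G e. Q e i j s * M e j k s)"

lemma QM_entry:
  assumes "e \<in> edges G" "s \<in> {0..len G e}" "i < kdim G e" "k < kdim G e"
  shows "(matQ G e s * matM G e s) $$ (i, k) = QM e i k s"
proof -
  have "matQ G e s \<in> carrier_mat (kdim G e) (kdim G e)" "matM G e s \<in> carrier_mat (kdim G e) (kdim G e)"
    using coeff assms by (auto simp: edge_coefficients_def lipschitz_mat_def)
  then show ?thesis using assms(3,4)
    by (auto simp: QM_def scalar_prod_def lessThan_atLeast0 intro!: sum.cong)
qed

lemma QM_hermitian:
  assumes "e \<in> edges G" "s \<in> {0..len G e}" "i < kdim G e" "k < kdim G e"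
  shows "cnj (QM e i k s) = QM e k i s"
proof -
  have "matQ G e s \<in> carrier_mat (kdim G e) (kdim G e)" "matM G e s \<in> carrier_mat (kdim G e) (kdim G e)"
    using coeff assms by (auto simp: edge_coefficients_def lipschitz_mat_def)
  then have "matQ G e s * matM G e s \<in> carrier_mat (kdim G e) (kdim G e)" by (rule mult_carrier_mat)
  moreover have "hermitian_mat (matQ G e s * matM G e s)"
    using coeff assms by (auto simp: edge_coefficients_def)
  ultimately have "cnj ((matQ G e s * matM G e s) $$ (i, k)) = (matQ G e s * matM G e s) $$ (k, i)"
    using assms(3,4) unfolding hermitian_mat_def
    by (metis (no_types, lifting) carrier_matD(1) carrier_matD(2) index_map_mat(1,2,3) index_transpose_mat(1))
  then show ?thesis using QM_entry[OF assms(1,2)] assms(3,4) by simp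
qed

lemma QM_lip:
  assumes "e \<in> edges G" "i < kdim G e" "k < kdim G e"
  shows "\<exists>K. K-lipschitz_on {0..len G e} (QM e i k)"
proof -
  have "\<exists>C. C-lipschitz_on {0..len G e} (\<lambda>x. \<Sum>j\<in>{..<kdim G e}. Q e i j x * M e j k x)"
  proof (rule lipschitz_sum)
    fix j assume "j \<in> {..<kdim G e}"
    then have j: "j < kdim G e" by simp
    show "\<exists>C. C-lipschitz_on {0..len G e} (\<lambda>x. Q e i j x * M e j k x)"
      using coeff_lip(1)[OF assms(1,2) j] coeff_lip(2)[OF assms(1) j assms(3)] lipschitz_mult by blast
  qed simp
  then show ?thesis by (simp add: QM_def[abs_def])
qed

lemma Q_coercive_ex:
  assumes "e \<in> edges G"
  shows "\<exists>q>0. \<forall>s\<in>{0..len G e}. \<forall>\<xi>. q * (\<Sum>i<kdim G e. (cmod (\<xi> i))\<^sup>2)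
     \<le> Re (\<Sum>i<kdim G e. (\<Sum>j<kdim G e. Q e i j s * \<xi> j) * cnj (\<xi> i))"
proof -
  obtain q where q: "q > 0" "\<And>s \<xi>. s \<in> {0..len G e} \<Longrightarrow> \<xi> \<in> carrier_vec (kdim G e) \<Longrightarrow>
      Re ((matQ G e s *\<^sub>v \<xi>) \<bullet>c \<xi>) \<ge> q * Re (\<xi> \<bullet>c \<xi>)"
    using coeff assms unfolding edge_coefficients_def by blast
  have "q * (\<Sum>i<kdim G e. (cmod (\<xi> i))\<^sup>2)
     \<le> Re (\<Sum>i<kdim G e. (\<Sum>j<kdim G e. Q e i j s * \<xi> j) * cnj (\<xi> i))" if s: "s \<in> {0..len G e}" for s \<xi>
  proof -
    define v where "v = vec (kdim G e) \<xi>"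
    have v: "v \<in> carrier_vec (kdim G e)" by (simp add: v_def)
    have car: "matQ G e s \<in> carrier_mat (kdim G e) (kdim G e)"
      using coeff assms s by (auto simp: edge_coefficients_def lipschitz_mat_def)
    have "v \<bullet>c v = (\<Sum>i<kdim G e. \<xi> i * cnj (\<xi> i))"
      by (auto simp: v_def scalar_prod_def lessThan_atLeast0 intro!: sum.cong)
    then have "Re (v \<bullet>c v) = (\<Sum>i<kdim G e. (cmod (\<xi> i))\<^sup>2)"
      by (simp add: cmod_power2) (simp add: power2_eq_square)
    moreover have "(matQ G e s *\<^sub>v v) \<bullet>c v = (\<Sum>i<kdim G e. (\<Sum>j<kdim G e. Q e i j s * \<xi> j) * cnj (\<xi> i))"
      using car by (auto simp: v_def scalar_prod_def lessThan_atLeast0 intro!: sum.cong)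
    ultimately show ?thesis using q(2)[OF s v] by simp
  qed
  then show ?thesis using q(1) by blast
qed

text \<open>There are finitely many edges, so the least of their constants serves for all.\<close>

lemma Q_coercive:
  "\<exists>q>0. \<forall>e\<in>edges G. \<forall>s\<in>{0..len G e}. \<forall>\<xi>.
     q * (\<Sum>i<kdim G e. (cmod (\<xi> i))\<^sup>2) \<le> Re (\<Sum>i<kdim G e. (\<Sum>j<kdim G e. Q e i j s * \<xi> j) * cnj (\<xi> i))"
proof -
  define C where "C = (\<lambda>e q. \<forall>s\<in>{0..len G e}. \<forall>\<xi>. q * (\<Sum>i<kdim G e. (cmod (\<xi> i))\<^sup>2)
     \<le> Re (\<Sum>i<kdim G e. (\<Sum>j<kdim G e. Q e i j s * \<xi> j) * cnj (\<xi> i)))"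
  have "\<forall>e\<in>edges G. \<exists>q. q > 0 \<and> C e q" unfolding C_def by (intro ballI Q_coercive_ex)
  then obtain q where qC: "\<forall>e\<in>edges G. q e > 0 \<and> C e (q e)" by (rule bchoice[THEN exE])
  then have q: "q e > 0" "s \<in> {0..len G e} \<Longrightarrow>
     q e * (\<Sum>i<kdim G e. (cmod (\<xi> i))\<^sup>2) \<le> Re (\<Sum>i<kdim G e. (\<Sum>j<kdim G e. Q e i j s * \<xi> j) * cnj (\<xi> i))"
    if "e \<in> edges G" for e s and \<xi> :: "nat \<Rightarrow> complex"
    using that unfolding C_def by blast+
  define r where "r = Min (insert 1 (q ` edges G))"
  have r: "r > 0" unfolding r_def using q(1) by (subst Min_gr_iff) auto
  have r_le: "r \<le> q e" if "e \<in> edges G" for e unfolding r_def using that by (intro Min_le) auto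
  show ?thesis
  proof (intro exI[of _ r] conjI ballI allI r)
    fix e s and \<xi> :: "nat \<Rightarrow> complex" assume e: "e \<in> edges G" "s \<in> {0..len G e}"
    have "r * (\<Sum>i<kdim G e. (cmod (\<xi> i))\<^sup>2) \<le> q e * (\<Sum>i<kdim G e. (cmod (\<xi> i))\<^sup>2)"
      using r_le[OF e(1)] by (intro mult_right_mono sum_nonneg) auto
    then show "r * (\<Sum>i<kdim G e. (cmod (\<xi> i))\<^sup>2) \<le> Re (\<Sum>i<kdim G e. (\<Sum>j<kdim G e. Q e i j s * \<xi> j) * cnj (\<xi> i))"
      using q(2)[OF e(1) e(2), of \<xi>] by linarith
  qed
qed

abbreviation Y where "Y v \<equiv> spaceY G v"
abbreviation Yd where "Yd v \<equiv> spaceYd G v"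
abbreviation I where "I v \<equiv> comps_at G v"

lemma Y_props:
  assumes "v \<in> vertices G"
  shows "cfun.subspace (Y v)" "Y v \<subseteq> cvecs (I v)" "cfun.subspace (Yd v)" "Yd v \<subseteq> Y v" "Yd v \<subseteq> cvecs (I v)"
    "linear_between cscale (Y v) (Yd v) (opB G v)" "linear_between cscale (Yd v) (Yd v) (opC G v)"
    "linear_between cscale (Yd v) (Yd v) (opQ G v)"
proof -
  note data = bspec[OF vdata[unfolded vertex_data_def] assms]
  show "cfun.subspace (Y v)" using data by (elim conjE) assumption
  show "cfun.subspace (Yd v)" using data by (elim conjE) assumption
  show *: "Yd v \<subseteq> Y v" using data by (elim conjE) assumption
  show **: "Y v \<subseteq> cvecs (I v)" using data by (elim conjE) assumption
  show "Yd v \<subseteq> cvecs (I v)" using * ** by (rule subset_trans)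
  show "linear_between cscale (Y v) (Yd v) (opB G v)" using data by (elim conjE) assumption
  show "linear_between cscale (Yd v) (Yd v) (opC G v)" using data by (elim conjE) assumption
  show "linear_between cscale (Yd v) (Yd v) (opQ G v)" using data by (elim conjE) assumption
qed

lemma Qv_symmetric:
  assumes "v \<in> vertices G" "x \<in> Yd v" "y \<in> Yd v"
  shows "cprod (I v) (opQ G v x) y = cprod (I v) x (opQ G v y)"
proof -
  have "\<forall>x\<in>Yd v. \<forall>y\<in>Yd v. cprod (I v) (opQ G v x) y = cprod (I v) x (opQ G v y)"
    using bspec[OF vdata[unfolded vertex_data_def] assms(1)] by (elim conjE) assumption
  from bspec[OF bspec[OF this assms(2)] assms(3)] show ?thesis .
qed

lemma Qv_positive:
  assumes "v \<in> vertices G" "x \<in> Yd v" "x \<noteq> 0" shows "0 < Re (cprod (I v) (opQ G v x) x)"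
proof -
  have "\<forall>x\<in>Yd v. x \<noteq> 0 \<longrightarrow> 0 < Re (cprod (I v) (opQ G v x) x)"
    using bspec[OF vdata[unfolded vertex_data_def] assms(1)] by (elim conjE) assumption
  then show ?thesis using assms(2,3) by blast
qed

lemma Qv_inner:
  assumes v: "v \<in> vertices G" shows "inner_carrier cscale (Yd v) (\<lambda>x y. cprod (I v) (opQ G v x) y)"
proof unfold_locales
  note lin = Y_props(8)[OF v, unfolded linear_between_def]
  show "cfun.subspace (Yd v)" using Y_props[OF v] by blast
  fix x y z c assume x: "x \<in> Yd v" and y: "y \<in> Yd v" and z: "z \<in> Yd v"
  show "cprod (I v) (opQ G v (x + y)) z = cprod (I v) (opQ G v x) z + cprod (I v) (opQ G v y) z"
    using lin x y by (simp add: cprod_simps)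
next
  note lin = Y_props(8)[OF v, unfolded linear_between_def]
  fix x y c assume x: "x \<in> Yd v" and y: "y \<in> Yd v"
  show "cprod (I v) (opQ G v (cscale c x)) y = c * cprod (I v) (opQ G v x) y"
    using lin x by (simp add: cprod_simps)
  show "cprod (I v) (opQ G v y) x = cnj (cprod (I v) (opQ G v x) y)"
    unfolding Qv_symmetric[OF v y x] by (rule cprod_cnj)
next
  show "x \<in> Yd v \<Longrightarrow> x \<noteq> 0 \<Longrightarrow> 0 < Re (cprod (I v) (opQ G v x) x)" for x
    by (rule Qv_positive[OF v])
qed

text \<open>The integrand of the \<open>L2\<close> part of \<open>L2d_inner\<close>.\<close>

definition edge_form :: "'e \<Rightarrow> (nat \<Rightarrow> real \<Rightarrow> complex) \<Rightarrow> (nat \<Rightarrow> real \<Rightarrow> complex) \<Rightarrow> real \<Rightarrow> complex" where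
  "edge_form e f g s = (\<Sum>i<kdim G e. (\<Sum>j<kdim G e. Q e i j s * f j s) * cnj (g i s))"

definition comp_rep :: "('e \<times> nat \<Rightarrow> l2fun) \<Rightarrow> 'e \<Rightarrow> nat \<Rightarrow> real \<Rightarrow> complex" where
  "comp_rep u e i = rep_l2 (u (e, i))"

lemma edge_form_integrable:
  assumes e: "e \<in> edges G"
    and f: "\<And>j. j < kdim G e \<Longrightarrow> f j \<in> borel_measurable (L e) \<and> integrable (L e) (\<lambda>s. (cmod (f j s))\<^sup>2)"
    and g: "\<And>j. j < kdim G e \<Longrightarrow> g j \<in> borel_measurable (L e) \<and> integrable (L e) (\<lambda>s. (cmod (g j s))\<^sup>2)"
  shows "integrable (L e) (edge_form e f g)"
proof -
  obtain B where B: "\<And>i j. i < kdim G e \<Longrightarrow> j < kdim G e \<Longrightarrow> AE s in L e. cmod (Q e i j s) \<le> B"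
    using coeff_bounded[OF e] by blast
  show ?thesis
    unfolding edge_form_def[abs_def]
  proof (rule Bochner_Integration.integrable_sum)
    fix i assume "i \<in> {..<kdim G e}"
    then have i: "i < kdim G e" by simp
    have "(\<lambda>s. \<Sum>j\<in>{..<kdim G e}. Q e i j s * f j s) \<in> borel_measurable (L e) \<and>
        integrable (L e) (\<lambda>s. (cmod (\<Sum>j\<in>{..<kdim G e}. Q e i j s * f j s))\<^sup>2)"
    proof (rule square_integrable_sum)
      fix j assume "j \<in> {..<kdim G e}"
      then have j: "j < kdim G e" by simp
      show "(\<lambda>s. Q e i j s * f j s) \<in> borel_measurable (L e) \<and> integrable (L e) (\<lambda>s. (cmod (Q e i j s * f j s))\<^sup>2)"
      proof
        show "(\<lambda>s. Q e i j s * f j s) \<in> borel_measurable (L e)"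
          by (rule borel_measurable_times) (use f[OF j] coeff_meas(1)[OF e i j] in auto)
        show "integrable (L e) (\<lambda>s. (cmod (Q e i j s * f j s))\<^sup>2)"
          by (rule square_integrable_mult_bounded[OF _ _ coeff_meas(1)[OF e i j] B[OF i j]])
            (use f[OF j] in auto)
      qed
    qed simp
    then show "integrable (L e) (\<lambda>s. (\<Sum>j<kdim G e. Q e i j s * f j s) * cnj (g i s))"
      using g[OF i] by (intro product_integrable borel_measurable_cnj) (simp_all)
  qed
qed

lemma comp_rep_sq: "comp_rep u e j \<in> borel_measurable (L e) \<and> integrable (L e) (\<lambda>s. (cmod (comp_rep u e j s))\<^sup>2)"
  unfolding comp_rep_def using rep_measurable_LI rep_square_integrable_LI by blast

lemmas form_int = edge_form_integrable[OF _ comp_rep_sq comp_rep_sq]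

lemma L2d_inner_eq:
  "L2d_inner G (u, x) (w, y) = (\<Sum>e\<in>edges G. LINT s|L e. edge_form e (comp_rep u e) (comp_rep w e) s)
     + (\<Sum>v\<in>vertices G. cprod (I v) (opQ G v (x v)) (y v))"
  by (simp add: L2d_inner_def LINT_LI edge_form_def comp_rep_def)

lemma L2d_iff:
  "(u, x) \<in> L2d G \<longleftrightarrow> (\<forall>e i. (e, i) \<in> comps G \<longrightarrow> u (e, i) \<in> L2_on (len G e)) \<and> (\<forall>p. p \<notin> comps G \<longrightarrow> u p = 0) \<and>
     (\<forall>v\<in>vertices G. x v \<in> Yd v) \<and> (\<forall>v. v \<notin> vertices G \<longrightarrow> x v = 0)"
  unfolding L2d_def by auto

lemma comp_rep_AE:
  "AE s in L e. comp_rep (u + w) e j s = comp_rep u e j s + comp_rep w e j s"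
  "AE s in L e. comp_rep (u - w) e j s = comp_rep u e j s - comp_rep w e j s"
  "AE s in L e. comp_rep (\<lambda>p. l2_scale c (u p)) e j s = c * comp_rep u e j s"
  unfolding comp_rep_def using rep_LI by (auto simp: plus_fun_def fun_diff_def)

lemma all_AE: "(\<And>j. j < kdim G e \<Longrightarrow> AE s in L e. P j s) \<Longrightarrow> AE s in L e. \<forall>j<kdim G e. P j s"
  using AE_finite_allI[of "{..<kdim G e}" "\<lambda>j s. P j s" "L e"] by auto

lemma form_cong_AE:
  assumes e: "e \<in> edges G"
    and f: "\<And>j. j < kdim G e \<Longrightarrow> AE s in L e. f j s = f' j s" and g: "\<And>j. j < kdim G e \<Longrightarrow> AE s in L e. g j s = g' j s"
  shows "AE s in L e. edge_form e f g s = edge_form e f' g' s"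
proof -
  have "AE s in L e. \<forall>j<kdim G e. f j s = f' j s" by (rule all_AE) (rule f)
  moreover have "AE s in L e. \<forall>j<kdim G e. g j s = g' j s" by (rule all_AE) (rule g)
  ultimately show ?thesis by eventually_elim (auto simp: edge_form_def intro!: sum.cong)
qed

lemma Yd_closed:
  assumes "v \<in> vertices G"
  shows "0 \<in> Yd v" "a \<in> Yd v \<Longrightarrow> b \<in> Yd v \<Longrightarrow> a + b \<in> Yd v" "a \<in> Yd v \<Longrightarrow> cscale c a \<in> Yd v"
    "a \<in> Yd v \<Longrightarrow> b \<in> Yd v \<Longrightarrow> a - b \<in> Yd v"
  by (rule cfun.subspace_0[OF Y_props(3)[OF assms]] cfun.subspace_add[OF Y_props(3)[OF assms]]
      cfun.subspace_scale[OF Y_props(3)[OF assms]] cfun.subspace_diff[OF Y_props(3)[OF assms]]; assumption?)+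

lemma subspace_L2d: "module.subspace state_scale (L2d G)"
proof -
  interpret vector_space "state_scale :: complex \<Rightarrow> ('v, 'e) state \<Rightarrow> ('v, 'e) state" by (rule vector_space_state_scale)
  show ?thesis
    unfolding subspace_def
  proof (intro conjI ballI allI)
    show "0 \<in> L2d G"
      by (auto simp: L2d_iff zero_prod_def L2_on_closed Yd_closed)
    fix z z' :: "('v, 'e) state" and c assume z: "z \<in> L2d G"
    obtain u x where z_eq: "z = (u, x)" by (cases z)
    show "state_scale c z \<in> L2d G"
      using z unfolding z_eq state_scale_def
      by (auto simp: L2d_iff L2_on_closed l2_scale_zero Yd_closed)
    assume z': "z' \<in> L2d G"
    obtain u' x' where z'_eq: "z' = (u', x')" by (cases z')
    show "z + z' \<in> L2d G"
      using z z' unfolding z_eq z'_eq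
      by (auto simp: L2d_iff L2_on_closed Yd_closed)
  qed
qed

end

lemma inner_carrier_subspace:
  assumes "inner_carrier scl H ip" "module.subspace scl U" "U \<subseteq> H" shows "inner_carrier scl U ip"
proof -
  interpret inner_carrier scl H ip by (rule assms(1))
  show ?thesis
  proof unfold_locales
    show "local.subspace U" by (rule assms(2))
    fix x y z c assume "x \<in> U" "y \<in> U" "z \<in> U"
    then have m: "x \<in> H" "y \<in> H" "z \<in> H" using assms(3) by auto
    show "ip (x + y) z = ip x z + ip y z" by (rule ip_add[OF m])
  next
    fix x y c assume "x \<in> U" "y \<in> U"
    then have m: "x \<in> H" "y \<in> H" using assms(3) by auto
    show "ip (scl c x) y = c * ip x y" by (rule ip_scale[OF m])
    show "ip y x = cnj (ip x y)" by (rule ip_hermitian[OF m])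
  next
    fix x assume "x \<in> U" "x \<noteq> 0"
    then show "0 < Re (ip x x)" using assms(3) ip_pos by blast
  qed
qed

lemma matrix_form_bound:
  fixes p :: "nat \<Rightarrow> nat \<Rightarrow> complex"
  assumes B: "\<And>i j. i < k \<Longrightarrow> j < k \<Longrightarrow> cmod (p i j) \<le> B"
  shows "cmod (\<Sum>i<k. (\<Sum>j<k. p i j * a j) * cnj (b i))
      \<le> B * real k * ((\<Sum>i<k. (cmod (a i))\<^sup>2) + (\<Sum>i<k. (cmod (b i))\<^sup>2)) / 2"
proof -
  have "cmod (\<Sum>i<k. (\<Sum>j<k. p i j * a j) * cnj (b i)) = cmod (\<Sum>i<k. \<Sum>j<k. p i j * a j * cnj (b i))"
    by (simp add: sum_distrib_right)
  also have "\<dots> \<le> (\<Sum>i<k. \<Sum>j<k. cmod (p i j * a j * cnj (b i)))"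
    by (intro order_trans[OF norm_sum] sum_mono norm_sum)
  also have "\<dots> \<le> (\<Sum>i<k. \<Sum>j<k. B * ((cmod (a j))\<^sup>2 + (cmod (b i))\<^sup>2) / 2)"
  proof (intro sum_mono)
    fix i j assume "i \<in> {..<k}" "j \<in> {..<k}"
    then have b: "cmod (p i j) \<le> B" by (intro B) auto
    have B0: "0 \<le> B" using b norm_ge_zero[of "p i j"] by linarith
    have "cmod (a j) * cmod (b i) \<le> ((cmod (a j))\<^sup>2 + (cmod (b i))\<^sup>2) / 2"
      using sum_squares_bound[of "cmod (a j)" "cmod (b i)"] by simp
    then have "cmod (p i j) * (cmod (a j) * cmod (b i)) \<le> B * (((cmod (a j))\<^sup>2 + (cmod (b i))\<^sup>2) / 2)"
      using b B0 by (intro mult_mono) auto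
    then show "cmod (p i j * a j * cnj (b i)) \<le> B * ((cmod (a j))\<^sup>2 + (cmod (b i))\<^sup>2) / 2"
      by (simp add: norm_mult mult.assoc)
  qed
  also have "\<dots> = B * real k * ((\<Sum>i<k. (cmod (a i))\<^sup>2) + (\<Sum>i<k. (cmod (b i))\<^sup>2)) / 2"
    by (simp add: sum.distrib distrib_left add_divide_distrib flip: sum_distrib_left sum_divide_distrib)
      (simp add: mult_ac)
  finally show ?thesis .
qed

context net begin

text \<open>The energy in which all errors are measured, for one component of \<open>u\<close>; its counterpart for the vertices is \<open>Ev\<close>, with the
  inner product given by \<open>opQ\<close>.\<close>

definition En :: "('e \<times> nat \<Rightarrow> l2fun) \<Rightarrow> 'e \<Rightarrow> nat \<Rightarrow> real" where
  "En u e i = (LINT s|L e. (cmod (comp_rep u e i s))\<^sup>2)"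

lemma En_nonneg: "0 \<le> En u e i"
  unfolding En_def by (rule Bochner_Integration.integral_nonneg) simp

definition Ev :: "('v \<Rightarrow> 'e cvec) \<Rightarrow> 'v \<Rightarrow> real" where
  "Ev x v = Re (cprod (I v) (opQ G v (x v)) (x v))"

lemma Ev_nonneg: "v \<in> vertices G \<Longrightarrow> x v \<in> Yd v \<Longrightarrow> 0 \<le> Ev x v"
  unfolding Ev_def using inner_carrier.Re_ip_nonneg[OF Qv_inner] by blast

lemma sum_En:
  assumes "e \<in> edges G"
  shows "(LINT s|L e. (\<Sum>i<kdim G e. (cmod (comp_rep u e i s))\<^sup>2)) = (\<Sum>i<kdim G e. En u e i)"
    and "integrable (L e) (\<lambda>s. \<Sum>i<kdim G e. (cmod (comp_rep u e i s))\<^sup>2)"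
  unfolding En_def using comp_rep_sq by (auto intro!: Bochner_Integration.integral_sum)

lemma form_lower:
  "\<exists>q>0. \<forall>e\<in>edges G. \<forall>u. q * (\<Sum>i<kdim G e. En u e i) \<le> Re (LINT s|L e. edge_form e (comp_rep u e) (comp_rep u e) s)"
proof -
  obtain q where q: "q > 0" "\<forall>e\<in>edges G. \<forall>s\<in>{0..len G e}. \<forall>\<xi>.
     q * (\<Sum>i<kdim G e. (cmod (\<xi> i))\<^sup>2) \<le> Re (\<Sum>i<kdim G e. (\<Sum>j<kdim G e. Q e i j s * \<xi> j) * cnj (\<xi> i))"
    using Q_coercive by blast
  show ?thesis
  proof (intro exI[of _ q] conjI ballI allI q(1))
    fix e u assume e: "e \<in> edges G"
    have "q * (\<Sum>i<kdim G e. En u e i) = (LINT s|L e. q * (\<Sum>i<kdim G e. (cmod (comp_rep u e i s))\<^sup>2))"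
      unfolding sum_En(1)[OF e, symmetric] by simp
    also have "\<dots> \<le> (LINT s|L e. Re (edge_form e (comp_rep u e) (comp_rep u e) s))"
    proof (rule integral_mono)
      show "integrable (L e) (\<lambda>s. q * (\<Sum>i<kdim G e. (cmod (comp_rep u e i s))\<^sup>2))"
        using sum_En(2)[OF e] by simp
      show "integrable (L e) (\<lambda>s. Re (edge_form e (comp_rep u e) (comp_rep u e) s))"
        by (rule integrable_Re[OF form_int[OF e]])
      fix s assume "s \<in> space (L e)"
      then show "q * (\<Sum>i<kdim G e. (cmod (comp_rep u e i s))\<^sup>2) \<le> Re (edge_form e (comp_rep u e) (comp_rep u e) s)"
        unfolding edge_form_def using spec[OF bspec[OF bspec[OF q(2) e], of s], of "\<lambda>i. comp_rep u e i s"] by simp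
    qed
    also have "\<dots> = Re (LINT s|L e. edge_form e (comp_rep u e) (comp_rep u e) s)"
      by (rule integral_Re[OF form_int[OF e]])
    finally show "q * (\<Sum>i<kdim G e. En u e i) \<le> Re (LINT s|L e. edge_form e (comp_rep u e) (comp_rep u e) s)" .
  qed
qed

lemma form_upper:
  assumes e: "e \<in> edges G"
  shows "\<exists>C\<ge>0. \<forall>u. cmod (LINT s|L e. edge_form e (comp_rep u e) (comp_rep u e) s) \<le> C * (\<Sum>i<kdim G e. En u e i)"
proof -
  obtain B where B: "B \<ge> 0" "\<And>i j. i < kdim G e \<Longrightarrow> j < kdim G e \<Longrightarrow> AE s in L e. cmod (Q e i j s) \<le> B"
    using coeff_bounded[OF e] by blast
  have ae: "AE s in L e. \<forall>i<kdim G e. \<forall>j<kdim G e. cmod (Q e i j s) \<le> B"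
    by (intro all_AE B(2))
  show ?thesis
  proof (intro exI[of _ "B * real (kdim G e)"] conjI allI)
    show "0 \<le> B * real (kdim G e)" using B(1) by simp
    fix u
    have "cmod (LINT s|L e. edge_form e (comp_rep u e) (comp_rep u e) s)
        \<le> (LINT s|L e. cmod (edge_form e (comp_rep u e) (comp_rep u e) s))" by (rule integral_norm_bound)
    also have "\<dots> \<le> (LINT s|L e. B * real (kdim G e) * (\<Sum>i<kdim G e. (cmod (comp_rep u e i s))\<^sup>2))"
    proof (rule integral_mono_AE)
      show "integrable (L e) (\<lambda>s. cmod (edge_form e (comp_rep u e) (comp_rep u e) s))"
        by (rule integrable_norm[OF form_int[OF e]])
      show "integrable (L e) (\<lambda>s. B * real (kdim G e) * (\<Sum>i<kdim G e. (cmod (comp_rep u e i s))\<^sup>2))"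
        using sum_En(2)[OF e] by simp
      show "AE s in L e. cmod (edge_form e (comp_rep u e) (comp_rep u e) s)
          \<le> B * real (kdim G e) * (\<Sum>i<kdim G e. (cmod (comp_rep u e i s))\<^sup>2)"
        using ae
      proof eventually_elim
        case (elim s)
        show ?case unfolding edge_form_def
          using matrix_form_bound[of "kdim G e" "\<lambda>i j. Q e i j s" B "\<lambda>j. comp_rep u e j s" "\<lambda>j. comp_rep u e j s"] elim
          by simp
      qed
    qed
    also have "\<dots> = B * real (kdim G e) * (\<Sum>i<kdim G e. En u e i)"
      unfolding sum_En(1)[OF e, symmetric] by simp
    finally show "cmod (LINT s|L e. edge_form e (comp_rep u e) (comp_rep u e) s) \<le> B * real (kdim G e) * (\<Sum>i<kdim G e. En u e i)" .
  qed
qed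

lemma Re_inner:
  "Re (L2d_inner G (u, x) (u, x)) = (\<Sum>e\<in>edges G. Re (LINT s|L e. edge_form e (comp_rep u e) (comp_rep u e) s))
     + (\<Sum>v\<in>vertices G. Ev x v)"
  by (simp add: L2d_inner_eq Ev_def)

lemma inner_lower:
  "\<exists>q>0. \<forall>u x. q * (\<Sum>e\<in>edges G. \<Sum>i<kdim G e. En u e i) + (\<Sum>v\<in>vertices G. Ev x v) \<le> Re (L2d_inner G (u, x) (u, x))"
proof -
  obtain q where q: "q > 0" "\<forall>e\<in>edges G. \<forall>u.
    q * (\<Sum>i<kdim G e. En u e i) \<le> Re (LINT s|L e. edge_form e (comp_rep u e) (comp_rep u e) s)"
    using form_lower by blast
  show ?thesis
  proof (intro exI[of _ q] conjI allI q(1))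
    fix u x
    show "q * (\<Sum>e\<in>edges G. \<Sum>i<kdim G e. En u e i) + (\<Sum>v\<in>vertices G. Ev x v) \<le> Re (L2d_inner G (u, x) (u, x))"
      unfolding Re_inner sum_distrib_left[of q _ "edges G"] using q(2) by (intro add_right_mono sum_mono) blast
  qed
qed

text \<open>Convergence of states means convergence of their components in \<open>L2\<close> and of their parts at the vertices; this is one half
  of the comparison of norms.\<close>

lemma inner_lower_single:
  "\<exists>q>0. \<forall>u x. (u, x) \<in> L2d G \<longrightarrow>
    (\<forall>e i. (e, i) \<in> comps G \<longrightarrow> q * En u e i \<le> Re (L2d_inner G (u, x) (u, x))) \<and>
    (\<forall>v\<in>vertices G. Ev x v \<le> Re (L2d_inner G (u, x) (u, x)))"
proof -
  obtain q where q: "q > 0" "\<forall>u x. q * (\<Sum>e\<in>edges G. \<Sum>i<kdim G e. En u e i) + (\<Sum>v\<in>vertices G. Ev x v) \<le> Re (L2d_inner G (u, x) (u, x))"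
    using inner_lower by blast
  have e_nonneg: "0 \<le> (\<Sum>e\<in>edges G. \<Sum>i<kdim G e. En u e i)" for u by (intro sum_nonneg En_nonneg)
  have v_nonneg: "0 \<le> (\<Sum>v\<in>vertices G. Ev x v)" if "(u, x) \<in> L2d G" for u x
    using that by (intro sum_nonneg Ev_nonneg) (auto simp: L2d_iff)
  show ?thesis
  proof (intro exI[of _ q] conjI allI ballI impI q(1))
    fix u x e i assume z: "(u, x) \<in> L2d G" and p: "(e, i) \<in> comps G"
    have "En u e i \<le> (\<Sum>i<kdim G e. En u e i)"
      by (rule member_le_sum) (use p En_nonneg in \<open>auto simp: comps_iff\<close>)
    also have "\<dots> \<le> (\<Sum>e\<in>edges G. \<Sum>i<kdim G e. En u e i)"
      by (rule member_le_sum[of e "edges G" "\<lambda>e. \<Sum>i<kdim G e. En u e i"])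
        (use p in \<open>auto simp: comps_iff intro!: sum_nonneg En_nonneg\<close>)
    finally have "q * En u e i \<le> q * (\<Sum>e\<in>edges G. \<Sum>i<kdim G e. En u e i)" using q(1) by simp
    then show "q * En u e i \<le> Re (L2d_inner G (u, x) (u, x))" using spec[OF spec[OF q(2), of u], of x] v_nonneg[OF z] by linarith
  next
    fix u x v assume z: "(u, x) \<in> L2d G" and v: "v \<in> vertices G"
    have "Ev x v \<le> (\<Sum>v\<in>vertices G. Ev x v)"
      by (rule member_le_sum[OF v]) (use z in \<open>auto simp: L2d_iff intro!: Ev_nonneg\<close>)
    moreover have "0 \<le> q * (\<Sum>e\<in>edges G. \<Sum>i<kdim G e. En u e i)" using q(1) e_nonneg by simp
    ultimately show "Ev x v \<le> Re (L2d_inner G (u, x) (u, x))" using spec[OF spec[OF q(2), of u], of x] by linarith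
  qed
qed

lemma L2d_inner_carrier: "inner_carrier state_scale (L2d G) (L2d_inner G)"
proof -
  interpret vector_space "state_scale :: complex \<Rightarrow> ('v, 'e) state \<Rightarrow> ('v, 'e) state" by (rule vector_space_state_scale)
  have mem: "v \<in> vertices G \<Longrightarrow> x v \<in> Yd v" if "(u, x) \<in> L2d G" for u x v using that by (simp add: L2d_iff)
  show ?thesis
  proof unfold_locales
    show "subspace (L2d G)" by (rule subspace_L2d)
    fix z z' z'' :: "('v, 'e) state" assume z: "z \<in> L2d G" "z' \<in> L2d G" "z'' \<in> L2d G"
    obtain u x where 1: "z = (u, x)" by (cases z)
    obtain u' x' where 2: "z' = (u', x')" by (cases z')
    obtain u'' x'' where 3: "z'' = (u'', x'')" by (cases z'')
    have "(LINT s|L e. edge_form e (comp_rep (u + u') e) (comp_rep u'' e) s)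
        = (LINT s|L e. edge_form e (comp_rep u e) (comp_rep u'' e) s) + (LINT s|L e. edge_form e (comp_rep u' e) (comp_rep u'' e) s)"
      if e: "e \<in> edges G" for e
    proof -
      have "AE s in L e. edge_form e (comp_rep (u + u') e) (comp_rep u'' e) s
          = edge_form e (\<lambda>j s. comp_rep u e j s + comp_rep u' e j s) (comp_rep u'' e) s"
        by (rule form_cong_AE[OF e comp_rep_AE(1)]) simp
      then have ae: "AE s in L e. edge_form e (comp_rep (u + u') e) (comp_rep u'' e) s
          = edge_form e (comp_rep u e) (comp_rep u'' e) s + edge_form e (comp_rep u' e) (comp_rep u'' e) s"
        by eventually_elim (simp add: edge_form_def distrib_left distrib_right sum.distrib)
      have "(LINT s|L e. edge_form e (comp_rep (u + u') e) (comp_rep u'' e) s)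
          = (LINT s|L e. edge_form e (comp_rep u e) (comp_rep u'' e) s + edge_form e (comp_rep u' e) (comp_rep u'' e) s)"
        by (rule integral_cong_AE[OF _ _ ae]) (use form_int[OF e] in auto)
      then show ?thesis using form_int[OF e] by simp
    qed
    moreover have "cprod (I v) (opQ G v ((x + x') v)) (x'' v)
        = cprod (I v) (opQ G v (x v)) (x'' v) + cprod (I v) (opQ G v (x' v)) (x'' v)" if v: "v \<in> vertices G" for v
      using inner_carrier.ip_add[OF Qv_inner[OF v]] mem v z unfolding 1 2 3 plus_fun_apply by blast
    ultimately show "L2d_inner G (z + z') z'' = L2d_inner G z z'' + L2d_inner G z' z''"
      unfolding 1 2 3 plus_prod_def fst_conv snd_conv L2d_inner_eq by (simp add: sum.distrib)
  next
    fix z z' :: "('v, 'e) state" and c assume z: "z \<in> L2d G" "z' \<in> L2d G"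
    obtain u x where 1: "z = (u, x)" by (cases z)
    obtain u' x' where 2: "z' = (u', x')" by (cases z')
    have "(LINT s|L e. edge_form e (comp_rep (\<lambda>p. l2_scale c (u p)) e) (comp_rep u' e) s)
        = c * (LINT s|L e. edge_form e (comp_rep u e) (comp_rep u' e) s)" if e: "e \<in> edges G" for e
    proof -
      have "AE s in L e. edge_form e (comp_rep (\<lambda>p. l2_scale c (u p)) e) (comp_rep u' e) s
          = edge_form e (\<lambda>j s. c * comp_rep u e j s) (comp_rep u' e) s"
        by (rule form_cong_AE[OF e comp_rep_AE(3)]) simp
      then have ae: "AE s in L e. edge_form e (comp_rep (\<lambda>p. l2_scale c (u p)) e) (comp_rep u' e) s
          = c * edge_form e (comp_rep u e) (comp_rep u' e) s"
        by eventually_elim (simp add: edge_form_def sum_distrib_left sum_distrib_right ac_simps)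
      have "(LINT s|L e. edge_form e (comp_rep (\<lambda>p. l2_scale c (u p)) e) (comp_rep u' e) s)
          = (LINT s|L e. c * edge_form e (comp_rep u e) (comp_rep u' e) s)"
        by (rule integral_cong_AE[OF _ _ ae]) (use form_int[OF e] in auto)
      then show ?thesis by simp
    qed
    moreover have "cprod (I v) (opQ G v (cscale c (x v))) (x' v) = c * cprod (I v) (opQ G v (x v)) (x' v)"
      if v: "v \<in> vertices G" for v
      using inner_carrier.ip_scale[OF Qv_inner[OF v]] mem v z unfolding 1 2 by blast
    ultimately show "L2d_inner G (state_scale c z) z' = c * L2d_inner G z z'"
      unfolding 1 2 state_scale_def prod.case L2d_inner_eq by (simp add: sum_distrib_left distrib_left)
    have "(LINT s|L e. edge_form e (comp_rep u' e) (comp_rep u e) s)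
        = cnj (LINT s|L e. edge_form e (comp_rep u e) (comp_rep u' e) s)" if e: "e \<in> edges G" for e
    proof -
      have "edge_form e (comp_rep u' e) (comp_rep u e) s = cnj (edge_form e (comp_rep u e) (comp_rep u' e) s)"
        if s: "s \<in> space (L e)" for s
      proof -
        have "cnj (edge_form e (comp_rep u e) (comp_rep u' e) s)
            = (\<Sum>i<kdim G e. \<Sum>j<kdim G e. cnj (Q e i j s) * cnj (comp_rep u e j s) * comp_rep u' e i s)"
          by (simp add: edge_form_def sum_distrib_right)
        also have "\<dots> = (\<Sum>i<kdim G e. \<Sum>j<kdim G e. Q e j i s * cnj (comp_rep u e j s) * comp_rep u' e i s)"
          by (intro sum.cong refl) (use Q_hermitian[OF e, of s] s in auto)
        also have "\<dots> = (\<Sum>j<kdim G e. \<Sum>i<kdim G e. Q e j i s * cnj (comp_rep u e j s) * comp_rep u' e i s)"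
          by (rule sum.swap)
        also have "\<dots> = edge_form e (comp_rep u' e) (comp_rep u e) s"
          unfolding edge_form_def sum_distrib_right by (intro sum.cong refl) (simp only: ac_simps)
        finally show ?thesis by (rule sym)
      qed
      then have "(LINT s|L e. edge_form e (comp_rep u' e) (comp_rep u e) s)
          = (LINT s|L e. cnj (edge_form e (comp_rep u e) (comp_rep u' e) s))"
        by (intro Bochner_Integration.integral_cong) auto
      then show ?thesis by simp
    qed
    moreover have "cprod (I v) (opQ G v (x' v)) (x v) = cnj (cprod (I v) (opQ G v (x v)) (x' v))"
      if v: "v \<in> vertices G" for v
      using inner_carrier.ip_hermitian[OF Qv_inner[OF v]] mem v z unfolding 1 2 by blast
    ultimately show "L2d_inner G z' z = cnj (L2d_inner G z z')"
      unfolding 1 2 L2d_inner_eq by simp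
  next
    fix z :: "('v, 'e) state" assume z: "z \<in> L2d G" "z \<noteq> 0"
    obtain u x where 1: "z = (u, x)" by (cases z)
    obtain q where q0: "q > 0" "\<forall>u x. (u, x) \<in> L2d G \<longrightarrow>
      (\<forall>e i. (e, i) \<in> comps G \<longrightarrow> q * En u e i \<le> Re (L2d_inner G (u, x) (u, x))) \<and>
      (\<forall>v\<in>vertices G. Ev x v \<le> Re (L2d_inner G (u, x) (u, x)))"
      using inner_lower_single by blast
    note q = q0(1) q0(2)[rule_format, THEN conjunct1, rule_format] q0(2)[rule_format, THEN conjunct2, rule_format]
    show "0 < Re (L2d_inner G z z)"
    proof (rule ccontr)
      assume neg: "\<not> 0 < Re (L2d_inner G z z)"
      have "x v = 0" for v
      proof (cases "v \<in> vertices G")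
        case True
        then have "\<not> 0 < Ev x v" using q(3)[of u x v] z(1) neg unfolding 1 by linarith
        then show ?thesis using Qv_positive[OF True, of "x v"] mem[of u x v] z(1) True unfolding 1 Ev_def by blast
      qed (use z(1) 1 in \<open>simp add: L2d_iff\<close>)
      moreover have "u p = 0" for p
      proof (cases "p \<in> comps G")
        case True
        obtain e i where p: "p = (e, i)" by (cases p)
        have "q * En u e i \<le> 0" using q(2)[of u x e i] z(1) neg True unfolding 1 p by linarith
        then have "En u e i = 0" using q(1) En_nonneg[of u e i] by (simp add: mult_le_0_iff)
        then have "AE s in L e. (cmod (comp_rep u e i s))\<^sup>2 = 0"
          unfolding En_def using comp_rep_sq[of u e i]
          by (subst (asm) integral_nonneg_eq_0_iff_AE) auto
        then have "AE s in L e. rep_l2 (u p) s = rep_l2 0 s"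
          using rep_LI(3)[of "len G e"] by eventually_elim (simp add: comp_rep_def p)
        moreover have "u p \<in> L2_on (len G e)" using z(1) True unfolding 1 p by (simp add: L2d_iff)
        ultimately show ?thesis using L2_on_eqI L2_on_closed(1) by blast
      qed (use z(1) 1 in \<open>cases p, simp add: L2d_iff\<close>)
      ultimately have "z = 0" unfolding 1 by (simp add: zero_prod_def fun_eq_iff)
      then show False using z(2) by simp
    qed
  qed
qed


lemma Yd_euclid: "v \<in> vertices G \<Longrightarrow> inner_carrier cscale (Yd v) (cprod (I v))"
  by (rule inner_carrier_subspace[OF inner_carrier_cprod[OF finite_comps(2)] Y_props(3) Y_props(5)])

lemma Ev_upper:
  assumes v: "v \<in> vertices G"
  shows "\<exists>K\<ge>0. \<forall>x. x v \<in> Yd v \<longrightarrow> Ev x v \<le> K * (\<Sum>i\<in>I v. (cmod (x v i))\<^sup>2)"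
proof -
  note lin = Y_props(8)[OF v, unfolded linear_between_def]
  obtain K where K: "K \<ge> 0" "\<forall>y\<in>Yd v. cmod (cprod (I v) (opQ G v y) y) \<le> K * Re (cprod (I v) y y)"
    using quadratic_form_bounded[OF finite_comps(2) Y_props(3)[OF v] Y_props(5)[OF v] Yd_euclid[OF v], of "opQ G v"] lin
    by blast
  show ?thesis
  proof (intro exI[of _ K] conjI allI impI K(1))
    fix x assume "x v \<in> Yd v"
    then have "cmod (cprod (I v) (opQ G v (x v)) (x v)) \<le> K * Re (cprod (I v) (x v) (x v))" using K(2) by blast
    then show "Ev x v \<le> K * (\<Sum>i\<in>I v. (cmod (x v i))\<^sup>2)"
      unfolding Ev_def Re_cprod_self[symmetric] using complex_Re_le_cmod order_trans by blast
  qed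
qed

text \<open>Together with \<open>Ev_upper\<close> this compares the inner product given by \<open>opQ\<close> with the Euclidean one.\<close>

lemma Ev_coord:
  assumes v: "v \<in> vertices G"
  shows "\<exists>K\<ge>0. \<forall>x. x v \<in> Yd v \<longrightarrow> (\<forall>i\<in>I v. cmod (x v i) \<le> K * sqrt (Ev x v))"
proof -
  obtain K where K: "K \<ge> 0" "\<forall>y\<in>Yd v. \<forall>i\<in>I v. cmod (y i) \<le> K * sqrt (Re (cprod (I v) (opQ G v y) y))"
    using linear_map_bounded[OF finite_comps(2) Y_props(3)[OF v] Y_props(5)[OF v] Qv_inner[OF v], of "\<lambda>x. x"]
    by blast
  then show ?thesis unfolding Ev_def by (intro exI[of _ K]) simp
qed

lemma En_diff: "En (u - w) e i = (LINT s|L e. (cmod (comp_rep u e i s - comp_rep w e i s))\<^sup>2)"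
  unfolding En_def
proof (rule integral_cong_AE)
  have [measurable]: "comp_rep u e i \<in> borel_measurable (L e)" for u i using comp_rep_sq by blast
  show "(\<lambda>s. (cmod (comp_rep (u - w) e i s))\<^sup>2) \<in> borel_measurable (L e)"
    "(\<lambda>s. (cmod (comp_rep u e i s - comp_rep w e i s))\<^sup>2) \<in> borel_measurable (L e)" by measurable
  show "AE s in L e. (cmod (comp_rep (u - w) e i s))\<^sup>2 = (cmod (comp_rep u e i s - comp_rep w e i s))\<^sup>2"
    using comp_rep_AE(2)[where e = e and u = u and w = w and j = i] by eventually_elim simp
qed

text \<open>A Cauchy sequence of states has limits in each component, in \<open>L2\<close> by \<open>L2_complete\<close> and at the vertices because subspaces of
  a finite-dimensional space are closed; the upper bounds on the forms make the state of the limits the limit.\<close>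

lemma L2d_hilbert: "hilbert_carrier state_scale (L2d G) (L2d_inner G)"
proof -
  interpret inner_carrier "state_scale :: complex \<Rightarrow> ('v, 'e) state \<Rightarrow> _" "L2d G" "L2d_inner G"
    by (rule L2d_inner_carrier)
  obtain q where q0: "q > 0" "\<forall>u x. (u, x) \<in> L2d G \<longrightarrow>
      (\<forall>e i. (e, i) \<in> comps G \<longrightarrow> q * En u e i \<le> Re (L2d_inner G (u, x) (u, x))) \<and>
      (\<forall>v\<in>vertices G. Ev x v \<le> Re (L2d_inner G (u, x) (u, x)))"
    using inner_lower_single by blast
  note q = q0(1) q0(2)[rule_format, THEN conjunct1, rule_format] q0(2)[rule_format, THEN conjunct2, rule_format]
  show ?thesis
  proof unfold_locales
    fix X :: "nat \<Rightarrow> ('v, 'e) state"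
    assume XH: "\<And>n. X n \<in> L2d G"
      and cauchy: "\<And>e. e > 0 \<Longrightarrow> \<exists>N. \<forall>m\<ge>N. \<forall>n\<ge>N. nrm (X m - X n) < e"
    define u x where "u = (\<lambda>n. fst (X n))" and "x = (\<lambda>n. snd (X n))"
    have X: "X n = (u n, x n)" for n by (simp add: u_def x_def)
    have mem: "(u n, x n) \<in> L2d G" for n using XH[of n] X by simp
    have diff: "X m - X n = (u m - u n, x m - x n)" for m n by (simp add: X)
    have diff_mem: "(u m - u n, x m - x n) \<in> L2d G" for m n using mem_diff[OF XH[of m] XH[of n]] diff by simp
    have sq_lt: "Re (L2d_inner G (u m - u n, x m - x n) (u m - u n, x m - x n)) < e\<^sup>2"
      if "nrm (X m - X n) < e" for m n e
    proof -
      have "(nrm (X m - X n))\<^sup>2 < e\<^sup>2"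
        using that nrm_ge_0[OF mem_diff[OF XH[of m] XH[of n]]] by (intro power_strict_mono) auto
      then show ?thesis using nrm_sq[OF mem_diff[OF XH[of m] XH[of n]]] diff by simp
    qed
    have "\<exists>w\<in>L2_on (len G e). (\<lambda>n. LINT s|L e. (cmod (rep_l2 (u n (e, i)) s - rep_l2 w s))\<^sup>2) \<longlonglongrightarrow> 0"
      if p: "(e, i) \<in> comps G" for e i
    proof (rule L2_complete)
      show "u n (e, i) \<in> L2_on (len G e)" for n using mem[of n] p unfolding L2d_iff by blast
      fix \<epsilon> :: real assume \<epsilon>: "\<epsilon> > 0"
      obtain N where N: "\<forall>m\<ge>N. \<forall>n\<ge>N. nrm (X m - X n) < sqrt (q * \<epsilon>)"
        using cauchy[of "sqrt (q * \<epsilon>)"] \<epsilon> q(1) by auto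
      have "(LINT s|L e. (cmod (rep_l2 (u m (e, i)) s - rep_l2 (u n (e, i)) s))\<^sup>2) < \<epsilon>" if "m \<ge> N" "n \<ge> N" for m n
      proof -
        have "q * En (u m - u n) e i < (sqrt (q * \<epsilon>))\<^sup>2"
          using q(2)[OF diff_mem[of m n] p] sq_lt[of m n "sqrt (q * \<epsilon>)"] N that by fastforce
        also have "\<dots> = q * \<epsilon>" using q(1) \<epsilon> by simp
        finally show ?thesis using q(1) by (simp add: En_diff comp_rep_def)
      qed
      then show "\<exists>N. \<forall>m\<ge>N. \<forall>n\<ge>N. (LINT s|L e. (cmod (rep_l2 (u m (e, i)) s - rep_l2 (u n (e, i)) s))\<^sup>2) < \<epsilon>" by blast
    qed
    then have "\<forall>p\<in>comps G. \<exists>w. w \<in> L2_on (len G (fst p)) \<and>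
        (\<lambda>n. LINT s|L (fst p). (cmod (rep_l2 (u n p) s - rep_l2 w s))\<^sup>2) \<longlonglongrightarrow> 0"
      by fastforce
    then obtain W where W: "\<forall>p\<in>comps G. W p \<in> L2_on (len G (fst p)) \<and>
        (\<lambda>n. LINT s|L (fst p). (cmod (rep_l2 (u n p) s - rep_l2 (W p) s))\<^sup>2) \<longlonglongrightarrow> 0"
      by (rule bchoice[THEN exE])
    define U where "U = (\<lambda>p. if p \<in> comps G then W p else 0)"
    have U_lim: "(\<lambda>n. En (u n - U) e i) \<longlonglongrightarrow> 0" if "(e, i) \<in> comps G" for e i
      using bspec[OF W that] that by (simp add: En_diff comp_rep_def U_def)
    have "convergent (\<lambda>n. x n v i)" if v: "v \<in> vertices G" and i: "i \<in> I v" for v i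
    proof -
      obtain K where K: "K \<ge> 0" "\<forall>x. x v \<in> Yd v \<longrightarrow> (\<forall>i\<in>I v. cmod (x v i) \<le> K * sqrt (Ev x v))"
        using Ev_coord[OF v] by blast
      have "Cauchy (\<lambda>n. x n v i)"
      proof (rule CauchyI)
        fix \<epsilon> :: real assume \<epsilon>: "\<epsilon> > 0"
        obtain N where N: "\<forall>m\<ge>N. \<forall>n\<ge>N. nrm (X m - X n) < \<epsilon> / (K + 1)"
          using cauchy[of "\<epsilon> / (K + 1)"] \<epsilon> K(1) by auto
        have "norm (x m v i - x n v i) < \<epsilon>" if mn: "m \<ge> N" "n \<ge> N" for m n
        proof -
          have lt: "nrm (X m - X n) < \<epsilon> / (K + 1)" using N mn by blast
          have "(x m - x n) v \<in> Yd v" using diff_mem[of m n] v unfolding L2d_iff by blast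
          then have "cmod ((x m - x n) v i) \<le> K * sqrt (Ev (x m - x n) v)" using K(2) i by blast
          also have "sqrt (Ev (x m - x n) v) \<le> nrm (X m - X n)"
            unfolding nrm_def diff by (rule real_sqrt_le_mono) (rule q(3)[OF diff_mem v])
          then have "K * sqrt (Ev (x m - x n) v) \<le> K * nrm (X m - X n)" using K(1) by (rule mult_left_mono)
          also have "\<dots> \<le> K * (\<epsilon> / (K + 1))" using lt K(1) by (intro mult_left_mono) auto
          also have "\<dots> < \<epsilon>" using K(1) \<epsilon> by (simp add: field_simps)
          finally show ?thesis by simp
        qed
        then show "\<exists>M. \<forall>m\<ge>M. \<forall>n\<ge>M. norm (x m v i - x n v i) < \<epsilon>" by blast
      qed
      then show ?thesis by (simp add: Cauchy_convergent_iff)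
    qed
    note conv = this
    define y where "y = (\<lambda>v i. if v \<in> vertices G \<and> i \<in> I v then lim (\<lambda>n. x n v i) else 0)"
    have y_lim: "(\<lambda>n. x n v i) \<longlonglongrightarrow> y v i" if "v \<in> vertices G" "i \<in> I v" for v i
      using conv[OF that] that by (simp add: y_def convergent_LIMSEQ_iff)
    have y_mem: "y v \<in> Yd v" if v: "v \<in> vertices G" for v
    proof (rule subspace_closed_limit[OF finite_comps(2) Y_props(3)[OF v] Y_props(5)[OF v], where X = "\<lambda>n. x n v"])
      show "x n v \<in> Yd v" for n using mem[of n] v unfolding L2d_iff by blast
      show "(\<lambda>n. x n v i) \<longlonglongrightarrow> y v i" if "i \<in> I v" for i by (rule y_lim[OF v that])
      show "y v \<in> cvecs (I v)" by (simp add: cvecs_def y_def)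
    qed
    have Uy: "(U, y) \<in> L2d G"
      unfolding L2d_iff
    proof (intro conjI allI impI ballI)
      show "U (e, i) \<in> L2_on (len G e)" if "(e, i) \<in> comps G" for e i
        using bspec[OF W that] that by (simp add: U_def)
      show "U p = 0" if "p \<notin> comps G" for p using that by (simp add: U_def)
      show "y v = 0" if "v \<notin> vertices G" for v using that by (simp add: y_def fun_eq_iff)
    qed (rule y_mem)
    have dU: "(u n - U, x n - y) \<in> L2d G" for n
      using mem_diff[OF mem[of n] Uy] by simp
    have "\<forall>e\<in>edges G. \<exists>C. C \<ge> 0 \<and> (\<forall>u. cmod (LINT s|L e. edge_form e (comp_rep u e) (comp_rep u e) s) \<le> C * (\<Sum>i<kdim G e. En u e i))"
      by (intro ballI form_upper)
    then obtain C where C: "\<forall>e\<in>edges G. C e \<ge> 0 \<and> (\<forall>u. cmod (LINT s|L e. edge_form e (comp_rep u e) (comp_rep u e) s) \<le> C e * (\<Sum>i<kdim G e. En u e i))"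
      by (rule bchoice[THEN exE])
    have "\<forall>v\<in>vertices G. \<exists>K. K \<ge> 0 \<and> (\<forall>x. x v \<in> Yd v \<longrightarrow> Ev x v \<le> K * (\<Sum>i\<in>I v. (cmod (x v i))\<^sup>2))"
      by (intro ballI Ev_upper)
    then obtain K where K: "\<forall>v\<in>vertices G. K v \<ge> 0 \<and> (\<forall>x. x v \<in> Yd v \<longrightarrow> Ev x v \<le> K v * (\<Sum>i\<in>I v. (cmod (x v i))\<^sup>2))"
      by (rule bchoice[THEN exE])
    define b where "b = (\<lambda>n. (\<Sum>e\<in>edges G. C e * (\<Sum>i<kdim G e. En (u n - U) e i))
        + (\<Sum>v\<in>vertices G. K v * (\<Sum>i\<in>I v. (cmod (x n v i - y v i))\<^sup>2)))"
    have b_lim: "b \<longlonglongrightarrow> (\<Sum>e\<in>edges G. C e * (\<Sum>i<kdim G e. 0)) + (\<Sum>v\<in>vertices G. K v * (\<Sum>i\<in>I v. (cmod (y v i - y v i))\<^sup>2))"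
      unfolding b_def
      by (intro tendsto_add tendsto_sum tendsto_mult tendsto_const U_lim tendsto_power tendsto_norm tendsto_diff y_lim)
        (auto simp: comps_iff)
    have le: "Re (L2d_inner G (u n - U, x n - y) (u n - U, x n - y)) \<le> b n" for n
      unfolding Re_inner b_def
    proof (intro add_mono sum_mono)
      fix e assume e: "e \<in> edges G"
      have "cmod (LINT s|L e. edge_form e (comp_rep (u n - U) e) (comp_rep (u n - U) e) s) \<le> C e * (\<Sum>i<kdim G e. En (u n - U) e i)"
        using bspec[OF C e] by blast
      then show "Re (LINT s|L e. edge_form e (comp_rep (u n - U) e) (comp_rep (u n - U) e) s) \<le> C e * (\<Sum>i<kdim G e. En (u n - U) e i)"
        using complex_Re_le_cmod order_trans by blast
    next
      fix v assume v: "v \<in> vertices G"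
      have "(x n - y) v \<in> Yd v" using dU[of n] v unfolding L2d_iff by blast
      then have "Ev (x n - y) v \<le> K v * (\<Sum>i\<in>I v. (cmod ((x n - y) v i))\<^sup>2)" using bspec[OF K v] by blast
      then show "Ev (x n - y) v \<le> K v * (\<Sum>i\<in>I v. (cmod (x n v i - y v i))\<^sup>2)" by simp
    qed
    have "(\<lambda>n. Re (L2d_inner G (u n - U, x n - y) (u n - U, x n - y))) \<longlonglongrightarrow> 0"
    proof (rule tendsto_sandwich[OF _ _ tendsto_const])
      show "\<forall>\<^sub>F n in sequentially. 0 \<le> Re (L2d_inner G (u n - U, x n - y) (u n - U, x n - y))"
        by (intro always_eventually allI Re_ip_nonneg dU)
      show "\<forall>\<^sub>F n in sequentially. Re (L2d_inner G (u n - U, x n - y) (u n - U, x n - y)) \<le> b n"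
        by (intro always_eventually allI le)
      show "b \<longlonglongrightarrow> 0" using b_lim by simp
    qed
    then have "(\<lambda>n. sqrt (Re (L2d_inner G (u n - U, x n - y) (u n - U, x n - y)))) \<longlonglongrightarrow> sqrt 0"
      by (rule tendsto_real_sqrt)
    then have "(\<lambda>n. nrm (X n - (U, y))) \<longlonglongrightarrow> 0" by (simp add: nrm_def X)
    then show "\<exists>z\<in>L2d G. (\<lambda>n. nrm (X n - z)) \<longlonglongrightarrow> 0" using Uy by (rule bexI)
  qed
qed

end

section \<open>The operator\<close>

context net begin

definition H1u :: "('e \<times> nat \<Rightarrow> l2fun) \<Rightarrow> bool" where
  "H1u u \<longleftrightarrow> (\<forall>e i. (e, i) \<in> comps G \<longrightarrow> u (e, i) \<in> H1_on (len G e))"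

text \<open>The components of the first part of \<open>A_op\<close>.\<close>

definition A1 :: "('e \<times> nat \<Rightarrow> l2fun) \<Rightarrow> 'e \<Rightarrow> nat \<Rightarrow> l2fun" where
  "A1 u e i = lift (len G e) (\<lambda>s. \<Sum>j<kdim G e. M e i j s * rep_l2 (wderiv (len G e) (u (e, j))) s
     + N e i j s * rep_l2 (u (e, j)) s)"

lemma A_dom_iff:
  "(u, x) \<in> A_dom G \<longleftrightarrow> (u, x) \<in> L2d G \<and> H1u u \<and> (\<forall>v\<in>vertices G. trace_at G v u \<in> Y v \<and>
     x v = orth_proj (I v) (Yd v) (trace_at G v u))"
  unfolding A_dom_def H1u_def by auto

lemma A_op_eq: "A_op G (u, x) = (\<lambda>(e, i). if (e, i) \<in> comps G then A1 u e i else 0,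
    \<lambda>v. if v \<in> vertices G then opB G v (trace_at G v u) + opC G v (x v) else 0)"
  unfolding A_op_def A1_def lift_def by simp

lemma A1_function:
  assumes e: "e \<in> edges G" and i: "i < kdim G e"
  shows "(\<lambda>s. \<Sum>j<kdim G e. M e i j s * rep_l2 (d j) s + N e i j s * rep_l2 (w j) s) \<in> borel_measurable (L e) \<and>
    integrable (L e) (\<lambda>s. (cmod (\<Sum>j<kdim G e. M e i j s * rep_l2 (d j) s + N e i j s * rep_l2 (w j) s))\<^sup>2)"
proof (rule square_integrable_sum)
  fix j assume "j \<in> {..<kdim G e}"
  then have j: "j < kdim G e" by simp
  obtain B where B: "B \<ge> 0" "\<forall>i<kdim G e. \<forall>j<kdim G e. (AE s in L e. cmod (Q e i j s) \<le> B) \<and>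
    (AE s in L e. cmod (M e i j s) \<le> B) \<and> (AE s in L e. cmod (N e i j s) \<le> B)"
    using coeff_bounded[OF e] by blast
  have MB: "AE s in L e. cmod (M e i j s) \<le> B" and NB: "AE s in L e. cmod (N e i j s) \<le> B"
    using B(2) i j by blast+
  note [measurable] = coeff_meas[OF e i j]
  show "(\<lambda>s. M e i j s * rep_l2 (d j) s + N e i j s * rep_l2 (w j) s) \<in> borel_measurable (L e) \<and>
    integrable (L e) (\<lambda>s. (cmod (M e i j s * rep_l2 (d j) s + N e i j s * rep_l2 (w j) s))\<^sup>2)"
  proof
    show "(\<lambda>s. M e i j s * rep_l2 (d j) s + N e i j s * rep_l2 (w j) s) \<in> borel_measurable (L e)" by measurable
    show "integrable (L e) (\<lambda>s. (cmod (M e i j s * rep_l2 (d j) s + N e i j s * rep_l2 (w j) s))\<^sup>2)"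
    proof (rule square_integrable_add)
      show "(\<lambda>s. M e i j s * rep_l2 (d j) s) \<in> borel_measurable (L e)" "(\<lambda>s. N e i j s * rep_l2 (w j) s) \<in> borel_measurable (L e)"
        by measurable
      show "integrable (L e) (\<lambda>s. (cmod (M e i j s * rep_l2 (d j) s))\<^sup>2)"
        by (rule square_integrable_mult_bounded[OF rep_measurable_LI rep_square_integrable_LI coeff_meas(2)[OF e i j] MB])
      show "integrable (L e) (\<lambda>s. (cmod (N e i j s * rep_l2 (w j) s))\<^sup>2)"
        by (rule square_integrable_mult_bounded[OF rep_measurable_LI rep_square_integrable_LI coeff_meas(3)[OF e i j] NB])
    qed
  qed
qed simp

lemma A1_props:
  assumes p: "(e, i) \<in> comps G"
  shows "A1 u e i \<in> L2_on (len G e)"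
    and "AE s in L e. rep_l2 (A1 u e i) s = (\<Sum>j<kdim G e. M e i j s * rep_l2 (wderiv (len G e) (u (e, j))) s
     + N e i j s * rep_l2 (u (e, j)) s)"
proof -
  have e: "e \<in> edges G" "i < kdim G e" using p by (auto simp: comps_iff)
  note * = A1_function[OF e, of "\<lambda>j. wderiv (len G e) (u (e, j))" "\<lambda>j. u (e, j)"]
  show "A1 u e i \<in> L2_on (len G e)"
    "AE s in L e. rep_l2 (A1 u e i) s = (\<Sum>j<kdim G e. M e i j s * rep_l2 (wderiv (len G e) (u (e, j))) s
     + N e i j s * rep_l2 (u (e, j)) s)"
    unfolding A1_def by (rule lift_props; use * in blast)+
qed

lemma trace_cvecs: "trace_at G v u \<in> cvecs (I v)"
  by (auto simp: trace_at_def cvecs_def)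

lemma trace_add:
  assumes "H1u u" "H1u w" shows "trace_at G v (u + w) = trace_at G v u + trace_at G v w"
proof
  fix p :: "'e \<times> nat"
  obtain e i where p: "p = (e, i)" by (cases p)
  show "trace_at G v (u + w) p = (trace_at G v u + trace_at G v w) p"
  proof (cases "(e, i) \<in> I v")
    case True
    then have c: "(e, i) \<in> comps G" "e \<in> edges G" using comps_at_comps comps_iff by blast+
    have "u (e, i) \<in> H1_on (len G e)" "w (e, i) \<in> H1_on (len G e)" using assms c(1) by (auto simp: H1u_def)
    from H1_add(3)[OF len_pos[OF c(2)] this endpoint_in[OF c(2)]] show ?thesis
      using True by (simp add: trace_at_def p)
  qed (simp add: trace_at_def p)
qed

lemma trace_scale:
  assumes "H1u u" shows "trace_at G v (\<lambda>p. l2_scale c (u p)) = cscale c (trace_at G v u)"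
proof
  fix p :: "'e \<times> nat"
  obtain e i where p: "p = (e, i)" by (cases p)
  show "trace_at G v (\<lambda>p. l2_scale c (u p)) p = cscale c (trace_at G v u) p"
  proof (cases "(e, i) \<in> I v")
    case True
    then have c: "(e, i) \<in> comps G" "e \<in> edges G" using comps_at_comps comps_iff by blast+
    have "u (e, i) \<in> H1_on (len G e)" using assms c(1) by (auto simp: H1u_def)
    from H1_scale(3)[OF len_pos[OF c(2)] this endpoint_in[OF c(2)]] show ?thesis
      using True by (simp add: trace_at_def p cscale_def)
  qed (simp add: trace_at_def p cscale_def)
qed

lemma H1u_add: "H1u u \<Longrightarrow> H1u w \<Longrightarrow> H1u (u + w)"
  unfolding H1u_def using H1_add(1) len_pos comps_iff by (metis plus_fun_apply)

lemma H1u_scale: "H1u u \<Longrightarrow> H1u (\<lambda>p. l2_scale c (u p))"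
  unfolding H1u_def using H1_scale(1) len_pos comps_iff by metis

lemma Yd_proj:
  assumes v: "v \<in> vertices G"
  shows "x \<in> cvecs (I v) \<Longrightarrow> orth_proj (I v) (Yd v) x \<in> Yd v"
    "x \<in> cvecs (I v) \<Longrightarrow> y \<in> cvecs (I v) \<Longrightarrow> orth_proj (I v) (Yd v) (x + y) = orth_proj (I v) (Yd v) x + orth_proj (I v) (Yd v) y"
    "x \<in> cvecs (I v) \<Longrightarrow> orth_proj (I v) (Yd v) (cscale c x) = cscale c (orth_proj (I v) (Yd v) x)"
    "x \<in> cvecs (I v) \<Longrightarrow> y \<in> Yd v \<Longrightarrow> cprod (I v) (orth_proj (I v) (Yd v) x) y = cprod (I v) x y"
    "x \<in> cvecs (I v) \<Longrightarrow> y \<in> Yd v \<Longrightarrow> cprod (I v) y (orth_proj (I v) (Yd v) x) = cprod (I v) y x"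
  by (fact orth_proj_mem[OF finite_comps(2) Y_props(3)[OF v] Y_props(5)[OF v]]
      orth_proj_add[OF finite_comps(2) Y_props(3)[OF v] Y_props(5)[OF v]]
      orth_proj_scale[OF finite_comps(2) Y_props(3)[OF v] Y_props(5)[OF v]]
      cprod_orth_proj(2)[OF finite_comps(2) Y_props(3)[OF v] Y_props(5)[OF v]]
      cprod_orth_proj(1)[OF finite_comps(2) Y_props(3)[OF v] Y_props(5)[OF v]])+

lemma B_lin:
  assumes v: "v \<in> vertices G"
  shows "x \<in> Y v \<Longrightarrow> opB G v x \<in> Yd v" "x \<in> Y v \<Longrightarrow> y \<in> Y v \<Longrightarrow> opB G v (x + y) = opB G v x + opB G v y"
    "x \<in> Y v \<Longrightarrow> opB G v (cscale c x) = cscale c (opB G v x)"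
  using Y_props(6)[OF v] unfolding linear_between_def by blast+

lemma C_lin:
  assumes v: "v \<in> vertices G"
  shows "x \<in> Yd v \<Longrightarrow> opC G v x \<in> Yd v" "x \<in> Yd v \<Longrightarrow> y \<in> Yd v \<Longrightarrow> opC G v (x + y) = opC G v x + opC G v y"
    "x \<in> Yd v \<Longrightarrow> opC G v (cscale c x) = cscale c (opC G v x)"
  using Y_props(7)[OF v] unfolding linear_between_def by blast+

lemma Qv_lin:
  assumes v: "v \<in> vertices G"
  shows "x \<in> Yd v \<Longrightarrow> opQ G v x \<in> Yd v" "x \<in> Yd v \<Longrightarrow> y \<in> Yd v \<Longrightarrow> opQ G v (x + y) = opQ G v x + opQ G v y"
    "x \<in> Yd v \<Longrightarrow> opQ G v (cscale c x) = cscale c (opQ G v x)"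
  using Y_props(8)[OF v] unfolding linear_between_def by blast+

lemma A_maps: assumes "z \<in> A_dom G" shows "A_op G z \<in> L2d G"
proof -
  obtain u x where z: "z = (u, x)" by (cases z)
  have d: "(u, x) \<in> L2d G" "\<And>v. v \<in> vertices G \<Longrightarrow> trace_at G v u \<in> Y v" "\<And>v. v \<in> vertices G \<Longrightarrow> x v \<in> Yd v"
    using assms unfolding z A_dom_iff by (auto simp: L2d_iff)
  show ?thesis
    unfolding z A_op_eq L2d_iff using d A1_props(1) B_lin(1) C_lin(1) Yd_closed(2) by auto
qed

lemma A_dom_subspace: "module.subspace state_scale (A_dom G)"
proof -
  interpret vector_space "state_scale :: complex \<Rightarrow> ('v, 'e) state \<Rightarrow> ('v, 'e) state" by (rule vector_space_state_scale)
  have HL: "z \<in> L2d G" if "z \<in> A_dom G" for z using that by (cases z) (simp add: A_dom_iff)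
  have scale: "state_scale c z \<in> A_dom G" if z: "z \<in> A_dom G" for c z
  proof -
    obtain u x where z_eq: "z = (u, x)" by (cases z)
    have d: "H1u u" "\<And>v. v \<in> vertices G \<Longrightarrow> trace_at G v u \<in> Y v \<and> x v = orth_proj (I v) (Yd v) (trace_at G v u)"
      using z unfolding z_eq A_dom_iff by blast+
    have mem: "state_scale c z \<in> L2d G" by (rule subspace_scale[OF subspace_L2d HL[OF z]])
    then have mem': "(\<lambda>p. l2_scale c (u p), \<lambda>v. cscale c (x v)) \<in> L2d G" unfolding z_eq state_scale_def by simp
    have tr: "trace_at G v (\<lambda>p. l2_scale c (u p)) = cscale c (trace_at G v u)" for v by (rule trace_scale[OF d(1)])
    show ?thesis
      unfolding z_eq state_scale_def prod.case A_dom_iff tr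
      using mem' H1u_scale[OF d(1)] d(2) Yd_proj(3)[OF _ trace_cvecs] cfun.subspace_scale[OF Y_props(1)]
      by simp
  qed
  have zero: "0 \<in> A_dom G"
  proof -
    have H0: "H1u 0" using H1_zero(1) len_pos comps_iff unfolding H1u_def by auto
    have mem: "(0, 0) \<in> L2d G" using subspace_0[OF subspace_L2d] by (simp add: zero_prod_def)
    have "(\<lambda>p. l2_scale 0 ((0 :: 'e \<times> nat \<Rightarrow> l2fun) p)) = 0" by (simp add: fun_eq_iff l2_scale_zero)
    then have tr: "trace_at G v (0 :: 'e \<times> nat \<Rightarrow> l2fun) = 0" for v
      using trace_scale[OF H0, of v 0] by (simp add: cscale_def zero_fun_def)
    have pr: "orth_proj (I v) (Yd v) 0 = 0" if v: "v \<in> vertices G" for v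
      using Yd_proj(3)[OF v, of 0 0] by (simp add: cvecs_def cscale_def zero_fun_def)
    show ?thesis
      unfolding zero_prod_def A_dom_iff tr using mem H0 pr cfun.subspace_0[OF Y_props(1)] by simp
  qed
  have add: "z + z' \<in> A_dom G" if z: "z \<in> A_dom G" "z' \<in> A_dom G" for z z'
  proof -
    obtain u x where z_eq: "z = (u, x)" by (cases z)
    obtain u' x' where z'_eq: "z' = (u', x')" by (cases z')
    have d: "H1u u" "\<And>v. v \<in> vertices G \<Longrightarrow> trace_at G v u \<in> Y v \<and> x v = orth_proj (I v) (Yd v) (trace_at G v u)"
      using z unfolding z_eq A_dom_iff by blast+
    have d': "H1u u'" "\<And>v. v \<in> vertices G \<Longrightarrow> trace_at G v u' \<in> Y v \<and> x' v = orth_proj (I v) (Yd v) (trace_at G v u')"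
      using z unfolding z'_eq A_dom_iff by blast+
    have "z + z' \<in> L2d G" by (rule subspace_add[OF subspace_L2d HL[OF z(1)] HL[OF z(2)]])
    then have mem: "(u + u', x + x') \<in> L2d G" unfolding z_eq z'_eq by simp
    have tr: "trace_at G v (u + u') = trace_at G v u + trace_at G v u'" for v by (rule trace_add[OF d(1) d'(1)])
    show ?thesis
      unfolding z_eq z'_eq plus_prod_def fst_conv snd_conv A_dom_iff tr
      using mem H1u_add[OF d(1) d'(1)] d(2) d'(2) Yd_proj(2)[OF _ trace_cvecs trace_cvecs] cfun.subspace_add[OF Y_props(1)]
      by simp
  qed
  show ?thesis unfolding subspace_def using zero add scale by blast
qed

lemma A_add: assumes z: "z \<in> A_dom G" "z' \<in> A_dom G" shows "A_op G (z + z') = A_op G z + A_op G z'"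
proof -
  obtain u x where z_eq: "z = (u, x)" by (cases z)
  obtain u' x' where z'_eq: "z' = (u', x')" by (cases z')
  have d: "H1u u" "\<And>v. v \<in> vertices G \<Longrightarrow> trace_at G v u \<in> Y v" "\<And>v. v \<in> vertices G \<Longrightarrow> x v \<in> Yd v"
    using z unfolding z_eq A_dom_iff L2d_iff by blast+
  have d': "H1u u'" "\<And>v. v \<in> vertices G \<Longrightarrow> trace_at G v u' \<in> Y v" "\<And>v. v \<in> vertices G \<Longrightarrow> x' v \<in> Yd v"
    using z unfolding z'_eq A_dom_iff L2d_iff by blast+
  have "A1 (u + u') e i = A1 u e i + A1 u' e i" if p: "(e, i) \<in> comps G" for e i
  proof (rule L2_on_eqI[OF A1_props(1)[OF p] L2_on_closed(2)[OF A1_props(1)[OF p] A1_props(1)[OF p]]])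
    have e: "e \<in> edges G" using p by (simp add: comps_iff)
    have "AE s in L e. \<forall>j<kdim G e. rep_l2 (wderiv (len G e) ((u + u') (e, j))) s
        = rep_l2 (wderiv (len G e) (u (e, j))) s + rep_l2 (wderiv (len G e) (u' (e, j))) s"
      by (rule all_AE) (use H1_add(2)[OF len_pos[OF e]] d(1) d'(1) e in \<open>simp add: H1u_def comps_iff\<close>)
    moreover have "AE s in L e. \<forall>j<kdim G e. rep_l2 ((u + u') (e, j)) s = rep_l2 (u (e, j)) s + rep_l2 (u' (e, j)) s"
      by (rule all_AE) (use rep_LI(1) in simp)
    ultimately show "AE s in L e. rep_l2 (A1 (u + u') e i) s = rep_l2 (A1 u e i + A1 u' e i) s"
      using A1_props(2)[OF p, of "u + u'"] A1_props(2)[OF p, of u] A1_props(2)[OF p, of u'] rep_LI(1)[of "A1 u e i" "A1 u' e i"]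
      by eventually_elim (simp add: distrib_left sum.distrib ac_simps)
  qed
  moreover have "opB G v (trace_at G v (u + u')) + opC G v ((x + x') v)
      = (opB G v (trace_at G v u) + opC G v (x v)) + (opB G v (trace_at G v u') + opC G v (x' v))"
    if v: "v \<in> vertices G" for v
  proof -
    have xv: "(x + x') v = x v + x' v" by (rule plus_fun_apply)
    show ?thesis
      unfolding trace_add[OF d(1) d'(1)] xv B_lin(2)[OF v d(2)[OF v] d'(2)[OF v]] C_lin(2)[OF v d(3)[OF v] d'(3)[OF v]]
      by (simp only: ac_simps)
  qed
  ultimately show ?thesis
    unfolding z_eq z'_eq plus_prod_def fst_conv snd_conv A_op_eq by (auto simp: fun_eq_iff)
qed

lemma A_scale: assumes z: "z \<in> A_dom G" shows "A_op G (state_scale c z) = state_scale c (A_op G z)"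
proof -
  obtain u x where z_eq: "z = (u, x)" by (cases z)
  have d: "H1u u" "\<And>v. v \<in> vertices G \<Longrightarrow> trace_at G v u \<in> Y v" "\<And>v. v \<in> vertices G \<Longrightarrow> x v \<in> Yd v"
    using z unfolding z_eq A_dom_iff L2d_iff by blast+
  have "A1 (\<lambda>p. l2_scale c (u p)) e i = l2_scale c (A1 u e i)" if p: "(e, i) \<in> comps G" for e i
  proof (rule L2_on_eqI[OF A1_props(1)[OF p] L2_on_closed(3)[OF A1_props(1)[OF p]]])
    have e: "e \<in> edges G" using p by (simp add: comps_iff)
    have "AE s in L e. \<forall>j<kdim G e. rep_l2 (wderiv (len G e) (l2_scale c (u (e, j)))) s
        = c * rep_l2 (wderiv (len G e) (u (e, j))) s"
      by (rule all_AE) (use H1_scale(2)[OF len_pos[OF e]] d(1) e in \<open>simp add: H1u_def comps_iff\<close>)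
    moreover have "AE s in L e. \<forall>j<kdim G e. rep_l2 (l2_scale c (u (e, j))) s = c * rep_l2 (u (e, j)) s"
      by (rule all_AE) (use rep_LI(2) in simp)
    ultimately show "AE s in L e. rep_l2 (A1 (\<lambda>p. l2_scale c (u p)) e i) s = rep_l2 (l2_scale c (A1 u e i)) s"
      using A1_props(2)[OF p, of "\<lambda>p. l2_scale c (u p)"] A1_props(2)[OF p, of u] rep_LI(2)[of c "A1 u e i"]
      by eventually_elim (simp add: distrib_left sum_distrib_left ac_simps)
  qed
  moreover have "opB G v (trace_at G v (\<lambda>p. l2_scale c (u p))) + opC G v (cscale c (x v))
      = cscale c (opB G v (trace_at G v u) + opC G v (x v))" if v: "v \<in> vertices G" for v
    unfolding trace_scale[OF d(1)] cfun.scale_right_distrib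
    using B_lin(3)[OF v d(2)[OF v]] C_lin(3)[OF v d(3)[OF v]] by simp
  ultimately show ?thesis
    unfolding z_eq state_scale_def prod.case A_op_eq
    by (auto simp: fun_eq_iff l2_scale_zero cscale_def)
qed


definition edge_value :: "('e \<times> nat \<Rightarrow> l2fun) \<Rightarrow> 'e \<Rightarrow> nat \<Rightarrow> real \<Rightarrow> complex" where
  "edge_value u e i s = point_value (len G e) (u (e, i)) s"

text \<open>The Hermitian form of \<open>Q M\<close>; integration by parts over an edge leaves the difference of its values at the endpoints.\<close>

definition endpoint_form :: "('e \<times> nat \<Rightarrow> l2fun) \<Rightarrow> 'e \<Rightarrow> real \<Rightarrow> complex" where
  "endpoint_form u e s = (\<Sum>i<kdim G e. \<Sum>k<kdim G e. QM e i k s * (edge_value u e k s * cnj (edge_value u e i s)))"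

text \<open>By the equation for \<open>A1\<close> the form is that of \<open>Q M u'\<close> with \<open>u\<close> plus that of \<open>Q N u\<close> with \<open>u\<close>; the latter is bounded by the
  energy. As \<open>Q M\<close> is Hermitian, twice the real part of the former pairs each entry of \<open>Q M\<close> with the derivative of a
  product of components of \<open>u\<close>, and \<open>AC_lipschitz_estimate\<close> applies with these products as \<open>F\<close>.\<close>

lemma edge_energy:
  assumes e: "e \<in> edges G"
  shows "\<exists>K\<ge>0. \<forall>u. H1u u \<longrightarrow>
    cmod (endpoint_form u e (len G e) - endpoint_form u e 0
      - of_real (2 * Re (LINT s|L e. edge_form e (\<lambda>j. rep_l2 (A1 u e j)) (comp_rep u e) s)))
    \<le> K * (\<Sum>i<kdim G e. En u e i)"
proof -
  let ?k = "kdim G e"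
  let ?l = "len G e"
  have l: "0 < ?l" by (rule len_pos[OF e])
  have "\<exists>K\<ge>0. \<forall>p\<in>{..<?k} \<times> {..<?k}. K-lipschitz_on {0..?l} (QM e (fst p) (snd p))"
  proof (rule finite_family_bound)
    show "\<exists>K. K-lipschitz_on {0..?l} (QM e (fst p) (snd p))" if "p \<in> {..<?k} \<times> {..<?k}" for p
      using QM_lip[OF e, of "fst p" "snd p"] that by auto
  qed (auto intro: lipschitz_on_le)
  then obtain K where K: "K \<ge> 0" "\<forall>p\<in>{..<?k} \<times> {..<?k}. K-lipschitz_on {0..?l} (QM e (fst p) (snd p))" by blast
  have K_lip: "K-lipschitz_on {0..?l} (QM e i k)" if "i < ?k" "k < ?k" for i k
    using bspec[OF K(2), of "(i, k)"] that by simp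
  obtain B where B: "B \<ge> 0" "\<forall>i<?k. \<forall>j<?k. (AE s in L e. cmod (Q e i j s) \<le> B) \<and>
    (AE s in L e. cmod (M e i j s) \<le> B) \<and> (AE s in L e. cmod (N e i j s) \<le> B)"
    using coeff_bounded[OF e] by blast
  define QN where "QN = (\<lambda>i k s. \<Sum>j<?k. Q e i j s * N e j k s)"
  define BB where "BB = real ?k * (B * B)"
  have BB: "0 \<le> BB" using B(1) by (simp add: BB_def)
  have QN_bound: "AE s in L e. \<forall>i<?k. \<forall>j<?k. cmod (QN i j s) \<le> BB"
  proof -
    have "AE s in L e. \<forall>i<?k. \<forall>j<?k. cmod (Q e i j s) \<le> B" using B(2) by (intro all_AE) blast
    moreover have "AE s in L e. \<forall>i<?k. \<forall>j<?k. cmod (N e i j s) \<le> B" using B(2) by (intro all_AE) blast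
    ultimately show ?thesis
    proof eventually_elim
      case (elim s)
      show ?case
      proof (intro allI impI)
        fix i j assume ij: "i < ?k" "j < ?k"
        have "cmod (QN i j s) \<le> (\<Sum>m<?k. cmod (Q e i m s) * cmod (N e m j s))"
          unfolding QN_def by (rule order_trans[OF norm_sum]) (simp add: norm_mult)
        also have "\<dots> \<le> (\<Sum>m<?k. B * B)"
          using elim ij B(1) by (intro sum_mono mult_mono) auto
        finally show "cmod (QN i j s) \<le> BB" by (simp add: BB_def)
      qed
    qed
  qed
  show ?thesis
  proof (intro exI[of _ "K * real ?k + 2 * (BB * real ?k)"] conjI allI impI)
    show "0 \<le> K * real ?k + 2 * (BB * real ?k)" using K(1) BB by simp
    fix u assume u: "H1u u"
    define f where "f = (\<lambda>i. rep_l2 (wderiv ?l (u (e, i))))"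
    define P where "P = (\<lambda>i F. AC ?l F (f i) \<and> (AE s in L e. comp_rep u e i s = F s) \<and>
      (\<forall>s\<in>{0..?l}. edge_value u e i s = F s))"
    have "\<forall>i\<in>{..<?k}. \<exists>F. P i F"
    proof
      fix i assume "i \<in> {..<?k}"
      then have "u (e, i) \<in> H1_on ?l" using u e by (auto simp: H1u_def comps_iff)
      from H1_cases[OF l this] show "\<exists>F. P i F"
        unfolding P_def f_def comp_rep_def edge_value_def by metis
    qed
    then obtain F where "\<forall>i\<in>{..<?k}. P i (F i)" by (rule bchoice[THEN exE])
    then have F: "AC ?l (F i) (f i)" "AE s in L e. comp_rep u e i s = F i s"
      "\<And>s. s \<in> {0..?l} \<Longrightarrow> edge_value u e i s = F i s" if "i < ?k" for i
      using that by (auto simp: P_def)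
    have Fc: "continuous_on {0..?l} (F i)" if "i < ?k" for i by (rule AC_continuous[OF F(1)[OF that]])
    have F_rep: "AE s in L e. \<forall>i<?k. comp_rep u e i s = F i s" by (rule all_AE) (rule F(2))
    have F_sq: "integrable (L e) (\<lambda>s. (cmod (F i s))\<^sup>2)" if i: "i < ?k" for i
      by (rule continuous_integrable_LI) (intro continuous_intros Fc i)
    have En_F: "En u e i = (LINT s|L e. (cmod (F i s))\<^sup>2)" if i: "i < ?k" for i
      unfolding En_def
    proof (rule integral_cong_AE)
      show "AE s in L e. (cmod (comp_rep u e i s))\<^sup>2 = (cmod (F i s))\<^sup>2" using F(2)[OF i] by eventually_elim simp
    qed (use comp_rep_sq F_sq[OF i] in \<open>blast intro: borel_measurable_integrable\<close>)+
    define H where "H = (\<lambda>i k s. F k s * cnj (F i s))"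
    define h where "h = (\<lambda>i k s. f k s * cnj (F i s) + F k s * cnj (f i s))"
    have H_AC: "AC ?l (H i k) (h i k)" if "i < ?k" "k < ?k" for i k
      unfolding H_def h_def by (rule AC_mult[OF F(1)[OF that(2)] AC_cnj[OF F(1)[OF that(1)]]])
    have QMc: "continuous_on {0..?l} (QM e i k)" if "i < ?k" "k < ?k" for i k
      by (rule lipschitz_on_continuous_on[OF K_lip[OF that]])
    have mult_cont: "integrable (L e) (\<lambda>s. a s * b s)" if ac: "continuous_on {0..?l} a" and bi: "integrable (L e) b"
      for a b :: "real \<Rightarrow> complex"
    proof -
      obtain C where C: "0 \<le> C" "\<And>x. x \<in> {0..?l} \<Longrightarrow> cmod (a x) \<le> C" using continuous_bounded_LI[OF ac] by metis
      have "integrable (L e) (\<lambda>s. b s * a s)"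
        by (rule integrable_mult_bounded[OF bi continuous_measurable_LI[OF ac], where B = C]) (use C(2) in \<open>intro AE_I2, simp\<close>)
      then show ?thesis by (simp add: mult.commute)
    qed
    have QMh: "integrable (L e) (\<lambda>s. QM e i k s * h i k s)" if "i < ?k" "k < ?k" for i k
      by (rule mult_cont[OF QMc[OF that]]) (use H_AC[OF that] in \<open>simp add: AC_def\<close>)
    define G1 where "G1 = (\<lambda>s. \<Sum>i<?k. \<Sum>k<?k. QM e i k s * (f k s * cnj (F i s)))"
    define G2 where "G2 = (\<lambda>s. \<Sum>i<?k. (\<Sum>k<?k. QN i k s * F k s) * cnj (F i s))"
    have G1_int: "integrable (L e) G1"
      unfolding G1_def
    proof (intro Bochner_Integration.integrable_sum)
      fix i k assume "i \<in> {..<?k}" "k \<in> {..<?k}"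
      then have ik: "i < ?k" "k < ?k" by auto
      have "integrable (L e) (f k)" using F(1)[OF ik(2)] by (simp add: AC_def)
      then have "integrable (L e) (\<lambda>s. (QM e i k s * cnj (F i s)) * f k s)"
        by (intro mult_cont continuous_intros QMc Fc ik)
      then show "integrable (L e) (\<lambda>s. QM e i k s * (f k s * cnj (F i s)))" by (simp add: ac_simps)
    qed
    have form_eq: "AE s in L e. edge_form e (\<lambda>j. rep_l2 (A1 u e j)) (comp_rep u e) s = G1 s + G2 s"
    proof -
      have "AE s in L e. \<forall>j<?k. rep_l2 (A1 u e j) s = (\<Sum>k<?k. M e j k s * f k s + N e j k s * comp_rep u e k s)"
        by (rule all_AE) (use A1_props(2)[of e _ u] e in \<open>simp add: comps_iff f_def comp_rep_def\<close>)
      then show ?thesis using F_rep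
      proof eventually_elim
        case (elim s)
        have "edge_form e (\<lambda>j. rep_l2 (A1 u e j)) (comp_rep u e) s
            = (\<Sum>i<?k. (\<Sum>j<?k. Q e i j s * (\<Sum>k<?k. M e j k s * f k s + N e j k s * F k s)) * cnj (F i s))"
          unfolding edge_form_def using elim by (intro sum.cong refl arg_cong2[where f = "(*)"]) auto
        also have "\<dots> = (\<Sum>i<?k. ((\<Sum>k<?k. QM e i k s * f k s) + (\<Sum>k<?k. QN i k s * F k s)) * cnj (F i s))"
        proof (intro sum.cong refl arg_cong2[where f = "(*)"])
          fix i
          have "(\<Sum>j<?k. Q e i j s * (\<Sum>k<?k. M e j k s * f k s + N e j k s * F k s))
              = (\<Sum>j<?k. \<Sum>k<?k. Q e i j s * M e j k s * f k s) + (\<Sum>j<?k. \<Sum>k<?k. Q e i j s * N e j k s * F k s)"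
            by (simp add: sum_distrib_left sum.distrib distrib_left mult.assoc)
          also have "\<dots> = (\<Sum>k<?k. \<Sum>j<?k. Q e i j s * M e j k s * f k s) + (\<Sum>k<?k. \<Sum>j<?k. Q e i j s * N e j k s * F k s)"
            by (intro arg_cong2[where f = "(+)"] sum.swap)
          also have "\<dots> = (\<Sum>k<?k. QM e i k s * f k s) + (\<Sum>k<?k. QN i k s * F k s)"
            by (simp add: QM_def QN_def sum_distrib_right)
          finally show "(\<Sum>j<?k. Q e i j s * (\<Sum>k<?k. M e j k s * f k s + N e j k s * F k s))
              = (\<Sum>k<?k. QM e i k s * f k s) + (\<Sum>k<?k. QN i k s * F k s)" .
        qed
        also have "\<dots> = G1 s + G2 s"
          by (simp add: G1_def G2_def distrib_right sum.distrib sum_distrib_right mult.assoc)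
        finally show ?case .
      qed
    qed
    have form_int1: "integrable (L e) (edge_form e (\<lambda>j. rep_l2 (A1 u e j)) (comp_rep u e))"
      by (rule edge_form_integrable[OF e]) (use comp_rep_sq rep_measurable_LI rep_square_integrable_LI in blast)+
    have G2_meas: "(\<lambda>s. edge_form e (\<lambda>j. rep_l2 (A1 u e j)) (comp_rep u e) s - G1 s) \<in> borel_measurable (L e)"
      using form_int1 G1_int by (intro borel_measurable_diff) auto
    define G2' where "G2' = (\<lambda>s. edge_form e (\<lambda>j. rep_l2 (A1 u e j)) (comp_rep u e) s - G1 s)"
    have G2'_int: "integrable (L e) G2'" unfolding G2'_def using form_int1 G1_int by (rule Bochner_Integration.integrable_diff)
    have total: "(LINT s|L e. edge_form e (\<lambda>j. rep_l2 (A1 u e j)) (comp_rep u e) s) = (LINT s|L e. G1 s) + (LINT s|L e. G2' s)"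
      unfolding G2'_def using form_int1 G1_int by simp
    have sumF_int: "integrable (L e) (\<lambda>s. \<Sum>i<?k. (cmod (F i s))\<^sup>2)"
      by (intro Bochner_Integration.integrable_sum F_sq) simp
    have sumF: "(LINT s|L e. (\<Sum>i<?k. (cmod (F i s))\<^sup>2)) = (\<Sum>i<?k. En u e i)"
      by (subst Bochner_Integration.integral_sum) (simp_all add: En_F F_sq)
    have G2_bound: "cmod (LINT s|L e. G2' s) \<le> BB * real ?k * (\<Sum>i<?k. En u e i)"
    proof -
      have "cmod (LINT s|L e. G2' s) \<le> (LINT s|L e. cmod (G2' s))" by (rule integral_norm_bound)
      also have "\<dots> \<le> (LINT s|L e. BB * real ?k * (\<Sum>i<?k. (cmod (F i s))\<^sup>2))"
      proof (rule integral_mono_AE)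
        show "integrable (L e) (\<lambda>s. cmod (G2' s))" by (rule integrable_norm[OF G2'_int])
        show "integrable (L e) (\<lambda>s. BB * real ?k * (\<Sum>i<?k. (cmod (F i s))\<^sup>2))" using sumF_int by simp
        show "AE s in L e. cmod (G2' s) \<le> BB * real ?k * (\<Sum>i<?k. (cmod (F i s))\<^sup>2)"
          using form_eq QN_bound
        proof eventually_elim
          case (elim s)
          have "G2' s = G2 s" using elim(1) by (simp add: G2'_def)
          then show ?case
            using matrix_form_bound[of ?k "\<lambda>i j. QN i j s" BB "\<lambda>j. F j s" "\<lambda>j. F j s"] elim(2) by (simp add: G2_def)
        qed
      qed
      also have "\<dots> = BB * real ?k * (\<Sum>i<?k. En u e i)" using sumF by simp
      finally show ?thesis .
    qed
    have G1_sym: "G1 s + cnj (G1 s) = (\<Sum>i<?k. \<Sum>k<?k. QM e i k s * h i k s)" if s: "s \<in> {0..?l}" for s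
    proof -
      have "cnj (G1 s) = (\<Sum>i<?k. \<Sum>k<?k. cnj (QM e i k s) * (cnj (f k s) * F i s))" by (simp add: G1_def)
      also have "\<dots> = (\<Sum>i<?k. \<Sum>k<?k. QM e k i s * (cnj (f k s) * F i s))"
        using QM_hermitian[OF e s] by (intro sum.cong refl) simp
      also have "\<dots> = (\<Sum>k<?k. \<Sum>i<?k. QM e k i s * (cnj (f k s) * F i s))" by (rule sum.swap)
      finally show ?thesis
        unfolding G1_def h_def by (simp add: sum.distrib distrib_left mult.commute[of "cnj _"])
    qed
    have Re_G1: "complex_of_real (2 * Re (LINT s|L e. G1 s)) = (\<Sum>i<?k. \<Sum>k<?k. LINT s|L e. QM e i k s * h i k s)"
    proof -
      have "complex_of_real (2 * Re (LINT s|L e. G1 s)) = (LINT s|L e. G1 s) + cnj (LINT s|L e. G1 s)"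
        by (simp add: complex_eq_iff)
      also have "\<dots> = (LINT s|L e. G1 s + cnj (G1 s))" using G1_int by simp
      also have "\<dots> = (LINT s|L e. (\<Sum>i<?k. \<Sum>k<?k. QM e i k s * h i k s))"
        using G1_sym by (intro Bochner_Integration.integral_cong) auto
      also have "\<dots> = (\<Sum>i<?k. \<Sum>k<?k. LINT s|L e. QM e i k s * h i k s)"
        using QMh by (subst Bochner_Integration.integral_sum; (intro Bochner_Integration.integrable_sum sum.cong refl)?; simp)
      finally show ?thesis .
    qed
    have ends: "endpoint_form u e s = (\<Sum>i<?k. \<Sum>k<?k. QM e i k s * H i k s)" if "s \<in> {0..?l}" for s
      unfolding endpoint_form_def H_def using F(3) that by (intro sum.cong refl) simp
    have H_bound: "(LINT s|L e. cmod (H i k s)) \<le> (En u e k + En u e i) / 2" if ik: "i < ?k" "k < ?k" for i k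
    proof -
      have "(LINT s|L e. cmod (H i k s)) \<le> (LINT s|L e. ((cmod (F k s))\<^sup>2 + (cmod (F i s))\<^sup>2) / 2)"
      proof (rule integral_mono)
        show "integrable (L e) (\<lambda>s. cmod (H i k s))"
          by (rule integrable_norm[OF continuous_integrable_LI[OF AC_continuous[OF H_AC[OF ik]]]])
        show "integrable (L e) (\<lambda>s. ((cmod (F k s))\<^sup>2 + (cmod (F i s))\<^sup>2) / 2)" using F_sq ik by simp
        show "cmod (H i k s) \<le> ((cmod (F k s))\<^sup>2 + (cmod (F i s))\<^sup>2) / 2" for s
          using sum_squares_bound[of "cmod (F k s)" "cmod (F i s)"] by (simp add: H_def norm_mult)
      qed
      also have "\<dots> = (En u e k + En u e i) / 2" using F_sq ik by (simp add: En_F)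
      finally show ?thesis .
    qed
    have "cmod (endpoint_form u e ?l - endpoint_form u e 0 - of_real (2 * Re (LINT s|L e. G1 s)))
        = cmod (\<Sum>i<?k. \<Sum>k<?k. QM e i k ?l * H i k ?l - QM e i k 0 * H i k 0 - (LINT s|L e. QM e i k s * h i k s))"
      unfolding Re_G1 using l by (simp add: ends sum_subtractf)
    also have "\<dots> \<le> (\<Sum>i<?k. \<Sum>k<?k. K * ((En u e k + En u e i) / 2))"
    proof (intro order_trans[OF norm_sum] sum_mono)
      fix i k assume "i \<in> {..<?k}" "k \<in> {..<?k}"
      then have ik: "i < ?k" "k < ?k" by auto
      have "cmod (QM e i k ?l * H i k ?l - QM e i k 0 * H i k 0 - (LINT s|L e. QM e i k s * h i k s))
          \<le> K * (LINT s|L e. cmod (H i k s))"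
        by (rule AC_lipschitz_estimate[OF _ H_AC[OF ik] K_lip[OF ik]]) (use l in simp)
      also have "\<dots> \<le> K * ((En u e k + En u e i) / 2)" by (rule mult_left_mono[OF H_bound[OF ik] K(1)])
      finally show "cmod (QM e i k ?l * H i k ?l - QM e i k 0 * H i k 0 - (LINT s|L e. QM e i k s * h i k s))
          \<le> K * ((En u e k + En u e i) / 2)" .
    qed
    also have "\<dots> = K * real ?k * (\<Sum>i<?k. En u e i)"
      by (simp add: sum.distrib add_divide_distrib distrib_left flip: sum_distrib_left sum_divide_distrib)
    finally have 1: "cmod (endpoint_form u e ?l - endpoint_form u e 0 - of_real (2 * Re (LINT s|L e. G1 s)))
        \<le> K * real ?k * (\<Sum>i<?k. En u e i)" .
    have 2: "cmod (of_real (2 * Re (LINT s|L e. G2' s))) \<le> 2 * (BB * real ?k * (\<Sum>i<?k. En u e i))"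
      using order_trans[OF abs_Re_le_cmod G2_bound] by simp
    have split: "endpoint_form u e ?l - endpoint_form u e 0
        - of_real (2 * Re (LINT s|L e. edge_form e (\<lambda>j. rep_l2 (A1 u e j)) (comp_rep u e) s))
        = (endpoint_form u e ?l - endpoint_form u e 0 - of_real (2 * Re (LINT s|L e. G1 s)))
          - of_real (2 * Re (LINT s|L e. G2' s))"
      unfolding total by simp
    show "cmod (endpoint_form u e ?l - endpoint_form u e 0
        - of_real (2 * Re (LINT s|L e. edge_form e (\<lambda>j. rep_l2 (A1 u e j)) (comp_rep u e) s)))
      \<le> (K * real ?k + 2 * (BB * real ?k)) * (\<Sum>i<?k. En u e i)"
      unfolding split using norm_triangle_le_diff[OF add_mono[OF 1 2]] by (simp add: algebra_simps)
  qed
qed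

end

section \<open>Almost skew-symmetry\<close>

context net begin

lemma T_form_edges:
  assumes v: "v \<in> vertices G"
  shows "cprod (I v) (opT G v (trace_at G v u)) (trace_at G v u)
    = (\<Sum>e\<in>edges_at G v. incidence G v e * endpoint_form u e (endpoint G v e))"
proof -
  have fin: "finite (edges_at G v)" by (rule finite_subset[OF _ finite_edges]) (auto simp: edges_at_iff)
  have one: "(\<Sum>i<kdim G e. opT G v (trace_at G v u) (e, i) * cnj (trace_at G v u (e, i)))
      = incidence G v e * endpoint_form u e (endpoint G v e)" if e: "e \<in> edges_at G v" for e
  proof -
    have e': "e \<in> edges G" using e by (simp add: edges_at_iff)
    let ?s = "endpoint G v e"
    have tr: "trace_at G v u (e, i) = edge_value u e i ?s" if "i < kdim G e" for i
      using e that by (simp add: trace_at_def comps_at_iff edge_value_def)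
    have "(\<Sum>i<kdim G e. opT G v (trace_at G v u) (e, i) * cnj (trace_at G v u (e, i)))
        = (\<Sum>i<kdim G e. (\<Sum>k<kdim G e. QM e i k ?s * incidence G v e * edge_value u e k ?s) * cnj (edge_value u e i ?s))"
      using e tr QM_entry[OF e' endpoint_in[OF e']]
      by (intro sum.cong refl arg_cong2[where f = "(*)"]) (auto simp: opT_def comps_at_iff intro!: sum.cong)
    also have "\<dots> = incidence G v e * endpoint_form u e ?s"
      unfolding endpoint_form_def sum_distrib_left sum_distrib_right by (simp add: ac_simps)
    finally show ?thesis .
  qed
  have "cprod (I v) (opT G v (trace_at G v u)) (trace_at G v u)
      = (\<Sum>e\<in>edges_at G v. \<Sum>i<kdim G e. opT G v (trace_at G v u) (e, i) * cnj (trace_at G v u (e, i)))"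
    unfolding cprod_def comps_at_def by (subst sum.Sigma) (use fin in \<open>auto simp: split_def\<close>)
  then show ?thesis using one by simp
qed

text \<open>Every edge contributes to exactly two vertices, with sign \<open>1\<close> at its terminal and \<open>-1\<close> at its
  initial endpoint; so the boundary terms of the edges add up to the forms of the \<open>opT G v\<close>.\<close>

lemma boundary_terms:
  "(\<Sum>v\<in>vertices G. cprod (I v) (opT G v (trace_at G v u)) (trace_at G v u))
    = (\<Sum>e\<in>edges G. endpoint_form u e (len G e) - endpoint_form u e 0)"
proof -
  let ?g = "\<lambda>v e. incidence G v e * endpoint_form u e (endpoint G v e)"
  have at: "edges_at G v = {e. e \<in> edges G \<and> (v = head (graph G) e \<or> v = tail (graph G) e)}" for v
    by (auto simp: edges_at_iff)
  have "(\<Sum>v\<in>vertices G. cprod (I v) (opT G v (trace_at G v u)) (trace_at G v u))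
      = (\<Sum>v\<in>vertices G. \<Sum>e\<in>{e. e \<in> edges G \<and> (v = head (graph G) e \<or> v = tail (graph G) e)}. ?g v e)"
    by (intro sum.cong refl) (simp add: T_form_edges at)
  also have "\<dots> = (\<Sum>e\<in>edges G. \<Sum>v\<in>{v. v \<in> vertices G \<and> (v = head (graph G) e \<or> v = tail (graph G) e)}. ?g v e)"
    by (rule sum.swap_restrict) simp_all
  also have "\<dots> = (\<Sum>e\<in>edges G. endpoint_form u e (len G e) - endpoint_form u e 0)"
  proof (rule sum.cong[OF refl])
    fix e assume e: "e \<in> edges G"
    have "{v. v \<in> vertices G \<and> (v = head (graph G) e \<or> v = tail (graph G) e)} = {head (graph G) e, tail (graph G) e}"
      using endpoints_in[OF e] by auto
    then show "(\<Sum>v\<in>{v. v \<in> vertices G \<and> (v = head (graph G) e \<or> v = tail (graph G) e)}. ?g v e)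
        = endpoint_form u e (len G e) - endpoint_form u e 0"
      using no_loop[OF e] by (auto simp: incidence_def endpoint_def)
  qed
  finally show ?thesis .
qed

text \<open>At the vertices the isotropy condition turns the endpoint terms into the negative of the contribution of \<open>opB\<close>. The
  projection in the definition of the domain may be dropped there, the other argument lying in \<open>spaceYd\<close>.\<close>

lemma almost_skew:
  assumes skew: "\<And>v \<xi>. v \<in> vertices G \<Longrightarrow> \<xi> \<in> Y v \<Longrightarrow>
    cprod (I v) (opT G v \<xi>) \<xi> + of_real (2 * Re (cprod (I v) (opQ G v (opB G v \<xi>)) \<xi>)) = 0"
  shows "\<exists>w\<ge>0. \<forall>z\<in>A_dom G. \<bar>Re (L2d_inner G (A_op G z) z)\<bar> \<le> w * Re (L2d_inner G z z)"
proof -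
  let ?edge = "\<lambda>u e. (LINT s|L e. edge_form e (\<lambda>j. rep_l2 (A1 u e j)) (comp_rep u e) s)"
  let ?E = "\<lambda>u e. \<Sum>i<kdim G e. En u e i"
  have "\<forall>e\<in>edges G. \<exists>K. 0 \<le> K \<and> (\<forall>u. H1u u \<longrightarrow>
      cmod (endpoint_form u e (len G e) - endpoint_form u e 0 - of_real (2 * Re (?edge u e))) \<le> K * ?E u e)"
    using edge_energy by blast
  then obtain k where k: "\<forall>e\<in>edges G. 0 \<le> k e \<and> (\<forall>u. H1u u \<longrightarrow>
      cmod (endpoint_form u e (len G e) - endpoint_form u e 0 - of_real (2 * Re (?edge u e))) \<le> k e * ?E u e)"
    by (rule bchoice[THEN exE])
  have "\<forall>v\<in>vertices G. \<exists>K. 0 \<le> K \<and> (\<forall>x\<in>Yd v. cmod (cprod (I v) (opQ G v (opC G v x)) x) \<le> K * Re (cprod (I v) (opQ G v x) x))"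
  proof
    fix v assume v: "v \<in> vertices G"
    show "\<exists>K. 0 \<le> K \<and> (\<forall>x\<in>Yd v. cmod (cprod (I v) (opQ G v (opC G v x)) x) \<le> K * Re (cprod (I v) (opQ G v x) x))"
      using quadratic_form_bounded[OF finite_comps(2) Y_props(3)[OF v] Y_props(5)[OF v] Qv_inner[OF v], of "\<lambda>x. opQ G v (opC G v x)"]
        C_lin[OF v] Qv_lin[OF v] by simp
  qed
  then obtain c where c: "\<forall>v\<in>vertices G. 0 \<le> c v \<and> (\<forall>x\<in>Yd v. cmod (cprod (I v) (opQ G v (opC G v x)) x) \<le> c v * Re (cprod (I v) (opQ G v x) x))"
    by (rule bchoice[THEN exE])
  obtain q where q: "q > 0" "\<forall>u x. q * (\<Sum>e\<in>edges G. ?E u e) + (\<Sum>v\<in>vertices G. Ev x v) \<le> Re (L2d_inner G (u, x) (u, x))"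
    using inner_lower by blast
  define KE where "KE = (\<Sum>e\<in>edges G. k e)"
  define KV where "KV = (\<Sum>v\<in>vertices G. c v)"
  have KE: "0 \<le> KE" "\<And>e. e \<in> edges G \<Longrightarrow> k e \<le> KE"
    using k unfolding KE_def by (auto intro!: sum_nonneg member_le_sum)
  have KV: "0 \<le> KV" "\<And>v. v \<in> vertices G \<Longrightarrow> c v \<le> KV"
    using c unfolding KV_def by (auto intro!: sum_nonneg member_le_sum)
  show ?thesis
  proof (intro exI[of _ "KE / (2 * q) + KV"] conjI ballI)
    show "0 \<le> KE / (2 * q) + KV" using KE(1) KV(1) q(1) by simp
    fix z assume z: "z \<in> A_dom G"
    obtain u x where z_eq: "z = (u, x)" by (cases z)
    have d: "(u, x) \<in> L2d G" "H1u u" "\<And>v. v \<in> vertices G \<Longrightarrow> trace_at G v u \<in> Y v \<and> x v = orth_proj (I v) (Yd v) (trace_at G v u)"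
      using z unfolding z_eq A_dom_iff by blast+
    have x: "x v \<in> Yd v" if "v \<in> vertices G" for v using d(1) that by (simp add: L2d_iff)
    let ?t = "\<lambda>v. trace_at G v u"
    define D where "D = (\<lambda>e. endpoint_form u e (len G e) - endpoint_form u e 0)"
    define b where "b = (\<lambda>v. cprod (I v) (opQ G v (opB G v (?t v))) (?t v))"
    define r where "r = (\<lambda>v. cprod (I v) (opQ G v (opC G v (x v))) (x v))"
    have inner: "L2d_inner G (A_op G z) z = (\<Sum>e\<in>edges G. ?edge u e) + (\<Sum>v\<in>vertices G. b v + r v)"
    proof -
      have "(LINT s|L e. edge_form e (comp_rep (\<lambda>(e, i). if (e, i) \<in> comps G then A1 u e i else 0) e) (comp_rep u e) s) = ?edge u e"
        if "e \<in> edges G" for e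
        using that by (intro Bochner_Integration.integral_cong refl) (simp add: edge_form_def comp_rep_def comps_iff)
      moreover have "cprod (I v) (opQ G v (if v \<in> vertices G then opB G v (?t v) + opC G v (x v) else 0)) (x v) = b v + r v"
        if v: "v \<in> vertices G" for v
      proof -
        have "cprod (I v) (opQ G v (opB G v (?t v))) (x v) = b v"
          using d(3)[OF v] Yd_proj(5)[OF v trace_cvecs Qv_lin(1)[OF v B_lin(1)[OF v]]] unfolding b_def by simp
        moreover have "opQ G v (opB G v (?t v) + opC G v (x v)) = opQ G v (opB G v (?t v)) + opQ G v (opC G v (x v))"
          by (rule Qv_lin(2)[OF v B_lin(1)[OF v] C_lin(1)[OF v x[OF v]]]) (use d(3)[OF v] in blast)
        ultimately show ?thesis using v by (simp only: cprod_simps r_def if_True)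
      qed
      ultimately show ?thesis unfolding z_eq A_op_eq L2d_inner_eq by simp
    qed
    have "(\<Sum>v\<in>vertices G. cprod (I v) (opT G v (?t v)) (?t v)) = (\<Sum>v\<in>vertices G. - of_real (2 * Re (b v)))"
      using skew d(3) unfolding b_def by (intro sum.cong refl) (simp add: eq_neg_iff_add_eq_0)
    then have "(\<Sum>e\<in>edges G. D e) = - of_real (\<Sum>v\<in>vertices G. 2 * Re (b v))"
      unfolding boundary_terms D_def by (simp add: sum_negf)
    then have "complex_of_real (2 * Re (L2d_inner G (A_op G z) z))
        = - (\<Sum>e\<in>edges G. D e - of_real (2 * Re (?edge u e))) + of_real (\<Sum>v\<in>vertices G. 2 * Re (r v))"
      unfolding inner by (simp add: sum_subtractf sum.distrib sum_distrib_left distrib_left)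
    then have "cmod (complex_of_real (2 * Re (L2d_inner G (A_op G z) z)))
        \<le> cmod (- (\<Sum>e\<in>edges G. D e - of_real (2 * Re (?edge u e)))) + cmod (complex_of_real (\<Sum>v\<in>vertices G. 2 * Re (r v)))"
      by (simp only: norm_triangle_ineq)
    then have "cmod (complex_of_real (2 * Re (L2d_inner G (A_op G z) z)))
        \<le> cmod (\<Sum>e\<in>edges G. D e - of_real (2 * Re (?edge u e))) + cmod (complex_of_real (\<Sum>v\<in>vertices G. 2 * Re (r v)))"
      unfolding norm_minus_cancel .
    also have "\<dots> \<le> (\<Sum>e\<in>edges G. KE * ?E u e) + (\<Sum>v\<in>vertices G. 2 * (KV * Ev x v))"
    proof (rule add_mono)
      show "cmod (\<Sum>e\<in>edges G. D e - of_real (2 * Re (?edge u e))) \<le> (\<Sum>e\<in>edges G. KE * ?E u e)"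
      proof (rule order_trans[OF norm_sum], rule sum_mono)
        fix e assume e: "e \<in> edges G"
        have "cmod (D e - of_real (2 * Re (?edge u e))) \<le> k e * ?E u e"
          using bspec[OF k e] d(2) unfolding D_def by blast
        also have "\<dots> \<le> KE * ?E u e" by (intro mult_right_mono KE(2)[OF e] sum_nonneg En_nonneg)
        finally show "cmod (D e - of_real (2 * Re (?edge u e))) \<le> KE * ?E u e" .
      qed
      have "cmod (complex_of_real (\<Sum>v\<in>vertices G. 2 * Re (r v))) \<le> (\<Sum>v\<in>vertices G. \<bar>2 * Re (r v)\<bar>)"
        unfolding norm_of_real by (rule sum_abs)
      also have "\<dots> \<le> (\<Sum>v\<in>vertices G. 2 * (KV * Ev x v))"
      proof (rule sum_mono)
        fix v assume v: "v \<in> vertices G"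
        have "\<bar>Re (r v)\<bar> \<le> cmod (r v)" by (rule abs_Re_le_cmod)
        also have "\<dots> \<le> c v * Ev x v" using bspec[OF c v] x[OF v] unfolding r_def Ev_def by blast
        also have "\<dots> \<le> KV * Ev x v" by (intro mult_right_mono KV(2)[OF v] Ev_nonneg[OF v] x[OF v])
        finally show "\<bar>2 * Re (r v)\<bar> \<le> 2 * (KV * Ev x v)" by simp
      qed
      finally show "cmod (complex_of_real (\<Sum>v\<in>vertices G. 2 * Re (r v))) \<le> (\<Sum>v\<in>vertices G. 2 * (KV * Ev x v))" .
    qed
    also have "\<dots> = KE * (\<Sum>e\<in>edges G. ?E u e) + 2 * KV * (\<Sum>v\<in>vertices G. Ev x v)"
      by (simp add: sum_distrib_left mult.assoc)
    finally have est: "\<bar>2 * Re (L2d_inner G (A_op G z) z)\<bar> \<le> KE * (\<Sum>e\<in>edges G. ?E u e) + 2 * KV * (\<Sum>v\<in>vertices G. Ev x v)"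
      by (simp only: norm_of_real)
    define SE where "SE = (\<Sum>e\<in>edges G. ?E u e)"
    define SV where "SV = (\<Sum>v\<in>vertices G. Ev x v)"
    have S: "0 \<le> SE" "0 \<le> SV" unfolding SE_def SV_def by (intro sum_nonneg En_nonneg Ev_nonneg x; assumption)+
    have "KE * SE + 2 * KV * SV \<le> (2 * (KE / (2 * q) + KV)) * (q * SE + SV)"
    proof -
      have "(2 * (KE / (2 * q) + KV)) * (q * SE + SV) = KE * SE + 2 * KV * SV + KE / q * SV + 2 * KV * q * SE"
        using q(1) by (simp add: field_simps)
      moreover have "0 \<le> KE / q * SV" "0 \<le> 2 * KV * q * SE" using KE(1) KV(1) q(1) S by simp_all
      ultimately show ?thesis by linarith
    qed
    also have "\<dots> \<le> (2 * (KE / (2 * q) + KV)) * Re (L2d_inner G z z)"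
      using q KE(1) KV(1) unfolding z_eq SE_def SV_def by (intro mult_left_mono) auto
    finally have "\<bar>2 * Re (L2d_inner G (A_op G z) z)\<bar> \<le> 2 * ((KE / (2 * q) + KV) * Re (L2d_inner G z z))"
      using est unfolding SE_def SV_def mult.assoc[of 2] by (rule order_trans[rotated])
    then show "\<bar>Re (L2d_inner G (A_op G z) z)\<bar> \<le> (KE / (2 * q) + KV) * Re (L2d_inner G z z)"
      unfolding abs_mult by (simp only: abs_numeral mult_le_cancel_left_pos zero_less_numeral)
  qed
qed

end

section \<open>Solvability of the stationary equation\<close>

lemma square_integrable_product:
  fixes f p :: "real \<Rightarrow> complex"
  assumes f: "f \<in> borel_measurable (LI l) \<and> integrable (LI l) (\<lambda>s. (cmod (f s))\<^sup>2)"
    and p: "p \<in> borel_measurable (LI l)" "AE s in LI l. cmod (p s) \<le> B"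
  shows "(\<lambda>s. p s * f s) \<in> borel_measurable (LI l) \<and> integrable (LI l) (\<lambda>s. (cmod (p s * f s))\<^sup>2)"
  using borel_measurable_times[OF p(1) conjunct1[OF f]]
    square_integrable_mult_bounded[OF conjunct1[OF f] conjunct2[OF f] p] by blast

context net begin

text \<open>The family \<open>V\<close> solves \<open>V - h (M V' + N V) = a\<close> almost everywhere on the edge \<open>e\<close>, with components whose derivatives are
  square integrable.\<close>

definition edge_solution :: "'e \<Rightarrow> complex \<Rightarrow> (nat \<Rightarrow> real \<Rightarrow> complex) \<Rightarrow> (nat \<Rightarrow> real \<Rightarrow> complex) \<Rightarrow> bool" where
  "edge_solution e h a V \<longleftrightarrow> (\<exists>f. \<forall>i<kdim G e. AC (len G e) (V i) (f i) \<and> f i \<in> borel_measurable (L e) \<and>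
     integrable (L e) (\<lambda>s. (cmod (f i s))\<^sup>2) \<and>
     (AE s in L e. V i s - h * (\<Sum>j<kdim G e. M e i j s * f j s + N e i j s * V j s) = a i s))"

text \<open>Multiplied by the inverse \<open>R\<close> of \<open>M\<close>, the equation is \<open>V' = P V + g\<close> with \<open>P\<close> bounded.\<close>

lemma edge_solution_exists:
  assumes e: "e \<in> edges G" and h: "h \<noteq> 0"
    and a: "\<And>i. i < kdim G e \<Longrightarrow> a i \<in> borel_measurable (L e) \<and> integrable (L e) (\<lambda>s. (cmod (a i s))\<^sup>2)"
  shows "\<exists>V. edge_solution e h a V \<and> (\<forall>i<kdim G e. V i 0 = c i)"
proof -
  let ?k = "kdim G e"
  let ?l = "len G e"
  have ce: "lipschitz_mat ?k ?l (matM G e)" "\<forall>x\<in>{0..?l}. invertible_mat (matM G e x)"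
    using bspec[OF coeff[unfolded edge_coefficients_def] e] by blast+
  have "\<exists>R. (\<forall>i<?k. \<forall>j<?k. continuous_on {0..?l} (R i j)) \<and>
    (\<forall>x\<in>{0..?l}. \<forall>i<?k. \<forall>j<?k. (\<Sum>k<?k. matM G e x $$ (i, k) * R k j x) = (if i = j then 1 else 0))"
    using ce coeff_cont(2)[OF e] by (intro inverse_mat_continuous) (auto simp: lipschitz_mat_def)
  then obtain R where R: "\<And>i j. i < ?k \<Longrightarrow> j < ?k \<Longrightarrow> continuous_on {0..?l} (R i j)"
    "\<And>x i j. x \<in> {0..?l} \<Longrightarrow> i < ?k \<Longrightarrow> j < ?k \<Longrightarrow> (\<Sum>k<?k. M e i k x * R k j x) = (if i = j then 1 else 0)"
    by blast
  have "\<exists>K\<ge>0. \<forall>p\<in>{..<?k} \<times> {..<?k}. \<forall>x\<in>{0..?l}. cmod (R (fst p) (snd p) x) \<le> K"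
  proof (rule finite_family_bound)
    fix p assume "p \<in> {..<?k} \<times> {..<?k}"
    then have "continuous_on {0..?l} (R (fst p) (snd p))" by (intro R(1)) auto
    then show "\<exists>K. \<forall>x\<in>{0..?l}. cmod (R (fst p) (snd p) x) \<le> K" by (rule continuous_bounded_LI) blast
  qed (auto intro: order_trans)
  then obtain K where K: "0 \<le> K" "\<forall>p\<in>{..<?k} \<times> {..<?k}. \<forall>x\<in>{0..?l}. cmod (R (fst p) (snd p) x) \<le> K" by blast
  have RK: "cmod (R i j x) \<le> K" if "i < ?k" "j < ?k" "x \<in> {0..?l}" for i j x
    using bspec[OF bspec[OF K(2), of "(i, j)"] that(3)] that by simp
  obtain B where B: "B \<ge> 0" "\<forall>i<?k. \<forall>j<?k. (AE s in L e. cmod (Q e i j s) \<le> B) \<and>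
    (AE s in L e. cmod (M e i j s) \<le> B) \<and> (AE s in L e. cmod (N e i j s) \<le> B)"
    using coeff_bounded[OF e] by blast
  have Rm: "R i j \<in> borel_measurable (L e)" if "i < ?k" "j < ?k" for i j
    by (rule continuous_measurable_LI[OF R(1)[OF that]])
  define P where "P = (\<lambda>i j s. \<Sum>m<?k. R i m s * ((if m = j then 1 / h else 0) - N e m j s))"
  define g where "g = (\<lambda>i s. \<Sum>m<?k. (- (1 / h) * R i m s) * a m s)"
  have Pm: "P i j \<in> borel_measurable (L e)" if "i < ?k" "j < ?k" for i j
    unfolding P_def
    by (rule borel_measurable_sum, rule borel_measurable_times[OF Rm borel_measurable_diff[OF _ coeff_meas(3)[OF e]]])
      (use that in auto)
  define BB where "BB = real ?k * (K * (cmod (1 / h) + B))"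
  have Pb: "AE s in L e. cmod (P i j s) \<le> BB" if ij: "i < ?k" "j < ?k" for i j
  proof -
    have "AE s in L e. \<forall>m<?k. cmod (N e m j s) \<le> B" using B(2) ij by (intro all_AE) blast
    moreover have "AE s in L e. s \<in> {0..?l}" by (rule AE_I2) simp
    ultimately show ?thesis
    proof eventually_elim
      case (elim s)
      have "cmod (P i j s) \<le> (\<Sum>m<?k. cmod (R i m s) * cmod ((if m = j then 1 / h else 0) - N e m j s))"
        unfolding P_def by (rule order_trans[OF norm_sum]) (simp only: norm_mult order_refl)
      also have "\<dots> \<le> (\<Sum>m<?k. K * (cmod (1 / h) + B))"
      proof (intro sum_mono mult_mono)
        fix m assume m: "m \<in> {..<?k}"
        have "cmod (if m = j then 1 / h else 0) \<le> cmod (1 / h)" by simp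
        moreover have "cmod (N e m j s) \<le> B" using elim m by simp
        ultimately show "cmod ((if m = j then 1 / h else 0) - N e m j s) \<le> cmod (1 / h) + B"
          by (intro order_trans[OF norm_triangle_ineq4] add_mono)
      qed (use elim ij RK K(1) in auto)
      finally show ?case by (simp add: BB_def)
    qed
  qed
  have g_sq: "g i \<in> borel_measurable (L e) \<and> integrable (L e) (\<lambda>s. (cmod (g i s))\<^sup>2)" if i: "i < ?k" for i
    unfolding g_def
  proof (rule square_integrable_sum)
    fix m assume "m \<in> {..<?k}"
    then have m: "m < ?k" by simp
    have Rm': "(\<lambda>s. - (1 / h) * R i m s) \<in> borel_measurable (L e)"
      by (rule borel_measurable_times[OF borel_measurable_const Rm[OF i m]])
    have "AE s in L e. cmod (- (1 / h) * R i m s) \<le> cmod (1 / h) * K"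
    proof (rule AE_I2)
      fix s assume "s \<in> space (L e)"
      then have "cmod (R i m s) \<le> K" using RK[OF i m] by simp
      then show "cmod (- (1 / h) * R i m s) \<le> cmod (1 / h) * K"
        unfolding norm_mult norm_minus_cancel by (rule mult_left_mono) simp
    qed
    then show "(\<lambda>s. - (1 / h) * R i m s * a m s) \<in> borel_measurable (L e) \<and>
        integrable (L e) (\<lambda>s. (cmod (- (1 / h) * R i m s * a m s))\<^sup>2)"
      by (rule square_integrable_product[OF a[OF m] Rm'])
  qed simp
  have "\<exists>u. \<forall>i\<in>{..<?k}. u i 0 = c i \<and> AC ?l (u i) (\<lambda>x. (\<Sum>j\<in>{..<?k}. P i j x * u j x) + g i x)"
  proof (rule linear_ode_exists)
    show "P i j \<in> borel_measurable (L e)" "AE s in L e. cmod (P i j s) \<le> BB"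
      if "i \<in> {..<?k}" "j \<in> {..<?k}" for i j using Pm[of i j] Pb[of i j] that by simp_all
    show "integrable (L e) (g i)" if "i \<in> {..<?k}" for i
      using square_integrable_LI[OF conjunct1[OF g_sq[of i]] conjunct2[OF g_sq[of i]]] that by simp
  qed (use len_pos[OF e] in simp_all)
  then obtain V where V: "\<forall>i\<in>{..<?k}. V i 0 = c i \<and> AC ?l (V i) (\<lambda>x. (\<Sum>j\<in>{..<?k}. P i j x * V j x) + g i x)" by blast
  define f where "f = (\<lambda>i x. (\<Sum>j<?k. P i j x * V j x) + g i x)"
  have VAC: "AC ?l (V i) (f i)" if "i < ?k" for i using bspec[OF V, of i] that unfolding f_def by simp
  have Vc: "continuous_on {0..?l} (V i)" if "i < ?k" for i by (rule AC_continuous[OF VAC[OF that]])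
  have V_sq: "V i \<in> borel_measurable (L e) \<and> integrable (L e) (\<lambda>s. (cmod (V i s))\<^sup>2)" if i: "i < ?k" for i
  proof
    show "V i \<in> borel_measurable (L e)" by (rule continuous_measurable_LI[OF Vc[OF i]])
    show "integrable (L e) (\<lambda>s. (cmod (V i s))\<^sup>2)" by (rule continuous_integrable_LI) (intro continuous_intros Vc i)
  qed
  have f_sq: "f i \<in> borel_measurable (L e) \<and> integrable (L e) (\<lambda>s. (cmod (f i s))\<^sup>2)" if i: "i < ?k" for i
  proof -
    have 1: "(\<lambda>s. \<Sum>j\<in>{..<?k}. P i j s * V j s) \<in> borel_measurable (L e) \<and>
        integrable (L e) (\<lambda>s. (cmod (\<Sum>j\<in>{..<?k}. P i j s * V j s))\<^sup>2)"
    proof (rule square_integrable_sum)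
      fix j assume "j \<in> {..<?k}"
      then have j: "j < ?k" by simp
      show "(\<lambda>s. P i j s * V j s) \<in> borel_measurable (L e) \<and> integrable (L e) (\<lambda>s. (cmod (P i j s * V j s))\<^sup>2)"
        by (rule square_integrable_product[OF V_sq[OF j] Pm[OF i j] Pb[OF i j]])
    qed simp
    show ?thesis
      unfolding f_def using borel_measurable_add[OF conjunct1[OF 1] conjunct1[OF g_sq[OF i]]]
        square_integrable_add[OF conjunct1[OF 1] conjunct2[OF 1] conjunct1[OF g_sq[OF i]] conjunct2[OF g_sq[OF i]]] by blast
  qed
  have eq: "V i s - h * (\<Sum>j<?k. M e i j s * f j s + N e i j s * V j s) = a i s" if i: "i < ?k" and s: "s \<in> {0..?l}" for i s
  proof -
    \<comment> \<open>the right-hand side of the differential equation is \<open>R\<close> applied to \<open>w\<close>\<close>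
    define w where "w = (\<lambda>m. (1 / h) * V m s - (\<Sum>j<?k. N e m j s * V j s) - (1 / h) * a m s)"
    have fw: "f j s = (\<Sum>m<?k. R j m s * w m)" for j
    proof -
      have "(\<Sum>n<?k. P j n s * V n s) = (\<Sum>n<?k. \<Sum>m<?k. R j m s * ((if m = n then 1 / h else 0) * V n s - N e m n s * V n s))"
        unfolding P_def sum_distrib_right by (simp only: mult.assoc left_diff_distrib)
      also have "\<dots> = (\<Sum>m<?k. \<Sum>n<?k. R j m s * ((if m = n then 1 / h else 0) * V n s - N e m n s * V n s))"
        by (rule sum.swap)
      also have "\<dots> = (\<Sum>m<?k. R j m s * ((1 / h) * V m s - (\<Sum>n<?k. N e m n s * V n s)))"
      proof (rule sum.cong[OF refl])
        fix m assume m: "m \<in> {..<?k}"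
        have "(\<Sum>n<?k. (if m = n then 1 / h else 0) * V n s) = (\<Sum>n<?k. if m = n then (1 / h) * V n s else 0)"
          by (intro sum.cong) auto
        also have "\<dots> = (1 / h) * V m s" using m by (subst sum.delta') auto
        finally show "(\<Sum>n<?k. R j m s * ((if m = n then 1 / h else 0) * V n s - N e m n s * V n s))
            = R j m s * ((1 / h) * V m s - (\<Sum>n<?k. N e m n s * V n s))"
          by (simp only: sum_distrib_left[symmetric] sum_subtractf)
      qed
      finally show ?thesis
        unfolding f_def g_def w_def by (simp add: sum.distrib[symmetric] sum_subtractf[symmetric] algebra_simps)
    qed
    have "(\<Sum>j<?k. M e i j s * f j s) = (\<Sum>j<?k. \<Sum>m<?k. M e i j s * R j m s * w m)"
      unfolding fw by (simp add: sum_distrib_left mult.assoc)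
    also have "\<dots> = (\<Sum>m<?k. \<Sum>j<?k. M e i j s * R j m s * w m)" by (rule sum.swap)
    also have "\<dots> = (\<Sum>m<?k. if i = m then w m else 0)"
      using R(2)[OF s i] by (intro sum.cong refl) (simp add: sum_distrib_right[symmetric])
    also have "\<dots> = w i" using i by (subst sum.delta') auto
    finally have "(\<Sum>j<?k. M e i j s * f j s + N e i j s * V j s) = (1 / h) * V i s - (1 / h) * a i s"
      unfolding sum.distrib w_def by simp
    then show ?thesis using h by (simp add: right_diff_distrib)
  qed
  have "edge_solution e h a V"
    unfolding edge_solution_def
  proof (intro exI[of _ f] allI impI conjI)
    fix i assume i: "i < ?k"
    show "AE s in L e. V i s - h * (\<Sum>j<?k. M e i j s * f j s + N e i j s * V j s) = a i s"
      by (rule AE_I2) (use eq[OF i] in simp)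
  qed (use VAC f_sq in blast)+
  then show ?thesis using V by auto
qed

lemma edge_solution_combine:
  fixes n :: nat
  assumes "edge_solution e h a V" and "\<And>m. m < n \<Longrightarrow> edge_solution e h (\<lambda>i s. 0) (W m)"
  shows "edge_solution e h a (\<lambda>i s. V i s + (\<Sum>m<n. c m * W m i s))"
  using assms(2)
proof (induction n)
  case 0
  then show ?case using assms(1) by simp
next
  case (Suc n)
  define U where "U = (\<lambda>i s. V i s + (\<Sum>m<n. c m * W m i s))"
  have "edge_solution e h a U" unfolding U_def using Suc by simp
  then obtain f where f: "\<And>i. i < kdim G e \<Longrightarrow> AC (len G e) (U i) (f i) \<and> f i \<in> borel_measurable (L e) \<and>
     integrable (L e) (\<lambda>s. (cmod (f i s))\<^sup>2) \<and>
     (AE s in L e. U i s - h * (\<Sum>j<kdim G e. M e i j s * f j s + N e i j s * U j s) = a i s)"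
    unfolding edge_solution_def by blast
  have "edge_solution e h (\<lambda>i s. 0) (W n)" using Suc.prems by simp
  then obtain g where g: "\<And>i. i < kdim G e \<Longrightarrow> AC (len G e) (W n i) (g i) \<and> g i \<in> borel_measurable (L e) \<and>
     integrable (L e) (\<lambda>s. (cmod (g i s))\<^sup>2) \<and>
     (AE s in L e. W n i s - h * (\<Sum>j<kdim G e. M e i j s * g j s + N e i j s * W n j s) = 0)"
    unfolding edge_solution_def by blast
  have "edge_solution e h a (\<lambda>i s. U i s + c n * W n i s)"
    unfolding edge_solution_def
  proof (intro exI[of _ "\<lambda>i s. f i s + c n * g i s"] allI impI conjI)
    fix i assume i: "i < kdim G e"
    note fi = f[OF i] and gi = g[OF i]
    have gs: "integrable (L e) (\<lambda>s. (cmod (c n * g i s))\<^sup>2)" using gi by (simp add: norm_mult power_mult_distrib)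
    show "AC (len G e) (\<lambda>s. U i s + c n * W n i s) (\<lambda>s. f i s + c n * g i s)"
      using fi gi by (intro AC_add AC_scale) blast+
    show "(\<lambda>s. f i s + c n * g i s) \<in> borel_measurable (L e)"
      using fi gi by (intro borel_measurable_add borel_measurable_times borel_measurable_const) blast+
    show "integrable (L e) (\<lambda>s. (cmod (f i s + c n * g i s))\<^sup>2)"
      using fi gi gs by (intro square_integrable_add borel_measurable_times borel_measurable_const) blast+
    show "AE s in L e. U i s + c n * W n i s - h * (\<Sum>j<kdim G e. M e i j s * (f j s + c n * g j s)
        + N e i j s * (U j s + c n * W n j s)) = a i s"
      using fi[THEN conjunct2, THEN conjunct2, THEN conjunct2] gi[THEN conjunct2, THEN conjunct2, THEN conjunct2]
    proof eventually_elim
      case (elim s)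
      have "(\<Sum>j<kdim G e. M e i j s * (f j s + c n * g j s) + N e i j s * (U j s + c n * W n j s))
          = (\<Sum>j<kdim G e. M e i j s * f j s + N e i j s * U j s)
            + c n * (\<Sum>j<kdim G e. M e i j s * g j s + N e i j s * W n j s)"
        unfolding sum_distrib_left sum.distrib[symmetric] by (intro sum.cong refl) (simp add: algebra_simps)
      then have "U i s + c n * W n i s - h * (\<Sum>j<kdim G e. M e i j s * (f j s + c n * g j s) + N e i j s * (U j s + c n * W n j s))
          = (U i s - h * (\<Sum>j<kdim G e. M e i j s * f j s + N e i j s * U j s))
            + c n * (W n i s - h * (\<Sum>j<kdim G e. M e i j s * g j s + N e i j s * W n j s))"
        by (simp add: algebra_simps)
      with elim show ?case by simp
    qed
  qed
  then show ?case by (simp add: U_def add.assoc)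
qed

definition edge_state :: "('e \<Rightarrow> nat \<Rightarrow> real \<Rightarrow> complex) \<Rightarrow> 'e \<times> nat \<Rightarrow> l2fun" where
  "edge_state V = (\<lambda>(e, i). if (e, i) \<in> comps G then lift (len G e) (V e i) else 0)"

text \<open>The counterpart of \<open>trace_at\<close> for continuous representatives.\<close>

definition boundary :: "('e \<Rightarrow> nat \<Rightarrow> real \<Rightarrow> complex) \<Rightarrow> 'v \<Rightarrow> 'e cvec" where
  "boundary V v = (\<lambda>(e, i). if (e, i) \<in> I v then V e i (endpoint G v e) else 0)"

lemma boundary_cvecs: "boundary V v \<in> cvecs (I v)"
  by (auto simp: boundary_def cvecs_def)

text \<open>It translates between functions on the edges and states: a solution that satisfies the conditions at the vertices
  represents an element of the domain.\<close>

lemma solution_state: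
  assumes fg: "(f, g) \<in> L2d G"
    and V: "\<And>e. e \<in> edges G \<Longrightarrow> edge_solution e h (\<lambda>i. rep_l2 (f (e, i))) (V e)"
    and vert: "\<And>v. v \<in> vertices G \<Longrightarrow> boundary V v \<in> Y v \<and>
      orth_proj (I v) (Yd v) (boundary V v)
        - cscale h (opB G v (boundary V v) + opC G v (orth_proj (I v) (Yd v) (boundary V v))) = g v"
  shows "\<exists>z\<in>A_dom G. z - state_scale h (A_op G z) = (f, g) \<and>
    (\<forall>e i. (e, i) \<in> comps G \<longrightarrow> continuous_on {0..len G e} (V e i) \<and> (AE s in L e. rep_l2 (fst z (e, i)) s = V e i s))"
proof -
  let ?u = "edge_state V"
  define x where "x = (\<lambda>v. if v \<in> vertices G then orth_proj (I v) (Yd v) (boundary V v) else 0)"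
  have "\<forall>e\<in>edges G. \<exists>d. \<forall>i<kdim G e. AC (len G e) (V e i) (d i) \<and> d i \<in> borel_measurable (L e) \<and>
     integrable (L e) (\<lambda>s. (cmod (d i s))\<^sup>2) \<and>
     (AE s in L e. V e i s - h * (\<Sum>j<kdim G e. M e i j s * d j s + N e i j s * V e j s) = rep_l2 (f (e, i)) s)"
    using V unfolding edge_solution_def by blast
  then obtain d where d: "\<forall>e\<in>edges G. \<forall>i<kdim G e. AC (len G e) (V e i) (d e i) \<and> d e i \<in> borel_measurable (L e) \<and>
     integrable (L e) (\<lambda>s. (cmod (d e i s))\<^sup>2) \<and>
     (AE s in L e. V e i s - h * (\<Sum>j<kdim G e. M e i j s * d e j s + N e i j s * V e j s) = rep_l2 (f (e, i)) s)"
    by (rule bchoice[THEN exE])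
  have d1: "AC (len G e) (V e i) (d e i)" "integrable (L e) (\<lambda>s. (cmod (d e i s))\<^sup>2)"
    "AE s in L e. V e i s - h * (\<Sum>j<kdim G e. M e i j s * d e j s + N e i j s * V e j s) = rep_l2 (f (e, i)) s"
    if "(e, i) \<in> comps G" for e i
    using d that unfolding comps_iff by blast+
  have Vc: "continuous_on {0..len G e} (V e i)" if "(e, i) \<in> comps G" for e i by (rule AC_continuous[OF d1(1)[OF that]])
  have u: "?u (e, i) \<in> L2_on (len G e)" "AE s in L e. rep_l2 (?u (e, i)) s = V e i s" if p: "(e, i) \<in> comps G" for e i
  proof -
    have "integrable (L e) (\<lambda>s. (cmod (V e i s))\<^sup>2)"
      by (rule continuous_integrable_LI) (intro continuous_intros Vc p)
    then show "?u (e, i) \<in> L2_on (len G e)" "AE s in L e. rep_l2 (?u (e, i)) s = V e i s"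
      using lift_props[OF continuous_measurable_LI[OF Vc[OF p]]] p unfolding edge_state_def by simp_all
  qed
  have H1: "?u (e, i) \<in> H1_on (len G e)" "AE s in L e. rep_l2 (wderiv (len G e) (?u (e, i))) s = d e i s"
    "s \<in> {0..len G e} \<Longrightarrow> point_value (len G e) (?u (e, i)) s = V e i s" if p: "(e, i) \<in> comps G" for e i s
  proof -
    have l: "0 < len G e" using p len_pos by (simp add: comps_iff)
    note * = H1_intro[OF l d1(1)[OF p] d1(2)[OF p] u(1)[OF p] u(2)[OF p]]
    show "?u (e, i) \<in> H1_on (len G e)" "AE s in L e. rep_l2 (wderiv (len G e) (?u (e, i))) s = d e i s"
      "s \<in> {0..len G e} \<Longrightarrow> point_value (len G e) (?u (e, i)) s = V e i s" by (fact *)+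
  qed
  have tr: "trace_at G v ?u = boundary V v" for v
  proof -
    have "point_value (len G e) (?u (e, i)) (endpoint G v e) = V e i (endpoint G v e)" if p: "(e, i) \<in> I v" for e i
      using H1(3)[OF comps_at_comps[OF p]] endpoint_in p by (simp add: comps_at_iff edges_at_iff)
    then show ?thesis by (auto simp: trace_at_def boundary_def fun_eq_iff)
  qed
  have "(?u, x) \<in> L2d G"
    unfolding L2d_iff x_def using u(1) Yd_proj(1)[OF _ boundary_cvecs] by (auto simp: edge_state_def)
  then have z: "(?u, x) \<in> A_dom G"
    unfolding A_dom_iff tr H1u_def using H1(1) vert by (simp add: x_def)
  have comp1: "?u (e, i) - l2_scale h (A1 ?u e i) = f (e, i)" if p: "(e, i) \<in> comps G" for e i
  proof (rule L2_on_eqI[OF L2_on_closed(4)[OF u(1)[OF p] L2_on_closed(3)[OF A1_props(1)[OF p]]]])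
    show "f (e, i) \<in> L2_on (len G e)" using fg p by (simp add: L2d_iff)
    have e: "e \<in> edges G" using p by (simp add: comps_iff)
    have 1: "AE s in L e. \<forall>j<kdim G e. rep_l2 (wderiv (len G e) (?u (e, j))) s = d e j s"
      by (rule all_AE) (use H1(2) e in \<open>simp add: comps_iff\<close>)
    have 2: "AE s in L e. \<forall>j<kdim G e. rep_l2 (?u (e, j)) s = V e j s"
      by (rule all_AE) (use u(2) e in \<open>simp add: comps_iff\<close>)
    show "AE s in L e. rep_l2 (?u (e, i) - l2_scale h (A1 ?u e i)) s = rep_l2 (f (e, i)) s"
      using 1 2 u(2)[OF p] d1(3)[OF p] A1_props(2)[OF p, of ?u] rep_LI(5)[of "?u (e, i)" "l2_scale h (A1 ?u e i)"]
        rep_LI(2)[of h "A1 ?u e i"]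
    proof eventually_elim
      case (elim s)
      have "(\<Sum>j<kdim G e. M e i j s * rep_l2 (wderiv (len G e) (?u (e, j))) s + N e i j s * rep_l2 (?u (e, j)) s)
          = (\<Sum>j<kdim G e. M e i j s * d e j s + N e i j s * V e j s)"
        using elim(1,2) by (intro sum.cong refl) simp
      then show ?case using elim(3-7) by simp
    qed
  qed
  have eq1: "?u - (\<lambda>p. l2_scale h ((\<lambda>(e, i). if (e, i) \<in> comps G then A1 ?u e i else 0) p)) = f"
  proof
    fix p :: "'e \<times> nat"
    obtain e i where p: "p = (e, i)" by (cases p)
    show "(?u - (\<lambda>p. l2_scale h ((\<lambda>(e, i). if (e, i) \<in> comps G then A1 ?u e i else 0) p))) p = f p"
    proof (cases "(e, i) \<in> comps G")
      case True then show ?thesis using comp1[OF True] by (simp add: p)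
    next
      case False
      then have "f (e, i) = 0" "?u (e, i) = 0" using fg by (auto simp: L2d_iff edge_state_def)
      then show ?thesis using False by (simp add: p l2_scale_zero)
    qed
  qed
  have eq2: "x - (\<lambda>v. cscale h (if v \<in> vertices G then opB G v (boundary V v) + opC G v (x v) else 0)) = g"
  proof
    fix v
    show "(x - (\<lambda>v. cscale h (if v \<in> vertices G then opB G v (boundary V v) + opC G v (x v) else 0))) v = g v"
    proof (cases "v \<in> vertices G")
      case True
      then show ?thesis using vert[OF True] unfolding x_def fun_diff_def by simp
    next
      case False
      then have "g v = 0" using fg by (simp add: L2d_iff)
      moreover have "cscale h 0 = 0" by (rule cfun.scale_zero_right)
      ultimately show ?thesis using False unfolding x_def fun_diff_def by (simp, simp add: zero_fun_def)
    qed
  qed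
  have "(?u, x) - state_scale h (A_op G (?u, x)) = (f, g)"
    unfolding A_op_eq state_scale_def prod.case tr minus_prod_def fst_conv snd_conv eq1 eq2 by simp
  then show ?thesis using z Vc u(2) by (intro bexI[of _ "(?u, x)"]) auto
qed

end

lemma cprod_span_zero:
  assumes zero: "\<And>y. y \<in> S \<Longrightarrow> cprod I x y = 0" and y: "y \<in> cfun.span S"
  shows "cprod I x y = 0"
proof (rule cfun.span_induct[OF y, of "\<lambda>y. cprod I x y = 0"])
  show "cfun.subspace {y. cprod I x y = 0}" unfolding cfun.subspace_def by (simp add: cprod_simps)
qed (rule zero)

context net begin

text \<open>What testing the equation at the vertex \<open>v\<close> with a vector \<open>y\<close> says about the boundary values
  \<open>\<xi>\<close>: the component of \<open>\<xi>\<close> in the space of the dynamic variables is compared with \<open>h\<close> times its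
  image, the term with \<open>B\<close> being rewritten with the adjoint so that it makes sense for every \<open>\<xi>\<close>,
  whether in \<open>Y v\<close> or not.\<close>

definition vertex_functional :: "complex \<Rightarrow> 'v \<Rightarrow> 'e cvec \<Rightarrow> 'e cvec \<Rightarrow> complex" where
  "vertex_functional h v \<xi> y = cprod (I v) \<xi> y - h * cprod (I v) \<xi> (adjB G v y)
     - h * cprod (I v) (opC G v (orth_proj (I v) (Yd v) \<xi>)) y"

lemma vertex_functional_add:
  assumes "v \<in> vertices G" "\<xi> \<in> cvecs (I v)" "\<eta> \<in> cvecs (I v)"
  shows "vertex_functional h v (\<xi> + \<eta>) y = vertex_functional h v \<xi> y + vertex_functional h v \<eta> y"
  unfolding vertex_functional_def Yd_proj(2)[OF assms]
    C_lin(2)[OF assms(1) Yd_proj(1)[OF assms(1,2)] Yd_proj(1)[OF assms(1,3)]] cprod_simps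
  by (simp add: algebra_simps)

lemma vertex_functional_scale:
  assumes "v \<in> vertices G" "\<xi> \<in> cvecs (I v)"
  shows "vertex_functional h v (cscale c \<xi>) y = c * vertex_functional h v \<xi> y"
  unfolding vertex_functional_def Yd_proj(3)[OF assms] C_lin(3)[OF assms(1) Yd_proj(1)[OF assms]] cprod_simps
  by (simp add: algebra_simps)

text \<open>The first conditions put \<open>\<xi>\<close> into the double orthogonal complement of \<open>Y v\<close>. The others say that the defect \<open>d\<close> of the
  equation is orthogonal to the range of \<open>opB\<close> and to the kernel of its adjoint. By the former it lies in that
  kernel, so by the latter it is orthogonal to itself.\<close>

lemma vertex_conditions:
  assumes v: "v \<in> vertices G" and \<xi>: "\<xi> \<in> cvecs (I v)" and g: "g \<in> Yd v"
    and span: "cfun.span S1 = orth_compl (I v) (Y v)" "cfun.span S2 = opB G v ` Y v"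
      "cfun.span S3 = {y \<in> Yd v. adjB G v y = 0}"
    and c1: "\<And>y. y \<in> S1 \<Longrightarrow> cprod (I v) \<xi> y = 0"
    and c2: "\<And>y. y \<in> S2 \<union> S3 \<Longrightarrow> vertex_functional h v \<xi> y = cprod (I v) g y"
  shows "\<xi> \<in> Y v \<and> orth_proj (I v) (Yd v) \<xi>
    - cscale h (opB G v \<xi> + opC G v (orth_proj (I v) (Yd v) \<xi>)) = g"
proof -
  have \<xi>Y: "\<xi> \<in> Y v"
    by (rule double_orth_compl[OF finite_comps(2) Y_props(1)[OF v] Y_props(2)[OF v] \<xi>])
      (use cprod_span_zero[of S1 "I v" \<xi>] c1 span(1) in blast)
  note adj = adjoint_on_prop[OF finite_comps(2) Y_props(1)[OF v] Y_props(2)[OF v] Y_props(6)[OF v], folded adjB_def]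
  let ?x = "orth_proj (I v) (Yd v) \<xi>"
  note x = Yd_proj(1)[OF v \<xi>]
  define d where "d = ?x - cscale h (opB G v \<xi> + opC G v ?x) - g"
  have d: "d \<in> Yd v"
    unfolding d_def by (intro Yd_closed[OF v] x g B_lin(1)[OF v \<xi>Y] C_lin(1)[OF v x])
  have test: "cprod (I v) d y = vertex_functional h v \<xi> y - cprod (I v) g y" if y: "y \<in> Yd v" for y
    unfolding d_def vertex_functional_def cprod_simps Yd_proj(4)[OF v \<xi> y] adj(2)[OF \<xi>Y] by (simp add: algebra_simps)
  have S23: "y \<in> Yd v" if "y \<in> S2 \<union> S3" for y
    using that span(2,3) cfun.span_base[of y S2] cfun.span_base[of y S3] B_lin(1)[OF v] by auto
  have dB: "cprod (I v) d (opB G v \<eta>) = 0" if \<eta>: "\<eta> \<in> Y v" for \<eta>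
  proof (rule cprod_span_zero[of S2])
    show "cprod (I v) d y = 0" if "y \<in> S2" for y using test[OF S23] c2 that by simp
    show "opB G v \<eta> \<in> cfun.span S2" unfolding span(2) using \<eta> by (rule imageI)
  qed
  have "adjB G v d = 0"
  proof -
    have "cprod (I v) (adjB G v d) (adjB G v d) = cprod (I v) (opB G v (adjB G v d)) d"
      by (rule adj(2)[OF adj(1), symmetric])
    also have "\<dots> = cnj (cprod (I v) d (opB G v (adjB G v d)))" by (rule cprod_cnj)
    also have "\<dots> = 0" using dB[OF adj(1)] by simp
    finally have "\<not> 0 < Re (cprod (I v) (adjB G v d) (adjB G v d))" by simp
    then show ?thesis
      using inner_carrier.ip_pos[OF inner_carrier_cprod[OF finite_comps(2)], of "adjB G v d" v] adj(1) Y_props(2)[OF v] by blast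
  qed
  then have "d \<in> cfun.span S3" unfolding span(3) using d by simp
  then have "cprod (I v) d d = 0"
    by (rule cprod_span_zero[rotated]) (use test[OF S23] c2 in simp)
  then have "\<not> 0 < Re (cprod (I v) d d)" by simp
  then have "d = 0"
    using inner_carrier.ip_pos[OF inner_carrier_cprod[OF finite_comps(2)], of d v] d Y_props(5)[OF v] by blast
  then show ?thesis using \<xi>Y unfolding d_def by simp
qed

lemma boundary_add: "boundary (\<lambda>e i s. V e i s + W e i s) v = boundary V v + boundary W v"
  by (auto simp: boundary_def fun_eq_iff)

lemma boundary_scale: "boundary (\<lambda>e i s. c * V e i s) v = cscale c (boundary V v)"
  by (auto simp: boundary_def cscale_def fun_eq_iff)

text \<open>The inner product of \<open>z = h A z\<close> with \<open>z\<close> has real part at most \<open>w |h|\<close> times the squared norm of \<open>z\<close>.\<close>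

lemma stationary_unique:
  assumes est: "\<And>z. z \<in> A_dom G \<Longrightarrow> \<bar>Re (L2d_inner G (A_op G z) z)\<bar> \<le> w * Re (L2d_inner G z z)"
    and h: "w * \<bar>h\<bar> < 1" and z: "z \<in> A_dom G" and eq: "z - state_scale (of_real h) (A_op G z) = 0"
  shows "z = 0"
proof (rule ccontr)
  assume nz: "z \<noteq> 0"
  interpret E: inner_carrier "state_scale :: complex \<Rightarrow> ('v, 'e) state \<Rightarrow> _" "L2d G" "L2d_inner G"
    by (rule L2d_inner_carrier)
  have zH: "z \<in> L2d G" using z by (cases z) (simp add: A_dom_iff)
  have z_eq: "state_scale (of_real h) (A_op G z) = z" using eq by simp
  have "L2d_inner G z z = of_real h * L2d_inner G (A_op G z) z"
    using E.ip_scale[OF A_maps[OF z] zH, of "of_real h"] unfolding z_eq .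
  then have "Re (L2d_inner G z z) = h * Re (L2d_inner G (A_op G z) z)" by simp
  also have "\<dots> \<le> \<bar>h\<bar> * \<bar>Re (L2d_inner G (A_op G z) z)\<bar>" by (metis abs_ge_self abs_mult)
  also have "\<dots> \<le> \<bar>h\<bar> * (w * Re (L2d_inner G z z))" by (rule mult_left_mono[OF est[OF z]]) simp
  also have "\<dots> = (w * \<bar>h\<bar>) * Re (L2d_inner G z z)" by simp
  also have "\<dots> < 1 * Re (L2d_inner G z z)" by (rule mult_strict_right_mono[OF h E.ip_pos[OF zH nz]])
  finally show False by simp
qed

text \<open>The general solution on the edges is a particular one, \<open>\<Psi>\<close>, plus \<open>hom c\<close>, where \<open>c\<close> is the vector of initial values. The map \<open>F\<close>
  sends \<open>c\<close> to the values of all the conditions at the vertices; it acts between spaces of the same dimension, so its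
  injectivity, which is \<open>stationary_unique\<close>, suffices.\<close>

lemma stationary_exists:
  assumes est: "\<And>z. z \<in> A_dom G \<Longrightarrow> \<bar>Re (L2d_inner G (A_op G z) z)\<bar> \<le> w * Re (L2d_inner G z z)"
    and h: "h \<noteq> 0" "w * \<bar>h\<bar> < 1" and fg: "(f, g) \<in> L2d G"
    and span: "\<And>v. v \<in> vertices G \<Longrightarrow> cfun.span (wY v ` {..<nY v}) = orth_compl (I v) (Y v)"
      "\<And>v. v \<in> vertices G \<Longrightarrow> cfun.span (yR v ` {..<nR v}) = opB G v ` Y v"
      "\<And>v. v \<in> vertices G \<Longrightarrow> cfun.span (wK v ` {..<nK v}) = {y \<in> Yd v. adjB G v y = 0}"
    and W: "finite (W_indices G nY nR nK)" "card (W_indices G nY nR nK) = card (comps G)"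
  shows "\<exists>z\<in>A_dom G. z - state_scale (of_real h) (A_op G z) = (f, g)"
proof -
  let ?h = "complex_of_real h"
  let ?W = "W_indices G nY nR nK"
  have h0: "?h \<noteq> 0" using h(1) by simp
  have "\<forall>e\<in>edges G. \<exists>V. edge_solution e ?h (\<lambda>i. rep_l2 (f (e, i))) V"
  proof
    fix e assume e: "e \<in> edges G"
    have "\<exists>V. edge_solution e ?h (\<lambda>i. rep_l2 (f (e, i))) V \<and> (\<forall>i<kdim G e. V i 0 = 0)"
      by (rule edge_solution_exists[OF e h0]) (simp add: rep_measurable_LI rep_square_integrable_LI)
    then show "\<exists>V. edge_solution e ?h (\<lambda>i. rep_l2 (f (e, i))) V" by blast
  qed
  then obtain \<Psi> where \<Psi>: "\<forall>e\<in>edges G. edge_solution e ?h (\<lambda>i. rep_l2 (f (e, i))) (\<Psi> e)"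
    by (rule bchoice[THEN exE])
  have "\<forall>p\<in>edges G \<times> UNIV. \<exists>V. edge_solution (fst p) ?h (\<lambda>i s. 0) V \<and>
      (\<forall>i<kdim G (fst p). V i 0 = (if i = snd p then 1 else 0))"
  proof
    fix p :: "'e \<times> nat" assume "p \<in> edges G \<times> UNIV"
    then show "\<exists>V. edge_solution (fst p) ?h (\<lambda>i s. 0) V \<and> (\<forall>i<kdim G (fst p). V i 0 = (if i = snd p then 1 else 0))"
      by (intro edge_solution_exists[OF _ h0]) auto
  qed
  then obtain \<Phi> where \<Phi>0: "\<forall>p\<in>edges G \<times> UNIV. edge_solution (fst p) ?h (\<lambda>i s. 0) (\<Phi> p) \<and>
      (\<forall>i<kdim G (fst p). \<Phi> p i 0 = (if i = snd p then 1 else 0))"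
    by (rule bchoice[THEN exE])
  have \<Phi>: "edge_solution e ?h (\<lambda>i s. 0) (\<Phi> (e, m))" "i < kdim G e \<Longrightarrow> \<Phi> (e, m) i 0 = (if i = m then 1 else 0)"
    if "e \<in> edges G" for e m i
    using bspec[OF \<Phi>0, of "(e, m)"] that by simp_all
  define hom where "hom = (\<lambda>c e i s. \<Sum>m<kdim G e. c (e, m) * \<Phi> (e, m) i s)"
  have hom_add: "hom (c + c') = (\<lambda>e i s. hom c e i s + hom c' e i s)" for c c'
    by (simp add: hom_def fun_eq_iff distrib_right sum.distrib)
  have hom_scale: "hom (cscale a c) = (\<lambda>e i s. a * hom c e i s)" for a c
    by (simp add: hom_def fun_eq_iff cscale_def sum_distrib_left mult.assoc)
  have hom_sol: "edge_solution e ?h a (\<lambda>i s. V i s + hom c e i s)"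
    if e: "e \<in> edges G" and "edge_solution e ?h a V" for e a V c
    unfolding hom_def by (rule edge_solution_combine[OF that(2)]) (rule \<Phi>(1)[OF e])
  have hom_0: "hom c e i 0 = c (e, i)" if p: "(e, i) \<in> comps G" for c e i
  proof -
    have p': "e \<in> edges G" "i < kdim G e" using p by (auto simp: comps_iff)
    have "hom c e i 0 = (\<Sum>m<kdim G e. if i = m then c (e, m) else 0)"
      unfolding hom_def using \<Phi>(2)[OF p'(1,2)] by (intro sum.cong refl) simp
    also have "\<dots> = c (e, i)" using p' by (subst sum.delta') auto
    finally show ?thesis .
  qed
  define \<phi> where "\<phi> = (\<lambda>v k \<xi>. case k of Orth i \<Rightarrow> cprod (I v) \<xi> (wY v i)
    | RanAdj j \<Rightarrow> vertex_functional ?h v \<xi> (yR v j) | KerAdj l \<Rightarrow> vertex_functional ?h v \<xi> (wK v l))"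
  have \<phi>_add: "\<phi> v k (\<xi> + \<eta>) = \<phi> v k \<xi> + \<phi> v k \<eta>"
    if "v \<in> vertices G" "\<xi> \<in> cvecs (I v)" "\<eta> \<in> cvecs (I v)" for v k \<xi> \<eta>
    unfolding \<phi>_def by (cases k) (simp_all add: cprod_simps vertex_functional_add[OF that])
  have \<phi>_scale: "\<phi> v k (cscale c \<xi>) = c * \<phi> v k \<xi>" if "v \<in> vertices G" "\<xi> \<in> cvecs (I v)" for v k c \<xi>
    unfolding \<phi>_def by (cases k) (simp_all add: cprod_simps vertex_functional_scale[OF that])
  define \<tau> where "\<tau> = (\<lambda>g v k. case k of Orth i \<Rightarrow> 0
    | RanAdj j \<Rightarrow> cprod (I v) (g v) (yR v j) | KerAdj l \<Rightarrow> cprod (I v) (g v) (wK v l))"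
  have solve: "\<exists>z\<in>A_dom G. z - state_scale ?h (A_op G z) = (f, g) \<and>
      (\<forall>e i. (e, i) \<in> comps G \<longrightarrow> continuous_on {0..len G e} (V e i) \<and> (AE s in L e. rep_l2 (fst z (e, i)) s = V e i s))"
    if fg: "(f, g) \<in> L2d G" and V: "\<And>e. e \<in> edges G \<Longrightarrow> edge_solution e ?h (\<lambda>i. rep_l2 (f (e, i))) (V e)"
      and \<phi>V: "\<And>v k. (v, k) \<in> ?W \<Longrightarrow> \<phi> v k (boundary V v) = \<tau> g v k" for f g V
  proof (rule solution_state[OF fg V])
    fix v assume v: "v \<in> vertices G"
    show "boundary V v \<in> Y v \<and> orth_proj (I v) (Yd v) (boundary V v)
        - cscale ?h (opB G v (boundary V v) + opC G v (orth_proj (I v) (Yd v) (boundary V v))) = g v"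
    proof (rule vertex_conditions[OF v boundary_cvecs _ span(1)[OF v] span(2)[OF v] span(3)[OF v]])
      show "g v \<in> Yd v" using fg v by (simp add: L2d_iff)
      show "cprod (I v) (boundary V v) y = 0" if y: "y \<in> wY v ` {..<nY v}" for y
      proof -
        obtain i where i: "i < nY v" "y = wY v i" using y by auto
        have "(v, Orth i) \<in> ?W" using v i by (simp add: W_indices_def)
        from \<phi>V[OF this] show ?thesis by (simp add: \<phi>_def \<tau>_def i)
      qed
      show "vertex_functional ?h v (boundary V v) y = cprod (I v) (g v) y"
        if y: "y \<in> yR v ` {..<nR v} \<union> wK v ` {..<nK v}" for y
        using y
      proof
        assume "y \<in> yR v ` {..<nR v}"
        then obtain j where j: "j < nR v" "y = yR v j" by auto
        have "(v, RanAdj j) \<in> ?W" using v j by (simp add: W_indices_def)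
        from \<phi>V[OF this] show ?thesis by (simp add: \<phi>_def \<tau>_def j)
      next
        assume "y \<in> wK v ` {..<nK v}"
        then obtain j where j: "j < nK v" "y = wK v j" by auto
        have "(v, KerAdj j) \<in> ?W" using v j by (simp add: W_indices_def)
        from \<phi>V[OF this] show ?thesis by (simp add: \<phi>_def \<tau>_def j)
      qed
    qed
  qed
  have Wv: "v \<in> vertices G" if "(v, k) \<in> ?W" for v k using that by (auto simp: W_indices_def)
  define F where "F = (\<lambda>c (v, k). if (v, k) \<in> ?W then \<phi> v k (boundary (hom c) v) else 0)"
  define t where "t = (\<lambda>(v, k). if (v, k) \<in> ?W then \<tau> g v k - \<phi> v k (boundary \<Psi> v) else 0)"
  have "\<exists>c\<in>cvecs (comps G). F c = t"
  proof (rule injective_imp_surjective[OF finite_comps(1) W(1) W(2)[symmetric]])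
    show "F c \<in> cvecs ?W" for c by (auto simp: F_def cvecs_def)
    show "t \<in> cvecs ?W" by (auto simp: t_def cvecs_def)
    show "F (c + c') = F c + F c'" for c c'
    proof
      fix p :: "'v \<times> w_index"
      obtain v k where p: "p = (v, k)" by (cases p)
      show "F (c + c') p = (F c + F c') p"
        using \<phi>_add[OF Wv boundary_cvecs boundary_cvecs] by (simp add: F_def p hom_add boundary_add)
    qed
    show "F (cscale a c) = cscale a (F c)" for a c
    proof
      fix p :: "'v \<times> w_index"
      obtain v k where p: "p = (v, k)" by (cases p)
      show "F (cscale a c) p = cscale a (F c) p"
        unfolding cscale_def[of a "F c"]
        using \<phi>_scale[OF Wv boundary_cvecs] by (simp add: F_def p hom_scale boundary_scale)
    qed
    fix c assume c: "c \<in> cvecs (comps G)" and Fc: "F c = 0"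
    have zero_sol: "edge_solution e ?h (\<lambda>i s. 0) (\<lambda>i s. 0)" for e
      unfolding edge_solution_def by (intro exI[of _ "\<lambda>i s. 0"]) (simp add: AC_zero)
    \<comment> \<open>the class of the zero function is represented only up to a null set\<close>
    have sol: "edge_solution e ?h (\<lambda>i. rep_l2 ((0 :: 'e \<times> nat \<Rightarrow> l2fun) (e, i))) (hom c e)" if e: "e \<in> edges G" for e
    proof -
      have "edge_solution e ?h (\<lambda>i s. 0) (hom c e)" using hom_sol[OF e zero_sol, of c] by simp
      then obtain d where d: "\<forall>i<kdim G e. AC (len G e) (hom c e i) (d i) \<and> d i \<in> borel_measurable (L e) \<and>
         integrable (L e) (\<lambda>s. (cmod (d i s))\<^sup>2) \<and>
         (AE s in L e. hom c e i s - ?h * (\<Sum>j<kdim G e. M e i j s * d j s + N e i j s * hom c e j s) = 0)"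
        unfolding edge_solution_def by blast
      show ?thesis
        unfolding edge_solution_def
      proof (intro exI[of _ d] allI impI conjI)
        fix i assume i: "i < kdim G e"
        have "AE s in L e. hom c e i s - ?h * (\<Sum>j<kdim G e. M e i j s * d j s + N e i j s * hom c e j s) = 0"
          using d i by blast
        then show "AE s in L e. hom c e i s - ?h * (\<Sum>j<kdim G e. M e i j s * d j s + N e i j s * hom c e j s)
            = rep_l2 ((0 :: 'e \<times> nat \<Rightarrow> l2fun) (e, i)) s"
          using rep_LI(3)[of "len G e"] by eventually_elim simp
      qed (use d in blast)+
    qed
    have mem0: "(0, 0) \<in> L2d G"
      using inner_carrier.mem_zero[OF L2d_inner_carrier] by (simp add: zero_prod_def)
    have "\<phi> v k (boundary (hom c) v) = \<tau> 0 v k" if "(v, k) \<in> ?W" for v k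
      using fun_cong[OF Fc, of "(v, k)"] that by (cases k) (simp_all add: F_def \<tau>_def cprod_simps)
    from solve[OF mem0 sol this] obtain z where z: "z \<in> A_dom G" "z - state_scale ?h (A_op G z) = (0, 0)"
      "\<forall>e i. (e, i) \<in> comps G \<longrightarrow> continuous_on {0..len G e} (hom c e i) \<and> (AE s in L e. rep_l2 (fst z (e, i)) s = hom c e i s)"
      by blast
    have zero: "z - state_scale ?h (A_op G z) = 0" unfolding z(2) by (rule zero_prod_def[symmetric])
    have "z = 0" by (rule stationary_unique[OF _ h(2) z(1) zero]) (rule est)
    have "c p = 0" for p
    proof (cases "p \<in> comps G")
      case True
      obtain e i where p: "p = (e, i)" by (cases p)
      have pc: "(e, i) \<in> comps G" and l: "0 < len G e" using True len_pos by (auto simp: p comps_iff)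
      have "AE s in L e. hom c e i s = 0"
        using z(3)[rule_format, OF pc, THEN conjunct2] rep_LI(3)[of "len G e"] unfolding \<open>z = 0\<close>
        by eventually_elim simp
      then have "hom c e i 0 = 0"
        by (rule continuous_AE_eq[OF l z(3)[rule_format, OF pc, THEN conjunct1] continuous_on_const]) (use l in simp)
      then show ?thesis using hom_0[OF pc] by (simp add: p)
    next
      case False then show ?thesis using c unfolding cvecs_def by blast
    qed
    then show "c = 0" by (simp add: fun_eq_iff)
  qed
  then obtain c where c: "F c = t" by blast
  define V where "V = (\<lambda>e i s. \<Psi> e i s + hom c e i s)"
  have "edge_solution e ?h (\<lambda>i. rep_l2 (f (e, i))) (V e)" if e: "e \<in> edges G" for e
    unfolding V_def by (rule hom_sol[OF e]) (use \<Psi> e in blast)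
  moreover have "\<phi> v k (boundary V v) = \<tau> g v k" if p: "(v, k) \<in> ?W" for v k
    unfolding V_def boundary_add \<phi>_add[OF Wv[OF p] boundary_cvecs boundary_cvecs]
    using fun_cong[OF c, of "(v, k)"] p by (simp add: F_def t_def)
  ultimately show ?thesis using solve[OF fg, of V] by blast
qed

end

theorem corollary3p4:
  fixes G :: "('v, 'e) network"
    and wY yR wK :: "'v \<Rightarrow> nat \<Rightarrow> 'e \<times> nat \<Rightarrow> complex"
    and nY nR nK :: "'v \<Rightarrow> nat"
  assumes "network_graph G" and "edge_coefficients G" and "vertex_data G"
    and "\<And>v. v \<in> vertices G \<Longrightarrow>
           basis_family {..<nY v} (wY v) (orth_compl (comps_at G v) (spaceY G v))"
    and "\<And>v. v \<in> vertices G \<Longrightarrow>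
           basis_family {..<nR v} (yR v) (opB G v ` spaceY G v)"
    and "\<And>v. v \<in> vertices G \<Longrightarrow>
           basis_family {..<nK v} (wK v) {y \<in> spaceYd G v. adjB G v y = 0}"
    and "basis_family (W_indices G nY nR nK) (W_family G wY yR wK) (cvecs (comps G))"
    and "\<And>v \<xi>. v \<in> vertices G \<Longrightarrow> \<xi> \<in> spaceY G v \<Longrightarrow>
           cprod (comps_at G v) (opT G v \<xi>) \<xi>
             + of_real (2 * Re (cprod (comps_at G v) (opQ G v (opB G v \<xi>)) \<xi>)) = 0"
  shows "generates_strongly_continuous_group state_scale (L2d G) (L2d_norm G) (A_dom G) (A_op G)"
proof -
  interpret net G by unfold_locales (fact assms)+
  interpret E: hilbert_carrier "state_scale :: complex \<Rightarrow> ('v, 'e) state \<Rightarrow> _" "L2d G" "L2d_inner G"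
    by (rule L2d_hilbert)
  have norm_eq: "L2d_norm G = E.nrm" by (simp add: fun_eq_iff L2d_norm_def E.nrm_def)
  have norm_sq: "(E.nrm z)\<^sup>2 = Re (L2d_inner G z z)" if "z \<in> A_dom G" for z
  proof -
    have "z \<in> L2d G" using that by (cases z) (simp add: A_dom_iff)
    then show ?thesis by (simp add: E.nrm_def E.Re_ip_nonneg)
  qed
  have "\<exists>w\<ge>0. \<forall>z\<in>A_dom G. \<bar>Re (L2d_inner G (A_op G z) z)\<bar> \<le> w * Re (L2d_inner G z z)"
    by (rule almost_skew) (fact assms(8))
  then obtain w where w: "0 \<le> w" "\<And>z. z \<in> A_dom G \<Longrightarrow> \<bar>Re (L2d_inner G (A_op G z) z)\<bar> \<le> w * Re (L2d_inner G z z)"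
    by blast
  have W: "finite (W_indices G nY nR nK)" "card (W_indices G nY nR nK) = card (comps G)"
    using card_basis_cvecs[OF finite_comps(1) assms(7)] by simp_all
  have span: "\<And>v. v \<in> vertices G \<Longrightarrow> cfun.span (wY v ` {..<nY v}) = orth_compl (I v) (Y v)"
      "\<And>v. v \<in> vertices G \<Longrightarrow> cfun.span (yR v ` {..<nR v}) = opB G v ` Y v"
      "\<And>v. v \<in> vertices G \<Longrightarrow> cfun.span (wK v ` {..<nK v}) = {y \<in> Yd v. adjB G v y = 0}"
    using assms(4-6) unfolding basis_family_def by blast+
  show ?thesis
    unfolding norm_eq
  proof (rule E.generates_group_if_almost_skew)
    show "E.subspace (A_dom G)" by (rule A_dom_subspace)
    show "A_dom G \<subseteq> L2d G" by (auto simp: A_dom_def)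
    show "\<And>z. z \<in> A_dom G \<Longrightarrow> A_op G z \<in> L2d G" by (rule A_maps)
    show "\<And>z z'. z \<in> A_dom G \<Longrightarrow> z' \<in> A_dom G \<Longrightarrow> A_op G (z + z') = A_op G z + A_op G z'" by (rule A_add)
    show "\<And>c z. z \<in> A_dom G \<Longrightarrow> A_op G (state_scale c z) = state_scale c (A_op G z)" by (rule A_scale)
    show "\<And>z. z \<in> A_dom G \<Longrightarrow> \<bar>Re (L2d_inner G (A_op G z) z)\<bar> \<le> w * (E.nrm z)\<^sup>2" using w(2) norm_sq by simp
    show "0 \<le> w" by (rule w(1))
    fix y h assume y: "y \<in> L2d G" and h: "h \<noteq> (0 :: real)" "w * \<bar>h\<bar> < 1"
    obtain f g where fg: "y = (f, g)" by (cases y)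
    show "\<exists>z\<in>A_dom G. z - state_scale (of_real h) (A_op G z) = y"
      using stationary_exists[OF w(2) h y[unfolded fg] span W] unfolding fg .
  qed
qed

end
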